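(* Let $k$ be a field with algebraic closure $\overline{k}$, and let $R$ be a $k$-algebra such that $R\otimes_k\overline{k}$ is noetherian and $\dim_k R<\operatorname{card} k$. Then: (1) If $R$ is an HNP ring, then either $R$ is a PI ring or $R$ has no proper invertible ideals. (2) If $R$ is a Dedekind prime ring, then $R$ is either a PI ring or a simple ring.
   Context: Rings are associative with $1$ (not assumed commutative), and a $k$-algebra has $k$ acting centrally; ideals are two-sided; "noetherian", "hereditary" and "artinian" mean left and right; $\operatorname{card} k$ is the cardinality of $k$ and $\dim_k R$ is regarded as a cardinal. An HNP ring is a nonartinian hereditary noetherian prime ring. For a prime noetherian ring $R$ with Goldie (classical) quotient ring $Q=Q(R)$, an ideal $I$ of $R$ is invertible if there is an $R$-subbimodule $I^{-1}$ of $Q$ with $II^{-1}=I^{-1}I=R$; proper means different from $R$. A Dedekind prime ring is an HNP ring in which every nonzero ideal is invertible. A PI ring is a ring satisfying a polynomial identity (a polynomial in noncommuting variables with integer coefficients, at least one of whose monomials of highest degree has coefficient $1$, that vanishes under all substitutions of elements of the ring). A ring is simple if its only ideals are $0$ and itself. *)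

theory Defs
  imports
    "HOL-Algebra.Algebra"
    "HOL-Algebra.Free_Abelian_Groups"
    "Jordan_Normal_Form.Missing_VectorSpace"
begin

section \<open>Modules and one-sided ideals over noncommutative rings\<close>

text \<open>The library locale \<^locale>\<open>module\<close> requires a commutative ring of scalars, so left modules over
  an arbitrary ring are introduced here.  Right modules, right ideals and so on are handled as
  left modules, left ideals and so on over the opposite ring.\<close>

locale left_module = R?: ring R + M?: abelian_group M
  for R :: "('a, 'd) ring_scheme" (structure) and M :: "('a, 'b, 'c) module_scheme" (structure) +
  assumes smult_closed:
      "\<lbrakk>a \<in> carrier R; x \<in> carrier M\<rbrakk> \<Longrightarrow> a \<odot>\<^bsub>M\<^esub> x \<in> carrier M"
    and smult_l_distr:
      "\<lbrakk>a \<in> carrier R; b \<in> carrier R; x \<in> carrier M\<rbrakk> \<Longrightarrow>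
        (a \<oplus>\<^bsub>R\<^esub> b) \<odot>\<^bsub>M\<^esub> x = a \<odot>\<^bsub>M\<^esub> x \<oplus>\<^bsub>M\<^esub> b \<odot>\<^bsub>M\<^esub> x"
    and smult_r_distr:
      "\<lbrakk>a \<in> carrier R; x \<in> carrier M; y \<in> carrier M\<rbrakk> \<Longrightarrow>
        a \<odot>\<^bsub>M\<^esub> (x \<oplus>\<^bsub>M\<^esub> y) = a \<odot>\<^bsub>M\<^esub> x \<oplus>\<^bsub>M\<^esub> a \<odot>\<^bsub>M\<^esub> y"
    and smult_assoc1:
      "\<lbrakk>a \<in> carrier R; b \<in> carrier R; x \<in> carrier M\<rbrakk> \<Longrightarrow>
        (a \<otimes>\<^bsub>R\<^esub> b) \<odot>\<^bsub>M\<^esub> x = a \<odot>\<^bsub>M\<^esub> (b \<odot>\<^bsub>M\<^esub> x)"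
    and smult_one: "x \<in> carrier M \<Longrightarrow> \<one>\<^bsub>R\<^esub> \<odot>\<^bsub>M\<^esub> x = x"

definition left_submodule ::
  "('a, 'm) ring_scheme \<Rightarrow> 'b set \<Rightarrow> ('a, 'b, 'n) module_scheme \<Rightarrow> bool" where
  "left_submodule R N M \<longleftrightarrow>
     additive_subgroup N M \<and> (\<forall>a\<in>carrier R. \<forall>x\<in>N. a \<odot>\<^bsub>M\<^esub> x \<in> N)"

definition left_module_hom ::
  "('a, 'm) ring_scheme \<Rightarrow> ('a, 'b, 'n) module_scheme \<Rightarrow> ('a, 'c, 'p) module_scheme
     \<Rightarrow> ('b \<Rightarrow> 'c) set" where
  "left_module_hom R M N =
     {h \<in> carrier M \<rightarrow> carrier N.
        (\<forall>x\<in>carrier M. \<forall>y\<in>carrier M. h (x \<oplus>\<^bsub>M\<^esub> y) = h x \<oplus>\<^bsub>N\<^esub> h y) \<and>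
        (\<forall>a\<in>carrier R. \<forall>x\<in>carrier M. h (a \<odot>\<^bsub>M\<^esub> x) = a \<odot>\<^bsub>N\<^esub> h x)}"

definition left_module_iso ::
  "('a, 'm) ring_scheme \<Rightarrow> ('a, 'b, 'n) module_scheme \<Rightarrow> ('a, 'c, 'p) module_scheme \<Rightarrow> bool" where
  "left_module_iso R M N \<longleftrightarrow>
     (\<exists>h \<in> left_module_hom R M N. bij_betw h (carrier M) (carrier N))"

text \<open>The multiplication and unit fields of the module records below play no role.\<close>

definition regular_left_module :: "('a, 'm) ring_scheme \<Rightarrow> ('a, 'a) module" where
  "regular_left_module R =
     \<lparr>carrier = carrier R, monoid.mult = (\<otimes>\<^bsub>R\<^esub>), monoid.one = \<one>\<^bsub>R\<^esub>,
      ring.zero = \<zero>\<^bsub>R\<^esub>, ring.add = (\<oplus>\<^bsub>R\<^esub>), module.smult = (\<otimes>\<^bsub>R\<^esub>)\<rparr>"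

definition free_left_module :: "('a, 'm) ring_scheme \<Rightarrow> 'i set \<Rightarrow> ('a, 'i \<Rightarrow> 'a) module" where
  "free_left_module R S =
     \<lparr>carrier = {f. (\<forall>i\<in>S. f i \<in> carrier R) \<and> (\<forall>i. i \<notin> S \<longrightarrow> f i = \<zero>\<^bsub>R\<^esub>) \<and> finite {i. f i \<noteq> \<zero>\<^bsub>R\<^esub>}},
      monoid.mult = undefined, monoid.one = undefined,
      ring.zero = (\<lambda>i. \<zero>\<^bsub>R\<^esub>), ring.add = (\<lambda>f g i. f i \<oplus>\<^bsub>R\<^esub> g i),
      module.smult = (\<lambda>a f i. a \<otimes>\<^bsub>R\<^esub> f i)\<rparr>"

text \<open>A module is projective if it is isomorphic to a direct summand of a free module.  It is no
  restriction to index the basis of the free module by elements of the type of \<open>M\<close>: if \<open>M\<close> is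
  projective, then every surjection onto \<open>M\<close>, in particular the one from the free module on the
  set \<open>carrier M\<close>, splits.\<close>

definition projective_left_module ::
  "('a, 'm) ring_scheme \<Rightarrow> ('a, 'b, 'n) module_scheme \<Rightarrow> bool" where
  "projective_left_module R M \<longleftrightarrow>
     left_module R M \<and>
     (\<exists>(S :: 'b set) N N'.
        left_submodule R N (free_left_module R S) \<and>
        left_submodule R N' (free_left_module R S) \<and>
        N \<inter> N' = {\<zero>\<^bsub>free_left_module R S\<^esub>} \<and>
        N <+>\<^bsub>free_left_module R S\<^esub> N' = carrier (free_left_module R S) \<and>
        left_module_iso R M (free_left_module R S \<lparr>carrier := N\<rparr>))"

definition left_ideal :: "('a, 'm) ring_scheme \<Rightarrow> 'a set \<Rightarrow> bool" where
  "left_ideal R I \<longleftrightarrow> left_submodule R I (regular_left_module R)"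

definition opposite_ring :: "('a, 'm) ring_scheme \<Rightarrow> 'a ring" where
  "opposite_ring R =
     \<lparr>carrier = carrier R, monoid.mult = (\<lambda>x y. y \<otimes>\<^bsub>R\<^esub> x), monoid.one = \<one>\<^bsub>R\<^esub>,
      ring.zero = \<zero>\<^bsub>R\<^esub>, ring.add = (\<oplus>\<^bsub>R\<^esub>)\<rparr>"


section \<open>Noetherian, artinian, hereditary and prime rings\<close>

definition left_noetherian :: "('a, 'm) ring_scheme \<Rightarrow> bool" where
  "left_noetherian R \<longleftrightarrow>
     (\<forall>I :: nat \<Rightarrow> 'a set. (\<forall>n. left_ideal R (I n)) \<and> (\<forall>n. I n \<subseteq> I (Suc n)) \<longrightarrow>
        (\<exists>n. \<forall>m\<ge>n. I m = I n))"

definition left_artinian :: "('a, 'm) ring_scheme \<Rightarrow> bool" where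
  "left_artinian R \<longleftrightarrow>
     (\<forall>I :: nat \<Rightarrow> 'a set. (\<forall>n. left_ideal R (I n)) \<and> (\<forall>n. I (Suc n) \<subseteq> I n) \<longrightarrow>
        (\<exists>n. \<forall>m\<ge>n. I m = I n))"

definition left_hereditary :: "('a, 'm) ring_scheme \<Rightarrow> bool" where
  "left_hereditary R \<longleftrightarrow>
     (\<forall>I. left_ideal R I \<longrightarrow>
        projective_left_module R (regular_left_module R \<lparr>carrier := I\<rparr>))"

text \<open>The library locale \<^locale>\<open>noetherian_ring\<close> is about two-sided ideals only, and is
  not the notion needed for noncommutative rings.\<close>

definition noetherian :: "('a, 'm) ring_scheme \<Rightarrow> bool" where
  "noetherian R \<longleftrightarrow> ring R \<and> left_noetherian R \<and> left_noetherian (opposite_ring R)"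

definition artinian :: "('a, 'm) ring_scheme \<Rightarrow> bool" where
  "artinian R \<longleftrightarrow> ring R \<and> left_artinian R \<and> left_artinian (opposite_ring R)"

definition hereditary :: "('a, 'm) ring_scheme \<Rightarrow> bool" where
  "hereditary R \<longleftrightarrow> ring R \<and> left_hereditary R \<and> left_hereditary (opposite_ring R)"

definition prime_ring :: "('a, 'm) ring_scheme \<Rightarrow> bool" where
  "prime_ring R \<longleftrightarrow>
     ring R \<and> \<one>\<^bsub>R\<^esub> \<noteq> \<zero>\<^bsub>R\<^esub> \<and>
     (\<forall>I J. ideal I R \<and> ideal J R \<and> I \<cdot>\<^bsub>R\<^esub> J = {\<zero>\<^bsub>R\<^esub>} \<longrightarrow> I = {\<zero>\<^bsub>R\<^esub>} \<or> J = {\<zero>\<^bsub>R\<^esub>})"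

definition simple_ring :: "('a, 'm) ring_scheme \<Rightarrow> bool" where
  "simple_ring R \<longleftrightarrow> ring R \<and> (\<forall>I. ideal I R \<longrightarrow> I = {\<zero>\<^bsub>R\<^esub>} \<or> I = carrier R)"

definition HNP_ring :: "('a, 'm) ring_scheme \<Rightarrow> bool" where
  "HNP_ring R \<longleftrightarrow> \<not> artinian R \<and> hereditary R \<and> noetherian R \<and> prime_ring R"


section \<open>Quotient rings and invertible ideals\<close>

definition regular_elements :: "('a, 'm) ring_scheme \<Rightarrow> 'a set" where
  "regular_elements R =
     {s \<in> carrier R. \<forall>r\<in>carrier R.
        (s \<otimes>\<^bsub>R\<^esub> r = \<zero>\<^bsub>R\<^esub> \<longrightarrow> r = \<zero>\<^bsub>R\<^esub>) \<and> (r \<otimes>\<^bsub>R\<^esub> s = \<zero>\<^bsub>R\<^esub> \<longrightarrow> r = \<zero>\<^bsub>R\<^esub>)}"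

text \<open>\<open>Q\<close>, with the embedding \<open>\<iota>\<close>, is a (two-sided) classical quotient ring of \<open>R\<close>.\<close>

definition classical_quotient_ring ::
  "('a, 'm) ring_scheme \<Rightarrow> ('q, 'n) ring_scheme \<Rightarrow> ('a \<Rightarrow> 'q) \<Rightarrow> bool" where
  "classical_quotient_ring R Q \<iota> \<longleftrightarrow>
     ring Q \<and> \<iota> \<in> ring_hom R Q \<and> inj_on \<iota> (carrier R) \<and>
     \<iota> ` regular_elements R \<subseteq> Units Q \<and>
     (\<forall>q\<in>carrier Q. \<exists>r\<in>carrier R. \<exists>s\<in>regular_elements R. q = \<iota> r \<otimes>\<^bsub>Q\<^esub> inv\<^bsub>Q\<^esub> (\<iota> s)) \<and>
     (\<forall>q\<in>carrier Q. \<exists>r\<in>carrier R. \<exists>s\<in>regular_elements R. q = inv\<^bsub>Q\<^esub> (\<iota> s) \<otimes>\<^bsub>Q\<^esub> \<iota> r)"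

definition subbimodule ::
  "('a, 'm) ring_scheme \<Rightarrow> ('q, 'n) ring_scheme \<Rightarrow> ('a \<Rightarrow> 'q) \<Rightarrow> 'q set \<Rightarrow> bool" where
  "subbimodule R Q \<iota> J \<longleftrightarrow>
     additive_subgroup J Q \<and>
     (\<forall>r\<in>carrier R. \<forall>x\<in>J. \<iota> r \<otimes>\<^bsub>Q\<^esub> x \<in> J \<and> x \<otimes>\<^bsub>Q\<^esub> \<iota> r \<in> J)"

text \<open>The library product \<^const>\<open>ideal_prod\<close> of two sets is the set of finite nonempty sums of products,
  that is, for additive subgroups, the additive subgroup generated by the products.

  The classical quotient ring is unique up to isomorphism over \<open>R\<close> where it exists, as it does for
  prime noetherian rings by Goldie's theorem.  Its elements can be represented as equivalence
  classes of pairs (numerator, denominator), so it can always be found on the type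
  \<open>('a \<times> 'a) set\<close>.\<close>

definition invertible_ideal :: "('a, 'm) ring_scheme \<Rightarrow> 'a set \<Rightarrow> bool" where
  "invertible_ideal R I \<longleftrightarrow>
     ideal I R \<and>
     (\<exists>(Q :: ('a \<times> 'a) set ring) \<iota> J.
        classical_quotient_ring R Q \<iota> \<and> subbimodule R Q \<iota> J \<and>
        (\<iota> ` I) \<cdot>\<^bsub>Q\<^esub> J = \<iota> ` carrier R \<and> J \<cdot>\<^bsub>Q\<^esub> (\<iota> ` I) = \<iota> ` carrier R)"

definition Dedekind_prime_ring :: "('a, 'm) ring_scheme \<Rightarrow> bool" where
  "Dedekind_prime_ring R \<longleftrightarrow>
     HNP_ring R \<and> (\<forall>I. ideal I R \<and> I \<noteq> {\<zero>\<^bsub>R\<^esub>} \<longrightarrow> invertible_ideal R I)"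


section \<open>Polynomial identities\<close>

text \<open>A polynomial with integer coefficients in the noncommuting variables \<open>x\<^sub>0, x\<^sub>1, \<dots>\<close> is a
  finitely supported integer-valued function on words; the word \<open>[i, j, \<dots>]\<close> stands for the
  monomial \<open>x\<^sub>i x\<^sub>j \<dots>\<close>.\<close>

type_synonym nc_int_poly = "nat list \<Rightarrow>\<^sub>0 int"

definition nc_eval :: "('a, 'm) ring_scheme \<Rightarrow> (nat \<Rightarrow> 'a) \<Rightarrow> nc_int_poly \<Rightarrow> 'a" where
  "nc_eval R \<sigma> p =
     (\<Oplus>\<^bsub>R\<^esub>w\<in>Poly_Mapping.keys p.
        add_pow R (Poly_Mapping.lookup p w) (foldr (\<lambda>i y. \<sigma> i \<otimes>\<^bsub>R\<^esub> y) w \<one>\<^bsub>R\<^esub>))"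

definition PI_ring :: "('a, 'm) ring_scheme \<Rightarrow> bool" where
  "PI_ring R \<longleftrightarrow>
     ring R \<and>
     (\<exists>p :: nc_int_poly.
        (\<exists>w. Poly_Mapping.lookup p w = 1 \<and> (\<forall>v\<in>Poly_Mapping.keys p. length v \<le> length w)) \<and>
        (\<forall>\<sigma> \<in> UNIV \<rightarrow> carrier R. nc_eval R \<sigma> p = \<zero>\<^bsub>R\<^esub>))"


section \<open>Algebras, dimension and tensor products\<close>

text \<open>Unlike the library locale \<^locale>\<open>algebra\<close>, the algebra is not required to be commutative.\<close>

locale central_algebra = module k A + A?: ring A
  for k :: "('a, 'd) ring_scheme" (structure) and A :: "('a, 'b, 'c) module_scheme" (structure) +
  assumes smult_mult_left:
      "\<lbrakk>c \<in> carrier k; x \<in> carrier A; y \<in> carrier A\<rbrakk> \<Longrightarrow>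
        (c \<odot>\<^bsub>A\<^esub> x) \<otimes>\<^bsub>A\<^esub> y = c \<odot>\<^bsub>A\<^esub> (x \<otimes>\<^bsub>A\<^esub> y)"
    and smult_mult_right:
      "\<lbrakk>c \<in> carrier k; x \<in> carrier A; y \<in> carrier A\<rbrakk> \<Longrightarrow>
        x \<otimes>\<^bsub>A\<^esub> (c \<odot>\<^bsub>A\<^esub> y) = c \<odot>\<^bsub>A\<^esub> (x \<otimes>\<^bsub>A\<^esub> y)"

definition is_algebraic_closure ::
  "('k, 'm) ring_scheme \<Rightarrow> ('k, 'l, 'n) module_scheme \<Rightarrow> bool" where
  "is_algebraic_closure k L \<longleftrightarrow>
     central_algebra k L \<and> algebraic_closure L ((\<lambda>c. c \<odot>\<^bsub>L\<^esub> \<one>\<^bsub>L\<^esub>) ` carrier k)"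

text \<open>The dimension of \<open>V\<close>, possibly infinite, is less than the cardinality of \<open>S\<close>.\<close>

definition dim_less_card ::
  "('k, 'm) ring_scheme \<Rightarrow> ('k, 'v, 'n) module_scheme \<Rightarrow> 'x set \<Rightarrow> bool" where
  "dim_less_card k V S \<longleftrightarrow> (\<exists>B. vectorspace.basis k V B \<and> ordLess2 (card_of B) (card_of S))"

text \<open>The tensor product of two \<open>k\<close>-algebras \<open>A\<close> and \<open>B\<close> is obtained in the usual way, dividing
  the free abelian group on \<open>A \<times> B\<close> by the bilinearity relations.  The free abelian group is
  first made into a ring by \<open>(a, b) (a', b') = (a a', b b')\<close>; the subgroup generated by the
  relations is then an ideal, as shown below, so that the quotient is a ring.\<close>

definition pair_ring ::
  "('a, 'm) ring_scheme \<Rightarrow> ('b, 'n) ring_scheme \<Rightarrow> ('a \<times> 'b \<Rightarrow>\<^sub>0 int) ring" where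
  "pair_ring A B =
     \<lparr>carrier = {u. Poly_Mapping.keys u \<subseteq> carrier A \<times> carrier B},
      monoid.mult = (\<lambda>u v. frag_extend (\<lambda>(a, b).
                frag_extend (\<lambda>(a', b'). frag_of (a \<otimes>\<^bsub>A\<^esub> a', b \<otimes>\<^bsub>B\<^esub> b')) v) u),
      monoid.one = frag_of (\<one>\<^bsub>A\<^esub>, \<one>\<^bsub>B\<^esub>), ring.zero = 0, ring.add = (+)\<rparr>"

definition tensor_relations ::
  "('k, 'p) ring_scheme \<Rightarrow> ('k, 'a, 'm) module_scheme \<Rightarrow> ('k, 'b, 'n) module_scheme
     \<Rightarrow> ('a \<times> 'b \<Rightarrow>\<^sub>0 int) set" where
  "tensor_relations k A B =
     {frag_of (a \<oplus>\<^bsub>A\<^esub> a', b) - frag_of (a, b) - frag_of (a', b) |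
        a a' b. a \<in> carrier A \<and> a' \<in> carrier A \<and> b \<in> carrier B} \<union>
     {frag_of (a, b \<oplus>\<^bsub>B\<^esub> b') - frag_of (a, b) - frag_of (a, b') |
        a b b'. a \<in> carrier A \<and> b \<in> carrier B \<and> b' \<in> carrier B} \<union>
     {frag_of (c \<odot>\<^bsub>A\<^esub> a, b) - frag_of (a, c \<odot>\<^bsub>B\<^esub> b) |
        c a b. c \<in> carrier k \<and> a \<in> carrier A \<and> b \<in> carrier B}"

definition tensor_algebra ::
  "('k, 'p) ring_scheme \<Rightarrow> ('k, 'a, 'm) module_scheme \<Rightarrow> ('k, 'b, 'n) module_scheme
     \<Rightarrow> ('a \<times> 'b \<Rightarrow>\<^sub>0 int) set ring" where
  "tensor_algebra k A B =
     pair_ring A B Quot (generate (add_monoid (pair_ring A B)) (tensor_relations k A B))"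

lemma frag_extend_fun_add:
  "frag_extend (\<lambda>x. f x + g x) u = frag_extend f u + frag_extend g u"
  by (simp add: frag_extend_def frag_cmul_distrib2 sum.distrib)

context
  fixes A :: "('a, 'm) ring_scheme" and B :: "('b, 'n) ring_scheme"
  assumes ring_A: "ring A" and ring_B: "ring B"
begin

interpretation A: ring A by (rule ring_A)
interpretation B: ring B by (rule ring_B)

private abbreviation (input) P where "P \<equiv> pair_ring A B"

lemma pair_ring_carrier: "u \<in> carrier P \<longleftrightarrow> Poly_Mapping.keys u \<subseteq> carrier A \<times> carrier B"
  by (simp add: pair_ring_def)

lemma pair_ring_simps:
  "u \<oplus>\<^bsub>P\<^esub> v = u + v" "\<zero>\<^bsub>P\<^esub> = 0" "\<one>\<^bsub>P\<^esub> = frag_of (\<one>\<^bsub>A\<^esub>, \<one>\<^bsub>B\<^esub>)"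
  by (simp_all add: pair_ring_def)

lemma pair_ring_mult_of:
  "frag_of (a, b) \<otimes>\<^bsub>P\<^esub> frag_of (a', b') = frag_of (a \<otimes>\<^bsub>A\<^esub> a', b \<otimes>\<^bsub>B\<^esub> b')"
  by (simp add: pair_ring_def)

lemma pair_ring_distrib_left: "u \<otimes>\<^bsub>P\<^esub> (v + w) = u \<otimes>\<^bsub>P\<^esub> v + u \<otimes>\<^bsub>P\<^esub> w"
  by (simp add: pair_ring_def frag_extend_add case_prod_unfold frag_extend_fun_add)

lemma pair_ring_distrib_right: "(u + v) \<otimes>\<^bsub>P\<^esub> w = u \<otimes>\<^bsub>P\<^esub> w + v \<otimes>\<^bsub>P\<^esub> w"
  by (simp add: pair_ring_def frag_extend_add)

lemma pair_ring_mult_zero: "u \<otimes>\<^bsub>P\<^esub> 0 = 0" "0 \<otimes>\<^bsub>P\<^esub> u = 0"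
  using pair_ring_distrib_left[of u 0 0] pair_ring_distrib_right[of 0 0 u] by simp_all

lemma pair_ring_diff_left: "u \<otimes>\<^bsub>P\<^esub> (v - w) = u \<otimes>\<^bsub>P\<^esub> v - u \<otimes>\<^bsub>P\<^esub> w"
  using pair_ring_distrib_left[of u "v - w" w] by (simp add: algebra_simps)

lemma pair_ring_diff_right: "(u - v) \<otimes>\<^bsub>P\<^esub> w = u \<otimes>\<^bsub>P\<^esub> w - v \<otimes>\<^bsub>P\<^esub> w"
  using pair_ring_distrib_right[of "u - v" v w] by (simp add: algebra_simps)

lemma pair_ring_diff_closed:
  "u \<in> carrier P \<Longrightarrow> v \<in> carrier P \<Longrightarrow> u - v \<in> carrier P"
  unfolding pair_ring_carrier using keys_diff[of u v] by blast

lemma pair_ring_induct [consumes 1, case_names zero gen diff]: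
  assumes "u \<in> carrier P" "Q 0"
    and "\<And>a b. a \<in> carrier A \<Longrightarrow> b \<in> carrier B \<Longrightarrow> Q (frag_of (a, b))"
    and "\<And>v w. Q v \<Longrightarrow> Q w \<Longrightarrow> Q (v - w)"
  shows "Q u"
  using assms(1)[unfolded pair_ring_carrier] by (rule frag_induction) (use assms in auto)

lemma pair_ring_mult_closed:
  assumes "u \<in> carrier P" "v \<in> carrier P"
  shows "u \<otimes>\<^bsub>P\<^esub> v \<in> carrier P"
  using assms(1)
proof (induction u rule: pair_ring_induct)
  case (gen a b)
  show ?case using assms(2)
    by (induction v rule: pair_ring_induct)
      (use gen in \<open>auto simp: pair_ring_mult_of pair_ring_mult_zero pair_ring_diff_left
        intro: pair_ring_diff_closed, auto simp: pair_ring_carrier\<close>)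
qed (auto simp: pair_ring_mult_zero pair_ring_diff_right intro: pair_ring_diff_closed,
     simp add: pair_ring_carrier)

lemma pair_ring_assoc:
  assumes "u \<in> carrier P" "v \<in> carrier P" "w \<in> carrier P"
  shows "(u \<otimes>\<^bsub>P\<^esub> v) \<otimes>\<^bsub>P\<^esub> w = u \<otimes>\<^bsub>P\<^esub> (v \<otimes>\<^bsub>P\<^esub> w)"
  using assms(1)
proof (induction u rule: pair_ring_induct)
  case (gen a b)
  note ab = gen
  show ?case using assms(2)
  proof (induction v rule: pair_ring_induct)
    case (gen a' b')
    show ?case using assms(3)
      by (induction w rule: pair_ring_induct)
        (use ab gen in \<open>auto simp: pair_ring_mult_of pair_ring_mult_zero pair_ring_diff_left
           A.m_assoc B.m_assoc\<close>)
  qed (auto simp: pair_ring_mult_zero pair_ring_diff_left pair_ring_diff_right)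
qed (auto simp: pair_ring_mult_zero pair_ring_diff_right)

lemma pair_ring_one_mult:
  assumes "u \<in> carrier P"
  shows "\<one>\<^bsub>P\<^esub> \<otimes>\<^bsub>P\<^esub> u = u \<and> u \<otimes>\<^bsub>P\<^esub> \<one>\<^bsub>P\<^esub> = u"
  unfolding pair_ring_simps
  using assms
  by (induction u rule: pair_ring_induct)
    (auto simp: pair_ring_mult_of pair_ring_mult_zero pair_ring_diff_left
      pair_ring_diff_right)

lemma ring_pair_ring: "ring P"
proof (rule ringI)
  show "abelian_group P"
  proof (rule abelian_groupI)
    fix u assume "u \<in> carrier P"
    then show "\<exists>v\<in>carrier P. v \<oplus>\<^bsub>P\<^esub> u = \<zero>\<^bsub>P\<^esub>"
      by (intro bexI[of _ "- u"]) (auto simp: pair_ring_simps pair_ring_carrier)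
  next
    fix u v assume "u \<in> carrier P" "v \<in> carrier P"
    then show "u \<oplus>\<^bsub>P\<^esub> v \<in> carrier P"
      using keys_add[of u v] by (auto simp: pair_ring_simps pair_ring_carrier)
  qed (auto simp: pair_ring_simps pair_ring_carrier add.assoc add.commute)
  show "Group.monoid P"
    by (rule monoidI) (auto simp: pair_ring_mult_closed pair_ring_assoc pair_ring_one_mult,
        simp add: pair_ring_simps pair_ring_carrier)
qed (auto simp: pair_ring_simps pair_ring_distrib_left pair_ring_distrib_right)

end

lemma ideal_tensor_relations:
  assumes "central_algebra k A" and "central_algebra k B"
  shows "ideal (generate (add_monoid (pair_ring A B)) (tensor_relations k A B)) (pair_ring A B)"
proof -
  interpret A: central_algebra k A by fact
  interpret B: central_algebra k B by fact
  note rings = A.A.ring_axioms B.A.ring_axioms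
  interpret P: ring "pair_ring A B" by (rule ring_pair_ring[OF rings])
  let ?P = "pair_ring A B" and ?T = "tensor_relations k A B"
  let ?G = "generate (add_monoid ?P) ?T"
  note diff = pair_ring_diff_left[OF rings] pair_ring_diff_right[OF rings]
  note add = pair_ring_distrib_left[OF rings] pair_ring_distrib_right[OF rings]
  note mult_of = pair_ring_mult_of[OF rings]
  have rel1: "frag_of (a \<oplus>\<^bsub>A\<^esub> a', b) - frag_of (a, b) - frag_of (a', b) \<in> ?T"
    if "a \<in> carrier A" "a' \<in> carrier A" "b \<in> carrier B" for a a' b
    using that unfolding tensor_relations_def by blast
  have rel2: "frag_of (a, b \<oplus>\<^bsub>B\<^esub> b') - frag_of (a, b) - frag_of (a, b') \<in> ?T"
    if "a \<in> carrier A" "b \<in> carrier B" "b' \<in> carrier B" for a b b'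
    using that unfolding tensor_relations_def by blast
  have rel3: "frag_of (c \<odot>\<^bsub>A\<^esub> a, b) - frag_of (a, c \<odot>\<^bsub>B\<^esub> b) \<in> ?T"
    if "c \<in> carrier k" "a \<in> carrier A" "b \<in> carrier B" for c a b
    using that unfolding tensor_relations_def by blast
  have fc: "frag_of (a, b) \<in> carrier ?P" if "a \<in> carrier A" "b \<in> carrier B" for a b
    using that by (simp add: pair_ring_carrier[OF rings])
  have T: "?T \<subseteq> carrier ?P"
    unfolding tensor_relations_def
    by (auto intro!: pair_ring_diff_closed[OF rings] fc)
  have sub: "subgroup ?G (add_monoid ?P)"
    by (rule P.add.generate_is_subgroup) (use T in simp)
  have minus: "inv\<^bsub>add_monoid ?P\<^esub> u = - u" if "u \<in> carrier ?P" for u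
  proof -
    have "\<ominus>\<^bsub>?P\<^esub> u = - u"
      by (rule P.minus_equality)
        (use that in \<open>auto simp: pair_ring_simps[OF rings] pair_ring_carrier[OF rings]\<close>)
    then show ?thesis by (simp add: a_inv_def)
  qed
  have G_carrier: "u \<in> carrier ?P" if "u \<in> ?G" for u
    using subgroup.subset[OF sub] that by auto
  have G_diff: "u - v \<in> ?G" if "u \<in> ?G" "v \<in> ?G" for u v
    using subgroup.m_closed[OF sub that(1) subgroup.m_inv_closed[OF sub that(2)]]
      minus[OF G_carrier[OF that(2)]] by (simp add: pair_ring_simps[OF rings])
  have G_zero: "0 \<in> ?G"
    using subgroup.one_closed[OF sub] by (simp add: pair_ring_simps[OF rings])
  have T_closed: "frag_of (x, y) \<otimes>\<^bsub>?P\<^esub> t \<in> ?T \<and> t \<otimes>\<^bsub>?P\<^esub> frag_of (x, y) \<in> ?T"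
    if t: "t \<in> ?T" and x: "x \<in> carrier A" and y: "y \<in> carrier B" for t x y
  proof -
    from t[unfolded tensor_relations_def] show ?thesis
    proof (elim UnE CollectE exE conjE)
      fix a a' b
      assume 1: "t = frag_of (a \<oplus>\<^bsub>A\<^esub> a', b) - frag_of (a, b) - frag_of (a', b)"
        "a \<in> carrier A" "a' \<in> carrier A" "b \<in> carrier B"
      show ?thesis
        using 1(2-) x y rel1[of "x \<otimes>\<^bsub>A\<^esub> a" "x \<otimes>\<^bsub>A\<^esub> a'" "y \<otimes>\<^bsub>B\<^esub> b"]
          rel1[of "a \<otimes>\<^bsub>A\<^esub> x" "a' \<otimes>\<^bsub>A\<^esub> x" "b \<otimes>\<^bsub>B\<^esub> y"]
        unfolding 1(1) by (simp add: diff mult_of A.A.r_distr A.A.l_distr)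
    next
      fix a b b'
      assume 2: "t = frag_of (a, b \<oplus>\<^bsub>B\<^esub> b') - frag_of (a, b) - frag_of (a, b')"
        "a \<in> carrier A" "b \<in> carrier B" "b' \<in> carrier B"
      show ?thesis
        using 2(2-) x y rel2[of "x \<otimes>\<^bsub>A\<^esub> a" "y \<otimes>\<^bsub>B\<^esub> b" "y \<otimes>\<^bsub>B\<^esub> b'"]
          rel2[of "a \<otimes>\<^bsub>A\<^esub> x" "b \<otimes>\<^bsub>B\<^esub> y" "b' \<otimes>\<^bsub>B\<^esub> y"]
        unfolding 2(1) by (simp add: diff mult_of B.A.r_distr B.A.l_distr)
    next
      fix c a b
      assume 3: "t = frag_of (c \<odot>\<^bsub>A\<^esub> a, b) - frag_of (a, c \<odot>\<^bsub>B\<^esub> b)"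
        "c \<in> carrier k" "a \<in> carrier A" "b \<in> carrier B"
      show ?thesis
        using 3(2-) x y rel3[of c "x \<otimes>\<^bsub>A\<^esub> a" "y \<otimes>\<^bsub>B\<^esub> b"]
          rel3[of c "a \<otimes>\<^bsub>A\<^esub> x" "b \<otimes>\<^bsub>B\<^esub> y"]
        unfolding 3(1)
        by (simp add: diff mult_of A.smult_mult_left A.smult_mult_right
            B.smult_mult_left B.smult_mult_right)
    qed
  qed
  have one_eq: "\<one>\<^bsub>add_monoid ?P\<^esub> = 0"
    and plus_eq: "g \<otimes>\<^bsub>add_monoid ?P\<^esub> h = g + h" for g h
    by (simp_all add: pair_ring_simps[OF rings])
  have closed: "u \<otimes>\<^bsub>?P\<^esub> g \<in> ?G \<and> g \<otimes>\<^bsub>?P\<^esub> u \<in> ?G" if "g \<in> ?G" "u \<in> carrier ?P" for u g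
    using that(2)
  proof (induction u rule: pair_ring_induct[OF rings, consumes 1, case_names zero gen diff])
    case (gen x y)
    show ?case using that(1)
    proof (induction g rule: generate.induct)
      case one
      show ?case unfolding one_eq pair_ring_mult_zero[OF rings] using G_zero by blast
    next
      case (incl h)
      then show ?case using T_closed[OF incl gen] by (auto intro: generate.incl)
    next
      case (inv h)
      have h: "h \<in> carrier ?P" using inv T by auto
      have "0 - frag_of (x, y) \<otimes>\<^bsub>?P\<^esub> h \<in> ?G" "0 - h \<otimes>\<^bsub>?P\<^esub> frag_of (x, y) \<in> ?G"
        using T_closed[OF inv gen] G_diff[OF G_zero generate.incl] by blast+
      moreover have "frag_of (x, y) \<otimes>\<^bsub>?P\<^esub> (- h) = 0 - frag_of (x, y) \<otimes>\<^bsub>?P\<^esub> h"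
        "(- h) \<otimes>\<^bsub>?P\<^esub> frag_of (x, y) = 0 - h \<otimes>\<^bsub>?P\<^esub> frag_of (x, y)"
        using diff(1)[of "frag_of (x, y)" 0 h] diff(2)[of 0 h "frag_of (x, y)"]
        by (simp_all add: pair_ring_mult_zero[OF rings])
      ultimately show ?case unfolding minus[OF h] by metis
    next
      case (eng g h)
      then show ?case
        unfolding plus_eq add using subgroup.m_closed[OF sub, unfolded plus_eq] by blast
    qed
  qed (use G_zero G_diff in \<open>auto simp: pair_ring_mult_zero[OF rings] diff\<close>)
  show ?thesis
    by (rule idealI[OF P.ring_axioms sub]) (use closed in auto)
qed

lemma ring_tensor_algebra:
  assumes "central_algebra k A" and "central_algebra k B"
  shows "ring (tensor_algebra k A B)"
  unfolding tensor_algebra_def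
  by (rule ideal.quotient_is_ring[OF ideal_tensor_relations[OF assms]])

end

theory Submission
  imports Defs "HOL-Combinatorics.Permutations"
begin

text \<open>Let \<open>I\<close> be a proper invertible ideal of \<open>R\<close>.  It contains a regular element \<open>s\<close>, and its powers
  intersect in \<open>0\<close>.  In a hereditary noetherian ring, left ideals containing a fixed regular element
  are determined by their duals, which are right ideals up to a factor; hence these left ideals
  satisfy the descending chain condition.  In particular there is an \<open>m\<close> with
  \<open>I\<^sup>m \<subseteq> R s + I\<^sup>n\<close> for all \<open>n\<close>.

  Next, \<open>R / I\<^sup>m\<close> is finite-dimensional over \<open>k\<close>.  It suffices to show this for \<open>R / L\<close>, where
  \<open>L\<close> is a maximal left ideal containing \<open>I\<^sup>m\<close>.  Let \<open>S\<close> be the idealizer of \<open>L\<close>, so that the division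
  ring \<open>S / L\<close> acts on the simple module \<open>R / L\<close>.  As \<open>dim R < card k\<close>, Amitsur's argument shows that
  \<open>S / L\<close> is algebraic over \<open>k\<close>.  A homomorphism \<open>\<chi>\<close> from a finite-dimensional commutative subalgebra
  of \<open>S / L\<close> to the algebraic closure gives a proper left ideal of the tensor product, generated by
  the elements \<open>x \<otimes> 1 - 1 \<otimes> \<chi> x\<close>, which grows strictly when \<open>\<chi>\<close> is extended properly.  Since the
  tensor product is noetherian, \<open>S / L\<close> has a finite-dimensional maximal commutative subalgebra, and
  the density theorem together with the chain condition bounds \<open>R / L\<close>.

  Let \<open>f\<^sub>1, \<dots>, f\<^sub>d\<close> span \<open>R\<close> modulo \<open>I\<^sup>m\<close> and let \<open>C\<close> be the commutative bicommutant of \<open>s\<close>.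
  Iterating \<open>R = \<Sum>\<^sub>i f\<^sub>i k + I\<^sup>m\<close> and \<open>I\<^sup>m \<subseteq> R s + I\<^sup>n\<close> yields \<open>R = \<Sum>\<^sub>i f\<^sub>i C + I\<^sup>n\<close>.  So every \<open>R / I\<^sup>n\<close>
  satisfies the standard identity of degree \<open>d\<^sup>2 + 1\<close>, hence so does \<open>R\<close>.\<close>

section \<open>One-sided ideals\<close>

text \<open>Neither the division ring \<open>S / L\<close> nor the module \<open>R / L\<close> is
  formed: residues are elements of \<open>R\<close> compared modulo \<open>L\<close>, dimensions are
  taken relative to a subspace, and the tensor product enters through its pure tensors and
  functionals. The hypothesis on the dimension serves Amitsur's counting: the inverses of
  \<open>a - c\<close> are indexed by \<open>k\<close>, and a basis smaller than \<open>k\<close>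
  has too few finite lists to hold them all. The counting needs an infinite basis; over a finite one
  every quotient is finite-dimensional at once. Algebraicity alone leaves room for
  infinite-dimensional commutative subfields of \<open>S / L\<close>, each of which would give a
  strictly ascending chain of left ideals in the tensor product; this is where noetherianity enters.
  Finally, the dimension of \<open>R / I^n\<close> may grow with \<open>n\<close>, so that finite
  dimension yields no common identity. The number \<open>d\<close> of generators over a commutative
  subring does not grow, and it fixes the degree \<open>d^2 + 1\<close>: a path through
  \<open>d\<close> indices has only \<open>d^2\<close> different steps.\<close>

context ring begin

lemma additive_subgroup_diffI:
  assumes "N \<subseteq> carrier R" "\<zero> \<in> N" "\<And>x y. x \<in> N \<Longrightarrow> y \<in> N \<Longrightarrow> x \<ominus> y \<in> N"
  shows "additive_subgroup N R"
proof -
  have neg: "\<ominus> x \<in> N" if "x \<in> N" for x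
    using assms(3)[OF assms(2) that] that assms(1) by (auto simp: a_minus_def)
  have "x \<oplus> y \<in> N" if "x \<in> N" "y \<in> N" for x y
    using assms(3)[OF that(1) neg[OF that(2)]] that assms(1) by (auto simp: a_minus_def subset_iff)
  then show ?thesis
    using assms neg by (intro additive_subgroup.intro subgroup.intro) (auto simp: a_inv_def)
qed

lemma additive_subgroup_diff:
  assumes "additive_subgroup N R" "x \<in> N" "y \<in> N"
  shows "x \<ominus> y \<in> N"
  using assms by (simp add: a_minus_def additive_subgroup.a_closed additive_subgroup.a_inv_closed)

lemma left_ideal_iff:
  "left_ideal R I \<longleftrightarrow> additive_subgroup I R \<and> (\<forall>a\<in>carrier R. \<forall>x\<in>I. a \<otimes> x \<in> I)"
  unfolding left_ideal_def left_submodule_def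
  by (simp add: regular_left_module_def additive_subgroup_def subgroup_def m_inv_def)

lemma left_idealD:
  assumes "left_ideal R I"
  shows "additive_subgroup I R" "I \<subseteq> carrier R" "\<zero> \<in> I"
    "\<And>x y. x \<in> I \<Longrightarrow> y \<in> I \<Longrightarrow> x \<oplus> y \<in> I" "\<And>x y. x \<in> I \<Longrightarrow> y \<in> I \<Longrightarrow> x \<ominus> y \<in> I"
    "\<And>x. x \<in> I \<Longrightarrow> \<ominus> x \<in> I" "\<And>a x. a \<in> carrier R \<Longrightarrow> x \<in> I \<Longrightarrow> a \<otimes> x \<in> I"
proof -
  show *: "additive_subgroup I R" using assms left_ideal_iff by blast
  then interpret additive_subgroup I R .
  show "I \<subseteq> carrier R" "\<zero> \<in> I" using a_subset zero_closed by auto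
  show "\<And>x y. x \<in> I \<Longrightarrow> y \<in> I \<Longrightarrow> x \<oplus> y \<in> I" by (rule a_closed)
  show "\<And>x y. x \<in> I \<Longrightarrow> y \<in> I \<Longrightarrow> x \<ominus> y \<in> I" using additive_subgroup_diff[OF *] .
  show "\<And>x. x \<in> I \<Longrightarrow> \<ominus> x \<in> I" by (rule a_inv_closed)
  show "\<And>a x. a \<in> carrier R \<Longrightarrow> x \<in> I \<Longrightarrow> a \<otimes> x \<in> I" using assms left_ideal_iff by blast
qed

lemma left_idealI:
  assumes "N \<subseteq> carrier R" "\<zero> \<in> N" "\<And>x y. x \<in> N \<Longrightarrow> y \<in> N \<Longrightarrow> x \<ominus> y \<in> N"
    "\<And>a x. a \<in> carrier R \<Longrightarrow> x \<in> N \<Longrightarrow> a \<otimes> x \<in> N"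
  shows "left_ideal R N"
  using additive_subgroup_diffI[OF assms(1-3)] assms(4) left_ideal_iff by blast

lemma ring_opposite_ring: "ring (opposite_ring R)"
proof (rule ringI)
  show "abelian_group (opposite_ring R)"
    by (rule abelian_groupI) (auto simp: opposite_ring_def a_assoc a_comm a_lcomm intro: l_neg)
  show "Group.monoid (opposite_ring R)"
    by (rule Group.monoidI) (auto simp: opposite_ring_def m_assoc)
qed (auto simp: opposite_ring_def l_distr r_distr)

lemma opposite_ring_simps:
  "carrier (opposite_ring R) = carrier R" "x \<otimes>\<^bsub>opposite_ring R\<^esub> y = y \<otimes> x"
  "\<one>\<^bsub>opposite_ring R\<^esub> = \<one>" "\<zero>\<^bsub>opposite_ring R\<^esub> = \<zero>" "x \<oplus>\<^bsub>opposite_ring R\<^esub> y = x \<oplus> y"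
  by (simp_all add: opposite_ring_def)

lemma right_idealI:
  assumes "N \<subseteq> carrier R" "\<zero> \<in> N" "\<And>x y. x \<in> N \<Longrightarrow> y \<in> N \<Longrightarrow> x \<ominus> y \<in> N"
    "\<And>a x. a \<in> carrier R \<Longrightarrow> x \<in> N \<Longrightarrow> x \<otimes> a \<in> N"
  shows "left_ideal (opposite_ring R) N"
proof -
  have "additive_subgroup N (opposite_ring R)"
    using additive_subgroup_diffI[OF assms(1-3)] by (simp add: additive_subgroup_def opposite_ring_def subgroup_def m_inv_def)
  then show ?thesis
    using assms(4) by (simp add: ring.left_ideal_iff[OF ring_opposite_ring] opposite_ring_simps)
qed

end

text \<open>Dependent choice turns a family without maximal member into a strictly ascending
  sequence. Applied to the opposite ring this serves for right ideals, and applied to the tensor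
  product for the left ideals attached to characters.\<close>

lemma left_noetherian_maximal:
  assumes "left_noetherian R" "\<F> \<noteq> {}" "\<And>I. I \<in> \<F> \<Longrightarrow> left_ideal R I"
  shows "\<exists>M\<in>\<F>. \<forall>I\<in>\<F>. M \<subseteq> I \<longrightarrow> I = M"
proof (rule ccontr)
  assume neg: "\<not> ?thesis"
  have step: "\<exists>I. I \<in> \<F> \<and> M \<subset> I" if "M \<in> \<F>" for M
    using neg that by (metis psubsetI)
  obtain f where f: "\<And>n::nat. f n \<in> \<F> \<and> f n \<subset> f (Suc n)"
    using dependent_nat_choice[of "\<lambda>_ I. I \<in> \<F>" "\<lambda>_ I J. I \<subset> J"] assms(2) step by blast
  have "(\<forall>n. left_ideal R (f n)) \<and> (\<forall>n. f n \<subseteq> f (Suc n))"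
    using f assms(3) by blast
  then obtain n where "\<forall>m\<ge>n. f m = f n"
    using assms(1) unfolding left_noetherian_def by blast
  then have "f (Suc n) = f n" using le_SucI by blast
  then show False using f[of n] by blast
qed

section \<open>Subspaces over a central subfield\<close>

text \<open>The field of scalars is represented by its image \<open>F\<close> in the ring, so that
  subspaces are subsets of \<open>R\<close> and the scalar action is ordinary
  multiplication.\<close>

locale central_subfield = ring R for R (structure) and F +
  assumes F_subset: "F \<subseteq> carrier R"
    and F_one: "\<one> \<in> F"
    and F_diff: "\<And>a b. a \<in> F \<Longrightarrow> b \<in> F \<Longrightarrow> a \<ominus> b \<in> F"
    and F_mult: "\<And>a b. a \<in> F \<Longrightarrow> b \<in> F \<Longrightarrow> a \<otimes> b \<in> F"
    and F_central: "\<And>a x. a \<in> F \<Longrightarrow> x \<in> carrier R \<Longrightarrow> a \<otimes> x = x \<otimes> a"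
    and F_inverse: "\<And>a. a \<in> F \<Longrightarrow> a \<noteq> \<zero> \<Longrightarrow> \<exists>b\<in>F. b \<otimes> a = \<one>"
    and one_not_zero: "\<one> \<noteq> \<zero>"
begin

lemma F_carrier [simp]: "a \<in> F \<Longrightarrow> a \<in> carrier R"
  using F_subset by blast

lemma F_zero: "\<zero> \<in> F"
  using F_diff[OF F_one F_one] by (simp add: a_minus_def r_neg)

definition ksub :: "'a set \<Rightarrow> bool" where
  "ksub W \<longleftrightarrow> W \<subseteq> carrier R \<and> \<zero> \<in> W \<and> (\<forall>x\<in>W. \<forall>y\<in>W. x \<ominus> y \<in> W) \<and> (\<forall>c\<in>F. \<forall>x\<in>W. c \<otimes> x \<in> W)"

lemma ksubI:
  assumes "W \<subseteq> carrier R" "\<zero> \<in> W" "\<And>x y. x \<in> W \<Longrightarrow> y \<in> W \<Longrightarrow> x \<ominus> y \<in> W"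
    "\<And>c x. c \<in> F \<Longrightarrow> x \<in> W \<Longrightarrow> c \<otimes> x \<in> W"
  shows "ksub W"
  using assms by (auto simp: ksub_def)

lemma ksubD:
  assumes "ksub W"
  shows "W \<subseteq> carrier R" "\<zero> \<in> W" "\<And>x y. x \<in> W \<Longrightarrow> y \<in> W \<Longrightarrow> x \<ominus> y \<in> W"
    "\<And>c x. c \<in> F \<Longrightarrow> x \<in> W \<Longrightarrow> c \<otimes> x \<in> W" "\<And>x y. x \<in> W \<Longrightarrow> y \<in> W \<Longrightarrow> x \<oplus> y \<in> W"
    "\<And>x. x \<in> W \<Longrightarrow> \<ominus> x \<in> W"
proof -
  show *: "W \<subseteq> carrier R" "\<zero> \<in> W" "\<And>x y. x \<in> W \<Longrightarrow> y \<in> W \<Longrightarrow> x \<ominus> y \<in> W"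
    "\<And>c x. c \<in> F \<Longrightarrow> x \<in> W \<Longrightarrow> c \<otimes> x \<in> W"
    using assms by (auto simp: ksub_def)
  have "additive_subgroup W R" using additive_subgroup_diffI[OF *(1-3)] .
  then show "\<And>x y. x \<in> W \<Longrightarrow> y \<in> W \<Longrightarrow> x \<oplus> y \<in> W" "\<And>x. x \<in> W \<Longrightarrow> \<ominus> x \<in> W"
    by (simp_all add: additive_subgroup.a_closed additive_subgroup.a_inv_closed)
qed

lemma ksub_carrier: "ksub W \<Longrightarrow> x \<in> W \<Longrightarrow> x \<in> carrier R"
  using ksubD(1) by blast

lemma ksub_left_ideal: "left_ideal R I \<Longrightarrow> ksub I"
  using left_idealD[of I] by (intro ksubI) auto

text \<open>Keeping a base \<open>W\<close> in the span makes the dimension of a quotient by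
  \<open>W\<close> a matter of list lengths, without quotient spaces.\<close>

primrec kspan :: "'a list \<Rightarrow> 'a set \<Rightarrow> 'a set" where
  "kspan [] W = W"
| "kspan (f # fs) W = {c \<otimes> f \<oplus> x | c x. c \<in> F \<and> x \<in> kspan fs W}"

lemma kspan_append: "kspan (xs @ ys) W = kspan xs (kspan ys W)"
  by (induction xs) auto

lemma kspan_ConsI: "c \<in> F \<Longrightarrow> x \<in> kspan fs W \<Longrightarrow> c \<otimes> f \<oplus> x \<in> kspan (f # fs) W"
  by auto

lemma ksub_kspan1:
  assumes "ksub W" "f \<in> carrier R"
  shows "ksub {c \<otimes> f \<oplus> x | c x. c \<in> F \<and> x \<in> W}"
proof (rule ksubI)
  note W = ksubD[OF assms(1)]
  show "{c \<otimes> f \<oplus> x | c x. c \<in> F \<and> x \<in> W} \<subseteq> carrier R"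
    using W(1) assms(2) by auto
  show "\<zero> \<in> {c \<otimes> f \<oplus> x | c x. c \<in> F \<and> x \<in> W}"
    using F_zero W(2) assms(2) by (intro CollectI exI[of _ \<zero>]) auto
next
  note W = ksubD[OF assms(1)]
  fix x y assume "x \<in> {c \<otimes> f \<oplus> x | c x. c \<in> F \<and> x \<in> W}" "y \<in> {c \<otimes> f \<oplus> x | c x. c \<in> F \<and> x \<in> W}"
  then obtain c x' d y' where *: "x = c \<otimes> f \<oplus> x'" "y = d \<otimes> f \<oplus> y'" "c \<in> F" "d \<in> F" "x' \<in> W" "y' \<in> W"
    by blast
  have c: "c \<in> carrier R" "d \<in> carrier R" "x' \<in> carrier R" "y' \<in> carrier R" using * W(1) by auto
  have "x \<ominus> y = (c \<ominus> d) \<otimes> f \<oplus> (x' \<ominus> y')"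
    unfolding *(1,2) using c assms(2) by algebra
  then show "x \<ominus> y \<in> {c \<otimes> f \<oplus> x | c x. c \<in> F \<and> x \<in> W}"
    using F_diff[OF *(3,4)] W(3)[OF *(5,6)] by blast
next
  note W = ksubD[OF assms(1)]
  fix e x assume "e \<in> F" "x \<in> {c \<otimes> f \<oplus> x | c x. c \<in> F \<and> x \<in> W}"
  then obtain c x' where *: "x = c \<otimes> f \<oplus> x'" "c \<in> F" "x' \<in> W" by blast
  have "e \<otimes> x = (e \<otimes> c) \<otimes> f \<oplus> e \<otimes> x'"
    unfolding *(1) using * W(1) \<open>e \<in> F\<close> assms(2) by (auto simp: r_distr m_assoc subset_iff)
  then show "e \<otimes> x \<in> {c \<otimes> f \<oplus> x | c x. c \<in> F \<and> x \<in> W}"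
    using F_mult[OF \<open>e \<in> F\<close> *(2)] W(4)[OF \<open>e \<in> F\<close> *(3)] by blast
qed

lemma ksub_kspan: "ksub W \<Longrightarrow> set fs \<subseteq> carrier R \<Longrightarrow> ksub (kspan fs W)"
proof (induction fs)
  case (Cons f fs)
  then show ?case using ksub_kspan1[of "kspan fs W" f] by simp
qed simp

lemma kspan_upper: "ksub W \<Longrightarrow> set fs \<subseteq> carrier R \<Longrightarrow> W \<subseteq> kspan fs W"
proof (induction fs)
  case (Cons f fs)
  have "x \<in> kspan (f # fs) W" if "x \<in> W" for x
    using Cons that ksub_carrier[OF Cons.prems(1) that] kspan_ConsI[OF F_zero, of x fs W f] by auto
  then show ?case by blast
qed simp

lemma kspan_gen: "ksub W \<Longrightarrow> set fs \<subseteq> carrier R \<Longrightarrow> set fs \<subseteq> kspan fs W"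
proof (induction fs)
  case (Cons f fs)
  have K: "ksub (kspan fs W)" using Cons ksub_kspan by simp
  have "f \<in> kspan (f # fs) W"
    using Cons.prems kspan_ConsI[OF F_one ksubD(2)[OF K], of f] by simp
  moreover have "x \<in> kspan (f # fs) W" if "x \<in> kspan fs W" for x
    using Cons that ksub_carrier[OF K that] kspan_ConsI[OF F_zero, of x fs W f] by simp
  ultimately show ?case using Cons by auto
qed simp

lemma kspan_least:
  assumes "ksub V" "W \<subseteq> V" "set fs \<subseteq> V"
  shows "kspan fs W \<subseteq> V"
  using assms(3)
proof (induction fs)
  case (Cons f fs)
  then show ?case using ksubD(4,5)[OF assms(1)] by auto
qed (use assms in auto)

lemma kspan_mono:
  assumes "ksub V" "set fs \<subseteq> carrier R" "W \<subseteq> V"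
  shows "kspan fs W \<subseteq> kspan fs V"
  using assms by (intro kspan_least ksub_kspan kspan_gen) (auto dest: kspan_upper)

lemma kspan_mono_set:
  assumes "ksub W" "set gs \<subseteq> carrier R" "set fs \<subseteq> set gs"
  shows "kspan fs W \<subseteq> kspan gs W"
  using assms kspan_gen[OF assms(1,2)] kspan_upper[OF assms(1,2)] by (intro kspan_least ksub_kspan) auto

text \<open>Steinitz exchange relative to \<open>W\<close>: the first generator that occurs in
  \<open>x\<close> with nonzero coefficient is solved for and dropped, and \<open>x\<close> joins
  the base instead.\<close>

lemma kspan_exchange:
  assumes "ksub W" "set fs \<subseteq> carrier R" "x \<in> kspan fs W" "x \<notin> W"
  shows "\<exists>gs. length fs = Suc (length gs) \<and> set gs \<subseteq> set fs \<and> kspan fs W \<subseteq> kspan gs (kspan [x] W)"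
  using assms(2,3)
proof (induction fs)
  case (Cons f fs)
  have x: "x \<in> carrier R" using Cons ksub_kspan[OF assms(1) Cons.prems(1)] ksub_carrier by blast
  have f: "f \<in> carrier R" "set fs \<subseteq> carrier R" using Cons by auto
  have Wx: "ksub (kspan [x] W)" by (rule ksub_kspan) (use assms x in auto)
  have W_Wx: "W \<subseteq> kspan [x] W" and x_Wx: "x \<in> kspan [x] W"
    using kspan_upper[of W "[x]"] kspan_gen[of W "[x]"] assms(1) x by simp_all
  from Cons.prems obtain c y where cy: "x = c \<otimes> f \<oplus> y" "c \<in> F" "y \<in> kspan fs W" by auto
  have y: "y \<in> carrier R" using cy ksub_kspan[OF assms(1) f(2)] ksub_carrier by blast
  show ?case
  proof (cases "c = \<zero>")
    case True
    then have "x \<in> kspan fs W" using cy y f by simp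
    from Cons.IH[OF f(2) this] obtain gs where gs: "length fs = Suc (length gs)" "set gs \<subseteq> set fs"
      "kspan fs W \<subseteq> kspan gs (kspan [x] W)" by blast
    have "kspan (f # fs) W \<subseteq> kspan (f # gs) (kspan [x] W)" using gs(3) by fastforce
    then show ?thesis using gs by (intro exI[of _ "f # gs"]) auto
  next
    case False
    then obtain d where d: "d \<in> F" "d \<otimes> c = \<one>" using F_inverse cy by blast
    let ?V = "kspan fs (kspan [x] W)"
    have V: "ksub ?V" by (rule ksub_kspan[OF Wx f(2)])
    have "x \<ominus> y = c \<otimes> f" unfolding cy(1) using cy(2) f y by (simp add: a_minus_def a_assoc r_neg)
    then have "f = d \<otimes> (x \<ominus> y)" using d f cy(2) by (simp add: m_assoc[symmetric])
    moreover have "y \<in> ?V" using cy(3) kspan_mono[OF Wx f(2) W_Wx] by blast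
    moreover have "x \<in> ?V" using x_Wx kspan_upper[OF Wx f(2)] by blast
    ultimately have "f \<in> ?V" using ksubD(3,4)[OF V] d by simp
    then have "kspan (f # fs) W \<subseteq> ?V"
      using kspan_gen[OF Wx f(2)] kspan_upper[OF Wx f(2)] W_Wx by (intro kspan_least[OF V]) auto
    then show ?thesis by (intro exI[of _ fs]) auto
  qed
qed (use assms in simp)

primrec kindep :: "'a list \<Rightarrow> 'a set \<Rightarrow> bool" where
  "kindep [] W \<longleftrightarrow> True"
| "kindep (x # xs) W \<longleftrightarrow> x \<notin> W \<and> kindep xs (kspan [x] W)"

lemma kindep_length:
  assumes "ksub W" "set fs \<subseteq> carrier R" "set xs \<subseteq> kspan fs W" "kindep xs W"
  shows "length xs \<le> length fs"
  using assms
proof (induction xs arbitrary: fs W)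
  case (Cons x xs)
  have "x \<in> carrier R" using ksub_carrier[OF ksub_kspan[OF Cons.prems(1,2)]] Cons.prems(3) by simp
  then have Wx: "ksub (kspan [x] W)" using Cons.prems by (intro ksub_kspan) auto
  obtain gs where gs: "length fs = Suc (length gs)" "set gs \<subseteq> set fs"
      "kspan fs W \<subseteq> kspan gs (kspan [x] W)"
    using kspan_exchange[of W fs x] Cons.prems by auto
  have "length xs \<le> length gs"
    by (rule Cons.IH[OF Wx]) (use gs Cons.prems in auto)
  then show ?case using gs by simp
qed simp

text \<open>For subspaces \<open>W \<subseteq> A\<close> this is finite dimension of the quotient.
  Neither the inclusion nor linearity of \<open>A\<close> is demanded, so images and sums need no
  such checks.\<close>

definition fin_mod :: "'a set \<Rightarrow> 'a set \<Rightarrow> bool" where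
  "fin_mod A W \<longleftrightarrow> (\<exists>fs. set fs \<subseteq> carrier R \<and> A \<subseteq> kspan fs W)"

lemma fin_mod_trans:
  assumes "fin_mod A B" "fin_mod B C" "ksub C"
  shows "fin_mod A C"
proof -
  obtain fs gs where *: "set fs \<subseteq> carrier R" "A \<subseteq> kspan fs B" "set gs \<subseteq> carrier R" "B \<subseteq> kspan gs C"
    using assms unfolding fin_mod_def by blast
  have "kspan fs B \<subseteq> kspan fs (kspan gs C)"
    using kspan_mono[OF ksub_kspan[OF assms(3) *(3)] *(1,4)] .
  then show ?thesis unfolding fin_mod_def kspan_append[symmetric]
    using * by (intro exI[of _ "fs @ gs"]) (auto simp: kspan_append)
qed

lemma fin_mod_mono:
  assumes "fin_mod A B" "A' \<subseteq> A" "B \<subseteq> B'" "ksub B'"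
  shows "fin_mod A' B'"
  using assms kspan_mono[of B' _ B] unfolding fin_mod_def by (meson subset_trans)

lemma fin_mod_image:
  assumes "fin_mod A W" "ksub V"
    and h: "\<And>x. x \<in> carrier R \<Longrightarrow> h x \<in> carrier R"
      "\<And>x y. x \<in> carrier R \<Longrightarrow> y \<in> carrier R \<Longrightarrow> h (x \<oplus> y) = h x \<oplus> h y"
      "\<And>c x. c \<in> F \<Longrightarrow> x \<in> carrier R \<Longrightarrow> h (c \<otimes> x) = c \<otimes> h x"
    and "h ` W \<subseteq> V" "ksub W"
  shows "fin_mod (h ` A) V"
proof -
  obtain fs where fs: "set fs \<subseteq> carrier R" "A \<subseteq> kspan fs W" using assms unfolding fin_mod_def by blast
  have "h ` kspan fs W \<subseteq> kspan (map h fs) V"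
    using fs(1)
  proof (induction fs)
    case (Cons f fs)
    then have K: "ksub (kspan fs W)" using ksub_kspan assms by simp
    show ?case
    proof
      fix z assume "z \<in> h ` kspan (f # fs) W"
      then obtain c x where z: "z = h (c \<otimes> f \<oplus> x)" "c \<in> F" "x \<in> kspan fs W" by auto
      have "z = c \<otimes> h f \<oplus> h x"
        using z Cons.prems ksub_carrier[OF K] by (simp add: h)
      moreover have "h x \<in> kspan (map h fs) V" using Cons z by auto
      ultimately show "z \<in> kspan (map h (f # fs)) V" using z(2) by auto
    qed
  qed (use assms in simp)
  then show ?thesis unfolding fin_mod_def using fs h(1) by (intro exI[of _ "map h fs"]) auto
qed

end

section \<open>Maximal left ideals and their idealizers\<close>

context ring begin

lemma add_minus_cancel: "x \<in> carrier R \<Longrightarrow> y \<in> carrier R \<Longrightarrow> x \<oplus> y \<ominus> y = x"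
  by (simp add: a_minus_def a_assoc r_neg)

lemma minus_add_cancel: "x \<in> carrier R \<Longrightarrow> y \<in> carrier R \<Longrightarrow> x \<ominus> y \<oplus> y = x"
  by (simp add: a_minus_def a_assoc l_neg)

lemma add_minus_cancel': "x \<in> carrier R \<Longrightarrow> y \<in> carrier R \<Longrightarrow> y \<oplus> (x \<ominus> y) = x"
  using minus_add_cancel[of x y] a_comm[of y "x \<ominus> y"] by simp

lemma l_distr_minus: "x \<in> carrier R \<Longrightarrow> y \<in> carrier R \<Longrightarrow> z \<in> carrier R \<Longrightarrow> (x \<ominus> y) \<otimes> z = x \<otimes> z \<ominus> y \<otimes> z"
  by (simp add: a_minus_def l_distr l_minus)

lemma r_distr_minus: "x \<in> carrier R \<Longrightarrow> y \<in> carrier R \<Longrightarrow> z \<in> carrier R \<Longrightarrow> z \<otimes> (x \<ominus> y) = z \<otimes> x \<ominus> z \<otimes> y"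
  by (simp add: a_minus_def r_distr r_minus)

lemma minus_self: "x \<in> carrier R \<Longrightarrow> x \<ominus> x = \<zero>"
  by (simp add: a_minus_def r_neg)

lemma diff_trans:
  assumes "x \<in> carrier R" "y \<in> carrier R" "z \<in> carrier R"
  shows "(x \<ominus> y) \<oplus> (y \<ominus> z) = x \<ominus> z"
proof -
  have "(x \<ominus> y) \<oplus> (y \<ominus> z) = ((x \<ominus> y) \<oplus> y) \<ominus> z"
    using assms by (simp add: a_minus_def a_assoc)
  then show ?thesis using assms by (simp add: minus_add_cancel)
qed

lemma diff_add_add:
  assumes "x \<in> carrier R" "y \<in> carrier R" "x' \<in> carrier R" "y' \<in> carrier R"
  shows "(x \<oplus> x') \<ominus> (y \<oplus> y') = (x \<ominus> y) \<oplus> (x' \<ominus> y')"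
  using assms by (simp add: a_minus_def minus_add a_ac)

lemma diff_diff_diff:
  assumes "x \<in> carrier R" "y \<in> carrier R" "x' \<in> carrier R" "y' \<in> carrier R"
  shows "(x \<ominus> x') \<ominus> (y \<ominus> y') = (x \<ominus> y) \<ominus> (x' \<ominus> y')"
  using assms by (simp add: a_minus_def minus_add a_ac)

lemma minus_diff: "x \<in> carrier R \<Longrightarrow> y \<in> carrier R \<Longrightarrow> \<ominus> (x \<ominus> y) = y \<ominus> x"
  by (simp add: a_minus_def minus_add a_comm)

lemma diff_lin:
  assumes "c \<in> carrier R" "d \<in> carrier R" "f \<in> carrier R" "x \<in> carrier R" "y \<in> carrier R"
  shows "(c \<otimes> f \<oplus> x) \<ominus> (d \<otimes> f \<oplus> y) = (c \<ominus> d) \<otimes> f \<oplus> (x \<ominus> y)"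
  using assms by (simp add: diff_add_add l_distr_minus)

lemma minus_zero_right: "x \<in> carrier R \<Longrightarrow> x \<ominus> \<zero> = x"
  by (simp add: a_minus_def)

end

section \<open>Congruence modulo a maximal left ideal\<close>

locale maximal_left_ideal = central_subfield +
  fixes L
  assumes L: "left_ideal R L"
    and one_notin_L: "\<one> \<notin> L"
    and L_max: "\<And>M. left_ideal R M \<Longrightarrow> L \<subseteq> M \<Longrightarrow> M \<noteq> L \<Longrightarrow> \<one> \<in> M"
begin

lemmas LD = left_idealD[OF L]

lemma L_carrier [simp]: "x \<in> L \<Longrightarrow> x \<in> carrier R"
  using LD(2) by blast

lemma ksub_L: "ksub L"
  by (rule ksub_left_ideal[OF L])

text \<open>Equality in the module \<open>R / L\<close>. Left multiplication always respects it,
  right multiplication does so for elements of the idealizer. Membership in the carrier is built in,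
  so that a congruence supplies it for both sides.\<close>

definition cg :: "'a \<Rightarrow> 'a \<Rightarrow> bool" where
  "cg x y \<longleftrightarrow> x \<in> carrier R \<and> y \<in> carrier R \<and> x \<ominus> y \<in> L"

lemma cg_refl: "x \<in> carrier R \<Longrightarrow> cg x x"
  using LD(3) by (simp add: cg_def minus_self)

lemma cgD: "cg x y \<Longrightarrow> x \<in> carrier R" "cg x y \<Longrightarrow> y \<in> carrier R" "cg x y \<Longrightarrow> x \<ominus> y \<in> L"
  by (auto simp: cg_def)

lemma cg_sym: assumes "cg x y" shows "cg y x"
proof -
  have "\<ominus> (x \<ominus> y) = y \<ominus> x" using cgD[OF assms] by (simp add: minus_diff)
  then show ?thesis using LD(6)[of "x \<ominus> y"] assms by (simp add: cg_def)
qed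

lemma cg_trans [trans]: assumes "cg x y" "cg y z" shows "cg x z"
proof -
  have "(x \<ominus> y) \<oplus> (y \<ominus> z) = x \<ominus> z"
    using cgD(1,2)[OF assms(1)] cgD(1,2)[OF assms(2)] by (simp add: diff_trans)
  then show ?thesis using LD(4)[of "x \<ominus> y" "y \<ominus> z"] assms by (simp add: cg_def)
qed

lemma cg_zero_iff: "cg x \<zero> \<longleftrightarrow> x \<in> L"
  by (auto simp: cg_def minus_zero_right)

lemma cg_L: "x \<in> L \<Longrightarrow> cg x y \<Longrightarrow> y \<in> L"
  using cg_trans[of y x \<zero>] cg_sym[of x y] by (simp add: cg_zero_iff)

lemma cg_L': "x \<in> L \<Longrightarrow> cg y x \<Longrightarrow> y \<in> L"
  using cg_L[of x y] cg_sym[of y x] by simp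

lemma cg_add: assumes "cg x y" "cg x' y'" shows "cg (x \<oplus> x') (y \<oplus> y')"
proof -
  have "(x \<oplus> x') \<ominus> (y \<oplus> y') = (x \<ominus> y) \<oplus> (x' \<ominus> y')"
    using cgD(1,2)[OF assms(1)] cgD(1,2)[OF assms(2)] by (simp add: diff_add_add)
  then show ?thesis using LD(4)[OF cgD(3)[OF assms(1)] cgD(3)[OF assms(2)]] assms by (simp add: cg_def)
qed

lemma cg_lmult: "cg x y \<Longrightarrow> r \<in> carrier R \<Longrightarrow> cg (r \<otimes> x) (r \<otimes> y)"
  using LD(7)[of r "x \<ominus> y"] by (auto simp: cg_def r_distr_minus)

text \<open>The largest subring in which \<open>L\<close> is a two-sided ideal. Acting by right
  multiplication, its residues modulo \<open>L\<close> are the endomorphisms of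
  \<open>R / L\<close>.\<close>

definition idealizer :: "'a set" where
  "idealizer = {d \<in> carrier R. \<forall>l\<in>L. l \<otimes> d \<in> L}"

lemma idealizerD: "d \<in> idealizer \<Longrightarrow> d \<in> carrier R" "d \<in> idealizer \<Longrightarrow> l \<in> L \<Longrightarrow> l \<otimes> d \<in> L"
  by (auto simp: idealizer_def)

lemma cg_rmult: "cg x y \<Longrightarrow> d \<in> idealizer \<Longrightarrow> cg (x \<otimes> d) (y \<otimes> d)"
  using idealizerD(2)[of d "x \<ominus> y"] idealizerD(1)[of d] by (auto simp: cg_def l_distr_minus[symmetric])

lemma idealizer_L: "L \<subseteq> idealizer"
  using LD(7) by (auto simp: idealizer_def)

lemma idealizer_F: "F \<subseteq> idealizer"
  using LD(7) F_central[symmetric] by (auto simp: idealizer_def)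

lemma idealizer_diff: "x \<in> idealizer \<Longrightarrow> y \<in> idealizer \<Longrightarrow> x \<ominus> y \<in> idealizer"
  using LD(5) by (auto simp: idealizer_def r_distr_minus)

lemma idealizer_mult: "x \<in> idealizer \<Longrightarrow> y \<in> idealizer \<Longrightarrow> x \<otimes> y \<in> idealizer"
  by (auto simp: idealizer_def m_assoc[symmetric])

lemma idealizer_add: "x \<in> idealizer \<Longrightarrow> y \<in> idealizer \<Longrightarrow> x \<oplus> y \<in> idealizer"
  using LD(4) by (auto simp: idealizer_def r_distr)

lemma idealizer_pow: "x \<in> idealizer \<Longrightarrow> x [^] (n::nat) \<in> idealizer"
proof (induction n)
  case 0
  show ?case using idealizer_F F_one by auto
qed (simp add: idealizer_mult)

text \<open>The left ideal \<open>R x + L\<close> lies strictly above \<open>L\<close>, so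
  maximality puts \<open>\<one>\<close> into it: every nonzero element generates
  \<open>R / L\<close>.\<close>

lemma generates_modulo:
  assumes "x \<in> carrier R" "x \<notin> L"
  obtains r where "r \<in> carrier R" "cg (r \<otimes> x) \<one>"
proof -
  let ?M = "{r \<otimes> x \<oplus> l | r l. r \<in> carrier R \<and> l \<in> L}"
  have "left_ideal R ?M"
  proof (rule left_idealI)
    show "\<zero> \<in> ?M" using LD(3) assms(1) by (auto intro!: exI[of _ \<zero>])
  next
    fix y z assume "y \<in> ?M" "z \<in> ?M"
    then obtain r l r' l' where *: "y = r \<otimes> x \<oplus> l" "z = r' \<otimes> x \<oplus> l'" "r \<in> carrier R" "r' \<in> carrier R" "l \<in> L" "l' \<in> L"
      by blast
    have "l \<in> carrier R" "l' \<in> carrier R" using * by auto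
    then have "y \<ominus> z = (r \<ominus> r') \<otimes> x \<oplus> (l \<ominus> l')" using * assms(1) by (simp add: diff_lin)
    then show "y \<ominus> z \<in> ?M" using LD(5)[OF *(5,6)] *(3,4) by blast
  next
    fix a y assume "a \<in> carrier R" "y \<in> ?M"
    then obtain r l where *: "y = r \<otimes> x \<oplus> l" "r \<in> carrier R" "l \<in> L" by blast
    then have "a \<otimes> y = (a \<otimes> r) \<otimes> x \<oplus> a \<otimes> l" using assms(1) \<open>a \<in> carrier R\<close> by (simp add: r_distr m_assoc)
    then show "a \<otimes> y \<in> ?M" using LD(7)[of a l] * \<open>a \<in> carrier R\<close> by blast
  qed (use assms in auto)
  moreover have "\<zero> \<otimes> x \<oplus> l \<in> ?M" if "l \<in> L" for l using that by blast
  then have "L \<subseteq> ?M" using assms(1) by auto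
  moreover have "\<one> \<otimes> x \<oplus> \<zero> \<in> ?M" using LD(3) by blast
  then have "?M \<noteq> L" using assms by auto
  ultimately have "\<one> \<in> ?M" by (rule L_max)
  then obtain r l where "\<one> = r \<otimes> x \<oplus> l" "r \<in> carrier R" "l \<in> L" by blast
  moreover from this have "\<one> \<ominus> r \<otimes> x = l" using assms(1) add_minus_cancel[of l "r \<otimes> x"] by (simp add: a_comm)
  ultimately show ?thesis using assms(1) by (intro that[of r] cg_sym[of \<one>]) (auto simp: cg_def)
qed

text \<open>Schur's lemma for residues. A left inverse \<open>e\<close> exists because
  \<open>d\<close> generates \<open>R / L\<close>; since right multiplication by \<open>d\<close> is
  injective modulo \<open>L\<close>, this \<open>e\<close> lies in the idealizer and is also a right
  inverse.\<close>

lemma idealizer_inverse: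
  assumes "d \<in> idealizer" "d \<notin> L"
  obtains e where "e \<in> idealizer" "cg (e \<otimes> d) \<one>" "cg (d \<otimes> e) \<one>"
proof -
  note d = idealizerD(1)[OF assms(1)]
  obtain e where e: "e \<in> carrier R" "cg (e \<otimes> d) \<one>" using generates_modulo[OF d assms(2)] .
  have cancel: "r \<in> L" if rd: "r \<in> carrier R" "r \<otimes> d \<in> L" for r
  proof (rule ccontr)
    assume "r \<notin> L"
    then obtain s where s: "s \<in> carrier R" "cg (s \<otimes> r) \<one>" using generates_modulo[OF rd(1)] by metis
    have "cg (s \<otimes> (r \<otimes> d)) d" using cg_rmult[OF s(2) assms(1)] s rd d by (simp add: m_assoc)
    then show False using cg_L[OF LD(7)[OF s(1) rd(2)]] assms(2) by blast
  qed
  \<comment> \<open>Both remaining claims about \<open>e\<close> are checked after right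
    multiplication by \<open>d\<close>, where \<open>e \<otimes> d\<close> becomes
    \<open>\<one>\<close>, and then \<open>d\<close> is cancelled.\<close>
  have "l \<otimes> e \<in> L" if l: "l \<in> L" for l
  proof (rule cancel)
    have "cg (l \<otimes> (e \<otimes> d)) (l \<otimes> \<one>)" using cg_lmult[OF e(2)] l by simp
    then show "l \<otimes> e \<otimes> d \<in> L" using cg_L' l e d by (simp add: m_assoc)
  qed (use l e in simp)
  moreover have "d \<otimes> e \<ominus> \<one> \<in> L"
  proof (rule cancel)
    have "cg (d \<otimes> (e \<otimes> d)) (d \<otimes> \<one>)" using cg_lmult[OF e(2)] d by simp
    then show "(d \<otimes> e \<ominus> \<one>) \<otimes> d \<in> L" using e d by (simp add: l_distr_minus m_assoc cg_def)
  qed (use d e in simp)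
  ultimately show ?thesis using that[of e] e d by (simp add: idealizer_def cg_def)
qed

text \<open>This is \<open>L + K + K a + ... + K a^(n-1)\<close>, with \<open>n\<close> counting the
  powers. Hence \<open>a [^] n \<in> powers F a n\<close> is a monic relation of degree
  \<open>n\<close> for \<open>a\<close> modulo \<open>L\<close>; algebraicity is expressed in this
  way throughout.\<close>

primrec powers :: "'a set \<Rightarrow> 'a \<Rightarrow> nat \<Rightarrow> 'a set" where
  "powers K a 0 = L"
| "powers K a (Suc n) = {p \<oplus> c \<otimes> a [^] n | p c. p \<in> powers K a n \<and> c \<in> K}"

lemma powers_SucI: "p \<in> powers K a n \<Longrightarrow> c \<in> K \<Longrightarrow> p \<oplus> c \<otimes> a [^] n \<in> powers K a (Suc n)"
  by auto

context
  fixes K a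
  assumes K: "K \<subseteq> idealizer" "\<one> \<in> K" "\<And>x y. x \<in> K \<Longrightarrow> y \<in> K \<Longrightarrow> x \<ominus> y \<in> K"
    "\<And>x y. x \<in> K \<Longrightarrow> y \<in> K \<Longrightarrow> x \<otimes> y \<in> K"
    and a: "a \<in> idealizer"
begin

lemma K_carrier: "x \<in> K \<Longrightarrow> x \<in> carrier R"
  using K(1) idealizerD(1)[of x] by (auto simp: subset_iff)

lemma K_zero: "\<zero> \<in> K"
  using K(3)[OF K(2) K(2)] by (simp add: minus_self)

lemma powers_idealizer: "powers K a n \<subseteq> idealizer"
proof (induction n)
  case (Suc n)
  then show ?case using idealizer_add idealizer_mult idealizer_pow[OF a] K(1) by (auto simp: subset_iff)
qed (use idealizer_L in simp)

lemma powers_carrier: "x \<in> powers K a n \<Longrightarrow> x \<in> carrier R"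
  using powers_idealizer[of n] idealizerD(1)[of x] by (auto simp: subset_iff)

lemma powers_mono: "powers K a n \<subseteq> powers K a (n + m)"
proof (induction m)
  case (Suc m)
  have "x \<in> powers K a (Suc (n + m))" if "x \<in> powers K a (n + m)" for x
    using powers_SucI[OF that K_zero] powers_carrier[OF that] idealizerD(1)[OF a] by simp
  then show ?case using Suc by auto
qed simp

lemma powers_L: "L \<subseteq> powers K a n"
  using powers_mono[of 0 n] by simp

lemma powers_diff: "x \<in> powers K a n \<Longrightarrow> y \<in> powers K a n \<Longrightarrow> x \<ominus> y \<in> powers K a n"
proof (induction n arbitrary: x y)
  case (Suc n)
  obtain p c where x: "x = p \<oplus> c \<otimes> a [^] n" "p \<in> powers K a n" "c \<in> K" using Suc.prems by auto
  obtain q d where y: "y = q \<oplus> d \<otimes> a [^] n" "q \<in> powers K a n" "d \<in> K" using Suc.prems by auto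
  have "x \<ominus> y = (p \<ominus> q) \<oplus> (c \<ominus> d) \<otimes> a [^] n"
    unfolding x(1) y(1)
    using powers_carrier[OF x(2)] powers_carrier[OF y(2)] K_carrier[OF x(3)] K_carrier[OF y(3)]
      nat_pow_closed[OF idealizerD(1)[OF a], of n]
    by (simp add: diff_add_add l_distr_minus)
  then show ?case using Suc.IH[OF x(2) y(2)] K(3)[OF x(3) y(3)] powers_SucI by simp
qed (use LD(5) in simp)

lemma powers_sub: "additive_subgroup (powers K a n) R"
  using powers_carrier powers_L[of n] LD(3) powers_diff[of _ n] by (intro additive_subgroup_diffI) (blast+)

lemma powers_add: "x \<in> powers K a n \<Longrightarrow> y \<in> powers K a n \<Longrightarrow> x \<oplus> y \<in> powers K a n"
  using additive_subgroup.a_closed[OF powers_sub] .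

lemma powers_lmult: "x \<in> powers K a n \<Longrightarrow> c \<in> K \<Longrightarrow> c \<otimes> x \<in> powers K a n"
proof (induction n arbitrary: x)
  case (Suc n)
  obtain p d where x: "x = p \<oplus> d \<otimes> a [^] n" "p \<in> powers K a n" "d \<in> K" using Suc.prems by auto
  have "c \<otimes> x = c \<otimes> p \<oplus> (c \<otimes> d) \<otimes> a [^] n"
    unfolding x(1) using powers_carrier[OF x(2)] K_carrier[OF x(3)] K_carrier[OF Suc.prems(2)]
      nat_pow_closed[OF idealizerD(1)[OF a], of n] by (simp add: r_distr m_assoc)
  then show ?case using Suc.IH[OF x(2) Suc.prems(2)] K(4)[OF Suc.prems(2) x(3)] powers_SucI by simp
qed (use LD(7) K_carrier in simp)

lemma powers_mult_gen: "x \<in> powers K a n \<Longrightarrow> x \<otimes> a \<in> powers K a (Suc n)"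
proof (induction n arbitrary: x)
  case 0
  then have "x \<otimes> a \<in> L" using idealizerD(2)[OF a] by simp
  then show ?case using powers_L by blast
next
  case (Suc n)
  obtain p c where x: "x = p \<oplus> c \<otimes> a [^] n" "p \<in> powers K a n" "c \<in> K" using Suc.prems by auto
  have "x \<otimes> a = p \<otimes> a \<oplus> c \<otimes> a [^] Suc n"
    unfolding x(1) using powers_carrier[OF x(2)] K_carrier[OF x(3)] idealizerD(1)[OF a]
    by (simp add: l_distr m_assoc)
  then show ?case using powers_SucI[OF Suc.IH[OF x(2)] x(3)] by simp
qed

text \<open>Multiplication by \<open>a\<close> raises the degree by one, and the monic relation
  reduces the term with \<open>a [^] n\<close> that this produces.\<close>

lemma powers_stable:
  assumes "a [^] n \<in> powers K a n" "x \<in> powers K a n"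
  shows "x \<otimes> a \<in> powers K a n"
proof -
  obtain p c where x: "x \<otimes> a = p \<oplus> c \<otimes> a [^] n" "p \<in> powers K a n" "c \<in> K"
    using powers_mult_gen[OF assms(2)] by auto
  then show ?thesis using powers_add powers_lmult[OF assms(1)] by simp
qed

lemma powers_rmult:
  assumes comm: "\<And>c. c \<in> K \<Longrightarrow> cg (a \<otimes> c) (c \<otimes> a)"
  shows "x \<in> powers K a n \<Longrightarrow> c \<in> K \<Longrightarrow> x \<otimes> c \<in> powers K a n"
proof (induction n arbitrary: x)
  case 0
  then show ?case using idealizerD(2) K(1) by auto
next
  case (Suc n)
  note ca = idealizerD(1)[OF a] and cc = K_carrier[OF Suc.prems(2)]
  have pow: "cg (a [^] m \<otimes> c) (c \<otimes> a [^] m)" for m :: nat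
  proof (induction m)
    case 0
    then show ?case using cc by (simp add: cg_refl)
  next
    case (Suc m)
    have "cg (a [^] m \<otimes> (a \<otimes> c)) (a [^] m \<otimes> (c \<otimes> a))"
      by (rule cg_lmult[OF comm[OF \<open>c \<in> K\<close>]]) (use ca in simp)
    moreover have "cg ((a [^] m \<otimes> c) \<otimes> a) ((c \<otimes> a [^] m) \<otimes> a)"
      by (rule cg_rmult[OF Suc a])
    ultimately show ?case using cg_trans ca cc by (simp add: m_assoc)
  qed
  obtain p d where x: "x = p \<oplus> d \<otimes> a [^] n" "p \<in> powers K a n" "d \<in> K" using Suc.prems by auto
  note cd = K_carrier[OF x(3)]
  \<comment> \<open>Moving \<open>c\<close> past \<open>a [^] n\<close> costs an element of
    \<open>L\<close>, which the lower part of the span absorbs.\<close>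
  have "cg (d \<otimes> (a [^] n \<otimes> c)) (d \<otimes> (c \<otimes> a [^] n))" by (rule cg_lmult[OF pow cd])
  then have l: "d \<otimes> (a [^] n \<otimes> c) \<ominus> d \<otimes> (c \<otimes> a [^] n) \<in> L" by (rule cgD(3))
  have "x \<otimes> c = (p \<otimes> c \<oplus> (d \<otimes> (a [^] n \<otimes> c) \<ominus> d \<otimes> (c \<otimes> a [^] n))) \<oplus> (d \<otimes> c) \<otimes> a [^] n"
    unfolding x(1) using powers_carrier[OF x(2)] cd cc ca
    by (simp add: l_distr m_assoc a_assoc minus_add_cancel)
  moreover have "p \<otimes> c \<oplus> (d \<otimes> (a [^] n \<otimes> c) \<ominus> d \<otimes> (c \<otimes> a [^] n)) \<in> powers K a n"
    using powers_add Suc.IH[OF x(2) \<open>c \<in> K\<close>] l powers_L by blast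
  ultimately show ?case using powers_SucI K(4)[OF x(3) \<open>c \<in> K\<close>] by simp
qed

end

lemma fin_mod_sum:
  assumes "fin_mod A L" "fin_mod B L"
  shows "fin_mod {x \<oplus> y | x y. x \<in> A \<and> y \<in> B} L"
proof -
  obtain fs gs where *: "set fs \<subseteq> carrier R" "A \<subseteq> kspan fs L" "set gs \<subseteq> carrier R" "B \<subseteq> kspan gs L"
    using assms unfolding fin_mod_def by blast
  have "A \<subseteq> kspan (fs @ gs) L" "B \<subseteq> kspan (fs @ gs) L"
    using * kspan_mono_set[OF ksub_L, of "fs @ gs" fs] kspan_mono_set[OF ksub_L, of "fs @ gs" gs]
    by (auto simp: subset_iff)
  then have "{x \<oplus> y | x y. x \<in> A \<and> y \<in> B} \<subseteq> kspan (fs @ gs) L"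
    using ksubD(5)[OF ksub_kspan[OF ksub_L, of "fs @ gs"]] * by auto
  then show ?thesis unfolding fin_mod_def using * by (intro exI[of _ "fs @ gs"]) auto
qed

lemma fin_mod_refl: "fin_mod L L"
  unfolding fin_mod_def by (intro exI[of _ "[]"]) auto

lemma fin_mod_lmult:
  assumes "fin_mod A L" "x \<in> carrier R"
  shows "fin_mod ((\<lambda>y. x \<otimes> y) ` A) L"
proof (rule fin_mod_image[OF assms(1) ksub_L])
  show "x \<otimes> (c \<otimes> y) = c \<otimes> (x \<otimes> y)" if "c \<in> F" "y \<in> carrier R" for c y
    using that F_central[of c x] assms(2) by (simp add: m_assoc[symmetric])
qed (use assms(2) LD(7) ksub_L in \<open>auto simp: r_distr\<close>)

lemma fin_mod_rmult:
  assumes "fin_mod A L" "x \<in> idealizer"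
  shows "fin_mod ((\<lambda>y. y \<otimes> x) ` A) L"
  by (rule fin_mod_image[OF assms(1) ksub_L])
    (use idealizerD[OF assms(2)] ksub_L in \<open>auto simp: l_distr m_assoc\<close>)

lemma fin_mod_powers:
  assumes "fin_mod K L" "a \<in> idealizer"
  shows "fin_mod (powers K a n) L"
proof (induction n)
  case (Suc n)
  have "fin_mod {x \<oplus> y | x y. x \<in> powers K a n \<and> y \<in> (\<lambda>c. c \<otimes> a [^] n) ` K} L"
    by (intro fin_mod_sum Suc fin_mod_rmult assms idealizer_pow)
  then show ?case by (rule fin_mod_mono[OF _ _ order_refl ksub_L]) auto
qed (simp add: fin_mod_refl)

end

section \<open>Algebraicity of the idealizer modulo L\<close>

context maximal_left_ideal
begin

text \<open>Independence modulo the larger \<open>V\<close> implies independence modulo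
  \<open>L\<close>, so by exchange the span of \<open>fs\<close> over \<open>L\<close> holds at most
  \<open>length fs\<close> of the vectors \<open>e c\<close>.\<close>

lemma finite_multiplicities:
  assumes e: "\<And>c. c \<in> F \<Longrightarrow> e c \<in> carrier R"
    and V: "ksub V" "L \<subseteq> V"
    and indep: "\<And>b as. distinct (b # as) \<Longrightarrow> set (b # as) \<subseteq> F \<Longrightarrow> e b \<notin> kspan (map e as) V"
    and fs: "set fs \<subseteq> carrier R"
  shows "finite {c \<in> F. e c \<in> kspan fs L}"
proof (rule ccontr)
  assume "infinite {c \<in> F. e c \<in> kspan fs L}"
  then obtain C where C: "finite C" "card C = Suc (length fs)" "C \<subseteq> {c \<in> F. e c \<in> kspan fs L}"
    using infinite_arbitrarily_large by blast
  then obtain as where as: "distinct as" "set as = C" using finite_distinct_list by blast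
  have "kindep (map e as) (kspan (map e bs) L)" if "distinct (as @ bs)" "set (as @ bs) \<subseteq> F" for as bs
    using that
  proof (induction as arbitrary: bs)
    case (Cons a as)
    have bs: "set (map e bs) \<subseteq> carrier R" using Cons.prems e by auto
    have "e a \<notin> kspan (map e bs) V" using Cons.prems by (intro indep) auto
    then have "e a \<notin> kspan (map e bs) L" using kspan_mono[OF V(1) bs V(2)] by blast
    moreover have "kindep (map e as) (kspan (map e (a # bs)) L)"
      by (rule Cons.IH) (use Cons.prems in auto)
    ultimately show ?case by simp
  qed simp
  from this[of as "[]"] have "kindep (map e as) L" using as C(3) by auto
  then have "length (map e as) \<le> length fs"
    using as C(3) by (intro kindep_length[OF ksub_L fs]) auto
  then show False using C(2) as distinct_card by fastforce
qed

lemma F_idealizer: "c \<in> F \<Longrightarrow> c \<in> idealizer"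
  using idealizer_F by blast

text \<open>Amitsur's argument: the inverses of \<open>a - c\<close>, for \<open>c \<in> F\<close>, would otherwise be linearly
  independent modulo \<open>L\<close>.\<close>

lemma algebraic_modulo:
  assumes a: "a \<in> idealizer"
    and cover: "carrier R \<subseteq> (\<Union>bs\<in>\<B>. kspan bs {\<zero>})" "\<And>bs. bs \<in> \<B> \<Longrightarrow> set bs \<subseteq> carrier R"
    and small: "infinite \<B>" "ordLess2 (card_of \<B>) (card_of F)"
  shows "\<exists>n. a [^] (n::nat) \<in> powers F a n"
proof (rule ccontr)
  assume na: "\<nexists>n::nat. a [^] n \<in> powers F a n"
  note ca = idealizerD(1)[OF a]
  note pw = idealizer_F F_one F_diff F_mult a
  have notL: "a \<ominus> c \<notin> L" if "c \<in> F" for c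
  proof
    assume "a \<ominus> c \<in> L"
    then have "(a \<ominus> c) \<oplus> c \<otimes> a [^] (0::nat) \<in> powers F a (Suc 0)" using that by (intro powers_SucI) auto
    then have "a [^] Suc 0 \<in> powers F a (Suc 0)" using that ca by (simp add: minus_add_cancel)
    then show False using na by blast
  qed
  have "\<exists>e. e \<in> idealizer \<and> cg (e \<otimes> (a \<ominus> c)) \<one>" if "c \<in> F" for c
    using idealizer_inverse[OF idealizer_diff[OF a F_idealizer[OF that]] notL[OF that]] by metis
  then obtain e where e: "\<And>c. c \<in> F \<Longrightarrow> e c \<in> idealizer" "\<And>c. c \<in> F \<Longrightarrow> cg (e c \<otimes> (a \<ominus> c)) \<one>"
    by metis
  have ec: "e c \<in> carrier R" if "c \<in> F" for c using e(1)[OF that] idealizerD(1) by blast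
  \<comment> \<open>\<open>M\<close> is \<open>L + F[a]\<close>. The inverses \<open>e c\<close> are
    shown to be independent even modulo \<open>M\<close>; the larger base makes the induction
    possible, because multiplying by \<open>a \<ominus> c\<close> produces constants, and these lie
    in \<open>M\<close>.\<close>
  define M where "M = (\<Union>n. powers F a n)"
  have LM: "L \<subseteq> M" unfolding M_def using UN_upper[of 0 UNIV "powers F a"] by simp
  have M: "ksub M"
  proof (rule ksubI)
    show "M \<subseteq> carrier R" unfolding M_def using powers_carrier[OF pw] by blast
    show "\<zero> \<in> M" using LM LD(3) by blast
    show "x \<ominus> y \<in> M" if "x \<in> M" "y \<in> M" for x y
    proof -
      obtain n m where "x \<in> powers F a n" "y \<in> powers F a m" using \<open>x \<in> M\<close> \<open>y \<in> M\<close> by (auto simp: M_def)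
      then have "x \<in> powers F a (n + m)" "y \<in> powers F a (n + m)"
        using powers_mono[OF pw, of n m] powers_mono[OF pw, of m n] by (auto simp: add.commute)
      then show ?thesis unfolding M_def using powers_diff[OF pw] by blast
    qed
    show "c \<otimes> x \<in> M" if "c \<in> F" "x \<in> M" for c x
      using that powers_lmult[OF pw] by (auto simp: M_def)
  qed
  have one_M: "\<one> \<in> M"
  proof -
    have "\<zero> \<oplus> \<one> \<otimes> a [^] (0::nat) \<in> powers F a (Suc 0)" by (rule powers_SucI) (auto simp: LD(3) F_one)
    then have "\<one> \<in> powers F a (Suc 0)" by (simp del: powers.simps)
    then show ?thesis unfolding M_def by blast
  qed
  have M_a: "x \<otimes> a \<in> M" if "x \<in> M" for x
    using that powers_mult_gen[OF pw] unfolding M_def by blast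
  have M_ac: "x \<otimes> (a \<ominus> c) \<in> M" if "x \<in> M" "c \<in> F" for x c
  proof -
    have "x \<otimes> (a \<ominus> c) = x \<otimes> a \<ominus> c \<otimes> x"
      using that ca ksub_carrier[OF M that(1)] F_central[OF that(2)] by (simp add: r_distr_minus)
    then show ?thesis using ksubD(3,4)[OF M] M_a that by simp
  qed
  have e_notin: "e c \<notin> M" if c: "c \<in> F" for c
  proof
    assume "e c \<in> M"
    then have ex: "\<exists>n. e c \<in> powers F a n" by (auto simp: M_def)
    \<comment> \<open>Minimality of \<open>n\<close> makes the leading coefficient \<open>d\<close>
      below nonzero, and then multiplying \<open>e c\<close> by \<open>a\<close> gives a monic
      relation of degree \<open>n\<close> for \<open>a\<close>.\<close>
    define n where "n = (LEAST n. e c \<in> powers F a n)"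
    have n: "e c \<in> powers F a n" unfolding n_def using ex by (rule LeastI_ex)
    show False
    proof (cases n)
      case 0
      then have "e c \<otimes> (a \<ominus> c) \<in> L"
        using n idealizerD(2)[OF idealizer_diff[OF a F_idealizer[OF c]]] by simp
      then show False using cg_L[OF _ e(2)[OF c]] one_notin_L by blast
    next
      case (Suc m)
      then obtain p d where pd: "e c = p \<oplus> d \<otimes> a [^] m" "p \<in> powers F a m" "d \<in> F" using n by auto
      have cp: "p \<in> carrier R" using powers_carrier[OF pw pd(2)] .
      have "d \<noteq> \<zero>"
      proof
        assume "d = \<zero>"
        then have "e c \<in> powers F a m" using pd cp ca by simp
        then have "n \<le> m" unfolding n_def by (rule Least_le)
        then show False using Suc by simp
      qed
      then obtain d' where d': "d' \<in> F" "d' \<otimes> d = \<one>" using F_inverse pd(3) by blast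
      have pa: "p \<otimes> a \<in> powers F a n" using powers_mult_gen[OF pw pd(2)] Suc by simp
      have one: "\<one> \<in> powers F a n"
      proof -
        have "\<zero> \<oplus> \<one> \<otimes> a [^] (0::nat) \<in> powers F a (Suc 0)" by (rule powers_SucI) (auto simp: LD(3) F_one)
        then have "\<one> \<in> powers F a (Suc 0)" by (simp del: powers.simps)
        then show ?thesis using powers_mono[OF pw, of "Suc 0" m] Suc by (auto simp del: powers.simps)
      qed
      let ?z = "e c \<otimes> (a \<ominus> c) \<ominus> \<one>"
      have z: "?z \<in> powers F a n" using cgD(3)[OF e(2)[OF c]] powers_L[OF pw] by blast
      have "e c \<otimes> a \<in> powers F a n"
      proof -
        have "e c \<otimes> a = e c \<otimes> (a \<ominus> c) \<oplus> e c \<otimes> c"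
          using ca c ec[OF c] by (simp add: r_distr[symmetric] minus_add_cancel)
        also have "\<dots> = (?z \<oplus> \<one>) \<oplus> c \<otimes> e c"
          using ca c ec[OF c] F_central[OF c ec[OF c]] by (simp add: minus_add_cancel)
        finally show ?thesis
          using powers_add[OF pw powers_add[OF pw z one] powers_lmult[OF pw n c]] by simp
      qed
      moreover have "d \<otimes> a [^] n = e c \<otimes> a \<ominus> p \<otimes> a"
        using pd cp ca Suc add_minus_cancel[of "d \<otimes> a [^] n" "p \<otimes> a"]
        by (simp add: l_distr m_assoc a_comm)
      ultimately have "d \<otimes> a [^] n \<in> powers F a n" using powers_diff[OF pw _ pa] by simp
      then have "d' \<otimes> (d \<otimes> a [^] n) \<in> powers F a n" using powers_lmult[OF pw _ d'(1)] by blast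
      then have "a [^] n \<in> powers F a n" using d' pd ca by (simp add: m_assoc[symmetric])
      then show False using na by blast
    qed
  qed
  have indep: "e b \<notin> kspan (map e as) M" if "distinct (b # as)" "set (b # as) \<subseteq> F" for b as
    using that
  proof (induction as)
    case Nil
    then show ?case using e_notin by simp
  next
    case (Cons c as)
    let ?V = "kspan (map e as) M"
    have cs: "set (map e as) \<subseteq> carrier R" using Cons.prems ec by auto
    have V: "ksub ?V" by (rule ksub_kspan[OF M cs])
    have MV: "M \<subseteq> ?V" by (rule kspan_upper[OF M cs])
    note LV = subset_trans[OF LM MV]
    have oneV: "\<one> \<in> ?V" using one_M MV by blast
    have cF: "c \<in> F" and bF: "b \<in> F" using Cons.prems by auto
    \<comment> \<open>Partial fractions: modulo \<open>L\<close>, right multiplication by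
      \<open>a \<ominus> c\<close> sends \<open>e c\<close> to \<open>\<one>\<close>, while it sends
      any other \<open>e d\<close> to a multiple of itself plus \<open>\<one>\<close>. It therefore
      strips \<open>e c\<close> from a linear relation.\<close>
    have gen: "\<exists>z\<in>L. e d \<otimes> (a \<ominus> c) = (\<one> \<oplus> z) \<oplus> (d \<ominus> c) \<otimes> e d" if d: "d \<in> F" for d
    proof -
      let ?z = "e d \<otimes> (a \<ominus> d) \<ominus> \<one>"
      have zL: "?z \<in> L" using e(2)[OF d] by (rule cgD(3))
      have "e d \<otimes> (a \<ominus> c) = e d \<otimes> ((a \<ominus> d) \<oplus> (d \<ominus> c))"
        using ca d cF by (simp add: diff_trans)
      also have "\<dots> = e d \<otimes> (a \<ominus> d) \<oplus> (d \<ominus> c) \<otimes> e d"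
        using ca d cF ec[OF d] F_central[OF F_diff[OF d cF] ec[OF d]] by (simp add: r_distr)
      also have "e d \<otimes> (a \<ominus> d) = \<one> \<oplus> ?z"
        using ca d ec[OF d] by (simp add: add_minus_cancel')
      finally show ?thesis using zL by blast
    qed
    have V_ac: "y \<otimes> (a \<ominus> c) \<in> ?V" if "y \<in> ?V" for y
    proof -
      have "y \<otimes> (a \<ominus> c) \<in> ?V" if "y \<in> kspan (map e ds) M" "set ds \<subseteq> set as" for ds
        using that
      proof (induction ds arbitrary: y)
        case Nil
        then show ?case using M_ac cF MV by auto
      next
        case (Cons d ds)
        obtain u x where y: "y = u \<otimes> e d \<oplus> x" "u \<in> F" "x \<in> kspan (map e ds) M" using Cons.prems by auto
        have dF: "d \<in> F" using Cons.prems \<open>set (b # c # as) \<subseteq> F\<close> by auto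
        have "set (map e ds) \<subseteq> carrier R" using cs Cons.prems(2) by auto
        then have xc: "x \<in> carrier R"
          using ksub_carrier[OF ksub_kspan[OF M] y(3)] by blast
        obtain z where z: "z \<in> L" "e d \<otimes> (a \<ominus> c) = (\<one> \<oplus> z) \<oplus> (d \<ominus> c) \<otimes> e d" using gen[OF dF] by blast
        have edV: "e d \<in> ?V" using subsetD[OF kspan_gen[OF M cs], of "e d"] Cons.prems by simp
        have "e d \<otimes> (a \<ominus> c) \<in> ?V"
          unfolding z(2)
          by (rule ksubD(5)[OF V ksubD(5)[OF V oneV subsetD[OF LV z(1)]] ksubD(4)[OF V F_diff[OF dF cF] edV]])
        then have "u \<otimes> (e d \<otimes> (a \<ominus> c)) \<oplus> x \<otimes> (a \<ominus> c) \<in> ?V"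
          using ksubD(4)[OF V y(2)] Cons.IH[OF y(3)] Cons.prems(2) by (intro ksubD(5)[OF V]) auto
        then show ?case using y ca xc cF ec[OF dF] by (simp add: l_distr m_assoc)
      qed
      then show ?thesis using that by blast
    qed
    show ?case
    proof
      assume "e b \<in> kspan (map e (c # as)) M"
      then obtain u y where uy: "e b = u \<otimes> e c \<oplus> y" "u \<in> F" "y \<in> ?V" by auto
      have yc: "y \<in> carrier R" using ksub_carrier[OF V uy(3)] .
      obtain z where z: "z \<in> L" "e b \<otimes> (a \<ominus> c) = (\<one> \<oplus> z) \<oplus> (b \<ominus> c) \<otimes> e b" using gen[OF bF] by blast
      have "e c \<otimes> (a \<ominus> c) \<ominus> \<one> \<in> ?V" using cgD(3)[OF e(2)[OF cF]] LV by blast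
      then have "(e c \<otimes> (a \<ominus> c) \<ominus> \<one>) \<oplus> \<one> \<in> ?V" using ksubD(5)[OF V _ oneV] by blast
      then have "e c \<otimes> (a \<ominus> c) \<in> ?V" using ca cF ec[OF cF] by (simp add: minus_add_cancel)
      then have "u \<otimes> (e c \<otimes> (a \<ominus> c)) \<oplus> y \<otimes> (a \<ominus> c) \<in> ?V"
        using ksubD(4)[OF V uy(2)] V_ac[OF uy(3)] by (intro ksubD(5)[OF V]) auto
      then have "e b \<otimes> (a \<ominus> c) \<in> ?V" using uy yc ca cF ec[OF cF] by (simp add: l_distr m_assoc)
      then have "e b \<otimes> (a \<ominus> c) \<ominus> (\<one> \<oplus> z) \<in> ?V"
        by (rule ksubD(3)[OF V _ ksubD(5)[OF V oneV subsetD[OF LV z(1)]]])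
      moreover have "e b \<otimes> (a \<ominus> c) \<ominus> (\<one> \<oplus> z) = (b \<ominus> c) \<otimes> e b"
        unfolding z(2) using z(1) bF cF ec[OF bF] add_minus_cancel[of "(b \<ominus> c) \<otimes> e b" "\<one> \<oplus> z"] by (simp add: a_comm)
      ultimately have bc: "(b \<ominus> c) \<otimes> e b \<in> ?V" by simp
      have "b \<ominus> c \<noteq> \<zero>" using Cons.prems bF cF minus_add_cancel[of b c] by auto
      then obtain v where v: "v \<in> F" "v \<otimes> (b \<ominus> c) = \<one>" using F_inverse[OF F_diff[OF bF cF]] by blast
      have "v \<otimes> ((b \<ominus> c) \<otimes> e b) \<in> ?V" using ksubD(4)[OF V v(1) bc] .
      then have "e b \<in> ?V" using v bF cF ec[OF bF] by (simp add: m_assoc[symmetric])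
      then show False using Cons by auto
    qed
  qed
  have zero: "{\<zero>} \<subseteq> L" using LD(3) by simp
  \<comment> \<open>Every \<open>e c\<close> lies in one of the spans indexed by
    \<open>\<B>\<close>, and each span holds only finitely many of them. This bounds the cardinality
    of \<open>F\<close> by that of the infinite family \<open>\<B>\<close>.\<close>
  have "F \<subseteq> (\<Union>bs\<in>\<B>. {c \<in> F. e c \<in> kspan bs L})"
  proof
    fix c assume c: "c \<in> F"
    then obtain bs where bs: "bs \<in> \<B>" "e c \<in> kspan bs {\<zero>}" using cover(1) ec by blast
    then have "e c \<in> kspan bs L" using kspan_mono[OF ksub_L cover(2)[OF bs(1)] zero] by blast
    then show "c \<in> (\<Union>bs\<in>\<B>. {c \<in> F. e c \<in> kspan bs L})" using bs c by blast
  qed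
  then have "ordLeq3 (card_of F) (card_of (\<Union>bs\<in>\<B>. {c \<in> F. e c \<in> kspan bs L}))"
    by (rule card_of_mono1)
  moreover have "ordLeq3 (card_of (\<Union>bs\<in>\<B>. {c \<in> F. e c \<in> kspan bs L})) (card_of \<B>)"
  proof (rule card_of_UNION_ordLeq_infinite[OF small(1)])
    show "ordLeq3 (card_of \<B>) (card_of \<B>)" by (simp add: card_of_refl ordIso_imp_ordLeq)
    show "\<forall>bs\<in>\<B>. ordLeq3 (card_of {c \<in> F. e c \<in> kspan bs L}) (card_of \<B>)"
      using finite_multiplicities[OF ec M LM indep cover(2)] small(1)
      by (intro ballI ordLess_imp_ordLeq finite_ordLess_infinite2) auto
  qed
  ultimately have "ordLeq3 (card_of F) (card_of \<B>)" by (rule ordLeq_transitive)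
  then show False using small(2) not_ordLess_ordLeq by blast
qed

end

section \<open>Density\<close>

text \<open>For a left ideal \<open>I\<close> this says that \<open>R / I\<close> is an artinian
  module, in the form of the minimum condition.\<close>

definition dcc_above :: "('a, 'm) ring_scheme \<Rightarrow> 'a set \<Rightarrow> bool" where
  "dcc_above R I \<longleftrightarrow> (\<forall>\<F>. \<F> \<noteq> {} \<longrightarrow> (\<forall>A\<in>\<F>. left_ideal R A \<and> I \<subseteq> A) \<longrightarrow>
     (\<exists>M\<in>\<F>. \<forall>A\<in>\<F>. A \<subseteq> M \<longrightarrow> A = M))"

lemma dcc_aboveD:
  assumes "dcc_above R I" "\<F> \<noteq> {}" "\<And>A. A \<in> \<F> \<Longrightarrow> left_ideal R A" "\<And>A. A \<in> \<F> \<Longrightarrow> I \<subseteq> A"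
  shows "\<exists>M\<in>\<F>. \<forall>A\<in>\<F>. A \<subseteq> M \<longrightarrow> A = M"
  using assms unfolding dcc_above_def by simp

section \<open>Operators composed of left and right multiplications\<close>

context maximal_left_ideal
begin

text \<open>The maps sending \<open>y\<close> to a sum of terms \<open>r y \<kappa>\<close>, one for
  each \<open>\<kappa>\<close> in the list. For \<open>\<kappa>s\<close> in the idealizer they are
  the operators on \<open>R / L\<close> that come from the tensor product of \<open>R\<close> with
  the span of \<open>\<kappa>s\<close>.\<close>

primrec maps :: "'a list \<Rightarrow> ('a \<Rightarrow> 'a) set" where
  "maps [] = {\<lambda>y. \<zero>}"
| "maps (\<kappa> # \<kappa>s) = {\<lambda>y. r \<otimes> y \<otimes> \<kappa> \<oplus> f y | r f. r \<in> carrier R \<and> f \<in> maps \<kappa>s}"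

lemma maps_ConsI: "r \<in> carrier R \<Longrightarrow> f \<in> maps \<kappa>s \<Longrightarrow> (\<lambda>y. r \<otimes> y \<otimes> \<kappa> \<oplus> f y) \<in> maps (\<kappa> # \<kappa>s)"
  by auto

lemma maps_closed: "set \<kappa>s \<subseteq> carrier R \<Longrightarrow> f \<in> maps \<kappa>s \<Longrightarrow> y \<in> carrier R \<Longrightarrow> f y \<in> carrier R"
  by (induction \<kappa>s arbitrary: f) auto

lemma maps_zero: "set \<kappa>s \<subseteq> carrier R \<Longrightarrow> \<exists>f\<in>maps \<kappa>s. \<forall>y\<in>carrier R. f y = \<zero>"
proof (induction \<kappa>s)
  case (Cons \<kappa> \<kappa>s)
  then obtain f where "f \<in> maps \<kappa>s" "\<forall>y\<in>carrier R. f y = \<zero>" by auto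
  then show ?case using Cons.prems by (intro bexI[OF _ maps_ConsI[of \<zero> f]]) auto
qed simp

lemma maps_diff:
  assumes "set \<kappa>s \<subseteq> carrier R" "f \<in> maps \<kappa>s" "g \<in> maps \<kappa>s"
  shows "\<exists>h\<in>maps \<kappa>s. \<forall>y\<in>carrier R. h y = f y \<ominus> g y"
  using assms
proof (induction \<kappa>s arbitrary: f g)
  case Nil
  then show ?case by (auto simp: minus_self)
next
  case (Cons \<kappa> \<kappa>s)
  obtain r f' s g' where *: "f = (\<lambda>y. r \<otimes> y \<otimes> \<kappa> \<oplus> f' y)" "g = (\<lambda>y. s \<otimes> y \<otimes> \<kappa> \<oplus> g' y)"
    "r \<in> carrier R" "s \<in> carrier R" "f' \<in> maps \<kappa>s" "g' \<in> maps \<kappa>s"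
    using Cons.prems by auto
  obtain h where h: "h \<in> maps \<kappa>s" "\<forall>y\<in>carrier R. h y = f' y \<ominus> g' y"
    using Cons.IH[OF _ *(5,6)] Cons.prems by auto
  have "(r \<ominus> s) \<otimes> y \<otimes> \<kappa> \<oplus> h y = f y \<ominus> g y" if "y \<in> carrier R" for y
    using that * h(2) Cons.prems maps_closed[OF _ *(5) that] maps_closed[OF _ *(6) that]
    by (simp add: l_distr_minus diff_add_add)
  then show ?case using * by (intro bexI[OF _ maps_ConsI[of "r \<ominus> s", OF _ h(1)]]) auto
qed

lemma maps_add_arg:
  "set \<kappa>s \<subseteq> carrier R \<Longrightarrow> f \<in> maps \<kappa>s \<Longrightarrow> x \<in> carrier R \<Longrightarrow> y \<in> carrier R \<Longrightarrow> f (x \<ominus> y) = f x \<ominus> f y"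
proof (induction \<kappa>s arbitrary: f)
  case (Cons \<kappa> \<kappa>s)
  obtain r g where *: "f = (\<lambda>y. r \<otimes> y \<otimes> \<kappa> \<oplus> g y)" "r \<in> carrier R" "g \<in> maps \<kappa>s"
    using Cons.prems by auto
  show ?case
    using Cons * maps_closed[OF _ *(3) \<open>x \<in> carrier R\<close>] maps_closed[OF _ *(3) \<open>y \<in> carrier R\<close>]
    by (simp add: r_distr_minus l_distr_minus diff_add_add)
qed (simp add: minus_self)

lemma maps_lmult:
  "set \<kappa>s \<subseteq> carrier R \<Longrightarrow> f \<in> maps \<kappa>s \<Longrightarrow> s \<in> carrier R \<Longrightarrow> \<exists>h\<in>maps \<kappa>s. \<forall>y\<in>carrier R. h y = s \<otimes> f y"
proof (induction \<kappa>s arbitrary: f)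
  case (Cons \<kappa> \<kappa>s)
  obtain r g where *: "f = (\<lambda>y. r \<otimes> y \<otimes> \<kappa> \<oplus> g y)" "r \<in> carrier R" "g \<in> maps \<kappa>s"
    using Cons.prems by auto
  obtain h where h: "h \<in> maps \<kappa>s" "\<forall>y\<in>carrier R. h y = s \<otimes> g y"
    using Cons.IH[OF _ *(3)] Cons.prems by auto
  have "(s \<otimes> r) \<otimes> y \<otimes> \<kappa> \<oplus> h y = s \<otimes> f y" if "y \<in> carrier R" for y
    using that * h(2) Cons.prems maps_closed[OF _ *(3) that] by (simp add: r_distr m_assoc)
  then show ?case using * Cons.prems by (intro bexI[OF _ maps_ConsI[of "s \<otimes> r", OF _ h(1)]]) auto
qed simp

text \<open>Consider the coefficients \<open>r\<close> of the first \<open>\<kappa>\<close> that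
  some map on the remaining \<open>\<kappa>s\<close> can cancel on the points \<open>ys\<close>.
  They form a left ideal which shrinks as \<open>ys\<close> grows, and the chain condition picks
  \<open>ys\<close> for which it no longer shrinks. These points are joined to those for the
  remaining \<open>\<kappa>s\<close>.\<close>

lemma maps_separating:
  assumes "dcc_above R I" "I \<subseteq> L" "\<And>i r. i \<in> I \<Longrightarrow> r \<in> carrier R \<Longrightarrow> i \<otimes> r \<in> I" "set \<kappa>s \<subseteq> carrier R"
  shows "\<exists>xs. set xs \<subseteq> carrier R \<and>
    (\<forall>f\<in>maps \<kappa>s. (\<forall>x\<in>set xs. f x \<in> L) \<longrightarrow> (\<forall>y\<in>carrier R. f y \<in> L))"
  using assms(4)
proof (induction \<kappa>s)
  case Nil
  then show ?case using LD(3) by (intro exI[of _ "[]"]) auto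
next
  case (Cons \<kappa> \<kappa>s)
  then obtain xs where xs: "set xs \<subseteq> carrier R"
    "\<And>f y. f \<in> maps \<kappa>s \<Longrightarrow> (\<forall>x\<in>set xs. f x \<in> L) \<Longrightarrow> y \<in> carrier R \<Longrightarrow> f y \<in> L" by auto
  have \<kappa>: "\<kappa> \<in> carrier R" "set \<kappa>s \<subseteq> carrier R" using Cons.prems by auto
  define A where "A ys = {r \<in> carrier R. \<exists>f\<in>maps \<kappa>s. \<forall>y\<in>set ys. r \<otimes> y \<otimes> \<kappa> \<oplus> f y \<in> L}" for ys
  have A: "left_ideal R (A ys)" "I \<subseteq> A ys" if "set ys \<subseteq> carrier R" for ys
  proof -
    obtain f0 where f0: "f0 \<in> maps \<kappa>s" "\<forall>y\<in>carrier R. f0 y = \<zero>" using maps_zero[OF \<kappa>(2)] by blast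
    have ycl: "y \<in> carrier R" if "y \<in> set ys" for y using that \<open>set ys \<subseteq> carrier R\<close> by blast
    show "left_ideal R (A ys)"
    proof (rule left_idealI)
      show "A ys \<subseteq> carrier R" by (auto simp: A_def)
      show "\<zero> \<in> A ys" using f0 LD(3) \<kappa> ycl unfolding A_def by (auto intro!: bexI[OF _ f0(1)])
    next
      fix r s assume "r \<in> A ys" "s \<in> A ys"
      then obtain f g where *: "r \<in> carrier R" "s \<in> carrier R" "f \<in> maps \<kappa>s" "g \<in> maps \<kappa>s"
        "\<And>y. y \<in> set ys \<Longrightarrow> r \<otimes> y \<otimes> \<kappa> \<oplus> f y \<in> L" "\<And>y. y \<in> set ys \<Longrightarrow> s \<otimes> y \<otimes> \<kappa> \<oplus> g y \<in> L"
        by (auto simp: A_def)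
      obtain h where h: "h \<in> maps \<kappa>s" "\<forall>y\<in>carrier R. h y = f y \<ominus> g y" using maps_diff[OF \<kappa>(2) *(3,4)] by blast
      have "(r \<ominus> s) \<otimes> y \<otimes> \<kappa> \<oplus> h y \<in> L" if "y \<in> set ys" for y
      proof -
        have "(r \<ominus> s) \<otimes> y \<otimes> \<kappa> \<oplus> h y = (r \<otimes> y \<otimes> \<kappa> \<oplus> f y) \<ominus> (s \<otimes> y \<otimes> \<kappa> \<oplus> g y)"
          using * h ycl[OF that] \<kappa> maps_closed[OF \<kappa>(2) *(3) ycl[OF that]] maps_closed[OF \<kappa>(2) *(4) ycl[OF that]]
          by (simp add: l_distr_minus diff_add_add)
        then show ?thesis using LD(5)[OF *(5,6)[OF that]] by simp
      qed
      then show "r \<ominus> s \<in> A ys" using * h(1) by (auto simp: A_def)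
    next
      fix s r assume s: "s \<in> carrier R" and "r \<in> A ys"
      then obtain f where *: "r \<in> carrier R" "f \<in> maps \<kappa>s" "\<And>y. y \<in> set ys \<Longrightarrow> r \<otimes> y \<otimes> \<kappa> \<oplus> f y \<in> L"
        by (auto simp: A_def)
      obtain h where h: "h \<in> maps \<kappa>s" "\<forall>y\<in>carrier R. h y = s \<otimes> f y" using maps_lmult[OF \<kappa>(2) *(2) s] by blast
      have "(s \<otimes> r) \<otimes> y \<otimes> \<kappa> \<oplus> h y \<in> L" if "y \<in> set ys" for y
      proof -
        have "(s \<otimes> r) \<otimes> y \<otimes> \<kappa> \<oplus> h y = s \<otimes> (r \<otimes> y \<otimes> \<kappa> \<oplus> f y)"
          using * h s ycl[OF that] \<kappa> maps_closed[OF \<kappa>(2) *(2) ycl[OF that]] by (simp add: r_distr m_assoc)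
        then show ?thesis using LD(7)[OF s *(3)[OF that]] by simp
      qed
      then show "s \<otimes> r \<in> A ys" using * s h(1) by (auto simp: A_def)
    qed
    show "I \<subseteq> A ys"
    proof
      fix i assume i: "i \<in> I"
      have "i \<otimes> y \<otimes> \<kappa> \<oplus> f0 y \<in> L" if "y \<in> set ys" for y
        using f0 ycl[OF that] assms(2) assms(3)[OF assms(3)[OF i ycl[OF that]] \<kappa>(1)] by (auto simp: subset_iff)
      moreover have "i \<in> carrier R" using i assms(2) by auto
      ultimately show "i \<in> A ys" using f0(1) by (auto simp: A_def)
    qed
  qed
  have "\<exists>M\<in>A ` {ys. set ys \<subseteq> carrier R}. \<forall>B\<in>A ` {ys. set ys \<subseteq> carrier R}. B \<subseteq> M \<longrightarrow> B = M"
  proof (rule dcc_aboveD[OF assms(1)])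
    have "[] \<in> {ys. set ys \<subseteq> carrier R}" by simp
    then show "A ` {ys. set ys \<subseteq> carrier R} \<noteq> {}" by blast
  qed (use A in auto)
  then obtain ys where ys: "set ys \<subseteq> carrier R"
    "\<And>zs. set zs \<subseteq> carrier R \<Longrightarrow> A zs \<subseteq> A ys \<Longrightarrow> A zs = A ys" by auto
  have anti: "A zs' \<subseteq> A zs" if "set zs \<subseteq> set zs'" for zs zs'
    using that unfolding A_def by blast
  have "f y \<in> L" if f: "f \<in> maps (\<kappa> # \<kappa>s)" "\<forall>x\<in>set (xs @ ys). f x \<in> L" and y: "y \<in> carrier R" for f y
  proof -
    obtain r g where *: "f = (\<lambda>y. r \<otimes> y \<otimes> \<kappa> \<oplus> g y)" "r \<in> carrier R" "g \<in> maps \<kappa>s"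
      using f(1) by auto
    have "r \<in> A (xs @ ys)" using f(2) * unfolding A_def by auto
    then have "r \<in> A ys" using anti[of ys "xs @ ys"] by auto
    \<comment> \<open>Since \<open>A\<close> no longer shrinks, some \<open>g'\<close> cancels
      \<open>r\<close> at \<open>y\<close> and on all of \<open>xs @ ys\<close> at once. Subtracting
      it from \<open>f\<close> leaves a map on \<open>\<kappa>s\<close> alone, which is settled by
      the choice of \<open>xs\<close>.\<close>
    moreover have "A (y # xs @ ys) = A ys"
      using ys xs(1) y anti[of ys "y # xs @ ys"] by (intro ys(2)) auto
    ultimately have "r \<in> A (y # xs @ ys)" by simp
    then obtain g' where g': "g' \<in> maps \<kappa>s" "\<And>x. x \<in> set (y # xs @ ys) \<Longrightarrow> r \<otimes> x \<otimes> \<kappa> \<oplus> g' x \<in> L"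
      by (auto simp: A_def)
    obtain h where h: "h \<in> maps \<kappa>s" "\<forall>y\<in>carrier R. h y = g y \<ominus> g' y" using maps_diff[OF \<kappa>(2) *(3) g'(1)] by blast
    have eq: "h x = f x \<ominus> (r \<otimes> x \<otimes> \<kappa> \<oplus> g' x)" if "x \<in> carrier R" for x
      using that h * \<kappa> maps_closed[OF \<kappa>(2) *(3) that] maps_closed[OF \<kappa>(2) g'(1) that]
      by (simp add: diff_add_add minus_self)
    have "h x \<in> L" if "x \<in> set xs" for x
    proof -
      have x: "x \<in> carrier R" using that xs(1) by blast
      show ?thesis unfolding eq[OF x] using f(2) g'(2)[of x] that by (intro LD(5)) auto
    qed
    then have "h y \<in> L" using xs(2)[OF h(1) _ y] by blast
    then have "h y \<oplus> (r \<otimes> y \<otimes> \<kappa> \<oplus> g' y) \<in> L" by (rule LD(4)[OF _ g'(2)]) simp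
    moreover have "h y \<oplus> (r \<otimes> y \<otimes> \<kappa> \<oplus> g' y) = f y"
      unfolding eq[OF y] using y * \<kappa> maps_closed[OF \<kappa>(2) *(3) y] maps_closed[OF \<kappa>(2) g'(1) y]
      by (simp add: minus_add_cancel)
    ultimately show ?thesis by simp
  qed
  then show ?case using xs(1) ys(1) by (intro exI[of _ "xs @ ys"]) auto
qed

text \<open>The coefficients stand on the right, where \<open>K\<close> acts on \<open>R / L\<close>
  by endomorphisms.\<close>

primrec rspan :: "'a set \<Rightarrow> 'a list \<Rightarrow> 'a set" where
  "rspan K [] = L"
| "rspan K (x # xs) = {x \<otimes> c \<oplus> w | c w. c \<in> K \<and> w \<in> rspan K xs}"

lemma rspan_ConsI: "c \<in> K \<Longrightarrow> w \<in> rspan K xs \<Longrightarrow> x \<otimes> c \<oplus> w \<in> rspan K (x # xs)"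
  by auto

lemma fin_mod_rspan:
  assumes "fin_mod K L" "set xs \<subseteq> carrier R"
  shows "fin_mod (rspan K xs) L"
  using assms(2)
proof (induction xs)
  case (Cons x xs)
  have "fin_mod {y \<oplus> w | y w. y \<in> (\<lambda>c. x \<otimes> c) ` K \<and> w \<in> rspan K xs} L"
    by (rule fin_mod_sum[OF fin_mod_lmult[OF assms(1)]]) (use Cons in auto)
  then show ?case by (rule fin_mod_mono[OF _ _ order_refl ksub_L]) auto
qed (simp add: fin_mod_refl)

section \<open>Density over a self-centralizing commutative subring\<close>

context
  fixes K \<kappa>s
  assumes K: "K \<subseteq> idealizer" "\<one> \<in> K" "\<And>x y. x \<in> K \<Longrightarrow> y \<in> K \<Longrightarrow> x \<ominus> y \<in> K"
    "\<And>x y. x \<in> K \<Longrightarrow> y \<in> K \<Longrightarrow> x \<otimes> y \<in> K"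
    "\<And>x y. x \<in> K \<Longrightarrow> y \<in> K \<Longrightarrow> cg (x \<otimes> y) (y \<otimes> x)"
    and self_centralizing: "\<And>d. d \<in> idealizer \<Longrightarrow> (\<And>x. x \<in> K \<Longrightarrow> cg (d \<otimes> x) (x \<otimes> d)) \<Longrightarrow> d \<in> K"
    and \<kappa>s: "set \<kappa>s \<subseteq> K" "K \<subseteq> kspan \<kappa>s L"
begin

lemma K_carrier': "x \<in> K \<Longrightarrow> x \<in> carrier R"
  using K(1) idealizerD(1)[of x] by (auto simp: subset_iff)

lemma \<kappa>s_carrier: "set \<kappa>s \<subseteq> carrier R"
  using \<kappa>s(1) K_carrier' by blast

text \<open>The coefficients of \<open>x\<close> with respect to \<open>xs\<close> lie in
  \<open>F\<close>; being central, they can be moved into the left factors.\<close>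

lemma maps_span:
  assumes "r \<in> carrier R" "x \<in> kspan xs L" "set xs \<subseteq> carrier R"
  shows "\<exists>f\<in>maps xs. \<forall>y\<in>carrier R. cg (f y) (r \<otimes> y \<otimes> x)"
  using assms(2,3)
proof (induction xs arbitrary: x)
  case Nil
  then have "cg \<zero> (r \<otimes> y \<otimes> x)" if "y \<in> carrier R" for y
    using assms(1) that LD(7)[of "r \<otimes> y" x] cg_sym cg_zero_iff by auto
  then show ?case by simp
next
  case (Cons z xs)
  obtain c w where *: "x = c \<otimes> z \<oplus> w" "c \<in> F" "w \<in> kspan xs L" using Cons.prems by auto
  have w: "w \<in> carrier R" using ksub_carrier[OF ksub_kspan[OF ksub_L] *(3)] Cons.prems by simp
  obtain f where f: "f \<in> maps xs" "\<forall>y\<in>carrier R. cg (f y) (r \<otimes> y \<otimes> w)"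
    using Cons.IH[OF *(3)] Cons.prems by auto
  have "cg ((r \<otimes> c) \<otimes> y \<otimes> z \<oplus> f y) (r \<otimes> y \<otimes> x)" if y: "y \<in> carrier R" for y
  proof -
    have z: "z \<in> carrier R" using Cons.prems by simp
    have "(r \<otimes> c) \<otimes> y \<otimes> z \<oplus> r \<otimes> y \<otimes> w = r \<otimes> y \<otimes> x"
    proof -
      have "c \<otimes> (y \<otimes> z) = y \<otimes> (c \<otimes> z)"
        using F_central[OF *(2) y] y z *(2) by (simp add: m_assoc[symmetric])
      then show ?thesis unfolding *(1) using y z w *(2) assms(1) by (simp add: r_distr m_assoc)
    qed
    moreover have "cg ((r \<otimes> c) \<otimes> y \<otimes> z \<oplus> f y) ((r \<otimes> c) \<otimes> y \<otimes> z \<oplus> r \<otimes> y \<otimes> w)"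
      using f y z *(2) assms(1) by (intro cg_add cg_refl) auto
    ultimately show ?thesis by simp
  qed
  then show ?case using assms(1) *(2) by (intro bexI[OF _ maps_ConsI[of "r \<otimes> c", OF _ f(1)]]) auto
qed

lemma maps_sum:
  assumes "set xs \<subseteq> carrier R" "f \<in> maps xs" "g \<in> maps xs"
  shows "\<exists>h\<in>maps xs. \<forall>y\<in>carrier R. h y = f y \<oplus> g y"
proof -
  obtain z where z: "z \<in> maps xs" "\<forall>y\<in>carrier R. z y = \<zero>" using maps_zero[OF assms(1)] by blast
  obtain h where h: "h \<in> maps xs" "\<forall>y\<in>carrier R. h y = z y \<ominus> g y" using maps_diff[OF assms(1) z(1) assms(3)] by blast
  obtain l where l: "l \<in> maps xs" "\<forall>y\<in>carrier R. l y = f y \<ominus> h y" using maps_diff[OF assms(1,2) h(1)] by blast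
  have "l y = f y \<oplus> g y" if "y \<in> carrier R" for y
    using that l h z maps_closed[OF assms(1,2) that] maps_closed[OF assms(1,3) that] by (simp add: a_minus_def)
  then show ?thesis using l(1) by blast
qed

text \<open>The product of an entry of \<open>\<kappa>s\<close> with \<open>c\<close> lies in
  \<open>K\<close> and hence in the span of \<open>\<kappa>s\<close>, so multiplying by
  \<open>c\<close> leads to no new maps modulo \<open>L\<close>.\<close>

lemma maps_rmult:
  assumes "f \<in> maps \<kappa>s" "c \<in> K"
  shows "\<exists>h\<in>maps \<kappa>s. \<forall>y\<in>carrier R. cg (h y) (f y \<otimes> c)"
proof -
  have "\<exists>h\<in>maps \<kappa>s. \<forall>y\<in>carrier R. cg (h y) (f y \<otimes> c)" if "f \<in> maps xs" "set xs \<subseteq> K" for f xs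
    using that
  proof (induction xs arbitrary: f)
    case Nil
    obtain z where z: "z \<in> maps \<kappa>s" "\<forall>y\<in>carrier R. z y = \<zero>" using maps_zero[OF \<kappa>s_carrier] by blast
    then show ?case using Nil K_carrier'[OF assms(2)] by (intro bexI[OF _ z(1)]) (auto simp: cg_refl)
  next
    case (Cons x xs)
    obtain r g where *: "f = (\<lambda>y. r \<otimes> y \<otimes> x \<oplus> g y)" "r \<in> carrier R" "g \<in> maps xs"
      using Cons.prems by auto
    obtain h where h: "h \<in> maps \<kappa>s" "\<forall>y\<in>carrier R. cg (h y) (g y \<otimes> c)"
      using Cons.IH[OF *(3)] Cons.prems by auto
    have x: "x \<in> K" "set xs \<subseteq> carrier R" using Cons.prems K_carrier' by auto
    obtain l where l: "l \<in> maps \<kappa>s" "\<forall>y\<in>carrier R. cg (l y) (r \<otimes> y \<otimes> (x \<otimes> c))"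
      using maps_span[OF *(2) _ \<kappa>s_carrier] K(4)[OF x(1) assms(2)] \<kappa>s(2) by blast
    obtain m where m: "m \<in> maps \<kappa>s" "\<forall>y\<in>carrier R. m y = l y \<oplus> h y" using maps_sum[OF \<kappa>s_carrier l(1) h(1)] by blast
    have "cg (m y) (f y \<otimes> c)" if y: "y \<in> carrier R" for y
    proof -
      have "f y \<otimes> c = r \<otimes> y \<otimes> (x \<otimes> c) \<oplus> g y \<otimes> c"
        unfolding *(1) using * y K_carrier'[OF x(1)] K_carrier'[OF assms(2)] maps_closed[OF x(2) *(3) y]
        by (simp add: l_distr m_assoc)
      then show ?thesis using m y l h by (simp add: cg_add)
    qed
    then show ?case using m(1) by blast
  qed
  then show ?thesis using assms(1) \<kappa>s(1) by blast
qed

text \<open>Commutativity of \<open>K\<close> modulo \<open>L\<close> makes the maps linear over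
  \<open>K\<close>.\<close>

lemma maps_arg_rmult:
  assumes "f \<in> maps \<kappa>s" "d \<in> K" "x \<in> carrier R"
  shows "cg (f (x \<otimes> d)) (f x \<otimes> d)"
proof -
  have "cg (f (x \<otimes> d)) (f x \<otimes> d)" if "f \<in> maps xs" "set xs \<subseteq> K" for f xs
    using that
  proof (induction xs arbitrary: f)
    case Nil
    then show ?case using K_carrier'[OF assms(2)] by (simp add: cg_refl)
  next
    case (Cons z xs)
    obtain r g where *: "f = (\<lambda>y. r \<otimes> y \<otimes> z \<oplus> g y)" "r \<in> carrier R" "g \<in> maps xs"
      using Cons.prems by auto
    have z: "z \<in> K" "set xs \<subseteq> carrier R" using Cons.prems K_carrier' by auto
    note cl = K_carrier'[OF assms(2)] K_carrier'[OF z(1)] maps_closed[OF z(2) *(3) assms(3)] assms(3) *(2)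
    have "cg (r \<otimes> x \<otimes> (d \<otimes> z)) (r \<otimes> x \<otimes> (z \<otimes> d))"
      using K(5)[OF assms(2) z(1)] cl by (intro cg_lmult) auto
    then have "cg (r \<otimes> (x \<otimes> d) \<otimes> z) (r \<otimes> x \<otimes> z \<otimes> d)" using cl by (simp add: m_assoc)
    moreover have "cg (g (x \<otimes> d)) (g x \<otimes> d)" using Cons *(3) by simp
    ultimately have "cg (r \<otimes> (x \<otimes> d) \<otimes> z \<oplus> g (x \<otimes> d)) (r \<otimes> x \<otimes> z \<otimes> d \<oplus> g x \<otimes> d)" by (rule cg_add)
    then show ?case using * cl by (simp add: l_distr)
  qed
  then show ?thesis using assms(1) \<kappa>s(1) by blast
qed

text \<open>Jacobson's density argument. Let \<open>A\<close> consist of the maps that kill all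
  points but the first, \<open>x\<close>. If some of them does not kill \<open>x\<close>, simplicity
  gives a map \<open>u\<close> in \<open>A\<close> with \<open>u x = 1\<close> modulo
  \<open>L\<close>, and \<open>w x\<close> determines \<open>w v\<close> for all \<open>w\<close> in
  \<open>A\<close> through right multiplication by \<open>d = u v\<close>. This \<open>d\<close>
  commutes with \<open>K\<close>, hence belongs to \<open>K\<close>, and \<open>v - x d\<close> is
  handled by induction.\<close>

lemma density:
  assumes "set xs \<subseteq> carrier R" "v \<in> carrier R"
    and "\<And>f. f \<in> maps \<kappa>s \<Longrightarrow> (\<forall>x\<in>set xs. f x \<in> L) \<Longrightarrow> f v \<in> L"
  shows "v \<in> rspan K xs"
  using assms
proof (induction xs arbitrary: v)
  case Nil
  \<comment> \<open>Without points every map must send \<open>v\<close> into \<open>L\<close>, and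
    one of the maps is the identity modulo \<open>L\<close>.\<close>
  have "\<one> \<in> kspan \<kappa>s L" using K(2) \<kappa>s(2) by blast
  then obtain f where f: "f \<in> maps \<kappa>s" "\<forall>y\<in>carrier R. cg (f y) (\<one> \<otimes> y \<otimes> \<one>)"
    using maps_span[OF one_closed _ \<kappa>s_carrier] by blast
  then have "cg (f v) v" "f v \<in> L" using Nil by auto
  then show ?case using cg_L by simp
next
  case (Cons x xs)
  note \<kappa>c = \<kappa>s_carrier
  have x: "x \<in> carrier R" "set xs \<subseteq> carrier R" and v: "v \<in> carrier R" using Cons.prems by auto
  define A where "A = {f \<in> maps \<kappa>s. \<forall>x\<in>set xs. f x \<in> L}"
  have AD: "f \<in> maps \<kappa>s" "y \<in> set xs \<Longrightarrow> f y \<in> L" if "f \<in> A" for f y using that by (auto simp: A_def)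
  have Acl: "f y \<in> carrier R" if "f \<in> A" "y \<in> carrier R" for f y
    using maps_closed[OF \<kappa>c AD(1)[OF that(1)] that(2)] .
  have kill: "f v \<in> L" if "f \<in> A" "f x \<in> L" for f
    using Cons.prems(3)[of f] that by (auto simp: A_def)
  show ?case
  proof (cases "\<forall>f\<in>A. f x \<in> L")
    case True
    have "v \<in> rspan K xs"
      by (rule Cons.IH[OF x(2) v]) (use True kill in \<open>auto simp: A_def\<close>)
    then have "x \<otimes> \<zero> \<oplus> v \<in> rspan K (x # xs)"
      using K(3)[OF K(2) K(2)] by (intro rspan_ConsI) (auto simp: minus_self)
    then show ?thesis using x v by simp
  next
    case False
    then obtain f where f: "f \<in> A" "f x \<notin> L" by blast
    obtain r where r: "r \<in> carrier R" "cg (r \<otimes> f x) \<one>" using generates_modulo[OF Acl[OF f(1) x(1)] f(2)] .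
    obtain u where u: "u \<in> maps \<kappa>s" "\<forall>y\<in>carrier R. u y = r \<otimes> f y" using maps_lmult[OF \<kappa>c AD(1)[OF f(1)] r(1)] by blast
    have uA: "u \<in> A" using u AD(2)[OF f(1)] LD(7)[OF r(1)] x by (auto simp: A_def subset_iff)
    have ux: "cg (u x) \<one>" using u r x by simp
    note cu = Acl[OF uA x(1)] Acl[OF uA v]
    define d where "d = u v"
    have d: "d \<in> carrier R" unfolding d_def using cu by simp
    \<comment> \<open>The map \<open>w - (w x) u\<close> kills the other points and also
      \<open>x\<close>, since \<open>u x\<close> is \<open>\<one>\<close> modulo \<open>L\<close>;
      by hypothesis it then kills \<open>v\<close>.\<close>
    have main: "cg (w v) (w x \<otimes> d)" if w: "w \<in> A" for w
    proof -
      note cw = Acl[OF w x(1)] Acl[OF w v]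
      obtain g where g: "g \<in> maps \<kappa>s" "\<forall>y\<in>carrier R. g y = w x \<otimes> u y" using maps_lmult[OF \<kappa>c u(1) cw(1)] by blast
      obtain h where h: "h \<in> maps \<kappa>s" "\<forall>y\<in>carrier R. h y = w y \<ominus> g y" using maps_diff[OF \<kappa>c AD(1)[OF w] g(1)] by blast
      have "h y \<in> L" if "y \<in> set xs" for y
        using that x h g AD(2)[OF w that] AD(2)[OF uA that] LD(5,7) cw(1) by (auto simp: subset_iff)
      then have hA: "h \<in> A" using h(1) by (auto simp: A_def)
      have "cg (w x \<otimes> u x) (w x \<otimes> \<one>)" by (rule cg_lmult[OF ux cw(1)])
      then have "cg (w x) (w x \<otimes> u x)" using cg_sym cw by simp
      then have "h x \<in> L" using h g x by (simp add: cg_def)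
      then have "h v \<in> L" by (rule kill[OF hA])
      then show ?thesis using h g v cw cu by (simp add: cg_def d_def)
    qed
    have "l \<otimes> d \<in> L" if l: "l \<in> L" for l
    proof -
      obtain w where w: "w \<in> maps \<kappa>s" "\<forall>y\<in>carrier R. w y = l \<otimes> u y" using maps_lmult[OF \<kappa>c u(1)] l L_carrier by blast
      have "w y \<in> L" if "y \<in> set xs" for y
        using that w x AD(2)[OF uA that] LD(7) l by (auto simp: subset_iff)
      then have "w \<in> A" using w(1) by (auto simp: A_def)
      moreover have "cg (l \<otimes> u x) (l \<otimes> \<one>)" by (rule cg_lmult[OF ux]) (use l in simp)
      then have "w x \<in> L" using w x l cg_L' by simp
      ultimately have "w v \<in> L" by (rule kill)
      then show ?thesis using w v by (simp add: d_def)
    qed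
    then have dS: "d \<in> idealizer" using d by (simp add: idealizer_def)
    have dK: "d \<in> K"
    proof (rule self_centralizing[OF dS])
      fix c assume c: "c \<in> K"
      note cS = subsetD[OF K(1) c]
      \<comment> \<open>Following \<open>u\<close> by multiplication with \<open>c\<close> gives a
        map with value \<open>c\<close> at \<open>x\<close> and \<open>d c\<close> at
        \<open>v\<close>. Comparison with \<open>main\<close> shows that \<open>d\<close> and
        \<open>c\<close> commute modulo \<open>L\<close>.\<close>
      obtain w where w: "w \<in> maps \<kappa>s" "\<forall>y\<in>carrier R. cg (w y) (u y \<otimes> c)" using maps_rmult[OF u(1) c] by blast
      have "w y \<in> L" if "y \<in> set xs" for y
      proof -
        have "u y \<otimes> c \<in> L" using AD(2)[OF uA that] idealizerD(2)[OF cS] by simp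
        then show ?thesis using w(2) that x(2) cg_L' by blast
      qed
      then have wA: "w \<in> A" using w(1) by (auto simp: A_def)
      have "cg (d \<otimes> c) (w v)" using w v cg_sym by (simp add: d_def)
      also have "cg (w v) (w x \<otimes> d)" by (rule main[OF wA])
      also have "cg (w x \<otimes> d) ((u x \<otimes> c) \<otimes> d)" using w x dS by (intro cg_rmult) auto
      also have "cg ((u x \<otimes> c) \<otimes> d) ((\<one> \<otimes> c) \<otimes> d)" by (intro cg_rmult ux cS dS)
      finally show "cg (d \<otimes> c) (c \<otimes> d)" using K_carrier'[OF c] by simp
    qed
    have "v \<ominus> x \<otimes> d \<in> rspan K xs"
    proof (rule Cons.IH[OF x(2)])
      fix w assume "w \<in> maps \<kappa>s" "\<forall>x\<in>set xs. w x \<in> L"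
      then have w: "w \<in> A" by (simp add: A_def)
      have "cg (w v) (w (x \<otimes> d))"
        using cg_trans[OF main[OF w] cg_sym[OF maps_arg_rmult[OF AD(1)[OF w] dK x(1)]]] .
      then show "w (v \<ominus> x \<otimes> d) \<in> L"
        using maps_add_arg[OF \<kappa>c AD(1)[OF w] v, of "x \<otimes> d"] x d by (simp add: cg_def)
    qed (use x v d in simp)
    then have "x \<otimes> d \<oplus> (v \<ominus> x \<otimes> d) \<in> rspan K (x # xs)" by (rule rspan_ConsI[OF dK])
    then show ?thesis using x v d by (simp add: add_minus_cancel')
  qed
qed

text \<open>For separating points \<open>xs\<close> the hypothesis of the density theorem holds for
  every \<open>v\<close>. So finitely many elements span \<open>R / L\<close> over \<open>K\<close>,
  which is itself finite-dimensional modulo \<open>L\<close>.\<close>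

lemma simple_quotient_finite:
  assumes "dcc_above R I" "I \<subseteq> L" "\<And>i r. i \<in> I \<Longrightarrow> r \<in> carrier R \<Longrightarrow> i \<otimes> r \<in> I" "fin_mod K L"
  shows "fin_mod (carrier R) L"
proof -
  obtain xs where xs: "set xs \<subseteq> carrier R"
    "\<forall>f\<in>maps \<kappa>s. (\<forall>x\<in>set xs. f x \<in> L) \<longrightarrow> (\<forall>y\<in>carrier R. f y \<in> L)"
    using maps_separating[OF assms(1-3) \<kappa>s_carrier] by blast
  have "carrier R \<subseteq> rspan K xs"
    using density[OF xs(1)] xs(2) by blast
  then show ?thesis using fin_mod_mono[OF fin_mod_rspan[OF assms(4) xs(1)] _ order_refl ksub_L] by blast
qed

end

end

section \<open>Extension of scalars\<close>

fun horner :: "('c, 'm) ring_scheme \<Rightarrow> 'c list \<Rightarrow> 'c \<Rightarrow> 'c" where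
  "horner C [] x = \<zero>\<^bsub>C\<^esub>"
| "horner C (c # cs) x = c \<oplus>\<^bsub>C\<^esub> horner C cs x \<otimes>\<^bsub>C\<^esub> x"

text \<open>The quotient of a polynomial by \<open>X - x\<close>, coefficients listed from the
  constant term upwards: its coefficients are the Horner values of the proper nonempty
  tails.\<close>

fun synthetic_division :: "('c, 'm) ring_scheme \<Rightarrow> 'c list \<Rightarrow> 'c \<Rightarrow> 'c list" where
  "synthetic_division C [] x = []"
| "synthetic_division C (c # cs) x = (if cs = [] then [] else horner C cs x # synthetic_division C cs x)"

lemma (in ring) horner_closed: "set cs \<subseteq> carrier R \<Longrightarrow> x \<in> carrier R \<Longrightarrow> horner R cs x \<in> carrier R"
  by (induction cs) auto

lemma (in ring) synthetic_division_closed: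
  "set cs \<subseteq> carrier R \<Longrightarrow> x \<in> carrier R \<Longrightarrow> set (synthetic_division R cs x) \<subseteq> carrier R"
  by (induction cs) (auto simp: horner_closed)

text \<open>The leading coefficient survives the division, so an induction on the degree can go
  on.\<close>

lemma (in ring) synthetic_division_last:
  "set cs \<subseteq> carrier R \<Longrightarrow> x \<in> carrier R \<Longrightarrow> length cs \<ge> 2 \<Longrightarrow>
   length cs = Suc (length (synthetic_division R cs x)) \<and> last (synthetic_division R cs x) = last cs \<and>
   synthetic_division R cs x \<noteq> []"
proof (induction cs)
  case (Cons c cs)
  show ?case
  proof (cases "length cs \<ge> 2")
    case True
    then show ?thesis using Cons by auto
  next
    case False
    then obtain d where "cs = [d]" using Cons.prems by (cases cs; cases "tl cs") auto
    then show ?thesis using Cons.prems by simp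
  qed
qed simp

context central_subfield
begin

lemma kindep_snoc: "kindep (xs @ [x]) W \<longleftrightarrow> kindep xs W \<and> x \<notin> kspan (rev xs) W"
proof (induction xs arbitrary: W)
  case (Cons y xs)
  have "kspan (rev xs) (kspan [y] W) = kspan (rev (y # xs)) W" by (simp add: kspan_append del: kspan.simps(2))
  then show ?case using Cons[of "kspan [y] W"] by (simp del: kspan.simps)
qed simp

text \<open>The generators supplied by \<open>fin_mod\<close> need not lie in \<open>K\<close>. A
  longest independent list of elements of \<open>K\<close> exists because lengths are bounded, and
  it spans.\<close>

lemma fin_mod_basis:
  assumes "ksub W" "fin_mod K W" "K \<subseteq> carrier R"
  shows "\<exists>xs. set xs \<subseteq> K \<and> K \<subseteq> kspan xs W"
proof -
  obtain fs where fs: "set fs \<subseteq> carrier R" "K \<subseteq> kspan fs W" using assms(2) unfolding fin_mod_def by blast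
  let ?P = "\<lambda>n. \<exists>xs. length xs = n \<and> set xs \<subseteq> K \<and> kindep xs W"
  have "?P 0" by simp
  moreover have "\<forall>n. ?P n \<longrightarrow> n \<le> length fs"
    using kindep_length[OF assms(1) fs(1)] fs(2) by (metis subset_trans)
  ultimately obtain n where n: "?P n" "\<And>m. ?P m \<Longrightarrow> m \<le> n"
    using ex_has_greatest_nat[of ?P 0 "\<lambda>n. n" "Suc (length fs)"] by (auto simp: less_Suc_eq_le)
  then obtain xs where xs: "length xs = n" "set xs \<subseteq> K" "kindep xs W" by blast
  have "x \<in> kspan (rev xs) W" if "x \<in> K" for x
  proof (rule ccontr)
    assume "x \<notin> kspan (rev xs) W"
    then have "?P (Suc n)" using xs that by (intro exI[of _ "xs @ [x]"]) (simp add: kindep_snoc)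
    then show False using n(2)[of "Suc n"] by simp
  qed
  then show ?thesis using xs by (intro exI[of _ "rev xs"]) auto
qed

end

text \<open>The tensor product of \<open>R\<close> and \<open>C\<close> is described by its pure
  tensors \<open>\<tau> r c\<close>: they generate \<open>T\<close> additively, and a linear
  functional on \<open>R\<close> extends to \<open>T\<close>. This keeps the construction by
  generators and relations out of the argument. \<open>\<zeta>\<close> is the embedding of
  \<open>F\<close> into \<open>C\<close>.\<close>

locale tensor_situation = maximal_left_ideal R F L + T: ring T + C: field C
  for R (structure) and F L and T :: "('t, 'm) ring_scheme" and C :: "('c, 'n) ring_scheme" +
  fixes \<tau> :: "'a \<Rightarrow> 'c \<Rightarrow> 't" and \<zeta> :: "'a \<Rightarrow> 'c"
  assumes \<tau>_closed: "\<And>r c. r \<in> carrier R \<Longrightarrow> c \<in> carrier C \<Longrightarrow> \<tau> r c \<in> carrier T"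
    and \<tau>_add_left: "\<And>r r' c. r \<in> carrier R \<Longrightarrow> r' \<in> carrier R \<Longrightarrow> c \<in> carrier C \<Longrightarrow>
      \<tau> (r \<oplus> r') c = \<tau> r c \<oplus>\<^bsub>T\<^esub> \<tau> r' c"
    and \<tau>_add_right: "\<And>r c c'. r \<in> carrier R \<Longrightarrow> c \<in> carrier C \<Longrightarrow> c' \<in> carrier C \<Longrightarrow>
      \<tau> r (c \<oplus>\<^bsub>C\<^esub> c') = \<tau> r c \<oplus>\<^bsub>T\<^esub> \<tau> r c'"
    and \<tau>_mult: "\<And>r r' c c'. r \<in> carrier R \<Longrightarrow> r' \<in> carrier R \<Longrightarrow> c \<in> carrier C \<Longrightarrow> c' \<in> carrier C \<Longrightarrow>
      \<tau> r c \<otimes>\<^bsub>T\<^esub> \<tau> r' c' = \<tau> (r \<otimes> r') (c \<otimes>\<^bsub>C\<^esub> c')"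
    and \<tau>_one: "\<tau> \<one> \<one>\<^bsub>C\<^esub> = \<one>\<^bsub>T\<^esub>"
    and \<tau>_scalar: "\<And>z. z \<in> F \<Longrightarrow> \<tau> z \<one>\<^bsub>C\<^esub> = \<tau> \<one> (\<zeta> z)"
    and \<tau>_span: "\<And>N. additive_subgroup N T \<Longrightarrow> (\<And>r c. r \<in> carrier R \<Longrightarrow> c \<in> carrier C \<Longrightarrow> \<tau> r c \<in> N) \<Longrightarrow>
      carrier T \<subseteq> N"
    and \<tau>_functional: "\<And>g. g \<in> carrier R \<rightarrow> carrier C \<Longrightarrow>
      (\<And>x y. x \<in> carrier R \<Longrightarrow> y \<in> carrier R \<Longrightarrow> g (x \<oplus> y) = g x \<oplus>\<^bsub>C\<^esub> g y) \<Longrightarrow>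
      (\<And>z x. z \<in> F \<Longrightarrow> x \<in> carrier R \<Longrightarrow> g (z \<otimes> x) = \<zeta> z \<otimes>\<^bsub>C\<^esub> g x) \<Longrightarrow>
      \<exists>\<Gamma>. \<Gamma> \<in> carrier T \<rightarrow> carrier C \<and>
        (\<forall>x\<in>carrier T. \<forall>y\<in>carrier T. \<Gamma> (x \<oplus>\<^bsub>T\<^esub> y) = \<Gamma> x \<oplus>\<^bsub>C\<^esub> \<Gamma> y) \<and>
        (\<forall>r\<in>carrier R. \<forall>c\<in>carrier C. \<Gamma> (\<tau> r c) = g r \<otimes>\<^bsub>C\<^esub> c)"
    and \<zeta>_closed: "\<And>z. z \<in> F \<Longrightarrow> \<zeta> z \<in> carrier C"
    and \<zeta>_one: "\<zeta> \<one> = \<one>\<^bsub>C\<^esub>"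
    and \<zeta>_diff: "\<And>z z'. z \<in> F \<Longrightarrow> z' \<in> F \<Longrightarrow> \<zeta> (z \<ominus> z') = \<zeta> z \<ominus>\<^bsub>C\<^esub> \<zeta> z'"
    and \<zeta>_mult: "\<And>z z'. z \<in> F \<Longrightarrow> z' \<in> F \<Longrightarrow> \<zeta> (z \<otimes> z') = \<zeta> z \<otimes>\<^bsub>C\<^esub> \<zeta> z'"
    and T_noetherian: "left_noetherian T"
    and C_root: "\<And>cs. set cs \<subseteq> carrier C \<Longrightarrow> length cs \<ge> 2 \<Longrightarrow> last cs \<noteq> \<zero>\<^bsub>C\<^esub> \<Longrightarrow>
      \<exists>x\<in>carrier C. horner C cs x = \<zero>\<^bsub>C\<^esub>"
    and algebraic: "\<And>a. a \<in> idealizer \<Longrightarrow> \<exists>n. a [^] (n::nat) \<in> powers F a n"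
begin

lemma \<tau>_zero_left: "c \<in> carrier C \<Longrightarrow> \<tau> \<zero> c = \<zero>\<^bsub>T\<^esub>"
  using \<tau>_add_left[of \<zero> \<zero> c] \<tau>_closed[of \<zero> c] by (simp add: T.add.l_cancel_one')

lemma \<tau>_zero_right: "r \<in> carrier R \<Longrightarrow> \<tau> r \<zero>\<^bsub>C\<^esub> = \<zero>\<^bsub>T\<^esub>"
  using \<tau>_add_right[of r "\<zero>\<^bsub>C\<^esub>" "\<zero>\<^bsub>C\<^esub>"] \<tau>_closed[of r "\<zero>\<^bsub>C\<^esub>"] by (simp add: T.add.l_cancel_one')

lemma \<tau>_diff_left:
  assumes "r \<in> carrier R" "r' \<in> carrier R" "c \<in> carrier C"
  shows "\<tau> (r \<ominus> r') c = \<tau> r c \<ominus>\<^bsub>T\<^esub> \<tau> r' c"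
proof -
  have "\<tau> r c = \<tau> (r \<ominus> r') c \<oplus>\<^bsub>T\<^esub> \<tau> r' c"
    using assms \<tau>_add_left[of "r \<ominus> r'" r' c] by (simp add: minus_add_cancel)
  then show ?thesis using assms by (simp add: T.add_minus_cancel \<tau>_closed)
qed

lemma \<tau>_diff_right:
  assumes "r \<in> carrier R" "c \<in> carrier C" "c' \<in> carrier C"
  shows "\<tau> r (c \<ominus>\<^bsub>C\<^esub> c') = \<tau> r c \<ominus>\<^bsub>T\<^esub> \<tau> r c'"
proof -
  have "\<tau> r c = \<tau> r (c \<ominus>\<^bsub>C\<^esub> c') \<oplus>\<^bsub>T\<^esub> \<tau> r c'"
    using assms \<tau>_add_right[of r "c \<ominus>\<^bsub>C\<^esub> c'" c'] by (simp add: C.minus_add_cancel)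
  then show ?thesis using assms by (simp add: T.add_minus_cancel \<tau>_closed)
qed

lemma \<tau>_central:
  assumes "c \<in> carrier C" "t \<in> carrier T"
  shows "\<tau> \<one> c \<otimes>\<^bsub>T\<^esub> t = t \<otimes>\<^bsub>T\<^esub> \<tau> \<one> c"
proof -
  note c = \<tau>_closed[OF one_closed assms(1)]
  have "carrier T \<subseteq> {t \<in> carrier T. \<tau> \<one> c \<otimes>\<^bsub>T\<^esub> t = t \<otimes>\<^bsub>T\<^esub> \<tau> \<one> c}"
  proof (rule \<tau>_span)
    show "additive_subgroup {t \<in> carrier T. \<tau> \<one> c \<otimes>\<^bsub>T\<^esub> t = t \<otimes>\<^bsub>T\<^esub> \<tau> \<one> c} T"
      by (rule T.additive_subgroup_diffI) (use c in \<open>auto simp: T.r_distr_minus T.l_distr_minus\<close>)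
  qed (use assms(1) in \<open>auto simp: \<tau>_closed \<tau>_mult C.m_comm\<close>)
  then show ?thesis using assms(2) by blast
qed

text \<open>Modulo a left ideal containing this element, the class of one is an eigenvector of
  \<open>x\<close> with eigenvalue \<open>c\<close>.\<close>

definition gap :: "'a \<Rightarrow> 'c \<Rightarrow> 't" where
  "gap x c = \<tau> x \<one>\<^bsub>C\<^esub> \<ominus>\<^bsub>T\<^esub> \<tau> \<one> c"

lemma gap_closed: "x \<in> carrier R \<Longrightarrow> c \<in> carrier C \<Longrightarrow> gap x c \<in> carrier T"
  by (simp add: gap_def \<tau>_closed)

definition gap_ideal :: "('a \<times> 'c) set \<Rightarrow> 't set" where
  "gap_ideal Z = \<Inter>{I. left_ideal T I \<and> (\<forall>(x, c)\<in>Z. gap x c \<in> I)}"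

lemma gap_ideal_least: "left_ideal T I \<Longrightarrow> (\<And>x c. (x, c) \<in> Z \<Longrightarrow> gap x c \<in> I) \<Longrightarrow> gap_ideal Z \<subseteq> I"
  unfolding gap_ideal_def by (rule Inter_lower) auto

lemma gap_ideal_gap: "(x, c) \<in> Z \<Longrightarrow> gap x c \<in> gap_ideal Z"
  unfolding gap_ideal_def by auto

lemma left_ideal_carrier: "left_ideal T (carrier T)"
  by (rule T.left_idealI) auto

lemma gap_ideal_left_ideal:
  assumes "Z \<subseteq> carrier R \<times> carrier C"
  shows "left_ideal T (gap_ideal Z)"
proof (rule T.left_idealI)
  show "gap_ideal Z \<subseteq> carrier T" by (rule gap_ideal_least[OF left_ideal_carrier]) (use assms in \<open>auto simp: gap_closed\<close>)
qed (auto simp: gap_ideal_def T.left_idealD)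

lemma gap_ideal_mono: "Z \<subseteq> Z' \<Longrightarrow> gap_ideal Z \<subseteq> gap_ideal Z'"
  unfolding gap_ideal_def by (rule Inter_anti_mono) auto

lemma gap_ideal_rmult_scalar:
  assumes "Z \<subseteq> carrier R \<times> carrier C" "u \<in> gap_ideal Z" "c \<in> carrier C"
  shows "u \<otimes>\<^bsub>T\<^esub> \<tau> \<one> c \<in> gap_ideal Z"
proof -
  have "u \<in> carrier T" using T.left_idealD(2)[OF gap_ideal_left_ideal[OF assms(1)]] assms(2) by blast
  moreover have "\<tau> \<one> c \<otimes>\<^bsub>T\<^esub> u \<in> gap_ideal Z"
    by (rule T.left_idealD(7)[OF gap_ideal_left_ideal[OF assms(1)] _ assms(2)]) (simp add: \<tau>_closed assms(3))
  ultimately show ?thesis using \<tau>_central[OF assms(3)] by simp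
qed

lemma gap_ideal_L:
  assumes "L \<times> {\<zero>\<^bsub>C\<^esub>} \<subseteq> Z" "l \<in> L"
  shows "\<tau> l \<one>\<^bsub>C\<^esub> \<in> gap_ideal Z"
  using gap_ideal_gap[of l "\<zero>\<^bsub>C\<^esub>" Z] assms by (auto simp: gap_def \<tau>_zero_right T.minus_zero_right \<tau>_closed)

text \<open>For \<open>y\<close>, \<open>d\<close> in \<open>Z\<close>, moving \<open>x\<close> to
  the left of \<open>gap y d\<close> leaves the commutator of \<open>y\<close> and \<open>x\<close>
  as error term. The commutator lies in \<open>L\<close>, and \<open>L\<close> is part of the gap
  ideal.\<close>

lemma gap_ideal_rmult:
  assumes Z: "Z \<subseteq> carrier R \<times> carrier C" "L \<times> {\<zero>\<^bsub>C\<^esub>} \<subseteq> Z"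
    and x: "x \<in> carrier R" "\<And>y d. (y, d) \<in> Z \<Longrightarrow> cg (y \<otimes> x) (x \<otimes> y)"
    and u: "u \<in> gap_ideal Z"
  shows "u \<otimes>\<^bsub>T\<^esub> \<tau> x \<one>\<^bsub>C\<^esub> \<in> gap_ideal Z"
proof -
  let ?x = "\<tau> x \<one>\<^bsub>C\<^esub>"
  note UD = T.left_idealD[OF gap_ideal_left_ideal[OF Z(1)]]
  have xT: "?x \<in> carrier T" using x(1) by (simp add: \<tau>_closed)
  have "gap_ideal Z \<subseteq> {t \<in> carrier T. t \<otimes>\<^bsub>T\<^esub> ?x \<in> gap_ideal Z}"
  proof (rule gap_ideal_least)
    show "left_ideal T {t \<in> carrier T. t \<otimes>\<^bsub>T\<^esub> ?x \<in> gap_ideal Z}"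
      by (rule T.left_idealI) (use xT UD in \<open>auto simp: T.l_distr_minus T.m_assoc\<close>)
  next
    fix y d assume yd: "(y, d) \<in> Z"
    then have y: "y \<in> carrier R" and d: "d \<in> carrier C" using Z(1) by auto
    have "gap y d \<otimes>\<^bsub>T\<^esub> ?x = \<tau> (y \<otimes> x) \<one>\<^bsub>C\<^esub> \<ominus>\<^bsub>T\<^esub> \<tau> x d"
      using x y d by (simp add: gap_def T.l_distr_minus \<tau>_closed \<tau>_mult)
    also have "\<tau> (y \<otimes> x) \<one>\<^bsub>C\<^esub> = \<tau> (y \<otimes> x \<ominus> x \<otimes> y) \<one>\<^bsub>C\<^esub> \<oplus>\<^bsub>T\<^esub> \<tau> (x \<otimes> y) \<one>\<^bsub>C\<^esub>"
      using x y by (simp add: \<tau>_add_left[symmetric] minus_add_cancel)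
    also have "(\<dots> \<ominus>\<^bsub>T\<^esub> \<tau> x d) = \<tau> (y \<otimes> x \<ominus> x \<otimes> y) \<one>\<^bsub>C\<^esub> \<oplus>\<^bsub>T\<^esub> ?x \<otimes>\<^bsub>T\<^esub> gap y d"
    proof -
      have "?x \<otimes>\<^bsub>T\<^esub> gap y d = \<tau> (x \<otimes> y) \<one>\<^bsub>C\<^esub> \<ominus>\<^bsub>T\<^esub> \<tau> x d"
        using x y d by (simp add: gap_def T.r_distr_minus \<tau>_closed \<tau>_mult)
      then show ?thesis using x y d by (simp add: \<tau>_closed a_minus_def T.a_assoc)
    qed
    finally have "gap y d \<otimes>\<^bsub>T\<^esub> ?x = \<tau> (y \<otimes> x \<ominus> x \<otimes> y) \<one>\<^bsub>C\<^esub> \<oplus>\<^bsub>T\<^esub> ?x \<otimes>\<^bsub>T\<^esub> gap y d" .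
    moreover have "\<tau> (y \<otimes> x \<ominus> x \<otimes> y) \<one>\<^bsub>C\<^esub> \<in> gap_ideal Z" by (rule gap_ideal_L[OF Z(2) cgD(3)[OF x(2)[OF yd]]])
    ultimately show "gap y d \<in> {t \<in> carrier T. t \<otimes>\<^bsub>T\<^esub> ?x \<in> gap_ideal Z}"
      using UD(4,7) gap_ideal_gap[OF yd] xT gap_closed[OF y d] by simp
  qed
  then show ?thesis using u by blast
qed

text \<open>The graph of a homomorphism from a finite-dimensional subalgebra of the idealizer to \<open>C\<close>
  with kernel \<open>L\<close>.\<close>

definition partial_character :: "('a \<times> 'c) set \<Rightarrow> bool" where
  "partial_character Z \<longleftrightarrow> Z \<subseteq> carrier R \<times> carrier C \<and>
     (\<forall>x c y d. (x, c) \<in> Z \<and> (y, d) \<in> Z \<longrightarrow>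
        (x \<ominus> y, c \<ominus>\<^bsub>C\<^esub> d) \<in> Z \<and> (x \<otimes> y, c \<otimes>\<^bsub>C\<^esub> d) \<in> Z) \<and>
     (\<forall>x c. (x, c) \<in> Z \<longrightarrow> (x \<in> L \<longleftrightarrow> c = \<zero>\<^bsub>C\<^esub>)) \<and>
     L \<times> {\<zero>\<^bsub>C\<^esub>} \<subseteq> Z \<and> (\<forall>z\<in>F. (z, \<zeta> z) \<in> Z) \<and> fin_mod (Domain Z) L"

section \<open>The field of residues on which a character is defined\<close>

context
  fixes Z
  assumes partial_character: "partial_character Z"
begin

lemma Z_carrier: "Z \<subseteq> carrier R \<times> carrier C" "(x, c) \<in> Z \<Longrightarrow> x \<in> carrier R" "(x, c) \<in> Z \<Longrightarrow> c \<in> carrier C"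
  using partial_character unfolding partial_character_def by blast+

lemma Z_diff: "(x, c) \<in> Z \<Longrightarrow> (y, d) \<in> Z \<Longrightarrow> (x \<ominus> y, c \<ominus>\<^bsub>C\<^esub> d) \<in> Z"
  and Z_mult: "(x, c) \<in> Z \<Longrightarrow> (y, d) \<in> Z \<Longrightarrow> (x \<otimes> y, c \<otimes>\<^bsub>C\<^esub> d) \<in> Z"
  and Z_kernel: "(x, c) \<in> Z \<Longrightarrow> x \<in> L \<longleftrightarrow> c = \<zero>\<^bsub>C\<^esub>"
  and Z_L: "L \<times> {\<zero>\<^bsub>C\<^esub>} \<subseteq> Z" "l \<in> L \<Longrightarrow> (l, \<zero>\<^bsub>C\<^esub>) \<in> Z"
  and Z_F: "z \<in> F \<Longrightarrow> (z, \<zeta> z) \<in> Z"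
  and Z_fin: "fin_mod (Domain Z) L"
  using partial_character unfolding partial_character_def by blast+

lemma Z_one: "(\<one>, \<one>\<^bsub>C\<^esub>) \<in> Z"
  using Z_F[OF F_one] by (simp add: \<zeta>_one)

lemma Z_zero: "(\<zero>, \<zero>\<^bsub>C\<^esub>) \<in> Z"
  using Z_L(2)[OF LD(3)] .

lemma Z_add:
  assumes "(x, c) \<in> Z" "(y, d) \<in> Z"
  shows "(x \<oplus> y, c \<oplus>\<^bsub>C\<^esub> d) \<in> Z"
  using Z_diff[OF assms(1) Z_diff[OF Z_zero assms(2)]] Z_carrier(2,3)[OF assms(1)] Z_carrier(2,3)[OF assms(2)]
  by (simp add: a_minus_def)

lemma Z_idealizer:
  assumes "(x, c) \<in> Z"
  shows "x \<in> idealizer"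
proof -
  have "l \<otimes> x \<in> L" if "l \<in> L" for l
    using Z_kernel[OF Z_mult[OF Z_L(2)[OF that] assms]] Z_carrier(3)[OF assms] by simp
  then show ?thesis using Z_carrier(2)[OF assms] by (simp add: idealizer_def)
qed

lemma Z_commute:
  assumes "(x, c) \<in> Z" "(y, d) \<in> Z"
  shows "cg (x \<otimes> y) (y \<otimes> x)"
proof -
  have "(x \<otimes> y \<ominus> y \<otimes> x, c \<otimes>\<^bsub>C\<^esub> d \<ominus>\<^bsub>C\<^esub> d \<otimes>\<^bsub>C\<^esub> c) \<in> Z"
    by (intro Z_diff Z_mult assms)
  moreover have "c \<otimes>\<^bsub>C\<^esub> d \<ominus>\<^bsub>C\<^esub> d \<otimes>\<^bsub>C\<^esub> c = \<zero>\<^bsub>C\<^esub>"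
    using Z_carrier(3)[OF assms(1)] Z_carrier(3)[OF assms(2)] by (simp add: C.m_comm C.minus_self)
  ultimately have "x \<otimes> y \<ominus> y \<otimes> x \<in> L" using Z_kernel by blast
  then show ?thesis using Z_carrier(2)[OF assms(1)] Z_carrier(2)[OF assms(2)] by (simp add: cg_def)
qed

lemma Domain_Z:
  "Domain Z \<subseteq> idealizer" "\<one> \<in> Domain Z" "\<And>x y. x \<in> Domain Z \<Longrightarrow> y \<in> Domain Z \<Longrightarrow> x \<ominus> y \<in> Domain Z"
  "\<And>x y. x \<in> Domain Z \<Longrightarrow> y \<in> Domain Z \<Longrightarrow> x \<otimes> y \<in> Domain Z"
  "\<And>x y. x \<in> Domain Z \<Longrightarrow> y \<in> Domain Z \<Longrightarrow> cg (x \<otimes> y) (y \<otimes> x)"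
  "L \<subseteq> Domain Z" "F \<subseteq> Domain Z"
proof -
  show "Domain Z \<subseteq> idealizer" using Z_idealizer by blast
  show "\<one> \<in> Domain Z" using Z_one by blast
  show "L \<subseteq> Domain Z" using Z_L(2) by blast
  show "F \<subseteq> Domain Z" using Z_F by blast
  fix x y assume "x \<in> Domain Z" "y \<in> Domain Z"
  then obtain c d where xy: "(x, c) \<in> Z" "(y, d) \<in> Z" by blast
  show "x \<ominus> y \<in> Domain Z" using Z_diff[OF xy] by blast
  show "x \<otimes> y \<in> Domain Z" using Z_mult[OF xy] by blast
  show "cg (x \<otimes> y) (y \<otimes> x)" using Z_commute[OF xy] .
qed

text \<open>The inverse \<open>e\<close> of \<open>x\<close> in the idealizer satisfies a monic
  relation of some degree \<open>n\<close>. Multiplied by \<open>x^(n-1)\<close>, the relation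
  expresses \<open>e\<close> modulo \<open>L\<close> as a polynomial in \<open>x\<close>, so
  \<open>e\<close> lies in the domain.\<close>

lemma Z_inverse:
  assumes x: "x \<in> Domain Z" "x \<notin> L"
  obtains e where "e \<in> Domain Z" "cg (x \<otimes> e) \<one>"
proof -
  have xS: "x \<in> idealizer" using x(1) Domain_Z(1) by blast
  note xc = idealizerD(1)[OF xS]
  obtain e where e: "e \<in> idealizer" "cg (e \<otimes> x) \<one>" "cg (x \<otimes> e) \<one>" using idealizer_inverse[OF xS x(2)] .
  note ec = idealizerD(1)[OF e(1)]
  obtain n where n: "e [^] (n::nat) \<in> powers F e n" using algebraic[OF e(1)] by blast
  have xpow: "x [^] (j::nat) \<in> Domain Z" for j
    by (induction j) (use Domain_Z(2,4) x(1) in auto)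
  have cancel: "i \<le> j \<Longrightarrow> cg (e [^] (i::nat) \<otimes> x [^] (j::nat)) (x [^] (j - i))" for i j
  proof (induction i arbitrary: j)
    case 0
    then show ?case using xc by (simp add: cg_refl)
  next
    case (Suc i)
    then obtain m where m: "j = Suc m" by (cases j) auto
    have "x [^] Suc m = x \<otimes> x [^] m" using xc by (rule nat_pow_Suc2)
    then have "e [^] Suc i \<otimes> x [^] j = e [^] i \<otimes> ((e \<otimes> x) \<otimes> x [^] m)"
      unfolding m using xc ec by (simp add: m_assoc del: nat_pow_Suc)
    moreover have "cg (e [^] i \<otimes> ((e \<otimes> x) \<otimes> x [^] m)) (e [^] i \<otimes> (\<one> \<otimes> x [^] m))"
      using ec by (intro cg_lmult cg_rmult[OF e(2)] idealizer_pow xS) auto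
    moreover have "cg (e [^] i \<otimes> (\<one> \<otimes> x [^] m)) (x [^] (m - i))"
      using Suc.IH[of m] Suc.prems m xc by simp
    ultimately show ?case using cg_trans m by simp
  qed
  have DL: "y \<in> Domain Z" if "cg y z" "z \<in> Domain Z" for y z
  proof -
    have "y \<ominus> z \<in> Domain Z" using cgD(3)[OF that(1)] Domain_Z(6) by blast
    then have "(y \<ominus> z) \<ominus> (\<zero> \<ominus> z) \<in> Domain Z" using Domain_Z(3) that(2) Z_zero by blast
    then show ?thesis using cgD(1,2)[OF that(1)] by (simp add: a_minus_def a_assoc l_neg)
  qed
  \<comment> \<open>The bound \<open>m \<le> Suc j\<close> keeps the exponents of \<open>e\<close>
    in \<open>y\<close> at most \<open>j\<close>, so that \<open>x [^] j\<close> cancels every power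
    of \<open>e\<close> that occurs.\<close>
  have "y \<otimes> x [^] j \<in> Domain Z" if "y \<in> powers F e m" "m \<le> Suc j" for y m j
    using that
  proof (induction m arbitrary: y)
    case 0
    then have "y \<otimes> x [^] j \<in> L" using idealizerD(2)[OF idealizer_pow[OF xS]] by simp
    then show ?case using Domain_Z(6) by blast
  next
    case (Suc m)
    then obtain p c where pc: "y = p \<oplus> c \<otimes> e [^] m" "p \<in> powers F e m" "c \<in> F" by auto
    have p: "p \<in> carrier R" using powers_carrier[OF idealizer_F F_one F_diff F_mult e(1) pc(2)] .
    have "p \<otimes> x [^] j \<in> Domain Z" using Suc pc by simp
    moreover have "e [^] m \<otimes> x [^] j \<in> Domain Z" using cancel[of m j] Suc.prems DL xpow by simp
    then have "c \<otimes> (e [^] m \<otimes> x [^] j) \<in> Domain Z" using Domain_Z(4,7) pc(3) by blast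
    moreover have "y \<otimes> x [^] j = p \<otimes> x [^] j \<oplus> c \<otimes> (e [^] m \<otimes> x [^] j)"
      using pc p ec xc by (simp add: l_distr m_assoc)
    ultimately show ?case using Z_add by (metis Domain_iff)
  qed
  moreover have "n \<noteq> 0"
  proof
    assume "n = 0"
    then show False using n one_notin_L by simp
  qed
  then obtain m where m: "n = Suc m" by (cases n) auto
  ultimately have "e [^] n \<otimes> x [^] m \<in> Domain Z" using n by blast
  moreover have "cg (e [^] n \<otimes> x [^] m) e"
  proof -
    have "e [^] n \<otimes> x [^] m = e \<otimes> (e [^] m \<otimes> x [^] m)"
      unfolding m nat_pow_Suc2[OF ec] using ec xc by (simp add: m_assoc)
    moreover have "cg (e \<otimes> (e [^] m \<otimes> x [^] m)) (e \<otimes> x [^] (m - m))" by (intro cg_lmult cancel ec) simp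
    ultimately show ?thesis using ec by simp
  qed
  ultimately have "e \<in> Domain Z" using DL cg_sym by blast
  then show ?thesis using that e(3) by blast
qed

text \<open>The domain modulo \<open>L\<close> is a field, and \<open>R / W\<close> is a right
  vector space over it in which \<open>a\<close> is nonzero. Take the coordinate along
  \<open>a\<close> with respect to a complementary hyperplane and apply the character to it.\<close>

lemma Z_functional:
  assumes W: "additive_subgroup W R" "L \<subseteq> W" "\<And>w x. w \<in> W \<Longrightarrow> x \<in> Domain Z \<Longrightarrow> w \<otimes> x \<in> W"
    and a: "a \<in> carrier R" "a \<notin> W"
  shows "\<exists>g. g \<in> carrier R \<rightarrow> carrier C \<and>
    (\<forall>x\<in>carrier R. \<forall>y\<in>carrier R. g (x \<oplus> y) = g x \<oplus>\<^bsub>C\<^esub> g y) \<and>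
    (\<forall>r\<in>carrier R. \<forall>(x, c)\<in>Z. g (r \<otimes> x) = g r \<otimes>\<^bsub>C\<^esub> c) \<and>
    (\<forall>w\<in>W. g w = \<zero>\<^bsub>C\<^esub>) \<and> g a = \<one>\<^bsub>C\<^esub>"
proof -
  define \<M> where "\<M> = {M. M \<subseteq> carrier R \<and> (\<forall>x\<in>M. \<forall>y\<in>M. x \<ominus> y \<in> M) \<and>
    (\<forall>w\<in>M. \<forall>x\<in>Domain Z. w \<otimes> x \<in> M) \<and> W \<subseteq> M \<and> a \<notin> M}"
  have \<M>I: "N \<in> \<M>" if "N \<subseteq> carrier R" "\<And>x y. x \<in> N \<Longrightarrow> y \<in> N \<Longrightarrow> x \<ominus> y \<in> N"
    "\<And>w x. w \<in> N \<Longrightarrow> x \<in> Domain Z \<Longrightarrow> w \<otimes> x \<in> N" "W \<subseteq> N" "a \<notin> N" for N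
    unfolding \<M>_def using that by simp
  have W0: "\<zero> \<in> W" "W \<subseteq> carrier R"
    using W(1) additive_subgroup.zero_closed additive_subgroup.a_subset by blast+
  have "\<exists>M\<in>\<M>. \<forall>N\<in>\<M>. M \<subseteq> N \<longrightarrow> N = M"
  proof (rule subset_Zorn_nonempty)
    have "W \<in> \<M>" using W a additive_subgroup_diff[OF W(1)] W0 by (auto simp: \<M>_def)
    then show "\<M> \<noteq> {}" by blast
  next
    fix \<C> assume C: "\<C> \<noteq> {}" "subset.chain \<M> \<C>"
    then have CM: "\<C> \<subseteq> \<M>" and tot: "\<And>A B. A \<in> \<C> \<Longrightarrow> B \<in> \<C> \<Longrightarrow> A \<subseteq> B \<or> B \<subseteq> A"
      by (auto simp: subset.chain_def)
    have "x \<ominus> y \<in> \<Union>\<C>" if xy: "x \<in> \<Union>\<C>" "y \<in> \<Union>\<C>" for x y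
    proof -
      obtain A B where AB: "A \<in> \<C>" "B \<in> \<C>" "x \<in> A" "y \<in> B" using xy by blast
      then obtain E where "E \<in> \<C>" "x \<in> E" "y \<in> E" using tot[of A B] by blast
      then show ?thesis using CM unfolding \<M>_def by blast
    qed
    moreover have "w \<otimes> x \<in> \<Union>\<C>" if "w \<in> \<Union>\<C>" "x \<in> Domain Z" for w x
      using that CM unfolding \<M>_def by blast
    moreover have "\<Union>\<C> \<subseteq> carrier R" "W \<subseteq> \<Union>\<C>" "a \<notin> \<Union>\<C>"
      using CM C(1) unfolding \<M>_def by blast+
    ultimately show "\<Union>\<C> \<in> \<M>" using \<M>I[of "\<Union>\<C>"] by presburger
  qed
  then obtain M where M: "M \<in> \<M>" and Mmax: "\<And>N. N \<in> \<M> \<Longrightarrow> M \<subseteq> N \<Longrightarrow> N = M" by blast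
  have MD: "M \<subseteq> carrier R" "\<And>x y. x \<in> M \<Longrightarrow> y \<in> M \<Longrightarrow> x \<ominus> y \<in> M"
    "\<And>w x. w \<in> M \<Longrightarrow> x \<in> Domain Z \<Longrightarrow> w \<otimes> x \<in> M" "W \<subseteq> M" "a \<notin> M"
    using M unfolding \<M>_def by blast+
  have M0: "\<zero> \<in> M" and LM: "L \<subseteq> M" using MD(4) W0 W(2) by auto
  have Msub: "additive_subgroup M R" by (rule additive_subgroup_diffI[OF MD(1) M0 MD(2)])
  have Madd: "\<And>x y. x \<in> M \<Longrightarrow> y \<in> M \<Longrightarrow> x \<oplus> y \<in> M" using additive_subgroup.a_closed[OF Msub] .
  have Mc: "x \<in> carrier R" if "x \<in> M" for x using that MD(1) by blast
  \<comment> \<open>\<open>M\<close> is a hyperplane complementary to the line through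
    \<open>a\<close>: if \<open>r \<notin> M\<close>, maximality puts \<open>a\<close> into the sum
    of \<open>M\<close> and the line through \<open>r\<close>, and solving for \<open>r\<close> uses
    an inverse in the domain.\<close>
  have ex: "\<exists>x\<in>Domain Z. r \<ominus> a \<otimes> x \<in> M" if r: "r \<in> carrier R" for r
  proof (cases "r \<in> M")
    case True
    then show ?thesis using Z_zero a r by (intro bexI[of _ \<zero>]) (auto simp: minus_zero_right)
  next
    case False
    let ?N = "{r \<otimes> x \<oplus> m | x m. x \<in> Domain Z \<and> m \<in> M}"
    have Dc: "x \<in> carrier R" if "x \<in> Domain Z" for x using that Z_carrier(2) by blast
    have "r \<otimes> \<zero> \<oplus> m \<in> ?N" if "m \<in> M" for m using that Z_zero by blast
    then have MN: "M \<subseteq> ?N" using r Mc by auto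
    have "r \<otimes> \<one> \<oplus> \<zero> \<in> ?N" using Domain_Z(2) M0 by blast
    then have rN: "r \<in> ?N" using r by simp
    have "a \<in> ?N"
    proof (rule ccontr)
      assume aN: "a \<notin> ?N"
      have "?N \<in> \<M>"
      proof (rule \<M>I)
        show "?N \<subseteq> carrier R" using r Dc Mc by auto
        show "W \<subseteq> ?N" using MD(4) MN by blast
        show "a \<notin> ?N" by (rule aN)
      next
        fix x y assume "x \<in> ?N" "y \<in> ?N"
        then obtain u m v n where *: "x = r \<otimes> u \<oplus> m" "y = r \<otimes> v \<oplus> n" "u \<in> Domain Z" "v \<in> Domain Z" "m \<in> M" "n \<in> M"
          by blast
        then have "x \<ominus> y = r \<otimes> (u \<ominus> v) \<oplus> (m \<ominus> n)"
          using r Dc Mc by (simp add: diff_add_add r_distr_minus)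
        then show "x \<ominus> y \<in> ?N" using Domain_Z(3)[OF *(3,4)] MD(2)[OF *(5,6)] by blast
      next
        fix w x assume "w \<in> ?N" "x \<in> Domain Z"
        from \<open>w \<in> ?N\<close> obtain u m where *: "w = r \<otimes> u \<oplus> m" "u \<in> Domain Z" "m \<in> M" by blast
        then have "w \<otimes> x = r \<otimes> (u \<otimes> x) \<oplus> m \<otimes> x"
          using r Dc Mc \<open>x \<in> Domain Z\<close> by (simp add: l_distr m_assoc)
        then show "w \<otimes> x \<in> ?N" using Domain_Z(4)[OF *(2)] MD(3)[OF *(3)] \<open>x \<in> Domain Z\<close> by blast
      qed
      then show False using Mmax[OF _ MN] rN False by blast
    qed
    then obtain x m where xm: "a = r \<otimes> x \<oplus> m" "x \<in> Domain Z" "m \<in> M" by blast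
    have "x \<notin> L" using xm(1) Madd[OF subsetD[OF LM LD(7)[OF r, of x]] xm(3)] MD(5) by auto
    then obtain e where e: "e \<in> Domain Z" "cg (x \<otimes> e) \<one>" using Z_inverse[OF xm(2)] by metis
    let ?l = "\<one> \<ominus> x \<otimes> e"
    have l: "?l \<in> L" using cg_sym[OF e(2)] by (simp add: cg_def)
    have cl: "x \<in> carrier R" "m \<in> carrier R" "e \<in> carrier R" using xm e Dc Mc by auto
    have "r \<ominus> a \<otimes> e = r \<otimes> ?l \<ominus> m \<otimes> e"
    proof -
      have "a \<otimes> e = r \<otimes> (x \<otimes> e) \<oplus> m \<otimes> e" unfolding xm(1) using cl r by (simp add: l_distr m_assoc)
      then show ?thesis using cl r by (simp add: r_distr_minus) (simp add: a_minus_def minus_add a_assoc)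
    qed
    moreover have "r \<otimes> ?l \<in> M" using LD(7)[OF r l] LM by blast
    ultimately show ?thesis using MD(2,3) xm(3) e(1) by (intro bexI[OF _ e(1)]) simp
  qed
  have zero: "x \<in> L" if x: "x \<in> Domain Z" "a \<otimes> x \<in> M" for x
  proof (rule ccontr)
    assume "x \<notin> L"
    then obtain e where e: "e \<in> Domain Z" "cg (x \<otimes> e) \<one>" using Z_inverse[OF x(1)] by metis
    have cl: "x \<in> carrier R" "e \<in> carrier R" using x e Z_carrier(2) by auto
    have "cg (a \<otimes> (x \<otimes> e)) (a \<otimes> \<one>)" by (rule cg_lmult[OF e(2) a(1)])
    then have "a \<otimes> (x \<otimes> e) \<ominus> a \<in> M" using a LM by (auto simp: cg_def)
    moreover have "a \<otimes> (x \<otimes> e) \<in> M" using MD(3)[OF x(2) e(1)] a cl by (simp add: m_assoc)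
    ultimately have "a \<otimes> (x \<otimes> e) \<ominus> (a \<otimes> (x \<otimes> e) \<ominus> a) \<in> M" using MD(2) by blast
    moreover have "a \<otimes> (x \<otimes> e) \<ominus> (a \<otimes> (x \<otimes> e) \<ominus> a) = a"
      using a cl minus_add_cancel[of "a \<otimes> (x \<otimes> e)" a] add_minus_cancel[of a "a \<otimes> (x \<otimes> e) \<ominus> a"]
      by (simp add: a_comm)
    ultimately show False using MD(5) by simp
  qed
  have uniq: "c = d" if "(x, c) \<in> Z" "(y, d) \<in> Z" "r \<ominus> a \<otimes> x \<in> M" "r \<ominus> a \<otimes> y \<in> M" "r \<in> carrier R" for x y c d r
  proof -
    note cl = Z_carrier(2,3)[OF that(1)] Z_carrier(2,3)[OF that(2)]
    have "(r \<ominus> a \<otimes> y) \<ominus> (r \<ominus> a \<otimes> x) = a \<otimes> (x \<ominus> y)"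
    proof -
      have "(r \<ominus> a \<otimes> y) \<ominus> (r \<ominus> a \<otimes> x) = (a \<otimes> x \<ominus> r) \<oplus> (r \<ominus> a \<otimes> y)"
        using a cl that(5) by (simp add: a_minus_def minus_add a_comm)
      then show ?thesis using a cl that(5) by (simp add: diff_trans r_distr_minus)
    qed
    then have "a \<otimes> (x \<ominus> y) \<in> M" using MD(2)[OF that(4,3)] by simp
    moreover have xy: "(x \<ominus> y, c \<ominus>\<^bsub>C\<^esub> d) \<in> Z" by (rule Z_diff[OF that(1,2)])
    ultimately have "x \<ominus> y \<in> L" using zero by blast
    then have "c \<ominus>\<^bsub>C\<^esub> d = \<zero>\<^bsub>C\<^esub>" using Z_kernel[OF xy] by simp
    then show ?thesis using C.minus_add_cancel[of c d] cl by simp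
  qed
  \<comment> \<open>The value of the character at the coordinate of \<open>r\<close> along
    \<open>a\<close>; by \<open>uniq\<close> it does not depend on the chosen coordinate.\<close>
  define g where "g r = (SOME c. \<exists>x. (x, c) \<in> Z \<and> r \<ominus> a \<otimes> x \<in> M)" for r
  have gex: "\<exists>x. (x, g r) \<in> Z \<and> r \<ominus> a \<otimes> x \<in> M" if "r \<in> carrier R" for r
  proof -
    have "\<exists>c x. (x, c) \<in> Z \<and> r \<ominus> a \<otimes> x \<in> M" using ex[OF that] by blast
    then show ?thesis unfolding g_def by (rule someI_ex)
  qed
  have geq: "g r = c" if "(x, c) \<in> Z" "r \<ominus> a \<otimes> x \<in> M" "r \<in> carrier R" for r x c
    using gex[OF that(3)] uniq[OF _ that(1) _ that(2,3)] by blast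
  have "g \<in> carrier R \<rightarrow> carrier C" using gex Z_carrier(3) by blast
  moreover have "g (r \<oplus> s) = g r \<oplus>\<^bsub>C\<^esub> g s" if rs: "r \<in> carrier R" "s \<in> carrier R" for r s
  proof -
    obtain x where x: "(x, g r) \<in> Z" "r \<ominus> a \<otimes> x \<in> M" using gex[OF rs(1)] by blast
    obtain y where y: "(y, g s) \<in> Z" "s \<ominus> a \<otimes> y \<in> M" using gex[OF rs(2)] by blast
    have "(r \<oplus> s) \<ominus> a \<otimes> (x \<oplus> y) = (r \<ominus> a \<otimes> x) \<oplus> (s \<ominus> a \<otimes> y)"
      using rs a Z_carrier(2)[OF x(1)] Z_carrier(2)[OF y(1)] by (simp add: r_distr diff_add_add)
    then show ?thesis using geq[OF Z_add[OF x(1) y(1)]] Madd[OF x(2) y(2)] rs by simp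
  qed
  moreover have "g (r \<otimes> y) = g r \<otimes>\<^bsub>C\<^esub> d" if r: "r \<in> carrier R" "(y, d) \<in> Z" for r y d
  proof -
    obtain x where x: "(x, g r) \<in> Z" "r \<ominus> a \<otimes> x \<in> M" using gex[OF r(1)] by blast
    have "r \<otimes> y \<ominus> a \<otimes> (x \<otimes> y) = (r \<ominus> a \<otimes> x) \<otimes> y"
      using r a Z_carrier(2)[OF x(1)] Z_carrier(2)[OF r(2)] by (simp add: l_distr_minus m_assoc)
    moreover have "y \<in> Domain Z" using r(2) by blast
    ultimately show ?thesis
      using r(1) Z_carrier(2)[OF r(2)] MD(3)[OF x(2)] by (intro geq[OF Z_mult[OF x(1) r(2)]]) auto
  qed
  moreover have "g w = \<zero>\<^bsub>C\<^esub>" if "w \<in> W" for w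
    using that MD(4) Mc a by (intro geq[OF Z_zero]) (auto simp: minus_zero_right)
  moreover have "g a = \<one>\<^bsub>C\<^esub>" using a M0 by (intro geq[OF Z_one]) (auto simp: minus_self)
  ultimately show ?thesis by blast
qed

text \<open>A functional that is compatible with the character extends to the tensor product and
  vanishes on all left multiples of the gaps. As it is \<open>1\<close> at \<open>a\<close> and
  \<open>0\<close> at \<open>w\<close>, it does not vanish on the given element.\<close>

lemma Z_separate:
  assumes W: "additive_subgroup W R" "L \<subseteq> W" "\<And>w x. w \<in> W \<Longrightarrow> x \<in> Domain Z \<Longrightarrow> w \<otimes> x \<in> W"
    and a: "a \<in> carrier R" "a \<notin> W"
    and w: "w \<in> W" and c: "c \<in> carrier C"
  shows "\<tau> a \<one>\<^bsub>C\<^esub> \<ominus>\<^bsub>T\<^esub> \<tau> w c \<notin> gap_ideal Z"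
proof
  assume inU: "\<tau> a \<one>\<^bsub>C\<^esub> \<ominus>\<^bsub>T\<^esub> \<tau> w c \<in> gap_ideal Z"
  obtain g where g: "g \<in> carrier R \<rightarrow> carrier C"
    "\<And>x y. x \<in> carrier R \<Longrightarrow> y \<in> carrier R \<Longrightarrow> g (x \<oplus> y) = g x \<oplus>\<^bsub>C\<^esub> g y"
    "\<And>r x c. r \<in> carrier R \<Longrightarrow> (x, c) \<in> Z \<Longrightarrow> g (r \<otimes> x) = g r \<otimes>\<^bsub>C\<^esub> c"
    "\<And>w. w \<in> W \<Longrightarrow> g w = \<zero>\<^bsub>C\<^esub>" "g a = \<one>\<^bsub>C\<^esub>"
    using Z_functional[OF W a] by blast
  have gc: "g x \<in> carrier C" if "x \<in> carrier R" for x using g(1) that by blast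
  have "g (z \<otimes> x) = \<zeta> z \<otimes>\<^bsub>C\<^esub> g x" if "z \<in> F" "x \<in> carrier R" for z x
    using g(3)[OF that(2) Z_F[OF that(1)]] F_central[OF that] gc[OF that(2)] \<zeta>_closed[OF that(1)]
    by (simp add: C.m_comm)
  from \<tau>_functional[OF g(1,2) this] obtain \<Gamma> where \<Gamma>: "\<Gamma> \<in> carrier T \<rightarrow> carrier C"
    "\<And>x y. x \<in> carrier T \<Longrightarrow> y \<in> carrier T \<Longrightarrow> \<Gamma> (x \<oplus>\<^bsub>T\<^esub> y) = \<Gamma> x \<oplus>\<^bsub>C\<^esub> \<Gamma> y"
    "\<And>r c. r \<in> carrier R \<Longrightarrow> c \<in> carrier C \<Longrightarrow> \<Gamma> (\<tau> r c) = g r \<otimes>\<^bsub>C\<^esub> c" by blast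
  have \<Gamma>c: "\<Gamma> x \<in> carrier C" if "x \<in> carrier T" for x using \<Gamma>(1) that by blast
  have \<Gamma>_diff: "\<Gamma> (x \<ominus>\<^bsub>T\<^esub> y) = \<Gamma> x \<ominus>\<^bsub>C\<^esub> \<Gamma> y" if "x \<in> carrier T" "y \<in> carrier T" for x y
  proof -
    have "\<Gamma> x = \<Gamma> (x \<ominus>\<^bsub>T\<^esub> y) \<oplus>\<^bsub>C\<^esub> \<Gamma> y"
      using that \<Gamma>(2)[of "x \<ominus>\<^bsub>T\<^esub> y" y] by (simp add: T.minus_add_cancel)
    then show ?thesis using that \<Gamma>c by (simp add: C.add_minus_cancel)
  qed
  have \<Gamma>_zero: "\<Gamma> \<zero>\<^bsub>T\<^esub> = \<zero>\<^bsub>C\<^esub>"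
    using \<Gamma>_diff[of "\<zero>\<^bsub>T\<^esub>" "\<zero>\<^bsub>T\<^esub>"] \<Gamma>c[of "\<zero>\<^bsub>T\<^esub>"] by (simp add: T.minus_self C.minus_self)
  \<comment> \<open>The kernel of \<open>\<Gamma>\<close> need not be a left ideal;
    \<open>?I\<close> is the largest left ideal inside it.\<close>
  let ?I = "{t \<in> carrier T. \<forall>s\<in>carrier T. \<Gamma> (s \<otimes>\<^bsub>T\<^esub> t) = \<zero>\<^bsub>C\<^esub>}"
  have "gap_ideal Z \<subseteq> ?I"
  proof (rule gap_ideal_least)
    show "left_ideal T ?I"
      by (rule T.left_idealI) (auto simp: \<Gamma>_zero T.r_distr_minus \<Gamma>_diff C.minus_self T.m_assoc[symmetric])
  next
    fix x d assume xd: "(x, d) \<in> Z"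
    note cl = Z_carrier(2,3)[OF xd]
    note gap = gap_closed[OF cl]
    have "carrier T \<subseteq> {s \<in> carrier T. \<Gamma> (s \<otimes>\<^bsub>T\<^esub> gap x d) = \<zero>\<^bsub>C\<^esub>}"
    proof (rule \<tau>_span)
      show "additive_subgroup {s \<in> carrier T. \<Gamma> (s \<otimes>\<^bsub>T\<^esub> gap x d) = \<zero>\<^bsub>C\<^esub>} T"
        by (rule T.additive_subgroup_diffI) (use gap in \<open>auto simp: \<Gamma>_zero T.l_distr_minus \<Gamma>_diff C.minus_self\<close>)
    next
      fix r e assume re: "r \<in> carrier R" "e \<in> carrier C"
      have "\<tau> r e \<otimes>\<^bsub>T\<^esub> gap x d = \<tau> (r \<otimes> x) e \<ominus>\<^bsub>T\<^esub> \<tau> r (e \<otimes>\<^bsub>C\<^esub> d)"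
        using re cl by (simp add: gap_def T.r_distr_minus \<tau>_closed \<tau>_mult)
      then have "\<Gamma> (\<tau> r e \<otimes>\<^bsub>T\<^esub> gap x d) = (g r \<otimes>\<^bsub>C\<^esub> d) \<otimes>\<^bsub>C\<^esub> e \<ominus>\<^bsub>C\<^esub> g r \<otimes>\<^bsub>C\<^esub> (e \<otimes>\<^bsub>C\<^esub> d)"
        using re cl g(3)[OF re(1) xd] by (simp add: \<Gamma>_diff \<Gamma>(3) \<tau>_closed)
      also have "\<dots> = \<zero>\<^bsub>C\<^esub>" using re cl gc[OF re(1)] by (simp add: C.m_ac C.minus_self)
      finally show "\<tau> r e \<in> {s \<in> carrier T. \<Gamma> (s \<otimes>\<^bsub>T\<^esub> gap x d) = \<zero>\<^bsub>C\<^esub>}" using re by (simp add: \<tau>_closed)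
    qed
    then show "gap x d \<in> ?I" using gap by blast
  qed
  moreover have wc: "w \<in> carrier R" using w additive_subgroup.a_subset[OF W(1)] by blast
  ultimately have "\<Gamma> (\<one>\<^bsub>T\<^esub> \<otimes>\<^bsub>T\<^esub> (\<tau> a \<one>\<^bsub>C\<^esub> \<ominus>\<^bsub>T\<^esub> \<tau> w c)) = \<zero>\<^bsub>C\<^esub>" using inU by blast
  then have "g a \<otimes>\<^bsub>C\<^esub> \<one>\<^bsub>C\<^esub> \<ominus>\<^bsub>C\<^esub> g w \<otimes>\<^bsub>C\<^esub> c = \<zero>\<^bsub>C\<^esub>"
    using a wc c by (simp add: \<Gamma>_diff \<Gamma>(3) \<tau>_closed)
  then show False using g(4)[OF w] g(5) c C.zero_not_one by (simp add: C.minus_zero_right)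
qed

text \<open>Separation of \<open>\<one>\<close> from \<open>W = L\<close>, with
  \<open>w = \<zero>\<close>.\<close>

lemma one_notin_gap_ideal: "\<one>\<^bsub>T\<^esub> \<notin> gap_ideal Z"
proof -
  have "\<tau> \<one> \<one>\<^bsub>C\<^esub> \<ominus>\<^bsub>T\<^esub> \<tau> \<zero> \<one>\<^bsub>C\<^esub> \<notin> gap_ideal Z"
    by (rule Z_separate[OF LD(1) order_refl _ one_closed one_notin_L LD(3)])
      (use Domain_Z(1) idealizerD(2) in blast, simp)
  then show ?thesis by (simp add: \<tau>_one \<tau>_zero_left T.minus_zero_right)
qed

text \<open>Separation of \<open>a\<close> from the domain, with \<open>w = \<one>\<close>. It
  follows that a character extending \<open>Z\<close> and defined at \<open>a\<close> has a strictly
  larger gap ideal.\<close>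

lemma gap_notin_gap_ideal:
  assumes "a \<in> carrier R" "a \<notin> Domain Z" "c \<in> carrier C"
  shows "gap a c \<notin> gap_ideal Z"
proof -
  have "additive_subgroup (Domain Z) R"
  proof (rule additive_subgroup_diffI)
    show "Domain Z \<subseteq> carrier R" using Z_carrier(2) by blast
    show "\<zero> \<in> Domain Z" using Z_zero by blast
  qed (rule Domain_Z(3))
  then show ?thesis unfolding gap_def
    by (rule Z_separate[OF _ Domain_Z(6,4) assms(1,2) Domain_Z(2) assms(3)])
qed

end

end

lemma (in ring) diff_diff_cancel: "x \<in> carrier R \<Longrightarrow> y \<in> carrier R \<Longrightarrow> x \<ominus> (x \<ominus> y) = y"
  using add_minus_cancel[of y "x \<ominus> y"] add_minus_cancel'[of x y] by simp

section \<open>Extending a character by an eigenvalue\<close>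

context tensor_situation
begin

text \<open>The value at \<open>\<tau> a \<one>\<close> of the polynomial over \<open>C\<close>
  whose coefficients are listed from the constant term upwards.\<close>

primrec ev :: "'a \<Rightarrow> 'c list \<Rightarrow> 't" where
  "ev a [] = \<zero>\<^bsub>T\<^esub>"
| "ev a (c # cs) = \<tau> \<one> c \<oplus>\<^bsub>T\<^esub> ev a cs \<otimes>\<^bsub>T\<^esub> \<tau> a \<one>\<^bsub>C\<^esub>"

lemma ev_closed: "a \<in> carrier R \<Longrightarrow> set cs \<subseteq> carrier C \<Longrightarrow> ev a cs \<in> carrier T"
  by (induction cs) (auto simp: \<tau>_closed)

lemma \<tau>_one_add: "c \<in> carrier C \<Longrightarrow> d \<in> carrier C \<Longrightarrow> \<tau> \<one> (c \<oplus>\<^bsub>C\<^esub> d) = \<tau> \<one> c \<oplus>\<^bsub>T\<^esub> \<tau> \<one> d"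
  by (simp add: \<tau>_add_right)

lemma \<tau>_one_mult: "c \<in> carrier C \<Longrightarrow> d \<in> carrier C \<Longrightarrow> \<tau> \<one> (c \<otimes>\<^bsub>C\<^esub> d) = \<tau> \<one> c \<otimes>\<^bsub>T\<^esub> \<tau> \<one> d"
  by (simp add: \<tau>_mult)

lemma gap_commute:
  assumes "a \<in> carrier R" "c \<in> carrier C"
  shows "\<tau> a \<one>\<^bsub>C\<^esub> \<otimes>\<^bsub>T\<^esub> gap a c = gap a c \<otimes>\<^bsub>T\<^esub> \<tau> a \<one>\<^bsub>C\<^esub>"
  using assms by (simp add: gap_def T.r_distr_minus T.l_distr_minus \<tau>_closed \<tau>_mult)

lemma ev_commute_gap:
  assumes "a \<in> carrier R" "c \<in> carrier C" "set cs \<subseteq> carrier C"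
  shows "gap a c \<otimes>\<^bsub>T\<^esub> ev a cs = ev a cs \<otimes>\<^bsub>T\<^esub> gap a c"
  using assms(3)
proof (induction cs)
  case Nil
  then show ?case using assms by (simp add: gap_closed)
next
  case (Cons d cs)
  have d: "d \<in> carrier C" "ev a cs \<in> carrier T" using Cons.prems ev_closed[OF assms(1)] by auto
  note gap = gap_closed[OF assms(1,2)]
  have A: "\<tau> a \<one>\<^bsub>C\<^esub> \<in> carrier T" using assms by (simp add: \<tau>_closed)
  have "gap a c \<otimes>\<^bsub>T\<^esub> (ev a cs \<otimes>\<^bsub>T\<^esub> \<tau> a \<one>\<^bsub>C\<^esub>) = ev a cs \<otimes>\<^bsub>T\<^esub> (gap a c \<otimes>\<^bsub>T\<^esub> \<tau> a \<one>\<^bsub>C\<^esub>)"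
    using Cons gap d A by (simp add: T.m_assoc[symmetric])
  also have "\<dots> = (ev a cs \<otimes>\<^bsub>T\<^esub> \<tau> a \<one>\<^bsub>C\<^esub>) \<otimes>\<^bsub>T\<^esub> gap a c"
    using gap d A gap_commute[OF assms(1,2)] by (simp add: T.m_assoc)
  finally show ?case
    using gap d A \<tau>_central[OF d(1) gap] by (simp add: T.r_distr T.l_distr \<tau>_closed)
qed

lemma ev_division:
  assumes a: "a \<in> carrier R" and x: "x \<in> carrier C" and cs: "set cs \<subseteq> carrier C"
  shows "ev a cs = \<tau> \<one> (horner C cs x) \<oplus>\<^bsub>T\<^esub> ev a (synthetic_division C cs x) \<otimes>\<^bsub>T\<^esub> gap a x"
  using cs
proof (induction cs)
  case Nil
  then show ?case using a x by (simp add: \<tau>_zero_right gap_closed)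
next
  case (Cons c cs)
  have c: "c \<in> carrier C" "set cs \<subseteq> carrier C" using Cons.prems by auto
  let ?h = "horner C cs x" and ?q = "ev a (synthetic_division C cs x)" and ?A = "\<tau> a \<one>\<^bsub>C\<^esub>"
  have h: "?h \<in> carrier C" by (rule C.horner_closed[OF c(2) x])
  have q: "?q \<in> carrier T" by (rule ev_closed[OF a C.synthetic_division_closed[OF c(2) x]])
  have A: "?A \<in> carrier T" using a by (simp add: \<tau>_closed)
  note gap = gap_closed[OF a x]
  have t: "\<tau> \<one> c \<in> carrier T" "\<tau> \<one> ?h \<in> carrier T" "\<tau> \<one> x \<in> carrier T" using c h x by (simp_all add: \<tau>_closed)
  show ?case
  proof (cases "cs = []")
    case True
    then show ?thesis using a c x by (simp add: \<tau>_closed gap_closed)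
  next
    case False
    have "?A = \<tau> \<one> x \<oplus>\<^bsub>T\<^esub> gap a x" using A t by (simp add: gap_def T.add_minus_cancel')
    then have hA: "\<tau> \<one> ?h \<otimes>\<^bsub>T\<^esub> ?A = \<tau> \<one> (?h \<otimes>\<^bsub>C\<^esub> x) \<oplus>\<^bsub>T\<^esub> \<tau> \<one> ?h \<otimes>\<^bsub>T\<^esub> gap a x"
      using t gap h x by (simp add: T.r_distr \<tau>_one_mult)
    have gA: "?q \<otimes>\<^bsub>T\<^esub> gap a x \<otimes>\<^bsub>T\<^esub> ?A = ?q \<otimes>\<^bsub>T\<^esub> ?A \<otimes>\<^bsub>T\<^esub> gap a x"
      using q gap A gap_commute[OF a x] by (simp add: T.m_assoc)
    have "ev a (c # cs) = \<tau> \<one> c \<oplus>\<^bsub>T\<^esub> (\<tau> \<one> ?h \<otimes>\<^bsub>T\<^esub> ?A \<oplus>\<^bsub>T\<^esub> ?q \<otimes>\<^bsub>T\<^esub> gap a x \<otimes>\<^bsub>T\<^esub> ?A)"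
      using Cons.IH[OF c(2)] q gap A t by (simp add: T.l_distr)
    also have "\<dots> = (\<tau> \<one> c \<oplus>\<^bsub>T\<^esub> \<tau> \<one> (?h \<otimes>\<^bsub>C\<^esub> x)) \<oplus>\<^bsub>T\<^esub> (\<tau> \<one> ?h \<otimes>\<^bsub>T\<^esub> gap a x \<oplus>\<^bsub>T\<^esub> ?q \<otimes>\<^bsub>T\<^esub> ?A \<otimes>\<^bsub>T\<^esub> gap a x)"
      unfolding hA gA using t gap q A h x by (simp add: T.a_assoc \<tau>_closed)
    also have "\<dots> = \<tau> \<one> (horner C (c # cs) x) \<oplus>\<^bsub>T\<^esub> ev a (synthetic_division C (c # cs) x) \<otimes>\<^bsub>T\<^esub> gap a x"
      using False t gap q A h x c by (simp add: \<tau>_one_add T.l_distr)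
    finally show ?thesis .
  qed
qed

lemma ev_snoc:
  assumes "a \<in> carrier R" "c \<in> carrier C" "set cs \<subseteq> carrier C"
  shows "ev a (cs @ [c]) = ev a cs \<oplus>\<^bsub>T\<^esub> \<tau> (a [^] length cs) c"
  using assms(3)
proof (induction cs)
  case Nil
  then show ?case using assms by (simp add: \<tau>_closed)
next
  case (Cons d cs)
  then have "d \<in> carrier C" "ev a cs \<in> carrier T" using ev_closed[OF assms(1)] by auto
  then show ?case using Cons assms by (simp add: T.l_distr \<tau>_closed \<tau>_mult T.a_assoc)
qed

text \<open>The list has exactly \<open>n\<close> entries, so that one more coefficient can be
  appended to complete a polynomial of degree \<open>n\<close>.\<close>

lemma powers_ev:
  assumes Z: "Z \<subseteq> carrier R \<times> carrier C" "L \<times> {\<zero>\<^bsub>C\<^esub>} \<subseteq> Z"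
    and a: "a \<in> idealizer" and y: "y \<in> powers F a n"
  shows "\<exists>cs. length cs = n \<and> set cs \<subseteq> carrier C \<and> \<tau> y \<one>\<^bsub>C\<^esub> \<ominus>\<^bsub>T\<^esub> ev a cs \<in> gap_ideal Z"
  using y
proof (induction n arbitrary: y)
  case 0
  then show ?case using gap_ideal_L[OF Z(2), of y] by (auto simp: T.minus_zero_right \<tau>_closed)
next
  case (Suc n)
  then obtain p z where pz: "y = p \<oplus> z \<otimes> a [^] n" "p \<in> powers F a n" "z \<in> F" by auto
  obtain cs where cs: "length cs = n" "set cs \<subseteq> carrier C" "\<tau> p \<one>\<^bsub>C\<^esub> \<ominus>\<^bsub>T\<^esub> ev a cs \<in> gap_ideal Z"
    using Suc.IH[OF pz(2)] by blast
  note ca = idealizerD(1)[OF a]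
  have p: "p \<in> carrier R" using powers_carrier[OF idealizer_F F_one F_diff F_mult a pz(2)] .
  have "\<tau> (z \<otimes> a [^] n) \<one>\<^bsub>C\<^esub> = \<tau> z \<one>\<^bsub>C\<^esub> \<otimes>\<^bsub>T\<^esub> \<tau> (a [^] n) \<one>\<^bsub>C\<^esub>"
    using pz(3) ca by (simp add: \<tau>_mult)
  also have "\<dots> = \<tau> (a [^] n) (\<zeta> z)" using pz(3) ca by (simp add: \<tau>_scalar \<tau>_mult \<zeta>_closed)
  finally have "\<tau> y \<one>\<^bsub>C\<^esub> = \<tau> p \<one>\<^bsub>C\<^esub> \<oplus>\<^bsub>T\<^esub> \<tau> (a [^] n) (\<zeta> z)"
    unfolding pz(1) using p pz(3) ca by (simp add: \<tau>_add_left)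
  then have "\<tau> y \<one>\<^bsub>C\<^esub> \<ominus>\<^bsub>T\<^esub> ev a (cs @ [\<zeta> z]) = \<tau> p \<one>\<^bsub>C\<^esub> \<ominus>\<^bsub>T\<^esub> ev a cs"
    using ev_snoc[OF ca \<zeta>_closed[OF pz(3)] cs(2)] cs(1) p ca pz(3) ev_closed[OF ca cs(2)]
    by (simp add: T.diff_add_add \<tau>_closed \<zeta>_closed T.minus_self T.minus_zero_right)
  then show ?case using cs pz(3) by (intro exI[of _ "cs @ [\<zeta> z]"]) (simp add: \<zeta>_closed)
qed

context
  fixes Z a
  assumes partial_character: "partial_character Z" and a: "a \<in> idealizer" "\<And>x. x \<in> Domain Z \<Longrightarrow> cg (a \<otimes> x) (x \<otimes> a)"
begin

lemma a_carrier: "a \<in> carrier R"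
  using idealizerD(1)[OF a(1)] .

lemma gap_ideal_ev:
  assumes "u \<in> gap_ideal Z" "set cs \<subseteq> carrier C"
  shows "u \<otimes>\<^bsub>T\<^esub> ev a cs \<in> gap_ideal Z"
  using assms(2)
proof (induction cs)
  case Nil
  then show ?case using assms(1) T.left_idealD[OF gap_ideal_left_ideal[OF Z_carrier(1)[OF partial_character]]] by auto
next
  case (Cons c cs)
  note UL = gap_ideal_left_ideal[OF Z_carrier(1)[OF partial_character]]
  have u: "u \<in> carrier T" using T.left_idealD(2)[OF UL] assms(1) by blast
  have c: "c \<in> carrier C" "ev a cs \<in> carrier T" using Cons.prems ev_closed[OF a_carrier] by auto
  have "(u \<otimes>\<^bsub>T\<^esub> ev a cs) \<otimes>\<^bsub>T\<^esub> \<tau> a \<one>\<^bsub>C\<^esub> \<in> gap_ideal Z"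
  proof (rule gap_ideal_rmult[OF Z_carrier(1)[OF partial_character] Z_L(1)[OF partial_character] a_carrier])
    show "cg (y \<otimes> a) (a \<otimes> y)" if "(y, d) \<in> Z" for y d using cg_sym[OF a(2)] that by blast
  qed (use Cons in simp)
  moreover have "u \<otimes>\<^bsub>T\<^esub> \<tau> \<one> c \<in> gap_ideal Z" by (rule gap_ideal_rmult_scalar[OF Z_carrier(1)[OF partial_character] assms(1) c(1)])
  ultimately show ?case
    using T.left_idealD(4)[OF UL] u c a_carrier by (simp add: T.r_distr \<tau>_closed T.m_assoc)
qed

text \<open>Otherwise every \<open>gap a x\<close> has a left inverse modulo the gap ideal of
  \<open>Z\<close>. A polynomial over \<open>C\<close> factors into linear terms, which can then be
  cancelled one after the other; so no nonzero polynomial in \<open>a\<close> lies in the gap ideal.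
  This contradicts the algebraicity of \<open>a\<close>.\<close>

lemma eigenvalue_exists: "\<exists>x\<in>carrier C. \<one>\<^bsub>T\<^esub> \<notin> gap_ideal (insert (a, x) Z)"
proof (rule ccontr)
  assume "\<not> ?thesis"
  then have all: "\<one>\<^bsub>T\<^esub> \<in> gap_ideal (insert (a, x) Z)" if "x \<in> carrier C" for x using that by blast
  note ZC = Z_carrier(1)[OF partial_character] and UL = gap_ideal_left_ideal[OF Z_carrier(1)[OF partial_character]]
  note UD = T.left_idealD[OF UL]
  have split: "\<exists>u t. u \<in> gap_ideal Z \<and> t \<in> carrier T \<and> \<one>\<^bsub>T\<^esub> = u \<oplus>\<^bsub>T\<^esub> t \<otimes>\<^bsub>T\<^esub> gap a x" if x: "x \<in> carrier C" for x
  proof -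
    note gap = gap_closed[OF a_carrier x]
    let ?I = "{u \<oplus>\<^bsub>T\<^esub> t \<otimes>\<^bsub>T\<^esub> gap a x | u t. u \<in> gap_ideal Z \<and> t \<in> carrier T}"
    have "gap_ideal (insert (a, x) Z) \<subseteq> ?I"
    proof (rule gap_ideal_least)
      show "left_ideal T ?I"
      proof (rule T.left_idealI)
        show "?I \<subseteq> carrier T" using UD(2) gap by auto
        have "\<zero>\<^bsub>T\<^esub> = \<zero>\<^bsub>T\<^esub> \<oplus>\<^bsub>T\<^esub> \<zero>\<^bsub>T\<^esub> \<otimes>\<^bsub>T\<^esub> gap a x" using gap by simp
        then show "\<zero>\<^bsub>T\<^esub> \<in> ?I" using UD(3) by blast
      next
        fix y z assume "y \<in> ?I" "z \<in> ?I"
        then obtain u t u' t' where *: "y = u \<oplus>\<^bsub>T\<^esub> t \<otimes>\<^bsub>T\<^esub> gap a x" "z = u' \<oplus>\<^bsub>T\<^esub> t' \<otimes>\<^bsub>T\<^esub> gap a x"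
          "u \<in> gap_ideal Z" "u' \<in> gap_ideal Z" "t \<in> carrier T" "t' \<in> carrier T" by blast
        have "y \<ominus>\<^bsub>T\<^esub> z = (u \<ominus>\<^bsub>T\<^esub> u') \<oplus>\<^bsub>T\<^esub> (t \<ominus>\<^bsub>T\<^esub> t') \<otimes>\<^bsub>T\<^esub> gap a x"
          unfolding *(1,2) using * UD(2) gap by (simp add: T.diff_add_add T.l_distr_minus subset_iff)
        then show "y \<ominus>\<^bsub>T\<^esub> z \<in> ?I" using UD(5)[OF *(3,4)] *(5,6) by blast
      next
        fix s y assume s: "s \<in> carrier T" and "y \<in> ?I"
        then obtain u t where *: "y = u \<oplus>\<^bsub>T\<^esub> t \<otimes>\<^bsub>T\<^esub> gap a x" "u \<in> gap_ideal Z" "t \<in> carrier T" by blast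
        have "s \<otimes>\<^bsub>T\<^esub> y = s \<otimes>\<^bsub>T\<^esub> u \<oplus>\<^bsub>T\<^esub> (s \<otimes>\<^bsub>T\<^esub> t) \<otimes>\<^bsub>T\<^esub> gap a x"
          unfolding *(1) using * UD(2) gap s by (simp add: T.r_distr T.m_assoc subset_iff)
        then show "s \<otimes>\<^bsub>T\<^esub> y \<in> ?I" using UD(7)[OF s *(2)] s *(3) by blast
      qed
    next
      fix y d assume "(y, d) \<in> insert (a, x) Z"
      then consider "y = a" "d = x" | "(y, d) \<in> Z" by auto
      then show "gap y d \<in> ?I"
      proof cases
        case 1
        have "gap y d = \<zero>\<^bsub>T\<^esub> \<oplus>\<^bsub>T\<^esub> \<one>\<^bsub>T\<^esub> \<otimes>\<^bsub>T\<^esub> gap a x" using 1 gap by simp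
        then show ?thesis using UD(3) T.one_closed by blast
      next
        case 2
        then have "gap y d \<in> gap_ideal Z" by (rule gap_ideal_gap)
        moreover from this have "gap y d = gap y d \<oplus>\<^bsub>T\<^esub> \<zero>\<^bsub>T\<^esub> \<otimes>\<^bsub>T\<^esub> gap a x" using UD(2) gap by (simp add: subset_iff)
        ultimately show ?thesis using T.zero_closed by blast
      qed
    qed
    then show ?thesis using all[OF x] by blast
  qed
  have not_in: "ev a cs \<notin> gap_ideal Z" if "set cs \<subseteq> carrier C" "cs \<noteq> []" "last cs \<noteq> \<zero>\<^bsub>C\<^esub>" for cs
    using that
  proof (induction "length cs" arbitrary: cs rule: less_induct)
    case less
    show ?case
    proof (cases "length cs \<ge> 2")
      case False
      then obtain c where c: "cs = [c]" using less.prems(2) by (cases cs; cases "tl cs") auto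
      have cC: "c \<in> Units C" "c \<in> carrier C" using c less.prems C.field_Units by auto
      show ?thesis
      proof
        assume "ev a cs \<in> gap_ideal Z"
        then have "\<tau> \<one> c \<in> gap_ideal Z" using c cC a_carrier by (simp add: \<tau>_closed)
        then have "\<tau> \<one> (inv\<^bsub>C\<^esub> c) \<otimes>\<^bsub>T\<^esub> \<tau> \<one> c \<in> gap_ideal Z" using cC by (intro UD(7) \<tau>_closed) auto
        then show False using cC one_notin_gap_ideal[OF partial_character] by (simp add: \<tau>_mult \<tau>_one)
      qed
    next
      case True
      obtain x where x: "x \<in> carrier C" "horner C cs x = \<zero>\<^bsub>C\<^esub>" using C_root[OF less.prems(1) True less.prems(3)] by blast
      let ?ds = "synthetic_division C cs x" and ?q = "ev a (synthetic_division C cs x)"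
      note ds = C.synthetic_division_last[OF less.prems(1) x(1) True] C.synthetic_division_closed[OF less.prems(1) x(1)]
      have q: "?q \<in> carrier T" by (rule ev_closed[OF a_carrier ds(2)])
      note gap = gap_closed[OF a_carrier x(1)]
      have IH: "?q \<notin> gap_ideal Z" by (rule less.hyps) (use ds less.prems in auto)
      show ?thesis
      proof
        assume "ev a cs \<in> gap_ideal Z"
        then have qg: "?q \<otimes>\<^bsub>T\<^esub> gap a x \<in> gap_ideal Z"
          using ev_division[OF a_carrier x(1) less.prems(1)] x(2) q gap by (simp add: \<tau>_zero_right)
        obtain u t where ut: "u \<in> gap_ideal Z" "t \<in> carrier T" "\<one>\<^bsub>T\<^esub> = u \<oplus>\<^bsub>T\<^esub> t \<otimes>\<^bsub>T\<^esub> gap a x" using split[OF x(1)] by blast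
        have u: "u \<in> carrier T" using ut(1) UD(2) by blast
        \<comment> \<open>As \<open>?q\<close> commutes with \<open>gap a x\<close>, the relation
          for \<open>\<one>\<close> writes \<open>?q\<close> as an element of the gap ideal plus a
          left multiple of \<open>?q \<otimes> gap a x\<close>.\<close>
        have "?q = (u \<oplus>\<^bsub>T\<^esub> t \<otimes>\<^bsub>T\<^esub> gap a x) \<otimes>\<^bsub>T\<^esub> ?q" unfolding ut(3)[symmetric] using q by simp
        also have "\<dots> = u \<otimes>\<^bsub>T\<^esub> ?q \<oplus>\<^bsub>T\<^esub> t \<otimes>\<^bsub>T\<^esub> (?q \<otimes>\<^bsub>T\<^esub> gap a x)"
          using u ut(2) q gap ev_commute_gap[OF a_carrier x(1) ds(2)] by (simp add: T.l_distr T.m_assoc)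
        finally have "?q \<in> gap_ideal Z" using UD(4)[OF gap_ideal_ev[OF ut(1) ds(2)] UD(7)[OF ut(2) qg]] by simp
        then show False using IH by blast
      qed
    qed
  qed
  \<comment> \<open>The monic relation for \<open>a\<close> becomes a polynomial of degree
    \<open>n\<close> with value in the gap ideal. The appended leading coefficient
    \<open>\<ominus> \<one>\<close> is nonzero, contrary to \<open>not_in\<close>.\<close>
  obtain n where n: "a [^] (n::nat) \<in> powers F a n" using algebraic[OF a(1)] by blast
  obtain cs where cs: "length cs = n" "set cs \<subseteq> carrier C" "\<tau> (a [^] n) \<one>\<^bsub>C\<^esub> \<ominus>\<^bsub>T\<^esub> ev a cs \<in> gap_ideal Z"
    using powers_ev[OF ZC Z_L(1)[OF partial_character] a(1) n] by blast
  have e: "ev a cs \<in> carrier T" "\<tau> (a [^] n) \<one>\<^bsub>C\<^esub> \<in> carrier T"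
    using ev_closed[OF a_carrier cs(2)] a_carrier by (auto simp: \<tau>_closed)
  have neg: "\<tau> (a [^] n) (\<ominus>\<^bsub>C\<^esub> \<one>\<^bsub>C\<^esub>) = \<ominus>\<^bsub>T\<^esub> \<tau> (a [^] n) \<one>\<^bsub>C\<^esub>"
    using \<tau>_diff_right[of "a [^] n" "\<zero>\<^bsub>C\<^esub>" "\<one>\<^bsub>C\<^esub>"] a_carrier e(2) by (simp add: \<tau>_zero_right a_minus_def)
  have "ev a (cs @ [\<ominus>\<^bsub>C\<^esub> \<one>\<^bsub>C\<^esub>]) = \<ominus>\<^bsub>T\<^esub> (\<tau> (a [^] n) \<one>\<^bsub>C\<^esub> \<ominus>\<^bsub>T\<^esub> ev a cs)"
    using ev_snoc[OF a_carrier _ cs(2), of "\<ominus>\<^bsub>C\<^esub> \<one>\<^bsub>C\<^esub>"] cs(1) e neg T.minus_diff[OF e(2,1)] by (simp add: a_minus_def)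
  then have "ev a (cs @ [\<ominus>\<^bsub>C\<^esub> \<one>\<^bsub>C\<^esub>]) \<in> gap_ideal Z" using UD(6)[OF cs(3)] by simp
  moreover have "\<ominus>\<^bsub>C\<^esub> \<one>\<^bsub>C\<^esub> \<noteq> \<zero>\<^bsub>C\<^esub>" using C.zero_not_one C.minus_minus[of "\<one>\<^bsub>C\<^esub>"] by fastforce
  ultimately show False using not_in[of "cs @ [\<ominus>\<^bsub>C\<^esub> \<one>\<^bsub>C\<^esub>]"] cs(2) by simp
qed

text \<open>The new graph is cut out by conditions instead of being built from polynomials in
  \<open>a\<close>: it pairs \<open>x\<close> with \<open>c\<close> when \<open>gap x c\<close> lies
  in the enlarged gap ideal \<open>V\<close> and right multiplication by \<open>x\<close> preserves
  \<open>V\<close> and a fixed finite-dimensional space \<open>N\<close>. Closure under the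
  operations is then direct, the kernel is \<open>L\<close> because \<open>V\<close> is proper, and
  the domain lies in \<open>N\<close>.\<close>

lemma partial_character_extension: "\<exists>Z' x. partial_character Z' \<and> Z \<subseteq> Z' \<and> x \<in> carrier C \<and> (a, x) \<in> Z'"
proof -
  obtain \<mu> where \<mu>: "\<mu> \<in> carrier C" "\<one>\<^bsub>T\<^esub> \<notin> gap_ideal (insert (a, \<mu>) Z)" using eigenvalue_exists by blast
  define V where "V = gap_ideal (insert (a, \<mu>) Z)"
  have ZC: "insert (a, \<mu>) Z \<subseteq> carrier R \<times> carrier C" using Z_carrier(1)[OF partial_character] a_carrier \<mu>(1) by auto
  have LZ: "L \<times> {\<zero>\<^bsub>C\<^esub>} \<subseteq> insert (a, \<mu>) Z" using Z_L(1)[OF partial_character] by blast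
  note VD = T.left_idealD[OF gap_ideal_left_ideal[OF ZC], folded V_def]
  have oneV: "\<one>\<^bsub>T\<^esub> \<notin> V" using \<mu>(2) by (simp add: V_def)
  have LV: "\<tau> l \<one>\<^bsub>C\<^esub> \<in> V" if "l \<in> L" for l unfolding V_def by (rule gap_ideal_L[OF LZ that])
  have scalV: "c = \<zero>\<^bsub>C\<^esub>" if "\<tau> \<one> c \<in> V" "c \<in> carrier C" for c
  proof (rule ccontr)
    assume "c \<noteq> \<zero>\<^bsub>C\<^esub>"
    then have cC: "c \<in> Units C" using that C.field_Units by auto
    then have "\<tau> \<one> (inv\<^bsub>C\<^esub> c) \<otimes>\<^bsub>T\<^esub> \<tau> \<one> c \<in> V" using that by (intro VD(7) \<tau>_closed) auto
    then show False using cC that oneV by (simp add: \<tau>_mult \<tau>_one)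
  qed
  note DZ = Domain_Z[OF partial_character]
  note pw = DZ(1-4) a(1)
  obtain n where n: "a [^] (n::nat) \<in> powers F a n" using algebraic[OF a(1)] by blast
  \<comment> \<open>The span, over the old domain, of the powers of \<open>a\<close>; it is
    finite-dimensional modulo \<open>L\<close>. It contains \<open>\<one>\<close>, so whatever
    preserves \<open>N\<close> under right multiplication belongs to \<open>N\<close>.\<close>
  define N where "N = powers (Domain Z) a n"
  have "powers F a m \<subseteq> powers (Domain Z) a m" for m
  proof (induction m)
    case (Suc m)
    then show ?case using DZ(7) by (simp add: subset_iff) blast
  qed simp
  then have an: "a [^] n \<in> N" using n by (auto simp: N_def)
  have Nc: "y \<in> carrier R" if "y \<in> N" for y using that powers_carrier[OF pw] by (simp add: N_def)
  have NL: "L \<subseteq> N" using powers_L[OF pw] by (simp add: N_def)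
  have "n \<noteq> 0"
  proof
    assume "n = 0"
    then show False using n one_notin_L by simp
  qed
  then obtain m where m: "n = Suc m" by (cases n) auto
  have oneN: "\<one> \<in> N"
  proof -
    have "\<zero> \<oplus> \<one> \<otimes> a [^] (0::nat) \<in> powers (Domain Z) a (Suc 0)"
      by (rule powers_SucI) (auto simp: LD(3) DZ(2))
    then have "\<one> \<in> powers (Domain Z) a (Suc 0)" by (simp del: powers.simps)
    then show ?thesis using powers_mono[OF pw, of "Suc 0" m] m unfolding N_def by (auto simp del: powers.simps)
  qed
  define Z' where "Z' = {(x, c). x \<in> idealizer \<and> c \<in> carrier C \<and> gap x c \<in> V \<and>
    (\<forall>u\<in>V. u \<otimes>\<^bsub>T\<^esub> \<tau> x \<one>\<^bsub>C\<^esub> \<in> V) \<and> (\<forall>y\<in>N. y \<otimes> x \<in> N)}"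
  have Vc: "u \<in> carrier T" if "u \<in> V" for u using that VD(2) by blast
  have "partial_character Z'"
    unfolding partial_character_def
  proof (intro conjI allI impI ballI)
    show "Z' \<subseteq> carrier R \<times> carrier C" using idealizerD(1) by (auto simp: Z'_def)
  next
    fix x c y d assume "(x, c) \<in> Z' \<and> (y, d) \<in> Z'"
    then have x: "x \<in> idealizer" "c \<in> carrier C" "gap x c \<in> V" "\<And>u. u \<in> V \<Longrightarrow> u \<otimes>\<^bsub>T\<^esub> \<tau> x \<one>\<^bsub>C\<^esub> \<in> V" "\<And>z. z \<in> N \<Longrightarrow> z \<otimes> x \<in> N"
      and y: "y \<in> idealizer" "d \<in> carrier C" "gap y d \<in> V" "\<And>u. u \<in> V \<Longrightarrow> u \<otimes>\<^bsub>T\<^esub> \<tau> y \<one>\<^bsub>C\<^esub> \<in> V" "\<And>z. z \<in> N \<Longrightarrow> z \<otimes> y \<in> N"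
      by (auto simp: Z'_def)
    note cl = idealizerD(1)[OF x(1)] idealizerD(1)[OF y(1)] x(2) y(2)
    have t: "\<tau> x \<one>\<^bsub>C\<^esub> \<in> carrier T" "\<tau> y \<one>\<^bsub>C\<^esub> \<in> carrier T" "\<tau> \<one> c \<in> carrier T" "\<tau> \<one> d \<in> carrier T"
      using cl by (auto simp: \<tau>_closed)
    have "gap (x \<ominus> y) (c \<ominus>\<^bsub>C\<^esub> d) = gap x c \<ominus>\<^bsub>T\<^esub> gap y d"
      using cl t by (simp add: gap_def \<tau>_diff_left \<tau>_diff_right T.diff_diff_diff)
    then have "gap (x \<ominus> y) (c \<ominus>\<^bsub>C\<^esub> d) \<in> V" using VD(5)[OF x(3) y(3)] by simp
    moreover have "u \<otimes>\<^bsub>T\<^esub> \<tau> (x \<ominus> y) \<one>\<^bsub>C\<^esub> \<in> V" if "u \<in> V" for u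
      using VD(5)[OF x(4)[OF that] y(4)[OF that]] Vc[OF that] cl t by (simp add: \<tau>_diff_left T.r_distr_minus)
    moreover have "z \<otimes> (x \<ominus> y) \<in> N" if "z \<in> N" for z
      using powers_diff[OF pw, of "z \<otimes> x" n "z \<otimes> y"] x(5)[OF that] y(5)[OF that] Nc[OF that] cl
      by (simp add: N_def r_distr_minus)
    ultimately show "(x \<ominus> y, c \<ominus>\<^bsub>C\<^esub> d) \<in> Z'" using idealizer_diff[OF x(1) y(1)] cl by (simp add: Z'_def)
    have "gap (x \<otimes> y) (c \<otimes>\<^bsub>C\<^esub> d) = gap x c \<otimes>\<^bsub>T\<^esub> \<tau> y \<one>\<^bsub>C\<^esub> \<oplus>\<^bsub>T\<^esub> \<tau> \<one> c \<otimes>\<^bsub>T\<^esub> gap y d"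
      using cl t by (simp add: gap_def T.l_distr_minus T.r_distr_minus \<tau>_mult T.diff_trans \<tau>_closed)
    then have "gap (x \<otimes> y) (c \<otimes>\<^bsub>C\<^esub> d) \<in> V" using VD(4)[OF y(4)[OF x(3)] VD(7)[OF t(3) y(3)]] by simp
    moreover have "u \<otimes>\<^bsub>T\<^esub> \<tau> (x \<otimes> y) \<one>\<^bsub>C\<^esub> \<in> V" if "u \<in> V" for u
      using y(4)[OF x(4)[OF that]] Vc[OF that] cl t by (simp add: T.m_assoc \<tau>_mult)
    moreover have "z \<otimes> (x \<otimes> y) \<in> N" if "z \<in> N" for z
      using y(5)[OF x(5)[OF that]] Nc[OF that] cl by (simp add: m_assoc)
    ultimately show "(x \<otimes> y, c \<otimes>\<^bsub>C\<^esub> d) \<in> Z'" using idealizer_mult[OF x(1) y(1)] cl by (simp add: Z'_def)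
  next
    fix x c assume "(x, c) \<in> Z'"
    then have x: "x \<in> idealizer" "c \<in> carrier C" "gap x c \<in> V" by (auto simp: Z'_def)
    note cl = idealizerD(1)[OF x(1)]
    have t: "\<tau> x \<one>\<^bsub>C\<^esub> \<in> carrier T" "\<tau> \<one> c \<in> carrier T" using cl x(2) by (auto simp: \<tau>_closed)
    show "x \<in> L \<longleftrightarrow> c = \<zero>\<^bsub>C\<^esub>"
    proof
      assume "x \<in> L"
      then have "\<tau> x \<one>\<^bsub>C\<^esub> \<ominus>\<^bsub>T\<^esub> gap x c \<in> V" using VD(5)[OF LV x(3)] by blast
      moreover have "\<tau> x \<one>\<^bsub>C\<^esub> \<ominus>\<^bsub>T\<^esub> gap x c = \<tau> \<one> c"
        unfolding gap_def using t by (simp add: T.diff_diff_cancel)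
      ultimately show "c = \<zero>\<^bsub>C\<^esub>" using scalV x(2) by simp
    next
      assume c: "c = \<zero>\<^bsub>C\<^esub>"
      show "x \<in> L"
      proof (rule ccontr)
        assume "x \<notin> L"
        then obtain e where e: "e \<in> idealizer" "cg (e \<otimes> x) \<one>" using idealizer_inverse[OF x(1)] by metis
        note ce = idealizerD(1)[OF e(1)]
        have "\<tau> x \<one>\<^bsub>C\<^esub> \<in> V" using x(3) c t by (simp add: gap_def \<tau>_zero_right T.minus_zero_right)
        then have "\<tau> e \<one>\<^bsub>C\<^esub> \<otimes>\<^bsub>T\<^esub> \<tau> x \<one>\<^bsub>C\<^esub> \<in> V" using ce by (intro VD(7)) (auto simp: \<tau>_closed)
        then have "\<tau> (e \<otimes> x) \<one>\<^bsub>C\<^esub> \<in> V" using ce cl by (simp add: \<tau>_mult)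
        then have "\<tau> (e \<otimes> x) \<one>\<^bsub>C\<^esub> \<ominus>\<^bsub>T\<^esub> \<tau> (e \<otimes> x \<ominus> \<one>) \<one>\<^bsub>C\<^esub> \<in> V" using VD(5) LV[OF cgD(3)[OF e(2)]] by blast
        moreover have "e \<otimes> x \<ominus> (e \<otimes> x \<ominus> \<one>) = \<one>"
          using ce cl by (simp add: diff_diff_cancel)
        then have "\<tau> (e \<otimes> x) \<one>\<^bsub>C\<^esub> \<ominus>\<^bsub>T\<^esub> \<tau> (e \<otimes> x \<ominus> \<one>) \<one>\<^bsub>C\<^esub> = \<one>\<^bsub>T\<^esub>"
          using ce cl by (simp add: \<tau>_diff_left[symmetric] \<tau>_one)
        ultimately show False using oneV by simp
      qed
    qed
  next
    show "L \<times> {\<zero>\<^bsub>C\<^esub>} \<subseteq> Z'"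
    proof
      fix p assume "p \<in> L \<times> {\<zero>\<^bsub>C\<^esub>}"
      then obtain l where l: "p = (l, \<zero>\<^bsub>C\<^esub>)" "l \<in> L" by auto
      have "gap l \<zero>\<^bsub>C\<^esub> \<in> V" using LV[OF l(2)] l(2) by (simp add: gap_def \<tau>_zero_right T.minus_zero_right \<tau>_closed)
      moreover have "u \<otimes>\<^bsub>T\<^esub> \<tau> l \<one>\<^bsub>C\<^esub> \<in> V" if "u \<in> V" for u using VD(7)[OF Vc[OF that] LV[OF l(2)]] .
      moreover have "y \<otimes> l \<in> N" if "y \<in> N" for y using LD(7)[OF Nc[OF that] l(2)] NL by blast
      ultimately show "p \<in> Z'" using l idealizer_L by (auto simp: Z'_def)
    qed
  next
    fix z assume z: "z \<in> F"
    have "gap z (\<zeta> z) = \<zero>\<^bsub>T\<^esub>" using z by (simp add: gap_def \<tau>_scalar T.minus_self \<tau>_closed \<zeta>_closed)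
    moreover have "u \<otimes>\<^bsub>T\<^esub> \<tau> z \<one>\<^bsub>C\<^esub> \<in> V" if "u \<in> V" for u
      using gap_ideal_rmult_scalar[OF ZC, of u "\<zeta> z"] that \<zeta>_closed[OF z] by (simp add: \<tau>_scalar[OF z] V_def)
    moreover have "y \<otimes> z \<in> N" if "y \<in> N" for y
      using powers_lmult[OF pw, of y n z] that z DZ(7) F_central[OF z Nc[OF that]] by (auto simp: N_def)
    ultimately show "(z, \<zeta> z) \<in> Z'" using z idealizer_F \<zeta>_closed VD(3) by (auto simp: Z'_def)
  next
    have "Domain Z' \<subseteq> N"
    proof
      fix x assume "x \<in> Domain Z'"
      then have "\<one> \<otimes> x \<in> N" "x \<in> idealizer" using oneN by (auto simp: Z'_def)
      then show "x \<in> N" using idealizerD(1) by simp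
    qed
    then show "fin_mod (Domain Z') L"
      using fin_mod_mono[OF fin_mod_powers[OF Z_fin[OF partial_character] a(1)] _ order_refl ksub_L] by (simp add: N_def)
  qed
  moreover have stab: "u \<otimes>\<^bsub>T\<^esub> \<tau> x \<one>\<^bsub>C\<^esub> \<in> V"
    if "u \<in> V" "x \<in> carrier R" "\<And>y. y \<in> insert a (Domain Z) \<Longrightarrow> cg (y \<otimes> x) (x \<otimes> y)" for u x
    unfolding V_def
    by (rule gap_ideal_rmult[OF ZC LZ that(2)]) (use that in \<open>auto simp: V_def\<close>)
  have "Z \<subseteq> Z'"
  proof
    fix p assume p: "p \<in> Z"
    obtain x c where xc: "p = (x, c)" by (cases p)
    then have xZ: "(x, c) \<in> Z" using p by simp
    have xD: "x \<in> Domain Z" using xZ by blast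
    have "gap x c \<in> V" unfolding V_def using xZ by (intro gap_ideal_gap) simp
    moreover have "u \<otimes>\<^bsub>T\<^esub> \<tau> x \<one>\<^bsub>C\<^esub> \<in> V" if "u \<in> V" for u
      by (rule stab[OF that Z_carrier(2)[OF partial_character xZ]]) (use a(2)[OF xD] DZ(5)[OF _ xD] in auto)
    moreover have "y \<otimes> x \<in> N" if "y \<in> N" for y
      using powers_rmult[OF pw a(2), of y n x] that xD by (simp add: N_def)
    ultimately show "p \<in> Z'" using Z_idealizer[OF partial_character xZ] Z_carrier(3)[OF partial_character xZ] by (simp add: Z'_def xc)
  qed
  moreover have "(a, \<mu>) \<in> Z'"
  proof -
    have "gap a \<mu> \<in> V" unfolding V_def by (intro gap_ideal_gap) simp
    moreover have "u \<otimes>\<^bsub>T\<^esub> \<tau> a \<one>\<^bsub>C\<^esub> \<in> V" if "u \<in> V" for u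
      by (rule stab[OF that a_carrier]) (use cg_sym[OF a(2)] cg_refl a_carrier in auto)
    moreover have "y \<otimes> a \<in> N" if "y \<in> N" for y
      using powers_stable[OF pw, of n y] an that by (simp add: N_def)
    ultimately show ?thesis using a(1) \<mu>(1) by (simp add: Z'_def)
  qed
  ultimately show ?thesis using \<mu>(1) by blast
qed

end

lemma partial_character_exists: "\<exists>Z. partial_character Z"
proof -
  define Z where "Z = {(z \<oplus> l, \<zeta> z) | z l. z \<in> F \<and> l \<in> L}"
  have \<zeta>_zero: "\<zeta> \<zero> = \<zero>\<^bsub>C\<^esub>" using \<zeta>_diff[OF F_one F_one] by (simp add: minus_self \<zeta>_one C.minus_self)
  have mem: "(z \<oplus> l, \<zeta> z) \<in> Z" if "z \<in> F" "l \<in> L" for z l using that by (auto simp: Z_def)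
  have "partial_character Z"
    unfolding partial_character_def
  proof (intro conjI allI impI ballI)
    show "Z \<subseteq> carrier R \<times> carrier C" using \<zeta>_closed by (auto simp: Z_def)
  next
    fix x c y d assume "(x, c) \<in> Z \<and> (y, d) \<in> Z"
    then obtain z l z' l' where *: "x = z \<oplus> l" "c = \<zeta> z" "y = z' \<oplus> l'" "d = \<zeta> z'" "z \<in> F" "z' \<in> F" "l \<in> L" "l' \<in> L"
      by (auto simp: Z_def)
    note cl = F_carrier[OF *(5)] F_carrier[OF *(6)] L_carrier[OF *(7)] L_carrier[OF *(8)]
    have "x \<ominus> y = (z \<ominus> z') \<oplus> (l \<ominus> l')" unfolding * using cl by (simp add: diff_add_add)
    then show "(x \<ominus> y, c \<ominus>\<^bsub>C\<^esub> d) \<in> Z" using mem[OF F_diff[OF *(5,6)] LD(5)[OF *(7,8)]] * by (simp add: \<zeta>_diff)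
    have "x \<otimes> y = z \<otimes> z' \<oplus> ((z \<otimes> l' \<oplus> z' \<otimes> l) \<oplus> l \<otimes> l')"
      unfolding * using cl F_central[OF *(6) cl(3)] by (simp add: l_distr r_distr a_ac)
    moreover have "(z \<otimes> l' \<oplus> z' \<otimes> l) \<oplus> l \<otimes> l' \<in> L" using cl * by (intro LD(4) LD(7)) auto
    ultimately show "(x \<otimes> y, c \<otimes>\<^bsub>C\<^esub> d) \<in> Z" using mem[OF F_mult[OF *(5,6)]] * by (simp add: \<zeta>_mult)
  next
    fix x c assume "(x, c) \<in> Z"
    then obtain z l where *: "x = z \<oplus> l" "c = \<zeta> z" "z \<in> F" "l \<in> L" by (auto simp: Z_def)
    show "x \<in> L \<longleftrightarrow> c = \<zero>\<^bsub>C\<^esub>"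
    proof (cases "z = \<zero>")
      case True
      then show ?thesis using * \<zeta>_zero by simp
    next
      case False
      then obtain y where y: "y \<in> F" "y \<otimes> z = \<one>" using F_inverse *(3) by blast
      have "x \<notin> L"
      proof
        assume "x \<in> L"
        then have "x \<ominus> l \<in> L" using LD(5) *(4) by blast
        then have "z \<in> L" using * by (simp add: add_minus_cancel)
        then have "y \<otimes> z \<in> L" using LD(7) y(1) by simp
        then show False using y(2) one_notin_L by simp
      qed
      moreover have "c \<noteq> \<zero>\<^bsub>C\<^esub>"
      proof
        assume "c = \<zero>\<^bsub>C\<^esub>"
        then have "\<zeta> (y \<otimes> z) = \<zero>\<^bsub>C\<^esub>" using *(2,3) \<zeta>_mult[OF y(1) *(3)] \<zeta>_closed[OF y(1)] by simp
        then show False using y(2) \<zeta>_one by simp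
      qed
      ultimately show ?thesis by blast
    qed
  next
    show "L \<times> {\<zero>\<^bsub>C\<^esub>} \<subseteq> Z" using mem[OF F_zero] \<zeta>_zero by auto
  next
    show "(z, \<zeta> z) \<in> Z" if "z \<in> F" for z using mem[OF that LD(3)] that by simp
  next
    have "z \<otimes> \<one> \<oplus> l \<in> kspan [\<one>] L" if "z \<in> F" "l \<in> L" for z l
      using that by (intro kspan_ConsI) auto
    then have "Domain Z \<subseteq> kspan [\<one>] L" by (auto simp: Z_def simp del: kspan.simps)
    then show "fin_mod (Domain Z) L" unfolding fin_mod_def by (intro exI[of _ "[\<one>]"]) simp
  qed
  then show ?thesis by blast
qed

text \<open>Maximality is imposed on the gap ideals, as the chain condition holds there. An element
  centralizing the domain extends the character without enlarging a maximal gap ideal, so it was in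
  the domain already, and the density theorem applies.\<close>

lemma simple_finite:
  assumes "dcc_above R I" "I \<subseteq> L" "\<And>i r. i \<in> I \<Longrightarrow> r \<in> carrier R \<Longrightarrow> i \<otimes> r \<in> I"
  shows "fin_mod (carrier R) L"
proof -
  have "\<exists>M\<in>gap_ideal ` Collect partial_character. \<forall>I\<in>gap_ideal ` Collect partial_character. M \<subseteq> I \<longrightarrow> I = M"
    by (rule left_noetherian_maximal[OF T_noetherian])
      (use partial_character_exists gap_ideal_left_ideal[OF Z_carrier(1)] in auto)
  then obtain Z where Z: "partial_character Z" "\<And>Z'. partial_character Z' \<Longrightarrow> gap_ideal Z \<subseteq> gap_ideal Z' \<Longrightarrow> gap_ideal Z' = gap_ideal Z" by auto
  note DZ = Domain_Z[OF Z(1)]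
  have self: "d \<in> Domain Z" if d: "d \<in> idealizer" "\<And>x. x \<in> Domain Z \<Longrightarrow> cg (d \<otimes> x) (x \<otimes> d)" for d
  proof (rule ccontr)
    assume "d \<notin> Domain Z"
    obtain Z' x where Z': "partial_character Z'" "Z \<subseteq> Z'" "x \<in> carrier C" "(d, x) \<in> Z'" using partial_character_extension[OF Z(1) d] by blast
    have "gap d x \<in> gap_ideal Z" using gap_ideal_gap[OF Z'(4)] Z(2)[OF Z'(1) gap_ideal_mono[OF Z'(2)]] by simp
    then show False using gap_notin_gap_ideal[OF Z(1) idealizerD(1)[OF d(1)] \<open>d \<notin> Domain Z\<close> Z'(3)] by blast
  qed
  have Dc: "Domain Z \<subseteq> carrier R" using Z_carrier(2)[OF Z(1)] by blast
  obtain \<kappa>s where \<kappa>s: "set \<kappa>s \<subseteq> Domain Z" "Domain Z \<subseteq> kspan \<kappa>s L"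
    using fin_mod_basis[OF ksub_L Z_fin[OF Z(1)] Dc] by blast
  show ?thesis
    by (rule simple_quotient_finite[OF DZ(1-5) self \<kappa>s assms Z_fin[OF Z(1)]])
qed

end

section \<open>Finite-dimensional quotients\<close>

context central_subfield
begin

text \<open>Choose \<open>A\<close> minimal above \<open>I\<close> with \<open>R / A\<close>
  finite-dimensional, by the chain condition. If \<open>A\<close> were not \<open>I\<close>,
  noetherianity would give \<open>B\<close> maximal below \<open>A\<close> and above
  \<open>I\<close>; then \<open>A / B\<close> is simple, hence finite-dimensional, and
  \<open>B\<close> contradicts the minimality of \<open>A\<close>.\<close>

lemma finite_quotient:
  assumes R: "left_noetherian R" and dcc: "dcc_above R I"
    and I: "left_ideal R I" "\<And>i r. i \<in> I \<Longrightarrow> r \<in> carrier R \<Longrightarrow> i \<otimes> r \<in> I"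
    and simple: "\<And>L. maximal_left_ideal R F L \<Longrightarrow> I \<subseteq> L \<Longrightarrow> fin_mod (carrier R) L"
  shows "fin_mod (carrier R) I"
proof (rule ccontr)
  assume notfin: "\<not> fin_mod (carrier R) I"
  define \<F> where "\<F> = {A. left_ideal R A \<and> I \<subseteq> A \<and> fin_mod (carrier R) A}"
  have "left_ideal R (carrier R)" by (rule left_idealI) auto
  moreover have "fin_mod (carrier R) (carrier R)" unfolding fin_mod_def by (intro exI[of _ "[]"]) simp
  ultimately have "carrier R \<in> \<F>" using left_idealD(2)[OF I(1)] by (simp add: \<F>_def)
  then have "\<exists>M\<in>\<F>. \<forall>A\<in>\<F>. A \<subseteq> M \<longrightarrow> A = M"
    by (intro dcc_aboveD[OF dcc]) (auto simp: \<F>_def)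
  then obtain A where AF: "A \<in> \<F>" "\<And>B. B \<in> \<F> \<Longrightarrow> B \<subseteq> A \<Longrightarrow> B = A" by blast
  then have A: "left_ideal R A" "I \<subseteq> A" "fin_mod (carrier R) A" by (auto simp: \<F>_def)
  have Amin: "B = A" if "left_ideal R B" "I \<subseteq> B" "fin_mod (carrier R) B" "B \<subseteq> A" for B
    using AF(2) that by (simp add: \<F>_def)
  have "I \<noteq> A" using notfin A(3) by blast
  define \<G> where "\<G> = {B. left_ideal R B \<and> I \<subseteq> B \<and> B \<subset> A}"
  have "I \<in> \<G>" using \<open>I \<noteq> A\<close> I(1) A(2) by (auto simp: \<G>_def)
  then have "\<exists>M\<in>\<G>. \<forall>N\<in>\<G>. M \<subseteq> N \<longrightarrow> N = M"
    by (intro left_noetherian_maximal[OF R]) (auto simp: \<G>_def)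
  then obtain B where BG: "B \<in> \<G>" "\<And>N. N \<in> \<G> \<Longrightarrow> B \<subseteq> N \<Longrightarrow> N = B" by blast
  then have B: "left_ideal R B" "I \<subseteq> B" "B \<subset> A" by (auto simp: \<G>_def)
  have Bmax: "N = B" if "left_ideal R N" "N \<subset> A" "B \<subseteq> N" for N
    using BG(2) that B(2) by (simp add: \<G>_def)
  obtain a where a: "a \<in> A" "a \<notin> B" using B(3) by blast
  note AD = left_idealD[OF A(1)] and BD = left_idealD[OF B(1)]
  have ac: "a \<in> carrier R" using a AD(2) by blast
  \<comment> \<open>\<open>E M\<close> is \<open>M a + B\<close>. Nothing lies strictly between
    \<open>B\<close> and \<open>A\<close>, so it is all of \<open>A\<close> unless
    \<open>M a \<subseteq> B\<close>.\<close>
  define E where "E M = {s \<otimes> a \<oplus> b | s b. s \<in> M \<and> b \<in> B}" for M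
  have EI: "s \<otimes> a \<oplus> b \<in> E M" if "s \<in> M" "b \<in> B" for s b M using that by (auto simp: E_def)
  have EE: "\<exists>s b. x = s \<otimes> a \<oplus> b \<and> s \<in> M \<and> b \<in> B" if "x \<in> E M" for x M using that by (auto simp: E_def)
  have E_ideal: "left_ideal R (E M)" if M: "left_ideal R M" for M
  proof (rule left_idealI)
    note MD = left_idealD[OF M]
    show "E M \<subseteq> carrier R" using MD(2) BD(2) ac by (auto simp: E_def)
    show "\<zero> \<in> E M" using EI[OF MD(3) BD(3)] ac by simp
  next
    note MD = left_idealD[OF M]
    fix x y assume "x \<in> E M" "y \<in> E M"
    then obtain s b t c where *: "x = s \<otimes> a \<oplus> b" "y = t \<otimes> a \<oplus> c" "s \<in> M" "t \<in> M" "b \<in> B" "c \<in> B"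
      using EE[of x M] EE[of y M] by blast
    then have "x \<ominus> y = (s \<ominus> t) \<otimes> a \<oplus> (b \<ominus> c)" using MD(2) BD(2) ac by (simp add: diff_lin subset_iff)
    then show "x \<ominus> y \<in> E M" using EI[OF MD(5)[OF *(3,4)] BD(5)[OF *(5,6)]] by simp
  next
    note MD = left_idealD[OF M]
    fix t x assume t: "t \<in> carrier R" and "x \<in> E M"
    then obtain s b where *: "x = s \<otimes> a \<oplus> b" "s \<in> M" "b \<in> B" using EE[of x M] by blast
    then have "t \<otimes> x = (t \<otimes> s) \<otimes> a \<oplus> t \<otimes> b" using MD(2) BD(2) ac t by (simp add: r_distr m_assoc subset_iff)
    then show "t \<otimes> x \<in> E M" using EI[OF MD(7)[OF t *(2)] BD(7)[OF t *(3)]] by simp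
  qed
  have E_eq: "E M = A" if M: "left_ideal R M" and r: "r \<in> M" "r \<otimes> a \<notin> B" for M r
  proof (rule ccontr)
    note MD = left_idealD[OF M]
    assume "E M \<noteq> A"
    moreover have "x \<in> A" if "x \<in> E M" for x
    proof -
      obtain s b where *: "x = s \<otimes> a \<oplus> b" "s \<in> M" "b \<in> B" using EE[OF \<open>x \<in> E M\<close>] by blast
      then have "s \<otimes> a \<in> A" "b \<in> A" using AD(7)[OF _ a(1), of s] MD(2) B(3) by auto
      then show ?thesis using AD(4) *(1) by simp
    qed
    ultimately have "E M \<subset> A" by blast
    moreover have "B \<subseteq> E M"
    proof
      fix b assume "b \<in> B"
      then show "b \<in> E M" using EI[OF MD(3), of b] ac BD(2) by (simp add: subset_iff)
    qed
    ultimately have "E M = B" by (rule Bmax[OF E_ideal[OF M]])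
    then show False using EI[OF r(1) BD(3)] r MD(2) ac by (simp add: subset_iff)
  qed
  \<comment> \<open>\<open>A / B\<close> is generated by \<open>a\<close> and isomorphic to
    \<open>R / L\<close>, which makes \<open>L\<close> maximal.\<close>
  define L where "L = {r \<in> carrier R. r \<otimes> a \<in> B}"
  have L: "left_ideal R L"
    by (rule left_idealI) (use ac BD in \<open>auto simp: L_def l_distr_minus m_assoc\<close>)
  have IL: "I \<subseteq> L" using I(2)[OF _ ac] B(2) left_idealD(2)[OF I(1)] by (auto simp: L_def)
  have "maximal_left_ideal R F L"
  proof (unfold_locales)
    show "left_ideal R L" by (rule L)
    show "\<one> \<notin> L" using a ac by (simp add: L_def)
  next
    fix M assume M: "left_ideal R M" "L \<subseteq> M" "M \<noteq> L"
    note MD = left_idealD[OF M(1)]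
    obtain r where r: "r \<in> M" "r \<notin> L" using M(2,3) by blast
    then have "r \<otimes> a \<notin> B" using MD(2) by (auto simp: L_def)
    then have "a \<in> E M" using E_eq[OF M(1) r(1)] a(1) by simp
    then obtain s b where sb: "a = s \<otimes> a \<oplus> b" "s \<in> M" "b \<in> B" using EE by blast
    have s: "s \<in> carrier R" "b \<in> carrier R" using sb(2,3) MD(2) BD(2) by auto
    have "(\<one> \<ominus> s) \<otimes> a = a \<ominus> s \<otimes> a" using s ac by (simp add: l_distr_minus)
    also have "a \<ominus> s \<otimes> a = (b \<oplus> s \<otimes> a) \<ominus> s \<otimes> a"
      using sb(1) s ac a_comm[of "s \<otimes> a" b] by (intro arg_cong[where f = "\<lambda>z. z \<ominus> s \<otimes> a"]) simp
    also have "\<dots> = b" using s ac by (simp add: add_minus_cancel)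
    finally have "\<one> \<ominus> s \<in> L" using sb(3) s by (simp add: L_def)
    then have "(\<one> \<ominus> s) \<oplus> s \<in> M" using M(2) MD(4) sb(2) by blast
    then show "\<one> \<in> M" using s by (simp add: minus_add_cancel)
  qed
  then have "fin_mod (carrier R) L" using simple IL by blast
  then have "fin_mod ((\<lambda>r. r \<otimes> a) ` carrier R) B"
    by (rule fin_mod_image[OF _ ksub_left_ideal[OF B(1)] _ _ _ _ ksub_left_ideal[OF L]])
      (use ac in \<open>auto simp: l_distr m_assoc L_def\<close>)
  then obtain fs where fs: "set fs \<subseteq> carrier R" "(\<lambda>r. r \<otimes> a) ` carrier R \<subseteq> kspan fs B" unfolding fin_mod_def by blast
  note ks = ksub_kspan[OF ksub_left_ideal[OF B(1)] fs(1)]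
  have "left_ideal R (carrier R)" by (rule left_idealI) auto
  from E_eq[OF this one_closed] have AE: "A = E (carrier R)" using a ac by simp
  have "x \<in> kspan fs B" if "x \<in> A" for x
  proof -
    obtain s b where *: "x = s \<otimes> a \<oplus> b" "s \<in> carrier R" "b \<in> B" using EE \<open>x \<in> A\<close> AE by blast
    have "s \<otimes> a \<in> kspan fs B" using fs(2) *(2) by blast
    moreover have "b \<in> kspan fs B" using kspan_upper[OF ksub_left_ideal[OF B(1)] fs(1)] *(3) by blast
    ultimately show ?thesis using ksubD(5)[OF ks] *(1) by simp
  qed
  then have "fin_mod A B" using fs(1) unfolding fin_mod_def by blast
  then have "fin_mod (carrier R) B" using fin_mod_trans[OF A(3) _ ksub_left_ideal[OF B(1)]] by blast
  then have "B = A" using Amin[OF B(1,2)] B(3) by blast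
  then show False using B(3) by blast
qed

end

section \<open>Duals of left ideals in the classical quotient ring\<close>

locale quotient_ring = ring R + Q: ring Q
  for R (structure) and Q :: "('q, 'n) ring_scheme" +
  fixes \<iota>
  assumes quot: "classical_quotient_ring R Q \<iota>"
begin

lemma \<iota>_hom: "\<iota> \<in> ring_hom R Q" and \<iota>_inj: "inj_on \<iota> (carrier R)"
  using quot unfolding classical_quotient_ring_def by auto

lemma \<iota>_closed: "x \<in> carrier R \<Longrightarrow> \<iota> x \<in> carrier Q"
  and \<iota>_mult: "x \<in> carrier R \<Longrightarrow> y \<in> carrier R \<Longrightarrow> \<iota> (x \<otimes> y) = \<iota> x \<otimes>\<^bsub>Q\<^esub> \<iota> y"
  and \<iota>_add: "x \<in> carrier R \<Longrightarrow> y \<in> carrier R \<Longrightarrow> \<iota> (x \<oplus> y) = \<iota> x \<oplus>\<^bsub>Q\<^esub> \<iota> y"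
  and \<iota>_one: "\<iota> \<one> = \<one>\<^bsub>Q\<^esub>"
  using ring_hom_memE[OF \<iota>_hom] by auto

lemma \<iota>_zero: "\<iota> \<zero> = \<zero>\<^bsub>Q\<^esub>"
  by (rule ring_hom_zero[OF \<iota>_hom ring_axioms Q.ring_axioms])

lemma \<iota>_diff: "x \<in> carrier R \<Longrightarrow> y \<in> carrier R \<Longrightarrow> \<iota> (x \<ominus> y) = \<iota> x \<ominus>\<^bsub>Q\<^esub> \<iota> y"
  using \<iota>_add[of "x \<ominus> y" y] Q.add_minus_cancel[of "\<iota> (x \<ominus> y)" "\<iota> y"] by (simp add: \<iota>_closed minus_add_cancel)

lemma \<iota>_eq_iff: "x \<in> carrier R \<Longrightarrow> y \<in> carrier R \<Longrightarrow> \<iota> x = \<iota> y \<longleftrightarrow> x = y"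
  using \<iota>_inj by (auto dest: inj_onD)

lemma regular_unit: "s \<in> regular_elements R \<Longrightarrow> \<iota> s \<in> Units Q"
  and right_fraction: "q \<in> carrier Q \<Longrightarrow> \<exists>r\<in>carrier R. \<exists>s\<in>regular_elements R. q = \<iota> r \<otimes>\<^bsub>Q\<^esub> inv\<^bsub>Q\<^esub> \<iota> s"
  and left_fraction: "q \<in> carrier Q \<Longrightarrow> \<exists>r\<in>carrier R. \<exists>s\<in>regular_elements R. q = inv\<^bsub>Q\<^esub> \<iota> s \<otimes>\<^bsub>Q\<^esub> \<iota> r"
  using quot unfolding classical_quotient_ring_def by blast+

lemma regular_carrier: "s \<in> regular_elements R \<Longrightarrow> s \<in> carrier R"
  by (auto simp: regular_elements_def)

lemma regular_one: "\<one> \<in> regular_elements R"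
  by (auto simp: regular_elements_def)

lemma regularD: "s \<in> regular_elements R \<Longrightarrow> r \<in> carrier R \<Longrightarrow> s \<otimes> r = \<zero> \<Longrightarrow> r = \<zero>"
  "s \<in> regular_elements R \<Longrightarrow> r \<in> carrier R \<Longrightarrow> r \<otimes> s = \<zero> \<Longrightarrow> r = \<zero>"
  unfolding regular_elements_def by blast+

lemma regularI: "s \<in> carrier R \<Longrightarrow> (\<And>r. r \<in> carrier R \<Longrightarrow> s \<otimes> r = \<zero> \<Longrightarrow> r = \<zero>) \<Longrightarrow>
    (\<And>r. r \<in> carrier R \<Longrightarrow> r \<otimes> s = \<zero> \<Longrightarrow> r = \<zero>) \<Longrightarrow> s \<in> regular_elements R"
  unfolding regular_elements_def by blast

lemma regular_mult:
  assumes "s \<in> regular_elements R" "t \<in> regular_elements R"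
  shows "s \<otimes> t \<in> regular_elements R"
proof -
  note c = regular_carrier[OF assms(1)] regular_carrier[OF assms(2)]
  have 1: "r = \<zero>" if "r \<in> carrier R" "s \<otimes> t \<otimes> r = \<zero>" for r
    using regularD(1)[OF assms(1), of "t \<otimes> r"] regularD(1)[OF assms(2) that(1)] that c by (simp add: m_assoc)
  have 2: "r = \<zero>" if "r \<in> carrier R" "r \<otimes> (s \<otimes> t) = \<zero>" for r
    using regularD(2)[OF assms(2), of "r \<otimes> s"] regularD(2)[OF assms(1) that(1)] that c by (simp add: m_assoc)
  show ?thesis by (rule regularI[OF m_closed[OF c] 1 2])
qed

context
  fixes s
  assumes s: "s \<in> regular_elements R"
begin

lemma s_carrier: "s \<in> carrier R"
  using regular_carrier[OF s] .

lemma s_inv: "inv\<^bsub>Q\<^esub> \<iota> s \<in> carrier Q" "inv\<^bsub>Q\<^esub> \<iota> s \<otimes>\<^bsub>Q\<^esub> \<iota> s = \<one>\<^bsub>Q\<^esub>"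
  using regular_unit[OF s] by auto

text \<open>Up to the factor \<open>s\<close>, this is the dual of the left ideal \<open>A\<close>.\<close>

definition dual :: "'a set \<Rightarrow> 'a set" where
  "dual A = {x \<in> carrier R. \<forall>a\<in>A. \<iota> a \<otimes>\<^bsub>Q\<^esub> inv\<^bsub>Q\<^esub> \<iota> s \<otimes>\<^bsub>Q\<^esub> \<iota> x \<in> \<iota> ` carrier R}"

lemma dual_right_ideal:
  assumes "A \<subseteq> carrier R"
  shows "left_ideal (opposite_ring R) (dual A)"
proof (rule right_idealI)
  have Ac: "\<iota> a \<otimes>\<^bsub>Q\<^esub> inv\<^bsub>Q\<^esub> \<iota> s \<in> carrier Q" if "a \<in> A" for a
    using that assms s_inv(1) \<iota>_closed by auto
  show "dual A \<subseteq> carrier R" by (auto simp: dual_def)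
  show "\<zero> \<in> dual A" using Ac by (auto simp: dual_def \<iota>_zero intro!: image_eqI[of _ _ \<zero>])
  show "x \<ominus> y \<in> dual A" if "x \<in> dual A" "y \<in> dual A" for x y
  proof -
    have xy: "x \<in> carrier R" "y \<in> carrier R" using that by (auto simp: dual_def)
    have "\<iota> a \<otimes>\<^bsub>Q\<^esub> inv\<^bsub>Q\<^esub> \<iota> s \<otimes>\<^bsub>Q\<^esub> \<iota> (x \<ominus> y) \<in> \<iota> ` carrier R" if a: "a \<in> A" for a
    proof -
      obtain u v where uv: "u \<in> carrier R" "v \<in> carrier R" "\<iota> a \<otimes>\<^bsub>Q\<^esub> inv\<^bsub>Q\<^esub> \<iota> s \<otimes>\<^bsub>Q\<^esub> \<iota> x = \<iota> u"
        "\<iota> a \<otimes>\<^bsub>Q\<^esub> inv\<^bsub>Q\<^esub> \<iota> s \<otimes>\<^bsub>Q\<^esub> \<iota> y = \<iota> v"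
        using \<open>x \<in> dual A\<close> \<open>y \<in> dual A\<close> a unfolding dual_def by blast
      then have "\<iota> a \<otimes>\<^bsub>Q\<^esub> inv\<^bsub>Q\<^esub> \<iota> s \<otimes>\<^bsub>Q\<^esub> \<iota> (x \<ominus> y) = \<iota> (u \<ominus> v)"
        using Ac[OF a] xy by (simp add: \<iota>_diff Q.r_distr_minus \<iota>_closed)
      then show ?thesis using uv by simp
    qed
    then show ?thesis using xy by (simp add: dual_def)
  qed
  show "x \<otimes> r \<in> dual A" if "r \<in> carrier R" "x \<in> dual A" for r x
  proof -
    have xy: "x \<in> carrier R" using that by (auto simp: dual_def)
    have "\<iota> a \<otimes>\<^bsub>Q\<^esub> inv\<^bsub>Q\<^esub> \<iota> s \<otimes>\<^bsub>Q\<^esub> \<iota> (x \<otimes> r) \<in> \<iota> ` carrier R" if a: "a \<in> A" for a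
    proof -
      obtain u where u: "u \<in> carrier R" "\<iota> a \<otimes>\<^bsub>Q\<^esub> inv\<^bsub>Q\<^esub> \<iota> s \<otimes>\<^bsub>Q\<^esub> \<iota> x = \<iota> u"
        using \<open>x \<in> dual A\<close> a unfolding dual_def by blast
      have "\<iota> a \<otimes>\<^bsub>Q\<^esub> inv\<^bsub>Q\<^esub> \<iota> s \<otimes>\<^bsub>Q\<^esub> \<iota> (x \<otimes> r) = (\<iota> a \<otimes>\<^bsub>Q\<^esub> inv\<^bsub>Q\<^esub> \<iota> s \<otimes>\<^bsub>Q\<^esub> \<iota> x) \<otimes>\<^bsub>Q\<^esub> \<iota> r"
        using Ac[OF a] xy \<open>r \<in> carrier R\<close> by (simp add: \<iota>_mult Q.m_assoc \<iota>_closed)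
      then show ?thesis using u \<open>r \<in> carrier R\<close> by (simp add: \<iota>_mult[symmetric])
    qed
    then show ?thesis using xy that by (simp add: dual_def)
  qed
qed

text \<open>Every \<open>R\<close>-linear map from a left ideal containing \<open>s\<close> to \<open>R\<close> is right multiplication by an
  element of \<open>Q\<close>.\<close>

lemma linear_map_dual:
  assumes A: "left_ideal R A" "s \<in> A"
    and f: "\<And>a. a \<in> A \<Longrightarrow> f a \<in> carrier R"
      "\<And>r a. r \<in> carrier R \<Longrightarrow> a \<in> A \<Longrightarrow> f (r \<otimes> a) = r \<otimes> f a"
  shows "f s \<in> dual A"
proof -
  have "\<iota> a \<otimes>\<^bsub>Q\<^esub> inv\<^bsub>Q\<^esub> \<iota> s \<otimes>\<^bsub>Q\<^esub> \<iota> (f s) \<in> \<iota> ` carrier R" if a: "a \<in> A" for a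
  proof -
    have ac: "a \<in> carrier R" using a left_idealD(2)[OF A(1)] by blast
    then obtain u t where ut: "u \<in> carrier R" "t \<in> regular_elements R"
      "\<iota> a \<otimes>\<^bsub>Q\<^esub> inv\<^bsub>Q\<^esub> \<iota> s = inv\<^bsub>Q\<^esub> \<iota> t \<otimes>\<^bsub>Q\<^esub> \<iota> u"
      using left_fraction[of "\<iota> a \<otimes>\<^bsub>Q\<^esub> inv\<^bsub>Q\<^esub> \<iota> s"] s_inv(1) \<iota>_closed by auto
    note t = regular_carrier[OF ut(2)] regular_unit[OF ut(2)]
    note cl = \<iota>_closed[OF ac] \<iota>_closed[OF s_carrier] \<iota>_closed[OF ut(1)] \<iota>_closed[OF t(1)] s_inv
    have "\<iota> t \<otimes>\<^bsub>Q\<^esub> \<iota> a = \<iota> t \<otimes>\<^bsub>Q\<^esub> (\<iota> a \<otimes>\<^bsub>Q\<^esub> inv\<^bsub>Q\<^esub> \<iota> s) \<otimes>\<^bsub>Q\<^esub> \<iota> s"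
      using cl by (simp add: Q.m_assoc)
    also have "\<dots> = \<iota> u \<otimes>\<^bsub>Q\<^esub> \<iota> s" unfolding ut(3) using cl t(2) by (simp add: Q.m_assoc[symmetric])
    finally have "t \<otimes> a = u \<otimes> s" using ac ut(1) t(1) s_carrier by (simp add: \<iota>_mult[symmetric] \<iota>_eq_iff)
    then have "t \<otimes> f a = u \<otimes> f s" using f(2)[OF t(1) a] f(2)[OF ut(1) A(2)] by simp
    then have "\<iota> t \<otimes>\<^bsub>Q\<^esub> \<iota> (f a) = \<iota> u \<otimes>\<^bsub>Q\<^esub> \<iota> (f s)" using f(1) a A(2) t(1) ut(1) by (simp add: \<iota>_mult[symmetric])
    moreover have "inv\<^bsub>Q\<^esub> \<iota> t \<otimes>\<^bsub>Q\<^esub> (\<iota> t \<otimes>\<^bsub>Q\<^esub> \<iota> (f a)) = \<iota> (f a)"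
      using t cl f(1)[OF a] by (simp add: Q.m_assoc[symmetric] \<iota>_closed)
    ultimately have "\<iota> a \<otimes>\<^bsub>Q\<^esub> inv\<^bsub>Q\<^esub> \<iota> s \<otimes>\<^bsub>Q\<^esub> \<iota> (f s) = \<iota> (f a)"
      unfolding ut(3) using cl t f(1)[OF A(2)] by (simp add: Q.m_assoc \<iota>_closed)
    then show ?thesis using f(1)[OF a] by simp
  qed
  then show ?thesis using f(1)[OF A(2)] by (simp add: dual_def)
qed

text \<open>The dual basis lemma. Projectivity embeds \<open>A\<close> as a direct summand of a free
  module; the coordinates of \<open>s\<close> lie in \<open>dual A\<close>, and projecting its
  expansion in the basis back to \<open>A\<close> writes \<open>s\<close> as a sum of products of
  elements of \<open>dual A\<close> and \<open>A\<close>. Any additive subgroup \<open>N\<close>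
  containing such products therefore contains \<open>s\<close>.\<close>

lemma dual_basis:
  assumes her: "left_hereditary R" and A: "left_ideal R A" "s \<in> A"
    and N: "additive_subgroup N R" "\<And>x b. x \<in> dual A \<Longrightarrow> b \<in> A \<Longrightarrow> x \<otimes> b \<in> N"
  shows "s \<in> N"
proof -
  note AD = left_idealD[OF A(1)]
  let ?M = "regular_left_module R \<lparr>carrier := A\<rparr>"
  have "projective_left_module R ?M" using her A(1) by (simp add: left_hereditary_def)
  then obtain S :: "'a set" and N1 N2 h where
    N1: "left_submodule R N1 (free_left_module R S)" and N2: "left_submodule R N2 (free_left_module R S)"
    and int: "N1 \<inter> N2 = {\<zero>\<^bsub>free_left_module R S\<^esub>}"
    and sum: "N1 <+>\<^bsub>free_left_module R S\<^esub> N2 = carrier (free_left_module R S)"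
    and h: "h \<in> left_module_hom R ?M (free_left_module R S \<lparr>carrier := N1\<rparr>)"
      "bij_betw h (carrier ?M) (carrier (free_left_module R S \<lparr>carrier := N1\<rparr>))"
    unfolding projective_left_module_def left_module_iso_def by blast
  let ?\<Phi> = "free_left_module R S"
  have simps: "carrier ?M = A" "x \<oplus>\<^bsub>?M\<^esub> y = x \<oplus> y" "r \<odot>\<^bsub>?M\<^esub> x = r \<otimes> x" for x y r
    by (simp_all add: regular_left_module_def)
  have fsimps: "f \<oplus>\<^bsub>?\<Phi>\<^esub> g = (\<lambda>i. f i \<oplus> g i)" "\<zero>\<^bsub>?\<Phi>\<^esub> = (\<lambda>i. \<zero>)" "r \<odot>\<^bsub>?\<Phi>\<^esub> f = (\<lambda>i. r \<otimes> f i)" for f g r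
    by (simp_all add: free_left_module_def)
  have fcar: "f i \<in> carrier R" if "f \<in> carrier ?\<Phi>" for f i
    using that by (cases "i \<in> S") (auto simp: free_left_module_def)
  have hbij: "bij_betw h A N1" using h(2) by (simp add: simps)
  have hN: "h a \<in> N1" if "a \<in> A" for a using hbij that by (auto simp: bij_betw_def)
  have hadd: "h (x \<oplus> y) = (\<lambda>i. h x i \<oplus> h y i)" if "x \<in> A" "y \<in> A" for x y
    using h(1) that by (simp add: left_module_hom_def regular_left_module_def fsimps)
  have hmult: "h (r \<otimes> x) = (\<lambda>i. r \<otimes> h x i)" if "r \<in> carrier R" "x \<in> A" for r x
    using h(1) that by (simp add: left_module_hom_def regular_left_module_def fsimps)
  have sub: "N1 \<subseteq> carrier ?\<Phi>" "N2 \<subseteq> carrier ?\<Phi>"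
    using N1 N2 additive_subgroup.a_subset unfolding left_submodule_def by blast+
  have N2_add: "(\<lambda>i. f i \<oplus> g i) \<in> N2" if "f \<in> N2" "g \<in> N2" for f g
  proof -
    have "subgroup N2 (add_monoid ?\<Phi>)" using N2 by (simp add: left_submodule_def additive_subgroup_def)
    from subgroup.m_closed[OF this that] show ?thesis by (simp add: fsimps)
  qed
  have N2_mult: "(\<lambda>i. r \<otimes> f i) \<in> N2" if "r \<in> carrier R" "f \<in> N2" for r f
    using N2 that by (simp add: left_submodule_def fsimps)
  have N2_zero: "(\<lambda>i. \<zero>) \<in> N2"
    using int by (auto simp: fsimps)
  have dec: "\<exists>b n. b \<in> A \<and> n \<in> N2 \<and> (\<forall>i. f i = h b i \<oplus> n i)" if "f \<in> carrier ?\<Phi>" for f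
  proof -
    have "f \<in> N1 <+>\<^bsub>?\<Phi>\<^esub> N2" using that sum by simp
    then obtain p n where pn: "p \<in> N1" "n \<in> N2" "f = p \<oplus>\<^bsub>?\<Phi>\<^esub> n" unfolding set_add_def' by blast
    obtain b where "b \<in> A" "p = h b" using hbij pn(1) by (auto simp: bij_betw_def)
    then show ?thesis using pn by (auto simp: fsimps)
  qed
  have hs_dual: "h s i \<in> dual A" for i
  proof (rule linear_map_dual[OF A])
    show "h a i \<in> carrier R" if "a \<in> A" for a using fcar hN[OF that] sub by blast
    show "h (r \<otimes> a) i = r \<otimes> h a i" if "r \<in> carrier R" "a \<in> A" for r a using hmult[OF that] by simp
  qed
  \<comment> \<open>Only vectors with all coordinates in \<open>dual A\<close> are projected; then
    each summand \<open>f j \<otimes> b\<close> is one of the products known to be in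
    \<open>N\<close>.\<close>
  have main: "\<exists>b\<in>A \<inter> N. \<exists>n\<in>N2. \<forall>i. f i = h b i \<oplus> n i"
    if "f \<in> carrier ?\<Phi>" "\<And>i. f i \<in> dual A" "{i. f i \<noteq> \<zero>} \<subseteq> Y" "finite Y" for f Y
    using that(4,1-3)
  proof (induction Y arbitrary: f rule: finite_induct)
    case empty
    have "h \<zero> i = \<zero>" for i
    proof -
      have "h \<zero> i \<in> carrier R" using fcar hN[OF AD(3)] sub(1) by blast
      then show ?thesis using fun_cong[OF hmult[OF zero_closed AD(3)], of i] by simp
    qed
    then show ?case using empty AD(3) additive_subgroup.zero_closed[OF N(1)] N2_zero
      by (intro bexI[of _ \<zero>] bexI[of _ "\<lambda>i. \<zero>"]) auto
  next
    case (insert j Y)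
    note fc = fcar[OF insert.prems(1)]
    show ?case
    proof (cases "j \<in> S")
      case False
      then have "f j = \<zero>" using insert.prems(1) by (auto simp: free_left_module_def)
      then have "{i. f i \<noteq> \<zero>} \<subseteq> Y" using insert.prems(3) by auto
      then show ?thesis using insert.IH insert.prems by blast
    next
      case True
      let ?e = "\<lambda>i. if i = j then \<one> else \<zero>"
      have fin: "finite {i. f i \<noteq> \<zero>}" using insert.prems(1) by (simp add: free_left_module_def)
      have "finite {i. ?e i \<noteq> \<zero>}" by (rule finite_subset[of _ "{j}"]) auto
      then have "?e \<in> carrier ?\<Phi>" using True by (auto simp: free_left_module_def)
      then obtain b n where b: "b \<in> A" "n \<in> N2" "\<And>i. ?e i = h b i \<oplus> n i" using dec by blast
      let ?f = "\<lambda>i. if i = j then \<zero> else f i"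
      have "finite {i. ?f i \<noteq> \<zero>}" by (rule finite_subset[OF _ fin]) auto
      then have "?f \<in> carrier ?\<Phi>" using insert.prems(1) by (auto simp: free_left_module_def)
      moreover have "?f i \<in> dual A" for i
        using insert.prems(2)
          ring.left_idealD(3)[OF ring_opposite_ring dual_right_ideal[OF AD(2)]]
        by (simp add: opposite_ring_simps)
      moreover have "{i. ?f i \<noteq> \<zero>} \<subseteq> Y" using insert.prems(3) by auto
      ultimately obtain b' n' where b': "b' \<in> A \<inter> N" "n' \<in> N2" "\<And>i. ?f i = h b' i \<oplus> n' i"
        using insert.IH[of ?f] by blast
      let ?b = "f j \<otimes> b \<oplus> b'"
      have fb: "f j \<otimes> b \<in> A" using AD(7)[OF fc b(1)] .
      have bN: "?b \<in> A \<inter> N"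
        using AD(4)[OF fb] b'(1) additive_subgroup.a_closed[OF N(1) N(2)[OF insert.prems(2) b(1)]] by blast
      have nN: "(\<lambda>i. f j \<otimes> n i \<oplus> n' i) \<in> N2" using N2_add[OF N2_mult[OF fc b(2)] b'(2)] .
      have eq: "f i = h ?b i \<oplus> (f j \<otimes> n i \<oplus> n' i)" for i
      proof -
        have cl: "h b i \<in> carrier R" "h b' i \<in> carrier R" "n i \<in> carrier R" "n' i \<in> carrier R"
          using fcar hN[OF b(1)] hN[of b'] b'(1,2) b(2) sub by auto
        have "h ?b i = f j \<otimes> h b i \<oplus> h b' i" using hadd[OF fb] hmult[OF fc b(1)] b'(1) by simp
        then have "h ?b i \<oplus> (f j \<otimes> n i \<oplus> n' i) = f j \<otimes> (h b i \<oplus> n i) \<oplus> (h b' i \<oplus> n' i)"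
          using cl fc[of j] by (simp add: r_distr a_ac)
        also have "\<dots> = f j \<otimes> ?e i \<oplus> ?f i" using b(3) b'(3) by simp
        also have "\<dots> = f i" using fc by simp
        finally show ?thesis by simp
      qed
      show ?thesis by (intro bexI[OF _ bN] bexI[OF _ nN] allI eq)
    qed
  qed
  have hsc: "h s \<in> carrier ?\<Phi>" using hN[OF A(2)] sub by blast
  then have "finite {i. h s i \<noteq> \<zero>}" by (simp add: free_left_module_def)
  from main[OF hsc hs_dual order_refl this] obtain b n where b: "b \<in> A" "b \<in> N" "n \<in> N2" "\<And>i. h s i = h b i \<oplus> n i"
    by blast
  have sb: "s \<ominus> b \<in> A" using AD(5)[OF A(2) b(1)] .
  have bc: "b \<in> carrier R" using b(1) AD(2) by blast
  have "n i = h (s \<ominus> b) i" for i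
  proof -
    have cl: "h b i \<in> carrier R" "n i \<in> carrier R" "h (s \<ominus> b) i \<in> carrier R"
      using fcar hN[OF b(1)] hN[OF sb] b(3) sub by auto
    have "h b i \<oplus> n i = h b i \<oplus> h (s \<ominus> b) i"
      using b(4)[of i] hadd[OF b(1) sb] bc s_carrier by (simp add: add_minus_cancel')
    then show ?thesis using cl by simp
  qed
  then have "n = h (s \<ominus> b)" by (rule ext)
  then have "h (s \<ominus> b) \<in> N1 \<inter> N2" using b(3) hN[OF sb] by simp
  then have z: "h (s \<ominus> b) = (\<lambda>i. \<zero>)" using int by (simp add: fsimps)
  have "h (\<zero> \<otimes> s) = (\<lambda>i. \<zero>)"
    using hmult[OF zero_closed A(2)] fcar[OF hsc] by simp
  then have "h \<zero> = h (s \<ominus> b)" using z s_carrier by simp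
  then have "s \<ominus> b = \<zero>" using hbij sb AD(3) unfolding bij_betw_def inj_on_def by metis
  then have "s = b" using minus_add_cancel[OF s_carrier bc] bc by simp
  then show ?thesis using b(2) by simp
qed

text \<open>Duals reverse inclusions and are right ideals, so a maximal dual exists. Let
  \<open>B \<subseteq> A\<close> have the same dual and let \<open>a \<in> A\<close>. Then
  \<open>a = (a s^-1) s\<close>, where \<open>s\<close> is a sum of products \<open>x b\<close> with
  \<open>x \<in> dual A\<close> and \<open>b \<in> B\<close>; since \<open>a s^-1 x\<close> lies in
  \<open>R\<close>, the element \<open>a\<close> lies in \<open>B\<close>.\<close>

lemma hereditary_dcc:
  assumes "left_hereditary R" "left_noetherian (opposite_ring R)" "s \<in> I"
  shows "dcc_above R I"
  unfolding dcc_above_def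
proof (intro allI impI)
  fix \<F> assume F: "\<F> \<noteq> {}" "\<forall>A\<in>\<F>. left_ideal R A \<and> I \<subseteq> A"
  have Ac: "A \<subseteq> carrier R" if "A \<in> \<F>" for A using F(2) that left_idealD(2) by blast
  have "\<exists>M\<in>dual ` \<F>. \<forall>N\<in>dual ` \<F>. M \<subseteq> N \<longrightarrow> N = M"
    by (rule left_noetherian_maximal[OF assms(2)]) (use F(1) dual_right_ideal Ac in auto)
  then obtain A where A: "A \<in> \<F>" "\<And>B. B \<in> \<F> \<Longrightarrow> dual A \<subseteq> dual B \<Longrightarrow> dual B = dual A" by auto
  have "B = A" if B: "B \<in> \<F>" "B \<subseteq> A" for B
  proof
    have "dual A \<subseteq> dual B" using B(2) by (auto simp: dual_def)
    then have eq: "dual B = dual A" using A(2) B(1) by blast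
    have Bl: "left_ideal R B" "s \<in> B" using F(2) B(1) assms(3) by auto
    note BD = left_idealD[OF Bl(1)]
    show "A \<subseteq> B"
    proof
      fix a assume a: "a \<in> A"
      then have ac: "a \<in> carrier R" using Ac A(1) by blast
      let ?q = "\<iota> a \<otimes>\<^bsub>Q\<^esub> inv\<^bsub>Q\<^esub> \<iota> s"
      have q: "?q \<in> carrier Q" using ac s_inv(1) \<iota>_closed by simp
      have "s \<in> {x \<in> carrier R. ?q \<otimes>\<^bsub>Q\<^esub> \<iota> x \<in> \<iota> ` B}"
      proof (rule dual_basis[OF assms(1) Bl])
        show "additive_subgroup {x \<in> carrier R. ?q \<otimes>\<^bsub>Q\<^esub> \<iota> x \<in> \<iota> ` B} R"
        proof (rule additive_subgroup_diffI)
          show "\<zero> \<in> {x \<in> carrier R. ?q \<otimes>\<^bsub>Q\<^esub> \<iota> x \<in> \<iota> ` B}" using q BD(3) by (auto simp: \<iota>_zero intro!: image_eqI[of _ _ \<zero>])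
        next
          fix x y assume "x \<in> {x \<in> carrier R. ?q \<otimes>\<^bsub>Q\<^esub> \<iota> x \<in> \<iota> ` B}" "y \<in> {x \<in> carrier R. ?q \<otimes>\<^bsub>Q\<^esub> \<iota> x \<in> \<iota> ` B}"
          then obtain u v where *: "x \<in> carrier R" "y \<in> carrier R" "u \<in> B" "v \<in> B" "?q \<otimes>\<^bsub>Q\<^esub> \<iota> x = \<iota> u" "?q \<otimes>\<^bsub>Q\<^esub> \<iota> y = \<iota> v" by blast
          then have "?q \<otimes>\<^bsub>Q\<^esub> \<iota> (x \<ominus> y) = \<iota> (u \<ominus> v)"
            using q BD(2) by (simp add: \<iota>_diff Q.r_distr_minus \<iota>_closed subset_iff)
          then show "x \<ominus> y \<in> {x \<in> carrier R. ?q \<otimes>\<^bsub>Q\<^esub> \<iota> x \<in> \<iota> ` B}" using * BD(5) by simp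
        qed auto
      next
        fix x b assume x: "x \<in> dual B" and b: "b \<in> B"
        have xc: "x \<in> carrier R" "b \<in> carrier R" using x b BD(2) by (auto simp: dual_def)
        have "?q \<otimes>\<^bsub>Q\<^esub> \<iota> x \<in> \<iota> ` carrier R" using x[unfolded eq] a by (simp add: dual_def)
        then obtain y where y: "y \<in> carrier R" "?q \<otimes>\<^bsub>Q\<^esub> \<iota> x = \<iota> y" by blast
        have "?q \<otimes>\<^bsub>Q\<^esub> \<iota> (x \<otimes> b) = (?q \<otimes>\<^bsub>Q\<^esub> \<iota> x) \<otimes>\<^bsub>Q\<^esub> \<iota> b" using q xc by (simp add: \<iota>_mult \<iota>_closed Q.m_assoc)
        also have "\<dots> = \<iota> (y \<otimes> b)" using y xc by (simp add: \<iota>_mult)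
        finally show "x \<otimes> b \<in> {x \<in> carrier R. ?q \<otimes>\<^bsub>Q\<^esub> \<iota> x \<in> \<iota> ` B}" using BD(7)[OF y(1) b] xc by simp
      qed
      then obtain b where b: "b \<in> B" "?q \<otimes>\<^bsub>Q\<^esub> \<iota> s = \<iota> b" by blast
      have "?q \<otimes>\<^bsub>Q\<^esub> \<iota> s = \<iota> a" using s_inv ac s_carrier \<iota>_closed by (simp add: Q.m_assoc)
      then have "a = b" using b ac BD(2) \<iota>_eq_iff[of a b] by auto
      then show "a \<in> B" using b(1) by simp
    qed
  qed (rule B(2))
  then show "\<exists>M\<in>\<F>. \<forall>A\<in>\<F>. A \<subseteq> M \<longrightarrow> A = M" using A(1) by blast
qed

end

end

section \<open>Powers of an invertible ideal\<close>

context ring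
begin

lemma ideal_prod_subsetI:
  assumes "\<And>a b. a \<in> A \<Longrightarrow> b \<in> B \<Longrightarrow> a \<otimes> b \<in> N" "\<And>x y. x \<in> N \<Longrightarrow> y \<in> N \<Longrightarrow> x \<oplus> y \<in> N"
  shows "A \<cdot> B \<subseteq> N"
proof
  fix x assume "x \<in> A \<cdot> B"
  then show "x \<in> N" by induction (use assms in blast)+
qed

lemma ideal_prod_carrier:
  assumes "A \<subseteq> carrier R" "B \<subseteq> carrier R"
  shows "A \<cdot> B \<subseteq> carrier R"
  by (rule ideal_prod_subsetI) (use assms in auto)

text \<open>Stated for subsets, because the factors used later are subbimodules of \<open>Q\<close>
  and need not be ideals of it.\<close>

lemma ideal_prod_set_assoc:
  assumes "A \<subseteq> carrier R" "B \<subseteq> carrier R" "C \<subseteq> carrier R"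
  shows "A \<cdot> B \<cdot> C = A \<cdot> (B \<cdot> C)"
proof
  note AB = ideal_prod_carrier[OF assms(1,2)] and BC = ideal_prod_carrier[OF assms(2,3)]
  show "A \<cdot> B \<cdot> C \<subseteq> A \<cdot> (B \<cdot> C)"
  proof (rule ideal_prod_subsetI)
    fix x c assume "x \<in> A \<cdot> B" "c \<in> C"
    then show "x \<otimes> c \<in> A \<cdot> (B \<cdot> C)"
    proof (induction rule: ideal_prod.induct)
      case (prod a b)
      then have "(a \<otimes> b) \<otimes> c = a \<otimes> (b \<otimes> c)" using assms by (simp add: m_assoc subset_iff)
      then show ?case using prod by (simp add: ideal_prod.prod)
    next
      case (sum x y)
      then have "(x \<oplus> y) \<otimes> c = x \<otimes> c \<oplus> y \<otimes> c" using AB assms(3) by (simp add: l_distr subset_iff)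
      then show ?case using sum by (simp add: ideal_prod.sum)
    qed
  qed (rule ideal_prod.sum)
  show "A \<cdot> (B \<cdot> C) \<subseteq> A \<cdot> B \<cdot> C"
  proof (rule ideal_prod_subsetI)
    fix a x assume "a \<in> A" "x \<in> B \<cdot> C"
    from this(2,1) show "a \<otimes> x \<in> A \<cdot> B \<cdot> C"
    proof (induction rule: ideal_prod.induct)
      case (prod b c)
      then have "a \<otimes> (b \<otimes> c) = (a \<otimes> b) \<otimes> c" using assms by (simp add: m_assoc subset_iff)
      then show ?case using prod by (simp add: ideal_prod.prod)
    next
      case (sum x y)
      then have "a \<otimes> (x \<oplus> y) = a \<otimes> x \<oplus> a \<otimes> y" using BC assms(1) by (simp add: r_distr subset_iff)
      then show ?case using sum by (simp add: ideal_prod.sum)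
    qed
  qed (rule ideal_prod.sum)
qed

primrec right_span :: "'a list \<Rightarrow> 'a set" where
  "right_span [] = {\<zero>}"
| "right_span (x # xs) = {x \<otimes> a \<oplus> y | a y. a \<in> carrier R \<and> y \<in> right_span xs}"

lemma right_span_right_ideal: "set xs \<subseteq> carrier R \<Longrightarrow> left_ideal (opposite_ring R) (right_span xs)"
proof (induction xs)
  case Nil
  show ?case by (rule right_idealI) (auto simp: minus_self)
next
  case (Cons x xs)
  then have x: "x \<in> carrier R" and I: "left_ideal (opposite_ring R) (right_span xs)" by auto
  note ID = ring.left_idealD[OF ring_opposite_ring I, unfolded opposite_ring_simps]
  have add: "y \<oplus> z \<in> right_span xs" if "y \<in> right_span xs" "z \<in> right_span xs" for y z using ID(4)[OF that] .
  have mult: "y \<otimes> r \<in> right_span xs" if "y \<in> right_span xs" "r \<in> carrier R" for y r using ID(7)[OF that(2,1)] .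
  have c: "y \<in> carrier R" if "y \<in> right_span xs" for y using ID(2) that by blast
  have diff: "y \<ominus> z \<in> right_span xs" if "y \<in> right_span xs" "z \<in> right_span xs" for y z
    using add[OF that(1) mult[OF that(2), of "\<ominus> \<one>"]] c[OF that(2)] by (simp add: a_minus_def r_minus)
  show ?case
  proof (rule right_idealI)
    show "right_span (x # xs) \<subseteq> carrier R" using x c by auto
    show "\<zero> \<in> right_span (x # xs)" using x ID(3) by (auto intro!: exI[of _ \<zero>])
  next
    fix y z assume "y \<in> right_span (x # xs)" "z \<in> right_span (x # xs)"
    then obtain a u b v where *: "y = x \<otimes> a \<oplus> u" "z = x \<otimes> b \<oplus> v" "a \<in> carrier R" "b \<in> carrier R"
      "u \<in> right_span xs" "v \<in> right_span xs" by auto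
    have "y \<ominus> z = x \<otimes> (a \<ominus> b) \<oplus> (u \<ominus> v)" using * x c by (simp add: diff_add_add r_distr_minus)
    then show "y \<ominus> z \<in> right_span (x # xs)" using diff[OF *(5,6)] *(3,4) by auto
  next
    fix r y assume r: "r \<in> carrier R" and "y \<in> right_span (x # xs)"
    then obtain a u where *: "y = x \<otimes> a \<oplus> u" "a \<in> carrier R" "u \<in> right_span xs" by auto
    have "y \<otimes> r = x \<otimes> (a \<otimes> r) \<oplus> u \<otimes> r" using * x c r by (simp add: l_distr m_assoc)
    then show "y \<otimes> r \<in> right_span (x # xs)" using mult[OF *(3) r] *(2) r by auto
  qed
qed

lemma right_span_Cons: "x \<in> carrier R \<Longrightarrow> set xs \<subseteq> carrier R \<Longrightarrow> x \<in> right_span (x # xs) \<and> right_span xs \<subseteq> right_span (x # xs)"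
proof -
  assume x: "x \<in> carrier R" "set xs \<subseteq> carrier R"
  note ID = ring.left_idealD[OF ring_opposite_ring right_span_right_ideal[OF x(2)], unfolded opposite_ring_simps]
  have "x \<otimes> \<one> \<oplus> \<zero> \<in> right_span (x # xs)" using ID(3) one_closed by (simp only: right_span.simps) blast
  moreover have "x \<otimes> \<zero> \<oplus> y \<in> right_span (x # xs)" if "y \<in> right_span xs" for y
    using that zero_closed by (simp only: right_span.simps) blast
  then have "y \<in> right_span (x # xs)" if y: "y \<in> right_span xs" for y
    using y x(1) subsetD[OF ID(2) y] by (metis r_null l_zero)
  ultimately show ?thesis using x(1) by (auto simp del: right_span.simps)
qed

lemma right_span_annihilated:
  assumes "r \<in> carrier R" "set xs \<subseteq> carrier R" "\<And>x. x \<in> set xs \<Longrightarrow> r \<otimes> x = \<zero>" "y \<in> right_span xs"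
  shows "r \<otimes> y = \<zero>"
  using assms(2-)
proof (induction xs arbitrary: y)
  case (Cons x xs)
  then obtain a u where *: "y = x \<otimes> a \<oplus> u" "a \<in> carrier R" "u \<in> right_span xs" by auto
  have "u \<in> carrier R"
    using ring.left_idealD(2)[OF ring_opposite_ring right_span_right_ideal[of xs], unfolded opposite_ring_simps] *(3) Cons.prems(1) by auto
  then have "r \<otimes> y = (r \<otimes> x) \<otimes> a \<oplus> r \<otimes> u" using * Cons.prems(1) assms(1) by (simp add: r_distr m_assoc)
  also have "r \<otimes> x = \<zero>" using Cons.prems(2) by simp
  also have "r \<otimes> u = \<zero>" using Cons.IH[OF _ _ *(3)] Cons.prems by simp
  finally show ?case using *(2) by simp
qed (use assms(1) in simp)

text \<open>A maximal right ideal among those generated by finite lists from \<open>N\<close>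
  absorbs every further element of \<open>N\<close>.\<close>

lemma right_ideal_finite:
  assumes "left_noetherian (opposite_ring R)" "N \<subseteq> carrier R"
  shows "\<exists>xs. set xs \<subseteq> N \<and> N \<subseteq> right_span xs"
proof -
  have "\<exists>M\<in>right_span ` {xs. set xs \<subseteq> N}. \<forall>I\<in>right_span ` {xs. set xs \<subseteq> N}. M \<subseteq> I \<longrightarrow> I = M"
  proof (rule left_noetherian_maximal[OF assms(1)])
    have "[] \<in> {xs. set xs \<subseteq> N}" by simp
    then show "right_span ` {xs. set xs \<subseteq> N} \<noteq> {}" by blast
  qed (use right_span_right_ideal assms(2) in auto)
  then obtain xs where xs: "set xs \<subseteq> N" "\<And>ys. set ys \<subseteq> N \<Longrightarrow> right_span xs \<subseteq> right_span ys \<Longrightarrow> right_span ys = right_span xs"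
    by auto
  have "x \<in> right_span xs" if x: "x \<in> N" for x
  proof -
    have xc: "x \<in> carrier R" "set xs \<subseteq> carrier R" using x xs(1) assms(2) by auto
    have "right_span (x # xs) = right_span xs"
      by (rule xs(2)) (use x xs(1) right_span_Cons[OF xc] in auto)
    then show ?thesis using right_span_Cons[OF xc] by simp
  qed
  then show ?thesis using xs(1) by blast
qed

text \<open>The left annihilator of \<open>N\<close> is a two-sided ideal whose product with
  \<open>N\<close> is zero.\<close>

lemma prime_annihilator:
  assumes "prime_ring R" "ideal N R" "N \<noteq> {\<zero>}" "r \<in> carrier R" "\<And>y. y \<in> N \<Longrightarrow> r \<otimes> y = \<zero>"
  shows "r = \<zero>"
proof -
  interpret N: ideal N R by fact
  let ?A = "{r \<in> carrier R. \<forall>y\<in>N. r \<otimes> y = \<zero>}"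
  have sub: "additive_subgroup ?A R"
    by (rule additive_subgroup_diffI) (auto simp: l_distr_minus minus_self N.Icarr)
  have A: "ideal ?A R"
  proof (rule idealI[OF ring_axioms])
    show "subgroup ?A (add_monoid R)" using sub by (rule additive_subgroup.a_subgroup)
    show "x \<otimes> a \<in> ?A" if "a \<in> ?A" "x \<in> carrier R" for a x
      using that by (auto simp: m_assoc N.Icarr)
    show "a \<otimes> x \<in> ?A" if "a \<in> ?A" "x \<in> carrier R" for a x
      using that N.I_l_closed by (auto simp: m_assoc N.Icarr)
  qed
  have "?A \<cdot> N \<subseteq> {\<zero>}" by (rule ideal_prod_subsetI) auto
  moreover have "\<zero> \<otimes> \<zero> \<in> ?A \<cdot> N"
    by (rule ideal_prod.prod) (auto simp: N.Icarr N.zero_closed)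
  then have "\<zero> \<in> ?A \<cdot> N" by simp
  ultimately have "?A \<cdot> N = {\<zero>}" by blast
  then have "?A = {\<zero>}" using assms(1-3) A unfolding prime_ring_def by blast
  then show ?thesis using assms(4,5) by blast
qed

end

section \<open>Ascending chains of fractional left ideals\<close>

context quotient_ring
begin

abbreviation R' where "R' \<equiv> \<iota> ` carrier R"

lemma R'_carrier: "R' \<subseteq> carrier Q"
  using \<iota>_closed by blast

text \<open>Clearing a left denominator of \<open>q\<close> leaves an element of \<open>R\<close>
  that still kills \<open>Y\<close> from the left.\<close>

lemma zero_if_kills:
  assumes "\<And>r. r \<in> carrier R \<Longrightarrow> (\<And>y. y \<in> Y \<Longrightarrow> r \<otimes> y = \<zero>) \<Longrightarrow> r = \<zero>" "Y \<subseteq> carrier R"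
    and q: "q \<in> carrier Q" "\<And>y. y \<in> Y \<Longrightarrow> q \<otimes>\<^bsub>Q\<^esub> \<iota> y = \<zero>\<^bsub>Q\<^esub>"
  shows "q = \<zero>\<^bsub>Q\<^esub>"
proof -
  obtain r s where rs: "r \<in> carrier R" "s \<in> regular_elements R" "q = inv\<^bsub>Q\<^esub> \<iota> s \<otimes>\<^bsub>Q\<^esub> \<iota> r"
    using left_fraction[OF q(1)] by blast
  note s = regular_unit[OF rs(2)] \<iota>_closed[OF regular_carrier[OF rs(2)]]
  have "\<iota> s \<otimes>\<^bsub>Q\<^esub> q = \<iota> r" using rs s by (simp add: Q.m_assoc[symmetric] \<iota>_closed)
  have "r \<otimes> y = \<zero>" if "y \<in> Y" for y
  proof -
    have yc: "y \<in> carrier R" using that assms(2) by blast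
    have "\<iota> (r \<otimes> y) = \<iota> s \<otimes>\<^bsub>Q\<^esub> (q \<otimes>\<^bsub>Q\<^esub> \<iota> y)"
      using \<open>\<iota> s \<otimes>\<^bsub>Q\<^esub> q = \<iota> r\<close>[symmetric] rs(1) yc s q(1) by (simp add: \<iota>_mult Q.m_assoc \<iota>_closed)
    also have "\<dots> = \<iota> \<zero>" using q(2)[OF that] s by (simp add: \<iota>_zero)
    finally show ?thesis using \<iota>_eq_iff[of "r \<otimes> y" \<zero>] rs(1) yc by simp
  qed
  then have "r = \<zero>" using assms(1)[OF rs(1)] by blast
  then show ?thesis using rs s by (simp add: \<iota>_zero)
qed

text \<open>Up to elements that kill all of \<open>ys\<close>, multiplication by the entries of
  \<open>ys\<close> embeds \<open>K n\<close> into a finite power of the noetherian module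
  \<open>R\<close>. The induction on \<open>ys\<close> is the usual proof that such a power is
  noetherian.\<close>

lemma fractional_acc:
  assumes noeth: "left_noetherian R"
    and K: "\<And>n. K n \<subseteq> carrier Q" "\<And>n. \<zero>\<^bsub>Q\<^esub> \<in> K n" "\<And>n x y. x \<in> K n \<Longrightarrow> y \<in> K n \<Longrightarrow> x \<ominus>\<^bsub>Q\<^esub> y \<in> K n"
      "\<And>n r x. r \<in> carrier R \<Longrightarrow> x \<in> K n \<Longrightarrow> \<iota> r \<otimes>\<^bsub>Q\<^esub> x \<in> K n"
    and inc: "\<And>n m. n \<le> m \<Longrightarrow> K n \<subseteq> K (m::nat)"
    and ys: "set ys \<subseteq> carrier R" "\<And>n q y. q \<in> K n \<Longrightarrow> y \<in> set ys \<Longrightarrow> q \<otimes>\<^bsub>Q\<^esub> \<iota> y \<in> R'"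
  shows "\<exists>m. \<forall>n\<ge>m. \<forall>q\<in>K n. \<exists>q'\<in>K m. \<forall>y\<in>set ys. (q \<ominus>\<^bsub>Q\<^esub> q') \<otimes>\<^bsub>Q\<^esub> \<iota> y = \<zero>\<^bsub>Q\<^esub>"
  using ys
proof (induction ys)
  case Nil
  show ?case using K(2) by auto
next
  case (Cons y ys)
  have "\<exists>m. \<forall>n\<ge>m. \<forall>q\<in>K n. \<exists>q'\<in>K m. \<forall>y\<in>set ys. (q \<ominus>\<^bsub>Q\<^esub> q') \<otimes>\<^bsub>Q\<^esub> \<iota> y = \<zero>\<^bsub>Q\<^esub>"
    by (rule Cons.IH) (use Cons.prems in auto)
  then obtain m0 where "\<forall>n\<ge>m0. \<forall>q\<in>K n. \<exists>q'\<in>K m0. \<forall>y\<in>set ys. (q \<ominus>\<^bsub>Q\<^esub> q') \<otimes>\<^bsub>Q\<^esub> \<iota> y = \<zero>\<^bsub>Q\<^esub>" ..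
  then have m0: "\<And>n q. m0 \<le> n \<Longrightarrow> q \<in> K n \<Longrightarrow> \<exists>q'\<in>K m0. \<forall>y\<in>set ys. (q \<ominus>\<^bsub>Q\<^esub> q') \<otimes>\<^bsub>Q\<^esub> \<iota> y = \<zero>\<^bsub>Q\<^esub>"
    by simp
  have yc: "y \<in> carrier R" and ysc: "z \<in> set ys \<Longrightarrow> z \<in> carrier R" for z using Cons.prems(1) by auto
  note iy = \<iota>_closed[OF yc]
  have Kc: "q \<in> carrier Q" if "q \<in> K n" for q n using K(1) that by blast
  \<comment> \<open>The left ideal of values at \<open>y\<close> of those elements of
    \<open>K n\<close> that kill the rest of the list; its stabilization settles the new
    coordinate.\<close>
  define E where "E n = {r \<in> carrier R. \<exists>q\<in>K n. (\<forall>z\<in>set ys. q \<otimes>\<^bsub>Q\<^esub> \<iota> z = \<zero>\<^bsub>Q\<^esub>) \<and> q \<otimes>\<^bsub>Q\<^esub> \<iota> y = \<iota> r}" for n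
  have EI: "r \<in> E n" if "r \<in> carrier R" "q \<in> K n" "\<And>z. z \<in> set ys \<Longrightarrow> q \<otimes>\<^bsub>Q\<^esub> \<iota> z = \<zero>\<^bsub>Q\<^esub>" "q \<otimes>\<^bsub>Q\<^esub> \<iota> y = \<iota> r" for r q n
    using that unfolding E_def by blast
  have EE: "\<exists>q. r \<in> carrier R \<and> q \<in> K n \<and> (\<forall>z\<in>set ys. q \<otimes>\<^bsub>Q\<^esub> \<iota> z = \<zero>\<^bsub>Q\<^esub>) \<and> q \<otimes>\<^bsub>Q\<^esub> \<iota> y = \<iota> r" if "r \<in> E n" for r n
    using that unfolding E_def by blast
  have E: "left_ideal R (E n)" for n
  proof (rule left_idealI)
    show "E n \<subseteq> carrier R" by (auto simp: E_def)
    show "\<zero> \<in> E n" by (rule EI[OF _ K(2)]) (use ysc iy in \<open>simp_all add: \<iota>_zero \<iota>_closed\<close>)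
  next
    fix r r' assume "r \<in> E n" "r' \<in> E n"
    then obtain q q' where *: "r \<in> carrier R" "q \<in> K n" "\<forall>z\<in>set ys. q \<otimes>\<^bsub>Q\<^esub> \<iota> z = \<zero>\<^bsub>Q\<^esub>" "q \<otimes>\<^bsub>Q\<^esub> \<iota> y = \<iota> r"
      "r' \<in> carrier R" "q' \<in> K n" "\<forall>z\<in>set ys. q' \<otimes>\<^bsub>Q\<^esub> \<iota> z = \<zero>\<^bsub>Q\<^esub>" "q' \<otimes>\<^bsub>Q\<^esub> \<iota> y = \<iota> r'"
      using EE[of r n] EE[of r' n] by blast
    show "r \<ominus> r' \<in> E n"
      by (rule EI[OF _ K(3)[OF *(2,6)]])
        (use * ysc iy Kc[OF *(2)] Kc[OF *(6)] in \<open>simp_all add: \<iota>_diff Q.l_distr_minus \<iota>_closed Q.minus_self\<close>)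
  next
    fix a r assume a: "a \<in> carrier R" and "r \<in> E n"
    then obtain q where *: "r \<in> carrier R" "q \<in> K n" "\<forall>z\<in>set ys. q \<otimes>\<^bsub>Q\<^esub> \<iota> z = \<zero>\<^bsub>Q\<^esub>" "q \<otimes>\<^bsub>Q\<^esub> \<iota> y = \<iota> r"
      using EE[of r n] by blast
    show "a \<otimes> r \<in> E n"
      by (rule EI[OF _ K(4)[OF a *(2)]])
        (use * a ysc iy Kc[OF *(2)] in \<open>simp_all add: \<iota>_mult Q.m_assoc \<iota>_closed\<close>)
  qed
  have Emono: "E n \<subseteq> E (Suc n)" for n
  proof
    fix r assume "r \<in> E n"
    then show "r \<in> E (Suc n)" using EE[of r n] EI[of r _ "Suc n"] inc[of n "Suc n"] by auto
  qed
  obtain m1 where m1: "\<And>n. m1 \<le> n \<Longrightarrow> E n = E m1"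
    using noeth E Emono unfolding left_noetherian_def by blast
  let ?m = "max m0 m1"
  have "\<exists>q'\<in>K ?m. \<forall>z\<in>set (y # ys). (q \<ominus>\<^bsub>Q\<^esub> q') \<otimes>\<^bsub>Q\<^esub> \<iota> z = \<zero>\<^bsub>Q\<^esub>" if n: "?m \<le> n" and q: "q \<in> K n" for n q
  proof -
    obtain q1 where q1: "q1 \<in> K m0" "\<And>z. z \<in> set ys \<Longrightarrow> (q \<ominus>\<^bsub>Q\<^esub> q1) \<otimes>\<^bsub>Q\<^esub> \<iota> z = \<zero>\<^bsub>Q\<^esub>"
      using m0[of n q] n q by auto
    have q1n: "q1 \<in> K n" using q1(1) inc[of m0 n] n by auto
    have d: "q \<ominus>\<^bsub>Q\<^esub> q1 \<in> K n" by (rule K(3)[OF q q1n])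
    obtain r where r: "r \<in> carrier R" "(q \<ominus>\<^bsub>Q\<^esub> q1) \<otimes>\<^bsub>Q\<^esub> \<iota> y = \<iota> r" using Cons.prems(2)[OF d, of y] by auto
    have "r \<in> E n" by (rule EI[OF r(1) d q1(2) r(2)])
    then have "r \<in> E ?m" using m1[of n] m1[of ?m] n by simp
    then obtain q2 where q2: "q2 \<in> K ?m" "\<forall>z\<in>set ys. q2 \<otimes>\<^bsub>Q\<^esub> \<iota> z = \<zero>\<^bsub>Q\<^esub>" "q2 \<otimes>\<^bsub>Q\<^esub> \<iota> y = \<iota> r"
      using EE[of r ?m] by blast
    note c = Kc[OF q] Kc[OF q1n] Kc[OF q2(1)]
    have q1m: "q1 \<in> K ?m" using q1(1) inc[of m0 ?m] by auto
    have "q1 \<ominus>\<^bsub>Q\<^esub> (\<zero>\<^bsub>Q\<^esub> \<ominus>\<^bsub>Q\<^esub> q2) \<in> K ?m" by (intro K(3) K(2) q1m q2(1))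
    then have s: "q1 \<oplus>\<^bsub>Q\<^esub> q2 \<in> K ?m" using c by (simp add: a_minus_def)
    have eq: "q \<ominus>\<^bsub>Q\<^esub> (q1 \<oplus>\<^bsub>Q\<^esub> q2) = (q \<ominus>\<^bsub>Q\<^esub> q1) \<ominus>\<^bsub>Q\<^esub> q2"
      using c by (simp add: a_minus_def Q.minus_add Q.a_assoc)
    have "(q \<ominus>\<^bsub>Q\<^esub> (q1 \<oplus>\<^bsub>Q\<^esub> q2)) \<otimes>\<^bsub>Q\<^esub> \<iota> z = \<zero>\<^bsub>Q\<^esub>" if z: "z \<in> set (y # ys)" for z
    proof (cases "z = y")
      case True
      have "((q \<ominus>\<^bsub>Q\<^esub> q1) \<ominus>\<^bsub>Q\<^esub> q2) \<otimes>\<^bsub>Q\<^esub> \<iota> y = (q \<ominus>\<^bsub>Q\<^esub> q1) \<otimes>\<^bsub>Q\<^esub> \<iota> y \<ominus>\<^bsub>Q\<^esub> q2 \<otimes>\<^bsub>Q\<^esub> \<iota> y"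
        by (rule Q.l_distr_minus) (use c iy in auto)
      then show ?thesis unfolding eq True r(2) q2(3) using \<iota>_closed[OF r(1)] by (simp add: Q.minus_self)
    next
      case False
      then have z: "z \<in> set ys" using z by simp
      have "((q \<ominus>\<^bsub>Q\<^esub> q1) \<ominus>\<^bsub>Q\<^esub> q2) \<otimes>\<^bsub>Q\<^esub> \<iota> z = (q \<ominus>\<^bsub>Q\<^esub> q1) \<otimes>\<^bsub>Q\<^esub> \<iota> z \<ominus>\<^bsub>Q\<^esub> q2 \<otimes>\<^bsub>Q\<^esub> \<iota> z"
        by (rule Q.l_distr_minus) (use c \<iota>_closed[OF ysc[OF z]] in auto)
      then show ?thesis unfolding eq q1(2)[OF z] bspec[OF q2(2) z] by (simp add: Q.minus_self)
    qed
    then show ?thesis using s by blast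
  qed
  then show ?case by blast
qed

end

section \<open>An invertible ideal, its inverse and their powers\<close>

locale invertible_situation = quotient_ring +
  fixes I J
  assumes I: "ideal I R" and J: "subbimodule R Q \<iota> J"
    and IJ: "(\<iota> ` I) \<cdot>\<^bsub>Q\<^esub> J = R'" and JI: "J \<cdot>\<^bsub>Q\<^esub> (\<iota> ` I) = R'"
begin

sublocale I: ideal I R by (rule I)

abbreviation I' where "I' \<equiv> \<iota> ` I"

lemma J_carrier: "J \<subseteq> carrier Q"
  using J additive_subgroup.a_subset unfolding subbimodule_def by blast

lemma J_sub: "additive_subgroup J Q"
  and J_rmult: "r \<in> carrier R \<Longrightarrow> x \<in> J \<Longrightarrow> x \<otimes>\<^bsub>Q\<^esub> \<iota> r \<in> J"
  using J unfolding subbimodule_def by blast+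

lemma I'_carrier: "I' \<subseteq> carrier Q"
  using I.Icarr \<iota>_closed by blast

lemma J_add: "x \<in> J \<Longrightarrow> y \<in> J \<Longrightarrow> x \<oplus>\<^bsub>Q\<^esub> y \<in> J"
  using additive_subgroup.a_closed[OF J_sub] .

text \<open>\<open>J\<close> absorbs \<open>I\<close> from the right, so it contains
  \<open>J I = R\<close>. Hence the powers of \<open>J\<close> ascend.\<close>

lemma one_in_J: "\<one>\<^bsub>Q\<^esub> \<in> J"
proof -
  have "J \<cdot>\<^bsub>Q\<^esub> I' \<subseteq> J"
    by (rule Q.ideal_prod_subsetI) (use J_rmult I.Icarr J_add in auto)
  moreover have "\<one>\<^bsub>Q\<^esub> \<in> R'" using \<iota>_one by (metis image_eqI one_closed)
  ultimately show ?thesis using JI by blast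
qed

text \<open>Write \<open>1\<close> as a sum of products \<open>i j\<close> with
  \<open>i \<in> I\<close> and \<open>j \<in> J\<close>. If \<open>t\<close> is a common right
  denominator of the factors \<open>j\<close>, then \<open>t\<close> is the sum of the products
  \<open>i (j t)\<close> and lies in \<open>I\<close>.\<close>

lemma regular_in_ideal: "\<exists>s. s \<in> I \<and> s \<in> regular_elements R"
proof -
  \<comment> \<open>Here \<open>t0\<close> is the denominator collected so far. New factors are
    multiplied on at the right, which preserves earlier memberships in the right ideal
    \<open>I\<close>.\<close>
  have "\<exists>t\<in>regular_elements R. z \<otimes>\<^bsub>Q\<^esub> \<iota> (t0 \<otimes> t) \<in> I'"
    if "z \<in> I' \<cdot>\<^bsub>Q\<^esub> J" "t0 \<in> regular_elements R" for z t0
    using that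
  proof (induction z arbitrary: t0 rule: ideal_prod.induct)
    case (prod i j)
    then obtain i0 where i0: "i = \<iota> i0" "i0 \<in> I" by blast
    have c: "i \<in> carrier Q" "j \<in> carrier Q" using prod I'_carrier J_carrier by auto
    note t0 = regular_carrier[OF prod(3)] \<iota>_closed[OF regular_carrier[OF prod(3)]]
    obtain r t where rt: "r \<in> carrier R" "t \<in> regular_elements R" "j \<otimes>\<^bsub>Q\<^esub> \<iota> t0 = \<iota> r \<otimes>\<^bsub>Q\<^esub> inv\<^bsub>Q\<^esub> \<iota> t"
      using right_fraction[of "j \<otimes>\<^bsub>Q\<^esub> \<iota> t0"] c t0 by auto
    note t = regular_unit[OF rt(2)] regular_carrier[OF rt(2)] \<iota>_closed[OF regular_carrier[OF rt(2)]]
    have "i \<otimes>\<^bsub>Q\<^esub> j \<otimes>\<^bsub>Q\<^esub> \<iota> (t0 \<otimes> t) = i \<otimes>\<^bsub>Q\<^esub> ((j \<otimes>\<^bsub>Q\<^esub> \<iota> t0) \<otimes>\<^bsub>Q\<^esub> \<iota> t)"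
      using c t0 t by (simp add: \<iota>_mult Q.m_assoc)
    also have "\<dots> = i \<otimes>\<^bsub>Q\<^esub> \<iota> r" unfolding rt(3) using t \<iota>_closed[OF rt(1)] by (simp add: Q.m_assoc)
    also have "\<dots> = \<iota> (i0 \<otimes> r)" using i0 rt(1) I.Icarr by (simp add: \<iota>_mult)
    finally show ?case using rt(2) I.I_r_closed[OF i0(2) rt(1)] by blast
  next
    case (sum x y)
    have c: "x \<in> carrier Q" "y \<in> carrier Q"
      using sum(1,2) Q.ideal_prod_carrier[OF I'_carrier J_carrier] by auto
    obtain t1 where t1: "t1 \<in> regular_elements R" "x \<otimes>\<^bsub>Q\<^esub> \<iota> (t0 \<otimes> t1) \<in> I'" using sum by blast
    obtain t2 where t2: "t2 \<in> regular_elements R" "y \<otimes>\<^bsub>Q\<^esub> \<iota> (t0 \<otimes> t1 \<otimes> t2) \<in> I'"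
      using sum regular_mult[OF sum.prems t1(1)] by blast
    note tc = regular_carrier[OF sum.prems] regular_carrier[OF t1(1)] regular_carrier[OF t2(1)]
    obtain u where u: "u \<in> I" "x \<otimes>\<^bsub>Q\<^esub> \<iota> (t0 \<otimes> t1) = \<iota> u" using t1(2) by blast
    obtain v where v: "v \<in> I" "y \<otimes>\<^bsub>Q\<^esub> \<iota> (t0 \<otimes> t1 \<otimes> t2) = \<iota> v" using t2(2) by blast
    have "x \<otimes>\<^bsub>Q\<^esub> \<iota> (t0 \<otimes> t1 \<otimes> t2) = \<iota> (u \<otimes> t2)"
    proof -
      have "x \<otimes>\<^bsub>Q\<^esub> \<iota> (t0 \<otimes> t1 \<otimes> t2) = (x \<otimes>\<^bsub>Q\<^esub> \<iota> (t0 \<otimes> t1)) \<otimes>\<^bsub>Q\<^esub> \<iota> t2"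
        using c tc by (simp add: \<iota>_mult Q.m_assoc \<iota>_closed)
      then show ?thesis using u tc I.Icarr by (simp add: \<iota>_mult)
    qed
    then have "(x \<oplus>\<^bsub>Q\<^esub> y) \<otimes>\<^bsub>Q\<^esub> \<iota> (t0 \<otimes> (t1 \<otimes> t2)) = \<iota> (u \<otimes> t2 \<oplus> v)"
      using c tc v u I.Icarr by (simp add: Q.l_distr \<iota>_closed m_assoc \<iota>_add)
    moreover have "u \<otimes> t2 \<oplus> v \<in> I" using u(1) v(1) tc I.I_r_closed by (intro I.a_closed) auto
    ultimately show ?case using regular_mult[OF t1(1) t2(1)] by blast
  qed
  moreover have "\<one>\<^bsub>Q\<^esub> \<in> I' \<cdot>\<^bsub>Q\<^esub> J" unfolding IJ using \<iota>_one by (metis image_eqI one_closed)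
  ultimately obtain t where t: "t \<in> regular_elements R" "\<one>\<^bsub>Q\<^esub> \<otimes>\<^bsub>Q\<^esub> \<iota> (\<one> \<otimes> t) \<in> I'" using regular_one by blast
  note tc = regular_carrier[OF t(1)]
  obtain u where "u \<in> I" "\<iota> t = \<iota> u" using t(2) tc \<iota>_closed[OF tc] by auto
  then have "t \<in> I" using \<iota>_eq_iff[OF tc, of u] I.Icarr by simp
  then show ?thesis using t(1) by blast
qed

primrec Ipow :: "nat \<Rightarrow> 'c set" where
  "Ipow 0 = R'"
| "Ipow (Suc n) = I' \<cdot>\<^bsub>Q\<^esub> Ipow n"

text \<open>Factors are added on the right, opposite to \<open>Ipow\<close>, so that in a product of
  \<open>Jpow n\<close> and \<open>Ipow n\<close> the adjacent factors \<open>J\<close> and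
  \<open>I\<close> cancel.\<close>

primrec Jpow :: "nat \<Rightarrow> 'c set" where
  "Jpow 0 = R'"
| "Jpow (Suc n) = Jpow n \<cdot>\<^bsub>Q\<^esub> J"

text \<open>The power \<open>I^n\<close> as a subset of \<open>R\<close>. Products are formed in
  \<open>Q\<close>, where they can be combined with those of \<open>J\<close>.\<close>

definition power :: "nat \<Rightarrow> 'a set" where
  "power n = {x \<in> carrier R. \<iota> x \<in> Ipow n}"

lemma R'_mult: "x \<in> R' \<Longrightarrow> y \<in> R' \<Longrightarrow> x \<otimes>\<^bsub>Q\<^esub> y \<in> R'"
  and R'_add: "x \<in> R' \<Longrightarrow> y \<in> R' \<Longrightarrow> x \<oplus>\<^bsub>Q\<^esub> y \<in> R'"
  by (auto simp: \<iota>_mult[symmetric] \<iota>_add[symmetric])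

lemma I'_sub: "I' \<subseteq> R'"
  using I.Icarr by blast

lemma Ipow_sub: "Ipow n \<subseteq> R'"
proof (induction n)
  case (Suc n)
  show ?case unfolding Ipow.simps
    by (rule Q.ideal_prod_subsetI) (use Suc I'_sub R'_mult R'_add in blast)+
qed simp

lemma Ipow_carrier: "Ipow n \<subseteq> carrier Q"
  using Ipow_sub R'_carrier by blast

lemma Ipow_add: "x \<in> Ipow n \<Longrightarrow> y \<in> Ipow n \<Longrightarrow> x \<oplus>\<^bsub>Q\<^esub> y \<in> Ipow n"
  by (cases n) (auto intro: R'_add ideal_prod.sum)

lemma Ipow_lmult:
  assumes "r \<in> R'" "x \<in> Ipow n"
  shows "r \<otimes>\<^bsub>Q\<^esub> x \<in> Ipow n"
proof (cases n)
  case 0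
  then show ?thesis using assms R'_mult by simp
next
  case (Suc m)
  have rc: "r \<in> carrier Q" using assms(1) R'_carrier by blast
  have "x \<in> I' \<cdot>\<^bsub>Q\<^esub> Ipow m" using assms(2) Suc by simp
  then have "r \<otimes>\<^bsub>Q\<^esub> x \<in> I' \<cdot>\<^bsub>Q\<^esub> Ipow m"
  proof (induction rule: ideal_prod.induct)
    case (prod i j)
    have "r \<otimes>\<^bsub>Q\<^esub> i \<in> I'"
      using assms(1) prod(1) I.I_l_closed I.Icarr by (auto simp: \<iota>_mult[symmetric])
    moreover have "r \<otimes>\<^bsub>Q\<^esub> (i \<otimes>\<^bsub>Q\<^esub> j) = (r \<otimes>\<^bsub>Q\<^esub> i) \<otimes>\<^bsub>Q\<^esub> j"
      using rc prod I'_carrier Ipow_carrier by (simp add: Q.m_assoc subset_iff)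
    ultimately show ?case using prod(2) by (simp add: ideal_prod.prod)
  next
    case (sum x y)
    have "x \<in> carrier Q" "y \<in> carrier Q"
      using sum(1,2) Q.ideal_prod_carrier[OF I'_carrier Ipow_carrier] by auto
    then show ?case using sum rc by (simp add: Q.r_distr ideal_prod.sum)
  qed
  then show ?thesis using Suc by simp
qed

lemma Ipow_rmult:
  assumes "r \<in> R'"
  shows "x \<in> Ipow n \<Longrightarrow> x \<otimes>\<^bsub>Q\<^esub> r \<in> Ipow n"
proof (induction n arbitrary: x)
  case 0
  then show ?case using assms R'_mult by simp
next
  case (Suc n)
  have rc: "r \<in> carrier Q" using assms R'_carrier by blast
  have "x \<in> I' \<cdot>\<^bsub>Q\<^esub> Ipow n" using Suc.prems by simp
  then have "x \<otimes>\<^bsub>Q\<^esub> r \<in> I' \<cdot>\<^bsub>Q\<^esub> Ipow n"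
  proof (induction rule: ideal_prod.induct)
    case (prod i j)
    have "(i \<otimes>\<^bsub>Q\<^esub> j) \<otimes>\<^bsub>Q\<^esub> r = i \<otimes>\<^bsub>Q\<^esub> (j \<otimes>\<^bsub>Q\<^esub> r)"
      using rc prod I'_carrier Ipow_carrier by (simp add: Q.m_assoc subset_iff)
    then show ?case using ideal_prod.prod[OF prod(1) Suc.IH[OF prod(2)], of Q] by simp
  next
    case (sum x y)
    have "x \<in> carrier Q" "y \<in> carrier Q"
      using sum(1,2) Q.ideal_prod_carrier[OF I'_carrier Ipow_carrier] by auto
    then show ?case using sum rc by (simp add: Q.l_distr ideal_prod.sum)
  qed
  then show ?case by simp
qed

lemma I'_one: "I' \<cdot>\<^bsub>Q\<^esub> R' = I'" and one_I': "R' \<cdot>\<^bsub>Q\<^esub> I' = I'"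
proof -
  have one: "\<one>\<^bsub>Q\<^esub> \<in> R'" using \<iota>_one by (metis image_eqI one_closed)
  have add: "x \<oplus>\<^bsub>Q\<^esub> y \<in> I'" if "x \<in> I'" "y \<in> I'" for x y
    using that I.Icarr I.a_closed by (auto simp: \<iota>_add[symmetric])
  have "I' \<cdot>\<^bsub>Q\<^esub> R' \<subseteq> I'" "R' \<cdot>\<^bsub>Q\<^esub> I' \<subseteq> I'"
    by (rule Q.ideal_prod_subsetI[OF _ add]; use I.I_r_closed I.I_l_closed I.Icarr in \<open>auto simp: \<iota>_mult[symmetric]\<close>)+
  moreover have "x \<in> I' \<cdot>\<^bsub>Q\<^esub> R' \<and> x \<in> R' \<cdot>\<^bsub>Q\<^esub> I'" if x: "x \<in> I'" for x
    using ideal_prod.prod[OF x one, of Q] ideal_prod.prod[OF one x, of Q] subsetD[OF I'_carrier x] by simp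
  ultimately show "I' \<cdot>\<^bsub>Q\<^esub> R' = I'" "R' \<cdot>\<^bsub>Q\<^esub> I' = I'" by blast+
qed

lemma one_Ipow: "R' \<cdot>\<^bsub>Q\<^esub> Ipow n = Ipow n"
proof
  show "R' \<cdot>\<^bsub>Q\<^esub> Ipow n \<subseteq> Ipow n" by (rule Q.ideal_prod_subsetI[OF Ipow_lmult Ipow_add])
  have one: "\<one>\<^bsub>Q\<^esub> \<in> R'" using \<iota>_one by (metis image_eqI one_closed)
  show "Ipow n \<subseteq> R' \<cdot>\<^bsub>Q\<^esub> Ipow n"
  proof
    fix x assume x: "x \<in> Ipow n"
    show "x \<in> R' \<cdot>\<^bsub>Q\<^esub> Ipow n" using ideal_prod.prod[OF one x, of Q] subsetD[OF Ipow_carrier x] by simp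
  qed
qed

lemma Ipow_Suc: "Ipow (Suc n) = Ipow n \<cdot>\<^bsub>Q\<^esub> I'"
proof (induction n)
  case 0
  show ?case using I'_one one_I' by simp
next
  case (Suc n)
  have "Ipow (Suc (Suc n)) = I' \<cdot>\<^bsub>Q\<^esub> (Ipow n \<cdot>\<^bsub>Q\<^esub> I')" using Suc by (simp del: Ipow.simps(2) add: Ipow.simps(2)[of "Suc n"])
  also have "\<dots> = Ipow (Suc n) \<cdot>\<^bsub>Q\<^esub> I'"
    using Q.ideal_prod_set_assoc[OF I'_carrier Ipow_carrier I'_carrier] by simp
  finally show ?case .
qed

lemma Ipow_mono: "Ipow (Suc n) \<subseteq> Ipow n"
  unfolding Ipow.simps by (rule Q.ideal_prod_subsetI[OF _ Ipow_add]) (use Ipow_lmult I'_sub in blast)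

lemma Jpow_carrier: "Jpow n \<subseteq> carrier Q"
proof (induction n)
  case (Suc n)
  then show ?case using Q.ideal_prod_carrier[OF Suc J_carrier] by simp
qed (simp add: R'_carrier)

lemma Jpow_Ipow: "Jpow n \<cdot>\<^bsub>Q\<^esub> Ipow n = R'"
proof (induction n)
  case 0
  show ?case using one_Ipow[of 0] by simp
next
  case (Suc n)
  have "Jpow (Suc n) \<cdot>\<^bsub>Q\<^esub> Ipow (Suc n) = Jpow n \<cdot>\<^bsub>Q\<^esub> (J \<cdot>\<^bsub>Q\<^esub> (I' \<cdot>\<^bsub>Q\<^esub> Ipow n))"
    using Q.ideal_prod_set_assoc[OF Jpow_carrier J_carrier Q.ideal_prod_carrier[OF I'_carrier Ipow_carrier]] by simp
  also have "J \<cdot>\<^bsub>Q\<^esub> (I' \<cdot>\<^bsub>Q\<^esub> Ipow n) = Ipow n"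
    using Q.ideal_prod_set_assoc[OF J_carrier I'_carrier Ipow_carrier] JI one_Ipow by simp
  finally show ?case using Suc by simp
qed

lemma Jpow_add: "x \<in> Jpow n \<Longrightarrow> y \<in> Jpow n \<Longrightarrow> x \<oplus>\<^bsub>Q\<^esub> y \<in> Jpow n"
  by (cases n) (auto intro: R'_add ideal_prod.sum)

lemma Jpow_lmult:
  assumes "r \<in> R'"
  shows "x \<in> Jpow n \<Longrightarrow> r \<otimes>\<^bsub>Q\<^esub> x \<in> Jpow n"
proof (induction n arbitrary: x)
  case 0
  then show ?case using assms R'_mult by simp
next
  case (Suc n)
  have rc: "r \<in> carrier Q" using assms R'_carrier by blast
  have "x \<in> Jpow n \<cdot>\<^bsub>Q\<^esub> J" using Suc.prems by simp
  then have "r \<otimes>\<^bsub>Q\<^esub> x \<in> Jpow n \<cdot>\<^bsub>Q\<^esub> J"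
  proof (induction rule: ideal_prod.induct)
    case (prod i j)
    have "r \<otimes>\<^bsub>Q\<^esub> (i \<otimes>\<^bsub>Q\<^esub> j) = (r \<otimes>\<^bsub>Q\<^esub> i) \<otimes>\<^bsub>Q\<^esub> j"
      using rc prod J_carrier Jpow_carrier by (simp add: Q.m_assoc subset_iff)
    then show ?case using ideal_prod.prod[OF Suc.IH[OF prod(1)] prod(2), of Q] by simp
  next
    case (sum x y)
    have "x \<in> carrier Q" "y \<in> carrier Q"
      using sum(1,2) Q.ideal_prod_carrier[OF Jpow_carrier J_carrier] by auto
    then show ?case using sum rc by (simp add: Q.r_distr ideal_prod.sum)
  qed
  then show ?case by simp
qed

lemma Jpow_mono: "n \<le> m \<Longrightarrow> Jpow n \<subseteq> Jpow m"
proof (rule lift_Suc_mono_le[of Jpow])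
  fix n
  show "Jpow n \<subseteq> Jpow (Suc n)"
  proof
    fix x assume x: "x \<in> Jpow n"
    show "x \<in> Jpow (Suc n)"
      using ideal_prod.prod[OF x one_in_J, of Q] subsetD[OF Jpow_carrier x] by simp
  qed
qed

lemma Jpow_zero: "\<zero>\<^bsub>Q\<^esub> \<in> Jpow n"
  using Jpow_mono[of 0 n] \<iota>_zero by (metis Jpow.simps(1) image_eqI le0 subsetD zero_closed)

lemma Jpow_diff: "x \<in> Jpow n \<Longrightarrow> y \<in> Jpow n \<Longrightarrow> x \<ominus>\<^bsub>Q\<^esub> y \<in> Jpow n"
proof -
  assume xy: "x \<in> Jpow n" "y \<in> Jpow n"
  have c: "x \<in> carrier Q" "y \<in> carrier Q" using xy Jpow_carrier by auto
  have "\<iota> (\<zero> \<ominus> \<one>) = \<ominus>\<^bsub>Q\<^esub> \<one>\<^bsub>Q\<^esub>"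
    unfolding \<iota>_diff[OF zero_closed one_closed] \<iota>_zero \<iota>_one by (simp add: a_minus_def)
  then have "\<ominus>\<^bsub>Q\<^esub> \<one>\<^bsub>Q\<^esub> \<in> R'" by (metis image_eqI minus_closed one_closed zero_closed)
  then have "\<ominus>\<^bsub>Q\<^esub> \<one>\<^bsub>Q\<^esub> \<otimes>\<^bsub>Q\<^esub> y \<in> Jpow n" by (intro Jpow_lmult xy(2))
  then show ?thesis using Jpow_add[OF xy(1)] c by (simp add: a_minus_def Q.l_minus)
qed

lemma power_ideal: "ideal (power n) R"
proof -
  obtain s where s: "s \<in> I" using regular_in_ideal by blast
  have z: "\<iota> \<zero> \<in> Ipow n"
  proof (induction n)
    case (Suc n)
    have "\<iota> \<zero> = \<iota> \<zero> \<otimes>\<^bsub>Q\<^esub> \<iota> \<zero>" by (simp add: \<iota>_zero)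
    moreover have "\<iota> \<zero> \<otimes>\<^bsub>Q\<^esub> \<iota> \<zero> \<in> Ipow (Suc n)"
      unfolding Ipow.simps by (rule ideal_prod.prod[OF _ Suc]) simp
    ultimately show ?case by simp
  qed simp
  have l: "r \<otimes> x \<in> power n" if "r \<in> carrier R" "x \<in> power n" for r x
    using that Ipow_lmult[of "\<iota> r" "\<iota> x" n] by (simp add: power_def \<iota>_mult)
  have "x \<ominus> y \<in> power n" if xy: "x \<in> power n" "y \<in> power n" for x y
  proof -
    have c: "x \<in> carrier R" "y \<in> carrier R" using xy by (auto simp: power_def)
    have "\<ominus> \<one> \<otimes> y \<in> power n" by (rule l[OF _ xy(2)]) simp
    then have "\<iota> (x \<oplus> \<ominus> \<one> \<otimes> y) \<in> Ipow n"
      using Ipow_add[of "\<iota> x" n "\<iota> (\<ominus> \<one> \<otimes> y)"] xy c by (simp add: power_def \<iota>_add)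
    then show ?thesis using c by (simp add: power_def a_minus_def l_minus)
  qed
  then have sub: "additive_subgroup (power n) R"
    by (intro additive_subgroup_diffI) (use z in \<open>auto simp: power_def\<close>)
  show ?thesis
  proof (rule idealI[OF ring_axioms])
    show "subgroup (power n) (add_monoid R)" using sub by (rule additive_subgroup.a_subgroup)
    show "x \<otimes> a \<in> power n" if "a \<in> power n" "x \<in> carrier R" for a x using l that by blast
    show "a \<otimes> x \<in> power n" if "a \<in> power n" "x \<in> carrier R" for a x
      using that Ipow_rmult[of "\<iota> x" "\<iota> a" n] by (simp add: power_def \<iota>_mult)
  qed
qed

lemma power_mono: "power (Suc n) \<subseteq> power n"
  using Ipow_mono by (auto simp: power_def)

lemma nat_pow_in_power: "s \<in> I \<Longrightarrow> s [^] n \<in> power n"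
proof (induction n)
  case (Suc n)
  have s: "s \<in> carrier R" using Suc.prems I.Icarr by simp
  have "\<iota> s \<otimes>\<^bsub>Q\<^esub> \<iota> (s [^] n) \<in> Ipow (Suc n)"
    unfolding Ipow.simps by (rule ideal_prod.prod) (use Suc in \<open>auto simp: power_def\<close>)
  then have "\<iota> (s \<otimes> s [^] n) \<in> Ipow (Suc n)" using s by (simp add: \<iota>_mult)
  then show ?case using s nat_pow_Suc2[OF s, of n] by (simp add: power_def del: Ipow.simps nat_pow_Suc)
qed (simp add: power_def)

text \<open>Let the intersection \<open>N\<close> be nonzero. Since
  \<open>J N \<subseteq> N\<close>, all powers of \<open>J\<close> multiply \<open>N\<close> into
  \<open>R\<close>; as \<open>N\<close> is finitely generated as a right ideal and has zero left
  annihilator by primeness, the ascending powers of \<open>J\<close> become stationary. Multiplying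
  \<open>J^(m+1) = J^m\<close> by \<open>I^(m+1)\<close> gives \<open>R = I\<close>.\<close>

lemma Inter_power:
  assumes "prime_ring R" "left_noetherian R" "left_noetherian (opposite_ring R)" "I \<noteq> carrier R"
  shows "(\<Inter>n. power n) = {\<zero>}"
proof (rule ccontr)
  assume ne: "(\<Inter>n. power n) \<noteq> {\<zero>}"
  define N where "N = (\<Inter>n. power n)"
  have N: "ideal N R"
  proof -
    have "ideal (\<Inter> (range power)) R" by (rule i_Intersect) (use power_ideal in auto)
    then show ?thesis by (simp add: N_def)
  qed
  interpret N: ideal N R by fact
  have Nsub: "N \<subseteq> carrier R" using N.Icarr by blast
  obtain xs where xs: "set xs \<subseteq> N" "N \<subseteq> right_span xs" using right_ideal_finite[OF assms(3) Nsub] by blast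
  have xsc: "set xs \<subseteq> carrier R" using xs(1) Nsub by blast
  have ann: "r = \<zero>" if "r \<in> carrier R" "\<And>y. y \<in> set xs \<Longrightarrow> r \<otimes> y = \<zero>" for r
    by (rule prime_annihilator[OF assms(1) N _ that(1)])
      (use ne right_span_annihilated[OF that(1) xsc that(2)] xs(2) in \<open>auto simp: N_def\<close>)
  \<comment> \<open>An element of \<open>N\<close> lies in every \<open>I^(n+1)\<close>, and
    multiplication by \<open>J\<close> lowers the exponent by one.\<close>
  have JN: "j \<otimes>\<^bsub>Q\<^esub> \<iota> y \<in> \<iota> ` N" if j: "j \<in> J" and y: "y \<in> N" for j y
  proof -
    have jc: "j \<in> carrier Q" using j J_carrier by blast
    have "j \<otimes>\<^bsub>Q\<^esub> z \<in> Ipow n" if "z \<in> I' \<cdot>\<^bsub>Q\<^esub> Ipow n" for z n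
      using that
    proof (induction rule: ideal_prod.induct)
      case (prod i z)
      have "j \<otimes>\<^bsub>Q\<^esub> i \<in> R'" unfolding JI[symmetric] by (rule ideal_prod.prod[OF j prod(1)])
      moreover have "j \<otimes>\<^bsub>Q\<^esub> (i \<otimes>\<^bsub>Q\<^esub> z) = (j \<otimes>\<^bsub>Q\<^esub> i) \<otimes>\<^bsub>Q\<^esub> z"
        using jc prod I'_carrier Ipow_carrier by (simp add: Q.m_assoc subset_iff)
      ultimately show ?case using Ipow_lmult prod(2) by simp
    next
      case (sum x y)
      have "x \<in> carrier Q" "y \<in> carrier Q"
        using sum(1,2) Q.ideal_prod_carrier[OF I'_carrier Ipow_carrier] by auto
      then show ?case using sum jc Ipow_add by (simp add: Q.r_distr)
    qed
    moreover have "\<iota> y \<in> I' \<cdot>\<^bsub>Q\<^esub> Ipow n" for n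
      using y unfolding N_def power_def by (auto dest: spec[of _ "Suc n"])
    ultimately have all: "j \<otimes>\<^bsub>Q\<^esub> \<iota> y \<in> Ipow n" for n by blast
    then have "j \<otimes>\<^bsub>Q\<^esub> \<iota> y \<in> R'" using Ipow_sub by blast
    then obtain z where z: "z \<in> carrier R" "j \<otimes>\<^bsub>Q\<^esub> \<iota> y = \<iota> z" by blast
    have "z \<in> power n" for n using all[of n] z unfolding power_def by auto
    then have "z \<in> N" unfolding N_def by blast
    then show ?thesis using z by blast
  qed
  have KN: "q \<otimes>\<^bsub>Q\<^esub> \<iota> y \<in> \<iota> ` N" if "q \<in> Jpow n" "y \<in> N" for q n y
    using that
  proof (induction n arbitrary: q y)
    case 0
    then obtain r where "r \<in> carrier R" "q = \<iota> r" by auto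
    then have "q \<otimes>\<^bsub>Q\<^esub> \<iota> y = \<iota> (r \<otimes> y)" "r \<otimes> y \<in> N"
      using 0(2) N.Icarr N.I_l_closed by (simp_all add: \<iota>_mult)
    then show ?case by blast
  next
    case (Suc n)
    have yc: "\<iota> y \<in> carrier Q" using Suc.prems(2) Nsub \<iota>_closed by blast
    have "q \<in> Jpow n \<cdot>\<^bsub>Q\<^esub> J" using Suc.prems(1) by simp
    then show ?case
    proof (induction rule: ideal_prod.induct)
      case (prod k j)
      obtain z where z: "z \<in> N" "j \<otimes>\<^bsub>Q\<^esub> \<iota> y = \<iota> z" using JN[OF prod(2) Suc.prems(2)] by blast
      have "(k \<otimes>\<^bsub>Q\<^esub> j) \<otimes>\<^bsub>Q\<^esub> \<iota> y = k \<otimes>\<^bsub>Q\<^esub> \<iota> z"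
        using prod J_carrier Jpow_carrier yc z(2) by (simp add: Q.m_assoc subset_iff)
      then show ?case using Suc.IH[OF prod(1) z(1)] by simp
    next
      case (sum u v)
      have "u \<in> carrier Q" "v \<in> carrier Q"
        using sum(1,2) Q.ideal_prod_carrier[OF Jpow_carrier J_carrier] by auto
      then have "(u \<oplus>\<^bsub>Q\<^esub> v) \<otimes>\<^bsub>Q\<^esub> \<iota> y = u \<otimes>\<^bsub>Q\<^esub> \<iota> y \<oplus>\<^bsub>Q\<^esub> v \<otimes>\<^bsub>Q\<^esub> \<iota> y" using yc by (simp add: Q.l_distr)
      moreover obtain a b where "a \<in> N" "b \<in> N" "u \<otimes>\<^bsub>Q\<^esub> \<iota> y = \<iota> a" "v \<otimes>\<^bsub>Q\<^esub> \<iota> y = \<iota> b" using sum(3,4) by blast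
      ultimately have "(u \<oplus>\<^bsub>Q\<^esub> v) \<otimes>\<^bsub>Q\<^esub> \<iota> y = \<iota> (a \<oplus> b)" "a \<oplus> b \<in> N" using N.Icarr by (simp_all add: \<iota>_add)
      then show ?case by blast
    qed
  qed
  have "\<exists>m. \<forall>n\<ge>m. \<forall>q\<in>Jpow n. \<exists>q'\<in>Jpow m. \<forall>y\<in>set xs. (q \<ominus>\<^bsub>Q\<^esub> q') \<otimes>\<^bsub>Q\<^esub> \<iota> y = \<zero>\<^bsub>Q\<^esub>"
  proof (rule fractional_acc[OF assms(2) Jpow_carrier Jpow_zero Jpow_diff _ Jpow_mono xsc])
    show "\<iota> r \<otimes>\<^bsub>Q\<^esub> x \<in> Jpow n" if "r \<in> carrier R" "x \<in> Jpow n" for n r x using Jpow_lmult that by blast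
    show "q \<otimes>\<^bsub>Q\<^esub> \<iota> y \<in> R'" if "q \<in> Jpow n" "y \<in> set xs" for n q y
      using KN[OF that(1), of y] that(2) xs(1) Nsub by blast
  qed
  then obtain m where m: "\<And>q. q \<in> Jpow (Suc m) \<Longrightarrow> \<exists>q'\<in>Jpow m. \<forall>y\<in>set xs. (q \<ominus>\<^bsub>Q\<^esub> q') \<otimes>\<^bsub>Q\<^esub> \<iota> y = \<zero>\<^bsub>Q\<^esub>"
    using le_SucI by blast
  have "Jpow (Suc m) \<subseteq> Jpow m"
  proof
    fix q assume q: "q \<in> Jpow (Suc m)"
    obtain q' where q': "q' \<in> Jpow m" "\<And>y. y \<in> set xs \<Longrightarrow> (q \<ominus>\<^bsub>Q\<^esub> q') \<otimes>\<^bsub>Q\<^esub> \<iota> y = \<zero>\<^bsub>Q\<^esub>" using m[OF q] by blast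
    have c: "q \<in> carrier Q" "q' \<in> carrier Q" using q q'(1) Jpow_carrier by blast+
    have "q \<ominus>\<^bsub>Q\<^esub> q' = \<zero>\<^bsub>Q\<^esub>" by (rule zero_if_kills[OF ann xsc _ q'(2)]) (use c in auto)
    then have "q = q'" using Q.minus_add_cancel[OF c] c by simp
    then show "q \<in> Jpow m" using q'(1) by simp
  qed
  then have eq: "Jpow (Suc m) = Jpow m" using Jpow_mono[of m "Suc m"] by (simp del: Jpow.simps)
  have "R' = Jpow m \<cdot>\<^bsub>Q\<^esub> Ipow (Suc m)" using Jpow_Ipow[of "Suc m"] unfolding eq by simp
  also have "\<dots> = Jpow m \<cdot>\<^bsub>Q\<^esub> Ipow m \<cdot>\<^bsub>Q\<^esub> I'"
    unfolding Ipow_Suc by (rule Q.ideal_prod_set_assoc[OF Jpow_carrier Ipow_carrier I'_carrier, symmetric])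
  also have "\<dots> = I'" using Jpow_Ipow one_I' by simp
  finally have "\<iota> \<one> \<in> I'" by auto
  then obtain i where "i \<in> I" "\<iota> \<one> = \<iota> i" by blast
  then have "\<one> \<in> I" using \<iota>_eq_iff[of \<one> i] I.Icarr by simp
  then show False using I.one_imp_carrier assms(4) by blast
qed

end

section \<open>The standard identity\<close>

definition perm_word :: "nat \<Rightarrow> (nat \<Rightarrow> nat) \<Rightarrow> nat list" where
  "perm_word n \<pi> = map \<pi> [0..<n]"

definition standard_poly :: "nat \<Rightarrow> nc_int_poly" where
  "standard_poly n = (\<Sum>\<pi> | \<pi> permutes {..<n}. Poly_Mapping.single (perm_word n \<pi>) (sign \<pi>))"

definition word_prod :: "('a, 'm) ring_scheme \<Rightarrow> (nat \<Rightarrow> 'a) \<Rightarrow> nat list \<Rightarrow> 'a" where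
  "word_prod R \<theta> w = foldr (\<lambda>i y. \<theta> i \<otimes>\<^bsub>R\<^esub> y) w \<one>\<^bsub>R\<^esub>"

text \<open>The signed sum over all permutations, written as even part minus odd part so that no
  integer multiples occur in \<open>R\<close>. The argument is a function of the word, which allows
  linear operations inside the sum.\<close>

definition alternation :: "('a, 'm) ring_scheme \<Rightarrow> nat \<Rightarrow> (nat list \<Rightarrow> 'a) \<Rightarrow> 'a" where
  "alternation R n f =
     (\<Oplus>\<^bsub>R\<^esub>\<pi>\<in>{\<pi>. \<pi> permutes {..<n} \<and> evenperm \<pi>}. f (perm_word n \<pi>)) \<ominus>\<^bsub>R\<^esub>
     (\<Oplus>\<^bsub>R\<^esub>\<pi>\<in>{\<pi>. \<pi> permutes {..<n} \<and> \<not> evenperm \<pi>}. f (perm_word n \<pi>))"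

lemma length_perm_word [simp]: "length (perm_word n \<pi>) = n"
  by (simp add: perm_word_def)

lemma perm_word_inj: "inj_on (perm_word n) {\<pi>. \<pi> permutes {..<n}}"
proof (rule inj_onI)
  fix \<pi> \<rho> assume *: "\<pi> \<in> {\<pi>. \<pi> permutes {..<n}}" "\<rho> \<in> {\<pi>. \<pi> permutes {..<n}}" "perm_word n \<pi> = perm_word n \<rho>"
  show "\<pi> = \<rho>"
  proof
    fix i
    show "\<pi> i = \<rho> i"
    proof (cases "i < n")
      case True
      then show ?thesis using arg_cong[OF *(3), of "\<lambda>w. w ! i"] by (simp add: perm_word_def)
    next
      case False
      then show ?thesis using * by (simp add: permutes_def)
    qed
  qed
qed

lemma finite_perms: "finite {\<pi>. \<pi> permutes {..<n::nat}}"
  by (simp add: finite_permutations)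

text \<open>Different permutations give different words, so nothing cancels.\<close>

lemma lookup_standard_poly:
  "\<pi> permutes {..<n} \<Longrightarrow> Poly_Mapping.lookup (standard_poly n) (perm_word n \<pi>) = sign \<pi>"
proof -
  assume \<pi>: "\<pi> permutes {..<n}"
  have "Poly_Mapping.lookup (standard_poly n) (perm_word n \<pi>) =
      (\<Sum>\<rho> | \<rho> permutes {..<n}. if \<rho> = \<pi> then sign \<rho> else 0)"
    unfolding standard_poly_def lookup_sum
    by (rule sum.cong) (use \<pi> inj_onD[OF perm_word_inj] in \<open>auto simp: lookup_single when_def\<close>)
  also have "\<dots> = sign \<pi>" using \<pi> by (simp add: finite_perms)
  finally show ?thesis .
qed

lemma keys_standard_poly: "Poly_Mapping.keys (standard_poly n) = perm_word n ` {\<pi>. \<pi> permutes {..<n}}"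
proof
  have "w \<in> perm_word n ` {\<pi>. \<pi> permutes {..<n}}" if "Poly_Mapping.lookup (standard_poly n) w \<noteq> 0" for w
  proof (rule ccontr)
    assume "w \<notin> perm_word n ` {\<pi>. \<pi> permutes {..<n}}"
    then have "Poly_Mapping.lookup (standard_poly n) w = (\<Sum>\<rho> | \<rho> permutes {..<n}. 0)"
      unfolding standard_poly_def lookup_sum by (intro sum.cong) (auto simp: lookup_single when_def)
    then show False using that by simp
  qed
  then show "Poly_Mapping.keys (standard_poly n) \<subseteq> perm_word n ` {\<pi>. \<pi> permutes {..<n}}"
    by (auto simp: in_keys_iff)
  show "perm_word n ` {\<pi>. \<pi> permutes {..<n}} \<subseteq> Poly_Mapping.keys (standard_poly n)"
    by (auto simp: in_keys_iff lookup_standard_poly)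
qed

lemma (in ring) finsum_minus:
  assumes "f \<in> A \<rightarrow> carrier R"
  shows "(\<Oplus>x\<in>A. \<ominus> f x) = \<ominus> (\<Oplus>x\<in>A. f x)"
proof -
  have "(\<Oplus>x\<in>A. \<ominus> f x) \<oplus> (\<Oplus>x\<in>A. f x) = (\<Oplus>x\<in>A. \<ominus> f x \<oplus> f x)"
    by (rule finsum_addf[symmetric]) (use assms in auto)
  also have "\<dots> = (\<Oplus>x\<in>A. \<zero>)" by (rule finsum_cong') (use assms in \<open>auto simp: Pi_iff l_neg\<close>)
  finally have "(\<Oplus>x\<in>A. \<ominus> f x) \<oplus> (\<Oplus>x\<in>A. f x) = \<zero>" by simp
  then show ?thesis using assms by (intro minus_equality[symmetric] finsum_closed) auto
qed

section \<open>Alternating sums\<close>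

context ring
begin

lemma word_prod_closed: "\<theta> \<in> UNIV \<rightarrow> carrier R \<Longrightarrow> word_prod R \<theta> w \<in> carrier R"
  unfolding word_prod_def by (induction w) auto

lemma nc_eval_standard_poly:
  assumes "\<theta> \<in> UNIV \<rightarrow> carrier R"
  shows "nc_eval R \<theta> (standard_poly n) = alternation R n (word_prod R \<theta>)"
proof -
  let ?P = "{\<pi>. \<pi> permutes {..<n}}"
  let ?E = "{\<pi>. \<pi> permutes {..<n} \<and> evenperm \<pi>}" and ?O = "{\<pi>. \<pi> permutes {..<n} \<and> \<not> evenperm \<pi>}"
  let ?f = "\<lambda>\<pi>. word_prod R \<theta> (perm_word n \<pi>)"
  have f: "?f \<pi> \<in> carrier R" for \<pi> by (rule word_prod_closed[OF assms])
  have pow: "add_pow R (sign \<pi> :: int) (?f \<pi>) = (if evenperm \<pi> then ?f \<pi> else \<ominus> ?f \<pi>)" for \<pi>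
    using f[of \<pi>] add.int_pow_1[of "?f \<pi>"] add.int_pow_neg[of "?f \<pi>" 1]
    by (auto simp: sign_def add_pow_def a_inv_def)
  have "nc_eval R \<theta> (standard_poly n) =
      (\<Oplus>\<pi>\<in>?P. add_pow R (Poly_Mapping.lookup (standard_poly n) (perm_word n \<pi>)) (?f \<pi>))"
    unfolding nc_eval_def keys_standard_poly word_prod_def[symmetric]
    by (rule finsum_reindex[OF _ perm_word_inj]) (use word_prod_closed[OF assms] in auto)
  also have "\<dots> = (\<Oplus>\<pi>\<in>?P. if evenperm \<pi> then ?f \<pi> else \<ominus> ?f \<pi>)"
    by (rule finsum_cong') (use f in \<open>auto simp: lookup_standard_poly pow\<close>)
  also have "?P = ?E \<union> ?O" by auto
  also have "(\<Oplus>\<pi>\<in>?E \<union> ?O. if evenperm \<pi> then ?f \<pi> else \<ominus> ?f \<pi>) =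
      (\<Oplus>\<pi>\<in>?E. if evenperm \<pi> then ?f \<pi> else \<ominus> ?f \<pi>) \<oplus> (\<Oplus>\<pi>\<in>?O. if evenperm \<pi> then ?f \<pi> else \<ominus> ?f \<pi>)"
    by (rule finsum_Un_disjoint) (use f finite_perms[of n] in auto)
  also have "(\<Oplus>\<pi>\<in>?E. if evenperm \<pi> then ?f \<pi> else \<ominus> ?f \<pi>) = (\<Oplus>\<pi>\<in>?E. ?f \<pi>)"
    by (rule finsum_cong') (use f in auto)
  also have "(\<Oplus>\<pi>\<in>?O. if evenperm \<pi> then ?f \<pi> else \<ominus> ?f \<pi>) = (\<Oplus>\<pi>\<in>?O. \<ominus> ?f \<pi>)"
    by (rule finsum_cong') (use f in auto)
  also have "\<dots> = \<ominus> (\<Oplus>\<pi>\<in>?O. ?f \<pi>)" by (rule finsum_minus) (use f in auto)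
  finally show ?thesis by (simp add: alternation_def a_minus_def)
qed

lemma alternation_closed: "(\<And>w. length w = n \<Longrightarrow> f w \<in> carrier R) \<Longrightarrow> alternation R n f \<in> carrier R"
  unfolding alternation_def by (intro minus_closed finsum_closed) auto

lemma alternation_cong:
  assumes "\<And>w. length w = n \<Longrightarrow> f w = g w" "\<And>w. length w = n \<Longrightarrow> g w \<in> carrier R"
  shows "alternation R n f = alternation R n g"
  unfolding alternation_def
  by (intro arg_cong2[where f = "\<lambda>x y. x \<ominus> y"] finsum_cong') (use assms in auto)

lemma alternation_add:
  assumes "\<And>w. length w = n \<Longrightarrow> f w \<in> carrier R" "\<And>w. length w = n \<Longrightarrow> g w \<in> carrier R"
  shows "alternation R n (\<lambda>w. f w \<oplus> g w) = alternation R n f \<oplus> alternation R n g"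
  unfolding alternation_def using assms
  by (simp add: finsum_addf diff_add_add Pi_def)

lemma alternation_rmult:
  assumes "\<And>w. length w = n \<Longrightarrow> f w \<in> carrier R" "x \<in> carrier R"
  shows "alternation R n f \<otimes> x = alternation R n (\<lambda>w. f w \<otimes> x)"
  unfolding alternation_def using assms finite_perms[of n]
  by (simp add: l_distr_minus finsum_ldistr Pi_def)

lemma alternation_zero: "alternation R n (\<lambda>w. \<zero>) = \<zero>"
  unfolding alternation_def by (simp add: minus_self)

text \<open>Composition with the transposition is a bijection between even and odd permutations
  which leaves the summands unchanged.\<close>

lemma alternation_symmetric:
  assumes f: "\<And>w. length w = n \<Longrightarrow> f w \<in> carrier R"
    and st: "s < n" "t < n" "s \<noteq> t"
    and sym: "\<And>\<pi>. \<pi> permutes {..<n} \<Longrightarrow> f (perm_word n (\<pi> \<circ> transpose s t)) = f (perm_word n \<pi>)"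
  shows "alternation R n f = \<zero>"
proof -
  let ?E = "{\<pi>. \<pi> permutes {..<n} \<and> evenperm \<pi>}" and ?O = "{\<pi>. \<pi> permutes {..<n} \<and> \<not> evenperm \<pi>}"
  let ?h = "\<lambda>\<pi>. \<pi> \<circ> transpose s t"
  have tr: "transpose s t permutes {..<n}" using st by (intro permutes_swap_id) auto
  have perm: "permutation \<pi>" if "\<pi> permutes {..<n}" for \<pi> using that permutation_permutes by blast
  have inv: "?h (?h \<pi>) = \<pi>" for \<pi> by (simp add: o_assoc[symmetric])
  have par: "evenperm (?h \<pi>) \<longleftrightarrow> \<not> evenperm \<pi>" if "\<pi> permutes {..<n}" for \<pi>
    using evenperm_comp[OF perm[OF that] perm[OF tr]] st by (simp add: evenperm_swap)
  have hperm: "?h \<pi> permutes {..<n}" if "\<pi> permutes {..<n}" for \<pi>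
    using permutes_compose[OF tr that] .
  have OE: "?O = ?h ` ?E"
  proof
    show "?h ` ?E \<subseteq> ?O" using par hperm by auto
    show "?O \<subseteq> ?h ` ?E"
    proof
      fix \<pi> assume "\<pi> \<in> ?O"
      then have "?h \<pi> \<in> ?E" using par hperm by auto
      then show "\<pi> \<in> ?h ` ?E" using inv[of \<pi>] by (intro image_eqI[of _ _ "?h \<pi>"]) auto
    qed
  qed
  have inj: "inj_on ?h ?E" using inv by (intro inj_on_inverseI[of _ ?h]) auto
  have "(\<Oplus>\<pi>\<in>?O. f (perm_word n \<pi>)) = (\<Oplus>\<pi>\<in>?E. f (perm_word n (?h \<pi>)))"
    unfolding OE by (rule finsum_reindex[OF _ inj]) (use f in auto)
  also have "\<dots> = (\<Oplus>\<pi>\<in>?E. f (perm_word n \<pi>))"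
    by (rule finsum_cong') (use f sym in auto)
  finally show ?thesis unfolding alternation_def using f by (simp add: minus_self Pi_def)
qed

text \<open>The coefficients stand on the right, so that left multiplication by \<open>R\<close> is
  linear over \<open>C\<close>.\<close>

primrec cspan :: "'a set \<Rightarrow> 'a list \<Rightarrow> 'a set" where
  "cspan C [] = {\<zero>}"
| "cspan C (x # xs) = {x \<otimes> c \<oplus> y | c y. c \<in> C \<and> y \<in> cspan C xs}"

end

text \<open>\<open>C\<close> need not be central in \<open>R\<close>. Left multiplication acts on
  the right \<open>C\<close>-module spanned by \<open>es\<close>, and so is described by square
  matrices of size \<open>length es\<close> over \<open>C\<close>.\<close>

locale finite_over_commutative = ring R for R (structure) and C es +
  assumes C_subset: "C \<subseteq> carrier R" and C_one: "\<one> \<in> C" and C_zero: "\<zero> \<in> C"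
    and C_mult: "\<And>x y. x \<in> C \<Longrightarrow> y \<in> C \<Longrightarrow> x \<otimes> y \<in> C"
    and C_comm: "\<And>x y. x \<in> C \<Longrightarrow> y \<in> C \<Longrightarrow> x \<otimes> y = y \<otimes> x"
    and es: "set es \<subseteq> carrier R" and span: "carrier R \<subseteq> cspan C es"
begin

abbreviation d where "d \<equiv> length es"

lemma C_carrier: "c \<in> C \<Longrightarrow> c \<in> carrier R"
  using C_subset by blast

lemma cspan_finsum:
  assumes "set xs \<subseteq> carrier R" "x \<in> cspan C xs"
  shows "\<exists>c. (\<forall>i. c i \<in> C) \<and> x = (\<Oplus>i\<in>{..<length xs}. xs ! i \<otimes> c i)"
  using assms
proof (induction xs arbitrary: x)
  case Nil
  then show ?case using C_zero by auto
next
  case (Cons z xs)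
  obtain a y where *: "x = z \<otimes> a \<oplus> y" "a \<in> C" "y \<in> cspan C xs" using Cons.prems(2) by auto
  obtain c where c: "\<And>i. c i \<in> C" "y = (\<Oplus>i\<in>{..<length xs}. xs ! i \<otimes> c i)" using Cons.IH[OF _ *(3)] Cons.prems(1) by auto
  have xsc: "xs ! i \<in> carrier R" if "i < length xs" for i using Cons.prems(1) that by auto
  let ?c = "\<lambda>i. case i of 0 \<Rightarrow> a | Suc j \<Rightarrow> c j"
  let ?g = "\<lambda>i. (z # xs) ! i \<otimes> ?c i"
  have g: "?g i \<in> carrier R" if "i < Suc (length xs)" for i
    using that C_carrier c(1) *(2) Cons.prems(1) xsc by (cases i) auto
  have "{..<Suc (length xs)} = insert 0 (Suc ` {..<length xs})" by (simp add: lessThan_Suc_eq_insert_0)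
  then have "(\<Oplus>i\<in>{..<Suc (length xs)}. ?g i) = (\<Oplus>i\<in>insert 0 (Suc ` {..<length xs}). ?g i)" by simp
  also have "\<dots> = ?g 0 \<oplus> (\<Oplus>i\<in>Suc ` {..<length xs}. ?g i)"
    by (rule finsum_insert) (use g g[of 0] in auto)
  also have "(\<Oplus>i\<in>Suc ` {..<length xs}. ?g i) = (\<Oplus>i\<in>{..<length xs}. ?g (Suc i))"
    by (rule finsum_reindex) (use g in auto)
  finally have "(\<Oplus>i\<in>{..<Suc (length xs)}. ?g i) = x" using * c(2) by simp
  moreover have "?c i \<in> C" for i using *(2) c(1) by (cases i) auto
  ultimately show ?case by (intro exI[of _ ?c]) auto
qed

text \<open>Left multiplication by \<open>r\<close> is \<open>C\<close>-linear; \<open>m r\<close> is a matrix for it.\<close>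

definition m :: "'a \<Rightarrow> nat \<Rightarrow> nat \<Rightarrow> 'a" where
  "m = (SOME m. \<forall>r j. r \<in> carrier R \<and> j < d \<longrightarrow> (\<forall>i. m r j i \<in> C) \<and> r \<otimes> es ! j = (\<Oplus>i\<in>{..<d}. es ! i \<otimes> m r j i))"

lemma es_carrier: "i < d \<Longrightarrow> es ! i \<in> carrier R"
  using es by auto

lemma m: "r \<in> carrier R \<Longrightarrow> j < d \<Longrightarrow> m r j i \<in> C"
  "r \<in> carrier R \<Longrightarrow> j < d \<Longrightarrow> r \<otimes> es ! j = (\<Oplus>i\<in>{..<d}. es ! i \<otimes> m r j i)"
proof -
  have "\<exists>c. r \<in> carrier R \<and> j < d \<longrightarrow> (\<forall>i. c i \<in> C) \<and> r \<otimes> es ! j = (\<Oplus>i\<in>{..<d}. es ! i \<otimes> c i)" for r j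
    using cspan_finsum[OF es, of "r \<otimes> es ! j"] span es_carrier[of j] by (cases "r \<in> carrier R \<and> j < d") auto
  then have "\<exists>m. \<forall>r j. r \<in> carrier R \<and> j < d \<longrightarrow> (\<forall>i. m r j i \<in> C) \<and> r \<otimes> es ! j = (\<Oplus>i\<in>{..<d}. es ! i \<otimes> m r j i)"
    by metis
  from someI_ex[OF this, folded m_def] show "r \<in> carrier R \<Longrightarrow> j < d \<Longrightarrow> m r j i \<in> C"
    "r \<in> carrier R \<Longrightarrow> j < d \<Longrightarrow> r \<otimes> es ! j = (\<Oplus>i\<in>{..<d}. es ! i \<otimes> m r j i)" by blast+
qed

text \<open>Matrix entries along a path are multiplied in this commutative monoid, where the factors
  may be permuted; sums of such products are formed in \<open>R\<close>.\<close>

definition CM :: "'a monoid" where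
  "CM = \<lparr>carrier = C, monoid.mult = (\<otimes>), monoid.one = \<one>\<rparr>"

lemma comm_monoid_CM: "comm_monoid CM"
  by (rule comm_monoidI) (auto simp: CM_def C_mult C_one m_assoc C_carrier intro: C_comm)

interpretation CM: comm_monoid CM by (rule comm_monoid_CM)

context
  fixes \<theta> :: "nat \<Rightarrow> 'a"
  assumes \<theta>: "\<theta> \<in> UNIV \<rightarrow> carrier R"
begin

lemma \<theta>_carrier: "\<theta> i \<in> carrier R"
  using \<theta> by blast

text \<open>The contribution of the path \<open>q\<close> to the entries of the matrix product along the word \<open>w\<close>.\<close>

definition path_prod :: "nat list \<Rightarrow> nat list \<Rightarrow> 'a" where
  "path_prod q w = finprod CM (\<lambda>t. m (\<theta> (w ! t)) (q ! Suc t) (q ! t)) {..<length w}"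

lemma nth_bound: "t < length q \<Longrightarrow> set q \<subseteq> {..<d} \<Longrightarrow> q ! t < d"
  using nth_mem[of t q] by blast

lemma path_prod_closed:
  assumes "length q = Suc (length w)" "set q \<subseteq> {..<d}"
  shows "path_prod q w \<in> C"
proof -
  have "m (\<theta> (w ! t)) (q ! Suc t) (q ! t) \<in> C" if "t < length w" for t
    by (rule m(1)[OF \<theta>_carrier nth_bound]) (use that assms in auto)
  then have "path_prod q w \<in> carrier CM" unfolding path_prod_def by (intro CM.finprod_closed) (auto simp: CM_def)
  then show ?thesis by (simp add: CM_def)
qed

lemma path_prod_Cons:
  assumes "length q = Suc (length w)" "set q \<subseteq> {..<d}"
  shows "path_prod (i # q) (a # w) = m (\<theta> a) (hd q) i \<otimes> path_prod q w"
proof -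
  let ?g = "\<lambda>t. m (\<theta> ((a # w) ! t)) (q ! t) ((i # q) ! t)"
  have g: "?g t \<in> carrier CM" if "t < Suc (length w)" for t
    using m(1)[OF \<theta>_carrier nth_bound[of t q]] that assms by (simp add: CM_def)
  have "{..<Suc (length w)} = insert 0 (Suc ` {..<length w})" by (simp add: lessThan_Suc_eq_insert_0)
  then have "path_prod (i # q) (a # w) = finprod CM ?g (insert 0 (Suc ` {..<length w}))"
    by (simp add: path_prod_def)
  also have "\<dots> = ?g 0 \<otimes>\<^bsub>CM\<^esub> finprod CM ?g (Suc ` {..<length w})"
    by (rule CM.finprod_insert) (use g g[of 0] in auto)
  also have "finprod CM ?g (Suc ` {..<length w}) = finprod CM (\<lambda>t. ?g (Suc t)) {..<length w}"
    by (rule CM.finprod_reindex) (use g in auto)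
  finally show ?thesis using assms(1) by (cases q) (simp_all add: path_prod_def CM_def)
qed

text \<open>Sums of path contributions as functions of the word. The paths, with
  \<open>n + 1\<close> vertices each, are the same for all words of length \<open>n\<close>, so an
  alternating sum can be treated path by path.\<close>

inductive_set path_sums :: "nat \<Rightarrow> (nat list \<Rightarrow> 'a) set" for n where
  zero: "(\<lambda>w. \<zero>) \<in> path_sums n"
| path: "length q = Suc n \<Longrightarrow> set q \<subseteq> {..<d} \<Longrightarrow> (\<lambda>w. es ! hd q \<otimes> path_prod q w) \<in> path_sums n"
| add: "f \<in> path_sums n \<Longrightarrow> g \<in> path_sums n \<Longrightarrow> (\<lambda>w. f w \<oplus> g w) \<in> path_sums n"

lemma hd_bound: "length q = Suc n \<Longrightarrow> set q \<subseteq> {..<d} \<Longrightarrow> hd q < d"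
  by (cases q) auto

lemma path_sums_closed:
  "f \<in> path_sums n \<Longrightarrow> length w = n \<Longrightarrow> f w \<in> carrier R"
  by (induction rule: path_sums.induct)
    (auto simp: es_carrier hd_bound C_carrier path_prod_closed)

text \<open>Expanding the product of \<open>\<theta> a\<close> with the generator at the head of a
  path prepends every possible vertex to the path.\<close>

lemma path_sums_extend:
  "f \<in> path_sums n \<Longrightarrow> \<exists>g\<in>path_sums (Suc n). \<forall>a w. length w = n \<longrightarrow> g (a # w) = \<theta> a \<otimes> f w"
proof (induction rule: path_sums.induct)
  case zero
  show ?case using \<theta>_carrier by (intro bexI[OF _ path_sums.zero]) simp
next
  case (path q)
  have "\<exists>g\<in>path_sums (Suc n). \<forall>a w. length w = n \<longrightarrow>
      g (a # w) = (\<Oplus>i\<in>{..<k}. es ! i \<otimes> (m (\<theta> a) (hd q) i \<otimes> path_prod q w))" if "k \<le> d" for k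
    using that
  proof (induction k)
    case 0
    show ?case by (intro bexI[OF _ path_sums.zero]) simp
  next
    case (Suc k)
    then obtain g where g: "g \<in> path_sums (Suc n)"
      "\<And>a w. length w = n \<Longrightarrow> g (a # w) = (\<Oplus>i\<in>{..<k}. es ! i \<otimes> (m (\<theta> a) (hd q) i \<otimes> path_prod q w))" by auto
    have k: "(\<lambda>w. es ! hd (k # q) \<otimes> path_prod (k # q) w) \<in> path_sums (Suc n)"
      by (rule path_sums.path) (use path Suc.prems in auto)
    have "es ! hd (k # q) \<otimes> path_prod (k # q) (a # w) \<oplus> g (a # w) =
        (\<Oplus>i\<in>{..<Suc k}. es ! i \<otimes> (m (\<theta> a) (hd q) i \<otimes> path_prod q w))" if w: "length w = n" for a w
    proof -
      have t: "es ! i \<otimes> (m (\<theta> a) (hd q) i \<otimes> path_prod q w) \<in> carrier R" if "i < d" for i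
        using es_carrier[OF that] m(1)[OF \<theta>_carrier hd_bound[OF path]] path_prod_closed[of q w] path w
        by (simp add: C_carrier)
      have "(\<Oplus>i\<in>insert k {..<k}. es ! i \<otimes> (m (\<theta> a) (hd q) i \<otimes> path_prod q w)) =
          es ! k \<otimes> (m (\<theta> a) (hd q) k \<otimes> path_prod q w) \<oplus> (\<Oplus>i\<in>{..<k}. es ! i \<otimes> (m (\<theta> a) (hd q) i \<otimes> path_prod q w))"
        by (rule finsum_insert) (use t Suc.prems in auto)
      then show ?thesis using g(2)[OF w] path_prod_Cons[of q w k a] path w by (simp add: lessThan_Suc)
    qed
    then show ?case by (intro bexI[OF _ path_sums.add[OF k g(1)]]) simp
  qed
  from this[of d] obtain g where g: "g \<in> path_sums (Suc n)"
    "\<And>a w. length w = n \<Longrightarrow> g (a # w) = (\<Oplus>i\<in>{..<d}. es ! i \<otimes> (m (\<theta> a) (hd q) i \<otimes> path_prod q w))" by auto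
  have "g (a # w) = \<theta> a \<otimes> (es ! hd q \<otimes> path_prod q w)" if w: "length w = n" for a w
  proof -
    note h = hd_bound[OF path]
    have p: "path_prod q w \<in> carrier R" using path_prod_closed[of q w] path w C_carrier by simp
    have mc: "m (\<theta> a) (hd q) i \<in> carrier R" for i using m(1)[OF \<theta>_carrier h] C_carrier by simp
    have "\<theta> a \<otimes> (es ! hd q \<otimes> path_prod q w) = (\<theta> a \<otimes> es ! hd q) \<otimes> path_prod q w"
      using \<theta>_carrier es_carrier[OF h] p by (simp add: m_assoc)
    also have "\<dots> = (\<Oplus>i\<in>{..<d}. es ! i \<otimes> m (\<theta> a) (hd q) i) \<otimes> path_prod q w" using m(2)[OF \<theta>_carrier h] by simp
    also have "\<dots> = (\<Oplus>i\<in>{..<d}. es ! i \<otimes> m (\<theta> a) (hd q) i \<otimes> path_prod q w)"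
      by (rule finsum_ldistr) (use p mc es_carrier in auto)
    also have "\<dots> = (\<Oplus>i\<in>{..<d}. es ! i \<otimes> (m (\<theta> a) (hd q) i \<otimes> path_prod q w))"
      by (rule finsum_cong') (use p mc es_carrier in \<open>auto simp: m_assoc\<close>)
    finally show ?thesis using g(2)[OF w] by simp
  qed
  then show ?case using g(1) by blast
next
  case (add f g)
  then obtain f' g' where *: "f' \<in> path_sums (Suc n)" "\<forall>a w. length w = n \<longrightarrow> f' (a # w) = \<theta> a \<otimes> f w"
    "g' \<in> path_sums (Suc n)" "\<forall>a w. length w = n \<longrightarrow> g' (a # w) = \<theta> a \<otimes> g w" by blast
  have "f' (a # w) \<oplus> g' (a # w) = \<theta> a \<otimes> (f w \<oplus> g w)" if "length w = n" for a w
    using * that path_sums_closed[OF add(1)] path_sums_closed[OF add(2)] \<theta>_carrier by (simp add: r_distr)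
  then show ?case by (intro bexI[OF _ path_sums.add[OF *(1,3)]]) simp
qed

lemma word_prod_path_sums:
  assumes "j < d"
  shows "\<exists>f\<in>path_sums n. \<forall>w. length w = n \<longrightarrow> word_prod R \<theta> w \<otimes> es ! j = f w"
proof (induction n)
  case 0
  have "(\<lambda>w. es ! hd [j] \<otimes> path_prod [j] w) \<in> path_sums 0" by (rule path_sums.path) (use assms in auto)
  then show ?case
  proof (rule bexI[rotated])
    have "path_prod [j] [] = \<one>\<^bsub>CM\<^esub>" by (simp add: path_prod_def)
    also have "\<dots> = \<one>" by (simp add: CM_def)
    finally show "\<forall>w. length w = 0 \<longrightarrow> word_prod R \<theta> w \<otimes> es ! j = es ! hd [j] \<otimes> path_prod [j] w"
      using es_carrier[OF assms] by (simp add: word_prod_def)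
  qed
next
  case (Suc n)
  then obtain f where f: "f \<in> path_sums n" "\<And>w. length w = n \<Longrightarrow> word_prod R \<theta> w \<otimes> es ! j = f w" by blast
  obtain g where g: "g \<in> path_sums (Suc n)" "\<And>a w. length w = n \<Longrightarrow> g (a # w) = \<theta> a \<otimes> f w"
    using path_sums_extend[OF f(1)] by blast
  have "word_prod R \<theta> w \<otimes> es ! j = g w" if "length w = Suc n" for w
  proof -
    obtain a v where w: "w = a # v" "length v = n" using \<open>length w = Suc n\<close> by (cases w) auto
    have "word_prod R \<theta> w \<otimes> es ! j = \<theta> a \<otimes> (word_prod R \<theta> v \<otimes> es ! j)"
      using w es_carrier[OF assms] \<theta>_carrier word_prod_closed[OF \<theta>, of v] by (simp add: word_prod_def m_assoc)
    then show ?thesis using f(2)[OF w(2)] g(2)[OF w(2)] w(1) by simp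
  qed
  then show ?case using g(1) by blast
qed

text \<open>By the pigeonhole principle a path of length exceeding \<open>d\<^sup>2\<close> repeats a step, and exchanging
  the two occurrences does not change its contribution.\<close>

lemma alternation_path_sum:
  assumes "f \<in> path_sums n" "d * d < n"
  shows "alternation R n f = \<zero>"
  using assms(1)
proof (induction rule: path_sums.induct)
  case zero
  show ?case by (rule alternation_zero)
next
  case (path q)
  let ?step = "\<lambda>t. (q ! t, q ! Suc t)"
  have "?step ` {..<n} \<subseteq> {..<d} \<times> {..<d}"
    using path nth_bound[of _ q] by auto
  then have "card (?step ` {..<n}) \<le> d * d"
    using card_mono[of "{..<d} \<times> {..<d}" "?step ` {..<n}"] by (simp add: card_cartesian_product)
  then have "\<not> inj_on ?step {..<n}" using assms(2) card_image[of ?step "{..<n}"] by auto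
  then obtain s t where st: "s < n" "t < n" "s \<noteq> t" "q ! s = q ! t" "q ! Suc s = q ! Suc t"
    unfolding inj_on_def by auto
  show ?case
  proof (rule alternation_symmetric[OF _ st(1-3)])
    show "es ! hd q \<otimes> path_prod q w \<in> carrier R" if "length w = n" for w
      using that path path_prod_closed[of q w] by (simp add: es_carrier hd_bound C_carrier)
  next
    fix \<pi> assume "\<pi> permutes {..<n}"
    let ?\<tau> = "transpose s t"
    let ?g = "\<lambda>u. m (\<theta> (\<pi> u)) (q ! Suc u) (q ! u)"
    have g: "?g u \<in> carrier CM" if "u < n" for u
      using m(1)[OF \<theta>_carrier nth_bound[of "Suc u" q]] that path by (simp add: CM_def)
    have img: "?\<tau> ` {..<n} = {..<n}"
      using permutes_image[OF permutes_swap_id[of s "{..<n}" t]] st(1,2) by simp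
    have "path_prod q (perm_word n (\<pi> \<circ> ?\<tau>)) = finprod CM (\<lambda>u. m (\<theta> (\<pi> (?\<tau> u))) (q ! Suc u) (q ! u)) {..<n}"
      unfolding path_prod_def by (rule CM.finprod_cong')
        (use m(1)[OF \<theta>_carrier] path nth_bound[of _ q] in \<open>auto simp: perm_word_def CM_def\<close>)
    \<comment> \<open>The steps at \<open>s\<close> and \<open>t\<close> coincide, so the
      transposition may be applied to the indices of \<open>q\<close> as well; the product is then a
      mere reindexing.\<close>
    also have "\<dots> = finprod CM (\<lambda>u. ?g (?\<tau> u)) {..<n}"
    proof (rule CM.finprod_cong')
      show "(\<lambda>u. ?g (?\<tau> u)) \<in> {..<n} \<rightarrow> carrier CM" using g img by blast
      fix u
      show "m (\<theta> (\<pi> (?\<tau> u))) (q ! Suc u) (q ! u) = ?g (?\<tau> u)"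
        using st(4,5) by (cases "u = s"; cases "u = t") (auto simp: transpose_def)
    qed simp
    also have "\<dots> = finprod CM ?g (?\<tau> ` {..<n})"
      by (rule CM.finprod_reindex[symmetric]) (use g img in \<open>auto intro: inj_on_subset[OF inj_transpose]\<close>)
    also have "\<dots> = path_prod q (perm_word n \<pi>)"
      unfolding path_prod_def img by (rule CM.finprod_cong') (use g in \<open>auto simp: perm_word_def\<close>)
    finally show "es ! hd q \<otimes> path_prod q (perm_word n (\<pi> \<circ> transpose s t)) = es ! hd q \<otimes> path_prod q (perm_word n \<pi>)"
      by simp
  qed
next
  case (add f g)
  then show ?case using alternation_add[of n f g] path_sums_closed[OF add(1)] path_sums_closed[OF add(2)] by simp
qed

text \<open>Multiplied on the right by any generator, the alternating sum becomes an alternating sum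
  of path contributions and vanishes. Since \<open>\<one>\<close> is a combination of the
  generators, the sum itself is zero.\<close>

lemma alternation_word_prod:
  assumes "d * d < n"
  shows "alternation R n (word_prod R \<theta>) = \<zero>"
proof -
  let ?S = "alternation R n (word_prod R \<theta>)"
  have S: "?S \<in> carrier R" by (rule alternation_closed[OF word_prod_closed[OF \<theta>]])
  have kill: "?S \<otimes> es ! j = \<zero>" if j: "j < d" for j
  proof -
    obtain f where f: "f \<in> path_sums n" "\<And>w. length w = n \<Longrightarrow> word_prod R \<theta> w \<otimes> es ! j = f w"
      using word_prod_path_sums[OF j] by blast
    have "?S \<otimes> es ! j = alternation R n (\<lambda>w. word_prod R \<theta> w \<otimes> es ! j)"
      by (rule alternation_rmult[OF word_prod_closed[OF \<theta>] es_carrier[OF j]])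
    also have "\<dots> = alternation R n f" by (rule alternation_cong[OF f(2) path_sums_closed[OF f(1)]])
    finally show ?thesis using alternation_path_sum[OF f(1) assms] by simp
  qed
  obtain c where c: "\<And>i. c i \<in> C" "\<one> = (\<Oplus>i\<in>{..<d}. es ! i \<otimes> c i)"
    using cspan_finsum[OF es, of \<one>] span by auto
  have "?S = ?S \<otimes> (\<Oplus>i\<in>{..<d}. es ! i \<otimes> c i)" unfolding c(2)[symmetric] using S by simp
  also have "\<dots> = (\<Oplus>i\<in>{..<d}. ?S \<otimes> (es ! i \<otimes> c i))"
    by (rule finsum_rdistr) (use S c(1) C_carrier es_carrier in auto)
  also have "\<dots> = (\<Oplus>i\<in>{..<d}. \<zero>)"
    by (rule finsum_cong') (use S kill c(1) C_carrier es_carrier in \<open>auto simp: m_assoc[symmetric]\<close>)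
  finally show ?thesis by simp
qed

end

end

section \<open>Quotients that are finite over a commutative subring\<close>

context ring
begin

lemma cspan_carrier: "C \<subseteq> carrier R \<Longrightarrow> set xs \<subseteq> carrier R \<Longrightarrow> cspan C xs \<subseteq> carrier R"
  by (induction xs) auto

lemma cspan_zero: "\<zero> \<in> C \<Longrightarrow> set xs \<subseteq> carrier R \<Longrightarrow> \<zero> \<in> cspan C xs"
proof (induction xs)
  case (Cons x xs)
  then have "\<zero> = x \<otimes> \<zero> \<oplus> \<zero>" "\<zero> \<in> cspan C xs" by auto
  then show ?case using Cons.prems(1) unfolding cspan.simps by blast
qed simp

lemma cspan_add:
  assumes "C \<subseteq> carrier R" "\<And>a b. a \<in> C \<Longrightarrow> b \<in> C \<Longrightarrow> a \<oplus> b \<in> C" "set xs \<subseteq> carrier R"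
    "x \<in> cspan C xs" "y \<in> cspan C xs"
  shows "x \<oplus> y \<in> cspan C xs"
  using assms(3-)
proof (induction xs arbitrary: x y)
  case (Cons z xs)
  then obtain a u b v where *: "x = z \<otimes> a \<oplus> u" "y = z \<otimes> b \<oplus> v" "a \<in> C" "b \<in> C"
    "u \<in> cspan C xs" "v \<in> cspan C xs" by auto
  have c: "a \<in> carrier R" "b \<in> carrier R" "u \<in> carrier R" "v \<in> carrier R" "z \<in> carrier R"
    using * assms(1) cspan_carrier[OF assms(1), of xs] Cons.prems(1) by auto
  have "x \<oplus> y = z \<otimes> (a \<oplus> b) \<oplus> (u \<oplus> v)" unfolding *(1,2) using c by (simp add: r_distr a_ac)
  moreover have "u \<oplus> v \<in> cspan C xs" using Cons * by simp
  ultimately show ?case using assms(2)[OF *(3,4)] by auto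
qed simp

lemma cspan_rmult:
  assumes "C \<subseteq> carrier R" "\<And>a b. a \<in> C \<Longrightarrow> b \<in> C \<Longrightarrow> a \<otimes> b \<in> C" "set xs \<subseteq> carrier R"
    "x \<in> cspan C xs" "c \<in> C"
  shows "x \<otimes> c \<in> cspan C xs"
  using assms(3,4)
proof (induction xs arbitrary: x)
  case Nil
  then show ?case using assms(1,5) by auto
next
  case (Cons z xs)
  then obtain a u where *: "x = z \<otimes> a \<oplus> u" "a \<in> C" "u \<in> cspan C xs" by auto
  have c: "a \<in> carrier R" "u \<in> carrier R" "z \<in> carrier R" "c \<in> carrier R"
    using * assms(1,5) cspan_carrier[OF assms(1), of xs] Cons.prems(1) by auto
  have "x \<otimes> c = z \<otimes> (a \<otimes> c) \<oplus> u \<otimes> c" unfolding *(1) using c by (simp add: l_distr m_assoc)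
  moreover have "u \<otimes> c \<in> cspan C xs" using Cons * by simp
  ultimately show ?case using assms(2)[OF *(2) assms(5)] by auto
qed

text \<open>Modulo \<open>I\<close> the ring is spanned by the images of \<open>es\<close> over the
  image of \<open>C\<close>, so the identity holds in the quotient.\<close>

lemma alternation_in_ideal:
  assumes I: "ideal I R"
    and C: "C \<subseteq> carrier R" "\<one> \<in> C" "\<zero> \<in> C" "\<And>a b. a \<in> C \<Longrightarrow> b \<in> C \<Longrightarrow> a \<otimes> b \<in> C"
      "\<And>a b. a \<in> C \<Longrightarrow> b \<in> C \<Longrightarrow> a \<otimes> b = b \<otimes> a"
    and es: "set es \<subseteq> carrier R"
    and span: "\<And>y. y \<in> carrier R \<Longrightarrow> \<exists>x\<in>cspan C es. \<exists>u\<in>I. y = x \<oplus> u"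
    and \<theta>: "\<theta> \<in> UNIV \<rightarrow> carrier R" and n: "length es * length es < n"
  shows "alternation R n (word_prod R \<theta>) \<in> I"
proof -
  let ?S = "R Quot I" and ?h = "(+>) I"
  interpret I: ideal I R by fact
  interpret h: ring_hom_ring R ?S ?h by (rule I.rcos_ring_hom_ring)
  have hI: "?h u = \<zero>\<^bsub>?S\<^esub>" if "u \<in> I" for u
    unfolding FactRing_def using I.a_rcos_const[OF that] by simp
  have hcspan: "?h x \<in> h.S.cspan (?h ` C) (map ?h es)" if "x \<in> cspan C es" for x
    using es that
  proof (induction es arbitrary: x)
    case (Cons e es)
    then obtain c y where *: "x = e \<otimes> c \<oplus> y" "c \<in> C" "y \<in> cspan C es" by auto
    have c: "e \<in> carrier R" "c \<in> carrier R" "y \<in> carrier R" "set es \<subseteq> carrier R"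
      using * C(1) Cons.prems(1) cspan_carrier[OF C(1), of es] by auto
    have "?h x = ?h (e \<otimes> c) \<oplus>\<^bsub>?S\<^esub> ?h y" unfolding *(1) by (rule h.hom_add) (use c in simp_all)
    also have "?h (e \<otimes> c) = ?h e \<otimes>\<^bsub>?S\<^esub> ?h c" by (rule h.hom_mult) (use c in simp_all)
    finally have "?h x = ?h e \<otimes>\<^bsub>?S\<^esub> ?h c \<oplus>\<^bsub>?S\<^esub> ?h y" .
    then show ?case unfolding list.map h.S.cspan.simps using *(2) Cons.IH[OF c(4) *(3)] by blast
  next
    case Nil
    then have "x = \<zero>" by simp
    then have "?h x = \<zero>\<^bsub>?S\<^esub>" by (simp only: h.hom_zero)
    then show ?case unfolding list.map h.S.cspan.simps by blast
  qed
  interpret Q: finite_over_commutative ?S "?h ` C" "map ?h es"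
  proof unfold_locales
    show "carrier ?S \<subseteq> h.S.cspan (?h ` C) (map ?h es)"
    proof
      fix q assume "q \<in> carrier ?S"
      then obtain y where y: "y \<in> carrier R" "q = ?h y"
        unfolding FactRing_def A_RCOSETS_def' by auto
      obtain x u where xu: "x \<in> cspan C es" "u \<in> I" "y = x \<oplus> u" using span[OF y(1)] by blast
      have "x \<in> carrier R" using cspan_carrier[OF C(1) es] xu(1) by blast
      then have "q = ?h x \<oplus>\<^bsub>?S\<^esub> ?h u" unfolding y(2) xu(3) using I.Icarr[OF xu(2)] by (rule h.hom_add)
      also have "?h u = \<zero>\<^bsub>?S\<^esub>" by (rule hI[OF xu(2)])
      also have "?h x \<oplus>\<^bsub>?S\<^esub> \<zero>\<^bsub>?S\<^esub> = ?h x" by (rule h.S.r_zero[OF h.hom_closed[OF \<open>x \<in> carrier R\<close>]])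
      finally show "q \<in> h.S.cspan (?h ` C) (map ?h es)" using hcspan[OF xu(1)] by (rule ssubst)
    qed
    show "?h ` C \<subseteq> carrier ?S" using C(1) h.hom_closed by blast
    show "\<one>\<^bsub>?S\<^esub> \<in> ?h ` C" using C(2) h.hom_one by (metis imageI)
    show "\<zero>\<^bsub>?S\<^esub> \<in> ?h ` C" using C(3) h.hom_zero by (metis imageI)
    show "set (map ?h es) \<subseteq> carrier ?S" using es h.hom_closed by auto
  next
    fix a b assume "a \<in> ?h ` C" "b \<in> ?h ` C"
    then obtain a' b' where *: "a = ?h a'" "b = ?h b'" "a' \<in> C" "b' \<in> C" by blast
    then have m: "a \<otimes>\<^bsub>?S\<^esub> b = ?h (a' \<otimes> b')" "b \<otimes>\<^bsub>?S\<^esub> a = ?h (b' \<otimes> a')"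
      unfolding * using h.hom_mult[of a' b'] h.hom_mult[of b' a'] subsetD[OF C(1)] by (metis *(3,4))+
    show "a \<otimes>\<^bsub>?S\<^esub> b \<in> ?h ` C" unfolding m(1) using C(4)[OF *(3,4)] by (rule imageI)
    show "a \<otimes>\<^bsub>?S\<^esub> b = b \<otimes>\<^bsub>?S\<^esub> a" unfolding m C(5)[OF *(3,4)] ..
  qed
  have \<theta>h: "(\<lambda>i. ?h (\<theta> i)) \<in> UNIV \<rightarrow> carrier ?S" using \<theta> h.hom_closed by blast
  have wp: "?h (word_prod R \<theta> w) = word_prod ?S (\<lambda>i. ?h (\<theta> i)) w" for w
  proof (induction w)
    case (Cons i w)
    have "\<theta> i \<in> carrier R" using \<theta> by blast
    then have "?h (\<theta> i \<otimes> word_prod R \<theta> w) = ?h (\<theta> i) \<otimes>\<^bsub>?S\<^esub> ?h (word_prod R \<theta> w)"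
      using word_prod_closed[OF \<theta>, of w] by (rule h.hom_mult)
    then show ?case unfolding Cons by (simp only: word_prod_def foldr.simps o_apply)
  next
    case Nil
    show ?case by (simp only: word_prod_def foldr.simps id_apply h.hom_one)
  qed
  note wc = word_prod_closed[OF \<theta>] and wc' = h.S.word_prod_closed[OF \<theta>h]
  have fs: "?h (\<Oplus>\<pi>\<in>A. word_prod R \<theta> (perm_word n \<pi>)) =
      (\<Oplus>\<^bsub>?S\<^esub>\<pi>\<in>A. word_prod ?S (\<lambda>i. ?h (\<theta> i)) (perm_word n \<pi>))" for A
  proof -
    have "?h (\<Oplus>\<pi>\<in>A. word_prod R \<theta> (perm_word n \<pi>)) = finsum ?S (?h \<circ> (\<lambda>\<pi>. word_prod R \<theta> (perm_word n \<pi>))) A"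
      by (rule h.hom_finsum) (use wc in blast)
    then show ?thesis by (simp only: o_def wp)
  qed
  have "?h (alternation R n (word_prod R \<theta>)) = alternation ?S n (word_prod ?S (\<lambda>i. ?h (\<theta> i)))"
  proof -
    have c: "(\<Oplus>\<pi>\<in>A. word_prod R \<theta> (perm_word n \<pi>)) \<in> carrier R" for A by (rule finsum_closed) (use wc in blast)
    show ?thesis unfolding alternation_def a_minus_def
      h.hom_add[OF c a_inv_closed[OF c]] h.hom_a_inv[OF c] fs ..
  qed
  also have "\<dots> = \<zero>\<^bsub>?S\<^esub>" by (rule Q.alternation_word_prod[OF \<theta>h]) (use n in simp)
  also have "\<dots> = I" by (simp only: FactRing_def ring.simps)
  finally show ?thesis by (rule I.rcos_const_imp_mem[OF alternation_closed[OF wc]])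
qed

end

context central_subfield
begin

lemma kspan_cspan:
  assumes "F \<subseteq> C" "C \<subseteq> carrier R" "set fs \<subseteq> carrier R" "W \<subseteq> carrier R" "y \<in> kspan fs W"
  shows "\<exists>x\<in>cspan C fs. \<exists>w\<in>W. y = x \<oplus> w"
  using assms(3,5)
proof (induction fs arbitrary: y)
  case Nil
  then have "y = \<zero> \<oplus> y" using assms(4) by auto
  then show ?case using Nil by auto
next
  case (Cons f fs)
  then obtain c z where *: "y = c \<otimes> f \<oplus> z" "c \<in> F" "z \<in> kspan fs W" by auto
  obtain x w where xw: "x \<in> cspan C fs" "w \<in> W" "z = x \<oplus> w" using Cons.IH[OF _ *(3)] Cons.prems(1) by auto
  have c: "x \<in> carrier R" "w \<in> carrier R" "f \<in> carrier R" "c \<in> carrier R"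
    using cspan_carrier[OF assms(2), of fs] xw(1,2) assms(4) Cons.prems(1) *(2) by auto
  have "y = (f \<otimes> c \<oplus> x) \<oplus> w" unfolding *(1) xw(3) using c F_central[OF *(2) c(3)] by (simp add: a_assoc)
  moreover have "f \<otimes> c \<oplus> x \<in> cspan C (f # fs)" using *(2) assms(1) xw(1) by auto
  ultimately show ?case using xw(2) by blast
qed

text \<open>The ideals \<open>A n\<close> stand for the powers of an invertible ideal. The same list
  \<open>fs\<close> spans \<open>R\<close> modulo every \<open>A n\<close> over one commutative
  subring, so a single standard identity holds modulo all \<open>A n\<close>, whose intersection is
  zero.\<close>

lemma PI_criterion:
  assumes A: "\<And>n. ideal (A n) R" "(\<Inter>n. A n) = {\<zero>}"
    and s: "s \<in> carrier R" "\<And>n::nat. s [^] n \<in> A n"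
    and m: "\<And>n x. x \<in> A m \<Longrightarrow> \<exists>r\<in>carrier R. \<exists>u\<in>A n. x = r \<otimes> s \<oplus> u"
    and fin: "fin_mod (carrier R) (A m)"
  shows "PI_ring R"
proof -
  obtain fs where fs: "set fs \<subseteq> carrier R" "carrier R \<subseteq> kspan fs (A m)"
    using fin unfolding fin_mod_def by blast
  \<comment> \<open>The bicommutant of \<open>s\<close>. It contains \<open>s\<close> and
    \<open>F\<close>, and it is commutative because its elements commute with \<open>s\<close> and
    hence with each other.\<close>
  define C where "C = {x \<in> carrier R. \<forall>y\<in>carrier R. y \<otimes> s = s \<otimes> y \<longrightarrow> x \<otimes> y = y \<otimes> x}"
  have CI: "x \<in> C" if "x \<in> carrier R" "\<And>y. y \<in> carrier R \<Longrightarrow> y \<otimes> s = s \<otimes> y \<Longrightarrow> x \<otimes> y = y \<otimes> x" for x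
    using that by (simp add: C_def)
  have CD: "x \<in> carrier R" "\<And>y. y \<in> carrier R \<Longrightarrow> y \<otimes> s = s \<otimes> y \<Longrightarrow> x \<otimes> y = y \<otimes> x" if "x \<in> C" for x
    using that by (simp_all add: C_def)
  have C_subset: "C \<subseteq> carrier R" using CD by blast
  have sC: "s \<in> C" by (rule CI) (use s in auto)
  have FC: "F \<subseteq> C"
  proof
    fix c assume "c \<in> F"
    then show "c \<in> C" by (intro CI) (use F_central in auto)
  qed
  have C_zero: "\<zero> \<in> C" using FC F_zero by blast
  have C_add: "a \<oplus> b \<in> C" if "a \<in> C" "b \<in> C" for a b
    by (rule CI) (use CD[OF that(1)] CD[OF that(2)] in \<open>auto simp: l_distr r_distr\<close>)
  have C_mult: "a \<otimes> b \<in> C" if "a \<in> C" "b \<in> C" for a b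
  proof (rule CI)
    fix y assume y: "y \<in> carrier R" "y \<otimes> s = s \<otimes> y"
    have "a \<otimes> b \<otimes> y = a \<otimes> (y \<otimes> b)" using CD[OF that(1)] CD[OF that(2)] y by (simp add: m_assoc)
    also have "\<dots> = y \<otimes> a \<otimes> b" using CD(1)[OF that(1)] CD(1)[OF that(2)] CD(2)[OF that(1) y] y(1)
      by (simp add: m_assoc[symmetric])
    finally show "a \<otimes> b \<otimes> y = y \<otimes> (a \<otimes> b)" using CD(1)[OF that(1)] CD(1)[OF that(2)] y(1) by (simp add: m_assoc)
  qed (use CD that in auto)
  have C_comm: "a \<otimes> b = b \<otimes> a" if "a \<in> C" "b \<in> C" for a b
    using CD(2)[OF that(1) CD(1)[OF that(2)]] CD(2)[OF that(2) s(1)] by simp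
  have Ac: "x \<in> carrier R" if "x \<in> A n" for x n
    using ideal.Icarr[OF A(1) that] .
  \<comment> \<open>\<open>N\<close> counts the substitutions. Each one replaces the coefficient of
    \<open>s\<close> by its own expansion, which pushes the remainder to a higher power of
    \<open>s\<close>; \<open>N = n\<close> will put it into \<open>A n\<close>.\<close>
  have expand: "\<exists>x\<in>cspan C fs. \<exists>b\<in>carrier R. \<exists>u\<in>A n. y = x \<oplus> b \<otimes> s [^] N \<oplus> u"
    if "y \<in> carrier R" for y n and N :: nat
    using that
  proof (induction N arbitrary: y)
    case 0
    have "y = \<zero> \<oplus> y \<otimes> s [^] (0::nat) \<oplus> \<zero>" using 0 by simp
    then show ?case using cspan_zero[OF C_zero fs(1)] 0 additive_subgroup.zero_closed[OF ideal.axioms(1)[OF A(1)]]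
      by blast
  next
    case (Suc N)
    have "y \<in> kspan fs (A m)" using Suc.prems fs(2) by blast
    then obtain x w where xw: "x \<in> cspan C fs" "w \<in> A m" "y = x \<oplus> w"
      using kspan_cspan[OF FC C_subset fs(1), of "A m" y] Ac by blast
    obtain r u where ru: "r \<in> carrier R" "u \<in> A n" "w = r \<otimes> s \<oplus> u" using m[OF xw(2)] by blast
    obtain x' b u' where IH: "x' \<in> cspan C fs" "b \<in> carrier R" "u' \<in> A n" "r = x' \<oplus> b \<otimes> s [^] N \<oplus> u'"
      using Suc.IH[OF ru(1)] by blast
    have c: "x \<in> carrier R" "x' \<in> carrier R" "u \<in> carrier R" "u' \<in> carrier R"
      using cspan_carrier[OF C_subset fs(1)] xw(1) IH(1,3) ru(2) Ac by auto
    have "y = (x \<oplus> x' \<otimes> s) \<oplus> b \<otimes> s [^] Suc N \<oplus> (u' \<otimes> s \<oplus> u)"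
      unfolding xw(3) ru(3) IH(4) using c IH(2) s(1) by (simp add: l_distr a_ac m_assoc)
    moreover have "x \<oplus> x' \<otimes> s \<in> cspan C fs"
      using cspan_add[OF C_subset C_add fs(1) xw(1) cspan_rmult[OF C_subset C_mult fs(1) IH(1) sC]] .
    moreover have "u' \<otimes> s \<oplus> u \<in> A n"
      using additive_subgroup.a_closed[OF ideal.axioms(1)[OF A(1)] ideal.I_r_closed[OF A(1) IH(3) s(1)] ru(2)] .
    ultimately show ?case using IH(2) by blast
  qed
  have span: "\<exists>x\<in>cspan C fs. \<exists>u\<in>A n. y = x \<oplus> u" if y: "y \<in> carrier R" for y n
  proof -
    obtain x b u where *: "x \<in> cspan C fs" "b \<in> carrier R" "u \<in> A n" "y = x \<oplus> b \<otimes> s [^] n \<oplus> u"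
      using expand[OF y] by blast
    have "b \<otimes> s [^] n \<oplus> u \<in> A n"
      using additive_subgroup.a_closed[OF ideal.axioms(1)[OF A(1)] ideal.I_l_closed[OF A(1) s(2) *(2)] *(3)] .
    moreover have "y = x \<oplus> (b \<otimes> s [^] n \<oplus> u)"
      unfolding *(4) using cspan_carrier[OF C_subset fs(1)] *(1,2) Ac[OF *(3)] s(1) by (auto simp: a_assoc)
    ultimately show ?thesis using *(1) by blast
  qed
  \<comment> \<open>One more than the number of different steps between \<open>length fs\<close>
    indices.\<close>
  let ?N = "Suc (length fs * length fs)"
  have zero: "nc_eval R \<theta> (standard_poly ?N) = \<zero>" if \<theta>: "\<theta> \<in> UNIV \<rightarrow> carrier R" for \<theta>
  proof -
    have "alternation R ?N (word_prod R \<theta>) \<in> A n" for n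
      by (rule alternation_in_ideal[OF A(1) C_subset _ C_zero C_mult C_comm fs(1) span \<theta>]) (use FC F_one in auto)
    then have "alternation R ?N (word_prod R \<theta>) \<in> (\<Inter>n. A n)" by blast
    then show ?thesis unfolding A(2) nc_eval_standard_poly[OF \<theta>] by simp
  qed
  have "Poly_Mapping.lookup (standard_poly ?N) (perm_word ?N id) = 1"
    using lookup_standard_poly[OF permutes_id, of ?N] sign_id by (simp add: id_def)
  moreover have "\<forall>v\<in>Poly_Mapping.keys (standard_poly ?N). length v \<le> length (perm_word ?N id)"
    by (auto simp: keys_standard_poly)
  ultimately show ?thesis unfolding PI_ring_def using zero ring_axioms by blast
qed

end

section \<open>Tensor products with an algebraic closure\<close>

text \<open>\<open>eval\<close> expects the leading coefficient first, \<open>horner\<close> the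
  constant term.\<close>

lemma (in ring) eval_rev:
  "set cs \<subseteq> carrier R \<Longrightarrow> x \<in> carrier R \<Longrightarrow> eval (rev cs) x = horner R cs x"
proof (induction cs)
  case (Cons c cs)
  then have "eval (rev cs @ [c]) x = eval (rev cs) x \<otimes> x \<oplus> c"
    by (intro eval_append_aux) auto
  then show ?case using Cons horner_closed[of cs x] by (simp add: a_comm)
qed simp

lemma (in algebraically_closed) horner_root:
  assumes "set cs \<subseteq> carrier L" "length cs \<ge> 2" "last cs \<noteq> \<zero>"
  shows "\<exists>x\<in>carrier L. horner L cs x = \<zero>"
proof -
  have p: "rev cs \<in> carrier (poly_ring L)"
    unfolding univ_poly_carrier[symmetric] polynomial_def using assms by (auto simp: hd_rev)
  have "size (roots (rev cs)) = length cs - 1"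
    using roots_over_carrier[OF p] unfolding splitted_def by simp
  then have "roots (rev cs) \<noteq> {#}" using assms(2) by auto
  then obtain x where "x \<in># roots (rev cs)" by blast
  then have "is_root (rev cs) x" using roots_mem_iff_is_root[OF p] by simp
  then show ?thesis unfolding is_root_def using eval_rev[OF assms(1)] by auto
qed

text \<open>The lists of a fixed length inject into a finite power of \<open>B\<close>, and
  countably many sets of size at most that of the infinite \<open>B\<close> do not exceed
  \<open>B\<close>.\<close>

lemma card_of_lists:
  assumes "infinite B"
  shows "ordLeq3 (card_of (lists B)) (card_of B)"
proof -
  let ?L = "\<lambda>n. {xs. set xs \<subseteq> B \<and> length xs = n}"
  have "ordLeq3 (card_of (?L n)) (card_of B)" for n
  proof (induction n)
    case 0
    have eq: "?L 0 = {[]}" by auto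
    show ?case unfolding eq by (rule card_of_singl_ordLeq) (use assms in auto)
  next
    case (Suc n)
    have eq: "?L (Suc n) = (\<lambda>(x, xs). x # xs) ` (B \<times> ?L n)"
      by (auto simp: length_Suc_conv image_iff)
    have "ordLeq3 (card_of (?L (Suc n))) (card_of (B \<times> ?L n))" unfolding eq by (rule card_of_image)
    moreover have "ordLeq3 (card_of (B \<times> ?L n)) (card_of B)"
      by (rule card_of_Times_ordLeq_infinite_Field)
        (use assms Suc in \<open>simp_all add: card_of_refl ordIso_imp_ordLeq card_of_Card_order Field_card_of\<close>)
    ultimately show ?case by (rule ordLeq_transitive)
  qed
  then have "ordLeq3 (card_of (\<Union>n\<in>UNIV. ?L n)) (card_of B)"
    using assms infinite_iff_card_of_nat[of B] by (intro card_of_UNION_ordLeq_infinite) auto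
  moreover have "lists B = (\<Union>n\<in>UNIV. ?L n)" by auto
  ultimately show ?thesis by simp
qed

section \<open>Scalars and bases in an algebra over a field\<close>

locale field_algebra = K: field k + central_algebra k R
  for k :: "('k, 'm) ring_scheme" and R :: "('k, 'r, 'p) module_scheme" +
  assumes nontrivial: "\<one>\<^bsub>R\<^esub> \<noteq> \<zero>\<^bsub>R\<^esub>"
begin

definition scalar :: "'k \<Rightarrow> 'r" where
  "scalar c = c \<odot>\<^bsub>R\<^esub> \<one>\<^bsub>R\<^esub>"

definition scalars :: "'r set" where
  "scalars = scalar ` carrier k"

lemma scalar_closed: "c \<in> carrier k \<Longrightarrow> scalar c \<in> carrier R"
  by (simp add: scalar_def)

lemma scalar_mult: "c \<in> carrier k \<Longrightarrow> x \<in> carrier R \<Longrightarrow> scalar c \<otimes>\<^bsub>R\<^esub> x = c \<odot>\<^bsub>R\<^esub> x"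
  by (simp add: scalar_def smult_mult_left)

lemma scalar_zero: "scalar \<zero>\<^bsub>k\<^esub> = \<zero>\<^bsub>R\<^esub>"
  by (simp add: scalar_def)

lemma scalar_diff: "c \<in> carrier k \<Longrightarrow> d \<in> carrier k \<Longrightarrow> scalar (c \<ominus>\<^bsub>k\<^esub> d) = scalar c \<ominus>\<^bsub>R\<^esub> scalar d"
  unfolding scalar_def a_minus_def by (simp add: smult_l_distr smult_l_minus)

lemma scalar_scalar: "c \<in> carrier k \<Longrightarrow> d \<in> carrier k \<Longrightarrow> scalar (c \<otimes>\<^bsub>k\<^esub> d) = scalar c \<otimes>\<^bsub>R\<^esub> scalar d"
  by (simp add: scalar_mult scalar_closed) (simp add: scalar_def smult_assoc1)

lemma scalar_one: "scalar \<one>\<^bsub>k\<^esub> = \<one>\<^bsub>R\<^esub>"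
  by (simp add: scalar_def)

lemma scalar_inverse:
  assumes "c \<in> carrier k" "c \<noteq> \<zero>\<^bsub>k\<^esub>"
  shows "inv\<^bsub>k\<^esub> c \<in> carrier k" "scalar (inv\<^bsub>k\<^esub> c) \<otimes>\<^bsub>R\<^esub> scalar c = \<one>\<^bsub>R\<^esub>"
proof -
  have U: "c \<in> Units k" using assms K.field_Units by blast
  then show c: "inv\<^bsub>k\<^esub> c \<in> carrier k" by simp
  show "scalar (inv\<^bsub>k\<^esub> c) \<otimes>\<^bsub>R\<^esub> scalar c = \<one>\<^bsub>R\<^esub>"
    using scalar_scalar[OF c assms(1)] K.Units_l_inv[OF U] scalar_one by simp
qed

lemma scalar_inj: "inj_on scalar (carrier k)"
proof (rule inj_onI)
  fix c d assume cd: "c \<in> carrier k" "d \<in> carrier k" "scalar c = scalar d"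
  have z: "scalar (c \<ominus>\<^bsub>k\<^esub> d) = \<zero>\<^bsub>R\<^esub>" using scalar_diff[OF cd(1,2)] cd A.minus_self[OF scalar_closed[OF cd(2)]] by simp
  have "c \<ominus>\<^bsub>k\<^esub> d = \<zero>\<^bsub>k\<^esub>"
  proof (rule ccontr)
    assume "c \<ominus>\<^bsub>k\<^esub> d \<noteq> \<zero>\<^bsub>k\<^esub>"
    with scalar_inverse[of "c \<ominus>\<^bsub>k\<^esub> d"] cd z nontrivial scalar_closed show False by simp
  qed
  then show "c = d" using cd by (simp add: K.r_right_minus_eq)
qed

lemma central_subfield_scalars: "central_subfield R scalars"
proof unfold_locales
  show "scalars \<subseteq> carrier R" by (auto simp: scalars_def scalar_closed)
  show "\<one>\<^bsub>R\<^esub> \<in> scalars" using scalar_one unfolding scalars_def by (metis K.one_closed imageI)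
  show "\<one>\<^bsub>R\<^esub> \<noteq> \<zero>\<^bsub>R\<^esub>" by (rule nontrivial)
  fix a assume "a \<in> scalars"
  then obtain c where c: "c \<in> carrier k" "a = scalar c" by (auto simp: scalars_def)
  show "a \<otimes>\<^bsub>R\<^esub> x = x \<otimes>\<^bsub>R\<^esub> a" if "x \<in> carrier R" for x
    using c that unfolding c(2) by (simp add: scalar_mult) (simp add: scalar_def smult_mult_right)
  show "\<exists>b\<in>scalars. b \<otimes>\<^bsub>R\<^esub> a = \<one>\<^bsub>R\<^esub>" if "a \<noteq> \<zero>\<^bsub>R\<^esub>"
    using scalar_inverse[OF c(1)] that c scalar_zero unfolding scalars_def by blast
  fix b assume "b \<in> scalars"
  then obtain d where d: "d \<in> carrier k" "b = scalar d" by (auto simp: scalars_def)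
  have "a \<ominus>\<^bsub>R\<^esub> b = scalar (c \<ominus>\<^bsub>k\<^esub> d)" "a \<otimes>\<^bsub>R\<^esub> b = scalar (c \<otimes>\<^bsub>k\<^esub> d)"
    using scalar_diff scalar_scalar c d by simp_all
  then show "a \<ominus>\<^bsub>R\<^esub> b \<in> scalars" "a \<otimes>\<^bsub>R\<^esub> b \<in> scalars" using c d unfolding scalars_def by auto
qed

sublocale F: central_subfield R scalars
  by (rule central_subfield_scalars)

lemma card_scalars: "ordIso2 (card_of (carrier k)) (card_of scalars)"
  using scalar_inj card_of_ordIso unfolding bij_betw_def scalars_def by blast

text \<open>A linear combination uses finitely many basis vectors. The spans of the lists over
  \<open>B\<close> thus form the covering family that Amitsur's counting requires.\<close>

lemma basis_cover:
  assumes "vectorspace.basis k R B"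
  shows "B \<subseteq> carrier R" "carrier R \<subseteq> (\<Union>bs\<in>lists B. F.kspan bs {\<zero>\<^bsub>R\<^esub>})"
proof -
  interpret V: vectorspace k R by unfold_locales
  show B: "B \<subseteq> carrier R" using assms unfolding V.basis_def by blast
  have lin: "\<exists>bs\<in>lists A. (\<Oplus>\<^bsub>R\<^esub>v\<in>A. a v \<odot>\<^bsub>R\<^esub> v) \<in> F.kspan bs {\<zero>\<^bsub>R\<^esub>}"
    if "finite A" "A \<subseteq> carrier R" "a \<in> A \<rightarrow> carrier k" for A a
    using that
  proof induction
    case empty
    show ?case by (intro bexI[of _ "[]"]) auto
  next
    case (insert v A)
    then obtain bs where bs: "bs \<in> lists A" "(\<Oplus>\<^bsub>R\<^esub>v\<in>A. a v \<odot>\<^bsub>R\<^esub> v) \<in> F.kspan bs {\<zero>\<^bsub>R\<^esub>}" by auto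
    have "(\<Oplus>\<^bsub>R\<^esub>v\<in>insert v A. a v \<odot>\<^bsub>R\<^esub> v) = a v \<odot>\<^bsub>R\<^esub> v \<oplus>\<^bsub>R\<^esub> (\<Oplus>\<^bsub>R\<^esub>v\<in>A. a v \<odot>\<^bsub>R\<^esub> v)"
      using insert.hyps insert.prems by (intro M.finsum_insert) (auto simp: Pi_iff)
    also have "a v \<odot>\<^bsub>R\<^esub> v = scalar (a v) \<otimes>\<^bsub>R\<^esub> v" using insert.prems by (intro scalar_mult[symmetric]) auto
    finally have "(\<Oplus>\<^bsub>R\<^esub>v\<in>insert v A. a v \<odot>\<^bsub>R\<^esub> v) = scalar (a v) \<otimes>\<^bsub>R\<^esub> v \<oplus>\<^bsub>R\<^esub> (\<Oplus>\<^bsub>R\<^esub>v\<in>A. a v \<odot>\<^bsub>R\<^esub> v)" .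
    moreover have "scalar (a v) \<in> scalars" using insert.prems by (auto simp: scalars_def)
    ultimately have "(\<Oplus>\<^bsub>R\<^esub>v\<in>insert v A. a v \<odot>\<^bsub>R\<^esub> v) \<in> F.kspan (v # bs) {\<zero>\<^bsub>R\<^esub>}"
      using F.kspan_ConsI[OF _ bs(2)] by simp
    moreover have "v # bs \<in> lists (insert v A)" using bs(1) by auto
    ultimately show ?case by blast
  qed
  show "carrier R \<subseteq> (\<Union>bs\<in>lists B. F.kspan bs {\<zero>\<^bsub>R\<^esub>})"
  proof
    fix x assume "x \<in> carrier R"
    then have "x \<in> span B" using assms unfolding V.basis_def by blast
    then obtain a A where *: "finite A" "A \<subseteq> B" "a \<in> A \<rightarrow> carrier k" "x = lincomb a A"
      unfolding span_def by blast
    obtain bs where "bs \<in> lists A" "x \<in> F.kspan bs {\<zero>\<^bsub>R\<^esub>}"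
      using lin[OF *(1) _ *(3)] *(2) B unfolding *(4) lincomb_def by blast
    moreover have "bs \<in> lists B" using \<open>bs \<in> lists A\<close> *(2) by auto
    ultimately show "x \<in> (\<Union>bs\<in>lists B. F.kspan bs {\<zero>\<^bsub>R\<^esub>})" by blast
  qed
qed

lemma ksub_zero: "F.ksub {\<zero>\<^bsub>R\<^esub>}"
  by (rule F.ksubI) (auto simp: A.minus_self)

lemma finite_basis:
  assumes "vectorspace.basis k R B" "finite B"
  shows "F.fin_mod (carrier R) {\<zero>\<^bsub>R\<^esub>}"
proof -
  obtain bs where bs: "set bs = B" using finite_list[OF assms(2)] by blast
  note B = basis_cover[OF assms(1)]
  have "carrier R \<subseteq> F.kspan bs {\<zero>\<^bsub>R\<^esub>}"
    using B F.kspan_mono_set[OF ksub_zero, of bs] bs by fastforce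
  then show ?thesis unfolding F.fin_mod_def using bs B(1) by blast
qed

text \<open>For infinite \<open>B\<close> there are no more lists than basis vectors, hence fewer
  lists than scalars.\<close>

lemma infinite_basis_algebraic:
  assumes "vectorspace.basis k R B" "infinite B" "ordLess2 (card_of B) (card_of (carrier k))"
    and "maximal_left_ideal R scalars L" "a \<in> maximal_left_ideal.idealizer R L"
  shows "\<exists>n. a [^]\<^bsub>R\<^esub> (n::nat) \<in> maximal_left_ideal.powers R L scalars a n"
proof -
  interpret M: maximal_left_ideal R scalars L by fact
  show ?thesis
  proof (rule M.algebraic_modulo[OF assms(5) basis_cover(2)[OF assms(1)]])
    show "set bs \<subseteq> carrier R" if "bs \<in> lists B" for bs using that basis_cover(1)[OF assms(1)] by auto
    have "infinite ((\<lambda>b. [b]) ` B)" using assms(2) finite_imageD[of "\<lambda>b. [b]" B] by (metis injI list.inject inj_on_subset subset_UNIV)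
    moreover have "(\<lambda>b. [b]) ` B \<subseteq> lists B" by auto
    ultimately show "infinite (lists B)" by (rule infinite_super[rotated])
    show "ordLess2 (card_of (lists B)) (card_of scalars)"
      using ordLeq_ordLess_trans[OF card_of_lists[OF assms(2)] assms(3)] card_scalars
      by (rule ordLess_ordIso_trans)
  qed
qed

end

section \<open>The tensor product with an extension field\<close>

locale base_change = field_algebra k R + B: central_algebra k B + B: field B
  for k :: "('k, 'm) ring_scheme" and R :: "('k, 'r, 'p) module_scheme" and B :: "('k, 'l, 'n) module_scheme"
begin

abbreviation P where "P \<equiv> pair_ring R B"
abbreviation G where "G \<equiv> generate (add_monoid P) (tensor_relations k R B)"
abbreviation T where "T \<equiv> tensor_algebra k R B"

lemma algebras: "central_algebra k R" "central_algebra k B"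
  by (rule central_algebra_axioms B.central_algebra_axioms)+

lemma rings: "ring R" "ring B"
  by (rule A.ring_axioms B.ring_axioms)+

definition cls :: "('r \<times> 'l \<Rightarrow>\<^sub>0 int) \<Rightarrow> ('r \<times> 'l \<Rightarrow>\<^sub>0 int) set" where
  "cls u = G +>\<^bsub>P\<^esub> u"

definition tensor :: "'r \<Rightarrow> 'l \<Rightarrow> ('r \<times> 'l \<Rightarrow>\<^sub>0 int) set" where
  "tensor r b = cls (frag_of (r, b))"

lemma cls_hom: "ring_hom_ring P T cls"
  using ideal.rcos_ring_hom_ring[OF ideal_tensor_relations[OF algebras]]
  by (simp add: tensor_algebra_def cls_def[abs_def])

lemma ring_P: "ring P"
  by (rule ring_pair_ring[OF rings])

lemma ring_T: "ring T"
  by (rule ring_tensor_algebra[OF algebras])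

lemma P_minus:
  assumes "u \<in> carrier P" "v \<in> carrier P"
  shows "u \<ominus>\<^bsub>P\<^esub> v = u - v"
proof -
  interpret P: ring P by (rule ring_P)
  have "\<ominus>\<^bsub>P\<^esub> v = - v"
    by (rule P.minus_equality)
      (use assms in \<open>auto simp: pair_ring_simps[OF rings] pair_ring_carrier[OF rings]\<close>)
  then show ?thesis by (simp add: a_minus_def pair_ring_simps[OF rings])
qed

lemma P_diff: "u \<in> carrier P \<Longrightarrow> v \<in> carrier P \<Longrightarrow> u - v \<in> carrier P"
  by (rule pair_ring_diff_closed[OF rings])

lemma P_zero: "0 \<in> carrier P"
  by (simp add: pair_ring_carrier[OF rings])

lemma P_add:
  assumes "u \<in> carrier P" "v \<in> carrier P"
  shows "u + v \<in> carrier P"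
  using P_diff[OF assms(1) P_diff[OF P_zero assms(2)]] by simp

lemma P_gen: "r \<in> carrier R \<Longrightarrow> b \<in> carrier B \<Longrightarrow> frag_of (r, b) \<in> carrier P"
  by (simp add: pair_ring_carrier[OF rings])

lemma cls_closed: "u \<in> carrier P \<Longrightarrow> cls u \<in> carrier T"
  using ring_hom_ring.homh[OF cls_hom] by (simp add: ring_hom_closed)

lemma cls_add: "u \<in> carrier P \<Longrightarrow> v \<in> carrier P \<Longrightarrow> cls (u + v) = cls u \<oplus>\<^bsub>T\<^esub> cls v"
  using ring_hom_add[OF ring_hom_ring.homh[OF cls_hom]] by (simp add: pair_ring_simps[OF rings])

lemma T_zero: "\<zero>\<^bsub>T\<^esub> = G"
  by (simp add: tensor_algebra_def FactRing_def)

lemma cls_G: "u \<in> G \<Longrightarrow> cls u = \<zero>\<^bsub>T\<^esub>"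
  unfolding T_zero cls_def
  using ideal_tensor_relations[OF algebras] by (simp add: ideal_def abelian_subgroup.a_rcos_const
      abelian_subgroupI3 ring.is_abelian_group)

lemma cls_eq_iff:
  assumes "u \<in> carrier P" "v \<in> carrier P"
  shows "cls u = cls v \<longleftrightarrow> u - v \<in> G"
proof -
  interpret T: ring T by (rule ring_T)
  note d = P_diff[OF assms]
  have e: "cls u = cls (u - v) \<oplus>\<^bsub>T\<^esub> cls v" using cls_add[OF d assms(2)] by simp
  show ?thesis
  proof
    assume "u - v \<in> G"
    then show "cls u = cls v" using e cls_G cls_closed[OF assms(2)] by simp
  next
    assume "cls u = cls v"
    then have "cls (u - v) = \<zero>\<^bsub>T\<^esub>" using e cls_closed[OF assms(2)] cls_closed[OF d] T.add.r_cancel_one' by metis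
    then show "u - v \<in> G"
      unfolding T_zero cls_def using ideal.rcos_const_imp_mem[OF ideal_tensor_relations[OF algebras] d] by blast
  qed
qed

lemma cls_surj: "t \<in> carrier T \<Longrightarrow> \<exists>u\<in>carrier P. t = cls u"
  unfolding tensor_algebra_def FactRing_def A_RCOSETS_def' cls_def by auto

lemma relation_in_G: "u \<in> tensor_relations k R B \<Longrightarrow> u \<in> G"
  by (rule generate.incl)

lemma tensor_closed: "r \<in> carrier R \<Longrightarrow> b \<in> carrier B \<Longrightarrow> tensor r b \<in> carrier T"
  unfolding tensor_def by (intro cls_closed P_gen)

lemma tensor_add_left:
  assumes "r \<in> carrier R" "r' \<in> carrier R" "b \<in> carrier B"
  shows "tensor (r \<oplus>\<^bsub>R\<^esub> r') b = tensor r b \<oplus>\<^bsub>T\<^esub> tensor r' b"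
proof -
  have "frag_of (r \<oplus>\<^bsub>R\<^esub> r', b) - frag_of (r, b) - frag_of (r', b) \<in> tensor_relations k R B"
    unfolding tensor_relations_def using assms by blast
  then have "frag_of (r \<oplus>\<^bsub>R\<^esub> r', b) - (frag_of (r, b) + frag_of (r', b)) \<in> G"
    using relation_in_G by (simp add: diff_diff_eq)
  then have "cls (frag_of (r \<oplus>\<^bsub>R\<^esub> r', b)) = cls (frag_of (r, b) + frag_of (r', b))"
    using assms by (intro iffD2[OF cls_eq_iff] P_add P_gen) auto
  then show ?thesis unfolding tensor_def using assms by (simp add: cls_add P_gen)
qed

lemma tensor_add_right:
  assumes "r \<in> carrier R" "b \<in> carrier B" "b' \<in> carrier B"
  shows "tensor r (b \<oplus>\<^bsub>B\<^esub> b') = tensor r b \<oplus>\<^bsub>T\<^esub> tensor r b'"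
proof -
  have "frag_of (r, b \<oplus>\<^bsub>B\<^esub> b') - frag_of (r, b) - frag_of (r, b') \<in> tensor_relations k R B"
    unfolding tensor_relations_def using assms by blast
  then have "frag_of (r, b \<oplus>\<^bsub>B\<^esub> b') - (frag_of (r, b) + frag_of (r, b')) \<in> G"
    using relation_in_G by (simp add: diff_diff_eq)
  then have "cls (frag_of (r, b \<oplus>\<^bsub>B\<^esub> b')) = cls (frag_of (r, b) + frag_of (r, b'))"
    using assms by (intro iffD2[OF cls_eq_iff] P_add P_gen) auto
  then show ?thesis unfolding tensor_def using assms by (simp add: cls_add P_gen)
qed

lemma tensor_smult:
  assumes "c \<in> carrier k" "r \<in> carrier R" "b \<in> carrier B"
  shows "tensor (c \<odot>\<^bsub>R\<^esub> r) b = tensor r (c \<odot>\<^bsub>B\<^esub> b)"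
proof -
  have "frag_of (c \<odot>\<^bsub>R\<^esub> r, b) - frag_of (r, c \<odot>\<^bsub>B\<^esub> b) \<in> tensor_relations k R B"
    unfolding tensor_relations_def using assms by blast
  then show ?thesis
    unfolding tensor_def using assms by (intro iffD2[OF cls_eq_iff] P_gen relation_in_G) auto
qed

lemma tensor_mult:
  assumes "r \<in> carrier R" "r' \<in> carrier R" "b \<in> carrier B" "b' \<in> carrier B"
  shows "tensor r b \<otimes>\<^bsub>T\<^esub> tensor r' b' = tensor (r \<otimes>\<^bsub>R\<^esub> r') (b \<otimes>\<^bsub>B\<^esub> b')"
  using ring_hom_mult[OF ring_hom_ring.homh[OF cls_hom] P_gen[OF assms(1,3)] P_gen[OF assms(2,4)]]
  unfolding tensor_def pair_ring_mult_of[OF rings] by simp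

lemma tensor_one: "tensor \<one>\<^bsub>R\<^esub> \<one>\<^bsub>B\<^esub> = \<one>\<^bsub>T\<^esub>"
  using ring_hom_one[OF ring_hom_ring.homh[OF cls_hom]] unfolding tensor_def pair_ring_simps[OF rings] .

lemma tensor_span:
  assumes N: "additive_subgroup N T"
    and gen: "\<And>r b. r \<in> carrier R \<Longrightarrow> b \<in> carrier B \<Longrightarrow> tensor r b \<in> N"
  shows "carrier T \<subseteq> N"
proof
  fix t assume "t \<in> carrier T"
  then obtain u where u: "u \<in> carrier P" "t = cls u" using cls_surj by blast
  interpret T: ring T by (rule ring_T)
  have "u \<in> carrier P \<and> cls u \<in> N"
    using u(1)
  proof (induction u rule: pair_ring_induct[OF rings, consumes 1, case_names zero gen diff])
    case zero
    have "0 \<in> G" using generate.one[of "add_monoid P" "tensor_relations k R B"]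
      by (simp add: pair_ring_simps[OF rings])
    then show ?case using cls_G additive_subgroup.zero_closed[OF N] P_zero by simp
  next
    case (gen r b)
    then show ?case using assms(2) P_gen by (simp add: tensor_def)
  next
    case (diff v w)
    then have d: "v - w \<in> carrier P" using P_diff by blast
    then have "cls v = cls (v - w) \<oplus>\<^bsub>T\<^esub> cls w" using cls_add[of "v - w" w] diff by simp
    then have "cls (v - w) = cls v \<ominus>\<^bsub>T\<^esub> cls w"
      using cls_closed[OF d] cls_closed[of w] diff T.add_minus_cancel by simp
    then show ?case using T.additive_subgroup_diff[OF N] diff d by simp
  qed
  then show "t \<in> N" using u(2) by blast
qed

text \<open>The universal property of the free abelian group on pairs extends the values
  \<open>g r \<otimes> b\<close> additively; additivity and linearity of \<open>g\<close> make the
  extension vanish on the relations, so it descends to the quotient.\<close>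

lemma tensor_functional:
  assumes g: "g \<in> carrier R \<rightarrow> carrier B"
    and g_add: "\<And>x y. x \<in> carrier R \<Longrightarrow> y \<in> carrier R \<Longrightarrow> g (x \<oplus>\<^bsub>R\<^esub> y) = g x \<oplus>\<^bsub>B\<^esub> g y"
    and g_smult: "\<And>c x. c \<in> carrier k \<Longrightarrow> x \<in> carrier R \<Longrightarrow> g (c \<odot>\<^bsub>R\<^esub> x) = c \<odot>\<^bsub>B\<^esub> g x"
  shows "\<exists>\<Gamma>. \<Gamma> \<in> carrier T \<rightarrow> carrier B \<and>
      (\<forall>x\<in>carrier T. \<forall>y\<in>carrier T. \<Gamma> (x \<oplus>\<^bsub>T\<^esub> y) = \<Gamma> x \<oplus>\<^bsub>B\<^esub> \<Gamma> y) \<and>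
      (\<forall>r\<in>carrier R. \<forall>b\<in>carrier B. \<Gamma> (tensor r b) = g r \<otimes>\<^bsub>B\<^esub> b)"
proof -
  have gc: "g r \<in> carrier B" if "r \<in> carrier R" for r using g that by blast
  let ?S = "carrier R \<times> carrier B"
  interpret P: ring P by (rule ring_P)
  have img: "(\<lambda>(r, b). g r \<otimes>\<^bsub>B\<^esub> b) ` ?S \<subseteq> carrier (add_monoid B)" using gc by auto
  obtain H where H: "H \<in> hom (free_Abelian_group ?S) (add_monoid B)"
    and Hof: "\<And>x. x \<in> ?S \<Longrightarrow> H (frag_of x) = (\<lambda>(r, b). g r \<otimes>\<^bsub>B\<^esub> b) x"
    using comm_group.free_Abelian_group_universal[OF B.add.comm_group_axioms img] by blast
  have Hc: "H u \<in> carrier B" if "u \<in> carrier P" for u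
    using that hom_in_carrier[OF H] by (simp add: pair_ring_carrier[OF rings] free_Abelian_group_def)
  have Hadd: "H (u + v) = H u \<oplus>\<^bsub>B\<^esub> H v" if "u \<in> carrier P" "v \<in> carrier P" for u v
    using that hom_mult[OF H, of u v] by (simp add: pair_ring_carrier[OF rings] free_Abelian_group_def)
  have Hdiff: "H (u - v) = H u \<ominus>\<^bsub>B\<^esub> H v" if "u \<in> carrier P" "v \<in> carrier P" for u v
    using Hadd[OF P_diff[OF that] that(2)] Hc[OF that(2)] Hc[OF P_diff[OF that]] by (simp add: B.add_minus_cancel)
  have Hgen: "H (frag_of (r, b)) = g r \<otimes>\<^bsub>B\<^esub> b" if "r \<in> carrier R" "b \<in> carrier B" for r b
    using Hof[of "(r, b)"] that by simp
  define N where "N = {u \<in> carrier P. H u = \<zero>\<^bsub>B\<^esub>}"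
  have NI: "u \<in> N" if "u \<in> carrier P" "H u = \<zero>\<^bsub>B\<^esub>" for u using that by (simp add: N_def)
  have ND: "u \<in> carrier P" "H u = \<zero>\<^bsub>B\<^esub>" if "u \<in> N" for u using that by (simp_all add: N_def)
  have N: "additive_subgroup N P"
  proof (rule P.additive_subgroup_diffI)
    show "N \<subseteq> carrier P" using ND by blast
    show "\<zero>\<^bsub>P\<^esub> \<in> N" using Hdiff[OF P_zero P_zero] Hc[OF P_zero]
      by (intro NI) (simp_all add: pair_ring_simps[OF rings] P_zero B.minus_self)
    show "u \<ominus>\<^bsub>P\<^esub> v \<in> N" if "u \<in> N" "v \<in> N" for u v
      using that ND Hdiff by (intro NI) (simp_all add: P_minus P_diff B.minus_self)
  qed
  have rel: "tensor_relations k R B \<subseteq> N"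
  proof
    fix t assume "t \<in> tensor_relations k R B"
    from this[unfolded tensor_relations_def] show "t \<in> N"
    proof (elim UnE CollectE exE conjE)
      fix a a' b
      assume 1: "t = frag_of (a \<oplus>\<^bsub>R\<^esub> a', b) - frag_of (a, b) - frag_of (a', b)"
        "a \<in> carrier R" "a' \<in> carrier R" "b \<in> carrier B"
      have "(g a \<otimes>\<^bsub>B\<^esub> b \<oplus>\<^bsub>B\<^esub> g a' \<otimes>\<^bsub>B\<^esub> b) \<ominus>\<^bsub>B\<^esub> g a \<otimes>\<^bsub>B\<^esub> b \<ominus>\<^bsub>B\<^esub> g a' \<otimes>\<^bsub>B\<^esub> b = \<zero>\<^bsub>B\<^esub>"
        using gc[OF 1(2)] gc[OF 1(3)] 1(4) B.a_comm[of "g a \<otimes>\<^bsub>B\<^esub> b" "g a' \<otimes>\<^bsub>B\<^esub> b"]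
        by (simp add: B.add_minus_cancel B.minus_self)
      then show ?thesis unfolding 1(1)
        using 1(2-) gc by (intro NI P_diff P_gen) (simp_all add: Hdiff Hgen P_diff P_gen g_add B.l_distr)
    next
      fix a b b'
      assume 2: "t = frag_of (a, b \<oplus>\<^bsub>B\<^esub> b') - frag_of (a, b) - frag_of (a, b')"
        "a \<in> carrier R" "b \<in> carrier B" "b' \<in> carrier B"
      have "(g a \<otimes>\<^bsub>B\<^esub> b \<oplus>\<^bsub>B\<^esub> g a \<otimes>\<^bsub>B\<^esub> b') \<ominus>\<^bsub>B\<^esub> g a \<otimes>\<^bsub>B\<^esub> b \<ominus>\<^bsub>B\<^esub> g a \<otimes>\<^bsub>B\<^esub> b' = \<zero>\<^bsub>B\<^esub>"
        using gc[OF 2(2)] 2(3,4) B.a_comm[of "g a \<otimes>\<^bsub>B\<^esub> b" "g a \<otimes>\<^bsub>B\<^esub> b'"]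
        by (simp add: B.add_minus_cancel B.minus_self)
      then show ?thesis unfolding 2(1)
        using 2(2-) gc by (intro NI P_diff P_gen) (simp_all add: Hdiff Hgen P_diff P_gen B.r_distr)
    next
      fix c a b
      assume 3: "t = frag_of (c \<odot>\<^bsub>R\<^esub> a, b) - frag_of (a, c \<odot>\<^bsub>B\<^esub> b)"
        "c \<in> carrier k" "a \<in> carrier R" "b \<in> carrier B"
      show ?thesis unfolding 3(1)
        using 3(2-) gc by (intro NI P_diff P_gen)
          (simp_all add: Hdiff Hgen P_gen g_smult B.smult_mult_left B.smult_mult_right B.minus_self)
    qed
  qed
  have "G \<subseteq> N"
    by (rule P.add.generate_subgroup_incl[OF rel]) (rule additive_subgroup.a_subgroup[OF N])
  then have HG: "H u = \<zero>\<^bsub>B\<^esub>" if "u \<in> G" for u using that ND by blast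
  \<comment> \<open>Evaluation at some representative; the next step shows that the choice does not
    matter.\<close>
  define \<Gamma> where "\<Gamma> t = H (SOME u. u \<in> carrier P \<and> t = cls u)" for t
  have \<Gamma>: "\<Gamma> (cls u) = H u" if u: "u \<in> carrier P" for u
  proof -
    have "\<exists>v. v \<in> carrier P \<and> cls u = cls v" using u by blast
    from someI_ex[OF this] obtain v where v: "v \<in> carrier P" "cls u = cls v" "\<Gamma> (cls u) = H v"
      unfolding \<Gamma>_def by blast
    then have "H u \<ominus>\<^bsub>B\<^esub> H v = \<zero>\<^bsub>B\<^esub>" using HG Hdiff[OF u v(1)] cls_eq_iff[OF u v(1)] by simp
    then show ?thesis using v Hc u by (simp add: B.r_right_minus_eq)
  qed
  show ?thesis
  proof (intro exI[of _ \<Gamma>] conjI ballI)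
    show "\<Gamma> \<in> carrier T \<rightarrow> carrier B"
    proof
      fix t assume "t \<in> carrier T"
      then obtain u where u: "u \<in> carrier P" "t = cls u" using cls_surj by blast
      then show "\<Gamma> t \<in> carrier B" using \<Gamma>[OF u(1)] Hc[OF u(1)] by simp
    qed
    fix x y assume "x \<in> carrier T" "y \<in> carrier T"
    then obtain u v where uv: "u \<in> carrier P" "v \<in> carrier P" "x = cls u" "y = cls v"
      using cls_surj[of x] cls_surj[of y] by blast
    then show "\<Gamma> (x \<oplus>\<^bsub>T\<^esub> y) = \<Gamma> x \<oplus>\<^bsub>B\<^esub> \<Gamma> y"
      using Hadd[OF uv(1,2)] \<Gamma>[OF P_add[OF uv(1,2)]] cls_add[OF uv(1,2)] \<Gamma>[OF uv(1)] \<Gamma>[OF uv(2)] by simp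
  next
    fix r b assume "r \<in> carrier R" "b \<in> carrier B"
    then show "\<Gamma> (tensor r b) = g r \<otimes>\<^bsub>B\<^esub> b" unfolding tensor_def by (simp only: \<Gamma>[OF P_gen] Hgen)
  qed
qed

text \<open>The embedding of the scalars into the extension field, to play the role of
  \<open>\<zeta>\<close>. It has to start from elements of \<open>R\<close>, so
  \<open>scalar\<close> is inverted first.\<close>

definition scalar' :: "'r \<Rightarrow> 'l" where
  "scalar' z = the_inv_into (carrier k) scalar z \<odot>\<^bsub>B\<^esub> \<one>\<^bsub>B\<^esub>"

lemma scalar': "c \<in> carrier k \<Longrightarrow> scalar' (scalar c) = c \<odot>\<^bsub>B\<^esub> \<one>\<^bsub>B\<^esub>"
  by (simp add: scalar'_def the_inv_into_f_f[OF scalar_inj])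

lemma scalar'_smult: "c \<in> carrier k \<Longrightarrow> x \<in> carrier B \<Longrightarrow> scalar' (scalar c) \<otimes>\<^bsub>B\<^esub> x = c \<odot>\<^bsub>B\<^esub> x"
  by (simp add: scalar' B.smult_mult_left)

lemma tensor_situation:
  assumes L: "maximal_left_ideal R scalars L" and T: "left_noetherian T"
    and alg: "\<And>a. a \<in> maximal_left_ideal.idealizer R L \<Longrightarrow>
      \<exists>n. a [^]\<^bsub>R\<^esub> (n::nat) \<in> maximal_left_ideal.powers R L scalars a n"
    and root: "\<And>cs. set cs \<subseteq> carrier B \<Longrightarrow> length cs \<ge> 2 \<Longrightarrow> last cs \<noteq> \<zero>\<^bsub>B\<^esub> \<Longrightarrow>
      \<exists>x\<in>carrier B. horner B cs x = \<zero>\<^bsub>B\<^esub>"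
  shows "tensor_situation R scalars L T B tensor scalar'"
proof -
  interpret maximal_left_ideal R scalars L by fact
  interpret T: ring T by (rule ring_T)
  have sD: "\<exists>c\<in>carrier k. z = scalar c" if "z \<in> scalars" for z using that unfolding scalars_def by blast
  show ?thesis
  proof (intro tensor_situation.intro tensor_situation_axioms.intro)
    show "maximal_left_ideal R scalars L" by fact
    show "ring T" by (rule ring_T)
    show "field B" by (rule B.field_axioms)
    show "tensor z \<one>\<^bsub>B\<^esub> = tensor \<one>\<^bsub>R\<^esub> (scalar' z)" if z: "z \<in> scalars" for z
    proof -
      obtain c where "c \<in> carrier k" "z = scalar c" using sD[OF z] by blast
      then show ?thesis using tensor_smult[of c "\<one>\<^bsub>R\<^esub>" "\<one>\<^bsub>B\<^esub>"] by (simp add: scalar') (simp add: scalar_def)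
    qed
    show "\<exists>\<Gamma>. \<Gamma> \<in> carrier T \<rightarrow> carrier B \<and>
        (\<forall>x\<in>carrier T. \<forall>y\<in>carrier T. \<Gamma> (x \<oplus>\<^bsub>T\<^esub> y) = \<Gamma> x \<oplus>\<^bsub>B\<^esub> \<Gamma> y) \<and>
        (\<forall>r\<in>carrier R. \<forall>c\<in>carrier B. \<Gamma> (tensor r c) = g r \<otimes>\<^bsub>B\<^esub> c)"
      if g: "g \<in> carrier R \<rightarrow> carrier B"
        "\<And>x y. x \<in> carrier R \<Longrightarrow> y \<in> carrier R \<Longrightarrow> g (x \<oplus>\<^bsub>R\<^esub> y) = g x \<oplus>\<^bsub>B\<^esub> g y"
        "\<And>z x. z \<in> scalars \<Longrightarrow> x \<in> carrier R \<Longrightarrow> g (z \<otimes>\<^bsub>R\<^esub> x) = scalar' z \<otimes>\<^bsub>B\<^esub> g x" for g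
    proof (rule tensor_functional[OF g(1,2)])
      fix c x assume cx: "c \<in> carrier k" "x \<in> carrier R"
      then have "scalar c \<in> scalars" "g x \<in> carrier B"
        using g(1) unfolding scalars_def by blast+
      then show "g (c \<odot>\<^bsub>R\<^esub> x) = c \<odot>\<^bsub>B\<^esub> g x"
        using g(3)[OF _ cx(2), of "scalar c"] scalar_mult[OF cx] scalar'_smult[OF cx(1), of "g x"] by metis
    qed
    show "scalar' z \<in> carrier B" if "z \<in> scalars" for z
      using sD[OF that] scalar' by auto
    show "scalar' \<one>\<^bsub>R\<^esub> = \<one>\<^bsub>B\<^esub>" using scalar'[of "\<one>\<^bsub>k\<^esub>"] by (simp add: scalar_one)
    fix z z' assume zz: "z \<in> scalars" "z' \<in> scalars"
    then obtain c d where cd: "c \<in> carrier k" "d \<in> carrier k" "z = scalar c" "z' = scalar d"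
      using sD[of z] sD[of z'] by blast
    show "scalar' (z \<ominus>\<^bsub>R\<^esub> z') = scalar' z \<ominus>\<^bsub>B\<^esub> scalar' z'"
      using cd unfolding cd(3,4) scalar_diff[OF cd(1,2), symmetric]
      by (simp add: scalar' a_minus_def B.smult_l_distr B.smult_l_minus)
    show "scalar' (z \<otimes>\<^bsub>R\<^esub> z') = scalar' z \<otimes>\<^bsub>B\<^esub> scalar' z'"
      using cd unfolding cd(3,4) scalar_scalar[OF cd(1,2), symmetric]
      by (simp add: scalar' B.smult_mult_left B.smult_assoc1)
  qed (use tensor_closed tensor_add_left tensor_add_right tensor_mult tensor_one tensor_span T root alg in auto)
qed

end

section \<open>Invertible ideals and polynomial identities\<close>

context invertible_situation
begin

lemma power_left_ideal: "left_ideal R (power n)"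
proof -
  interpret A: ideal "power n" R by (rule power_ideal)
  show ?thesis
    using A.additive_subgroup_axioms A.I_l_closed by (simp add: left_ideal_iff)
qed

lemma power_antimono: "n \<le> n' \<Longrightarrow> power n' \<subseteq> power n"
  by (rule lift_Suc_antimono_le[of power, OF power_mono])

lemma nat_pow_regular: "s \<in> regular_elements R \<Longrightarrow> s [^] (n::nat) \<in> regular_elements R"
  by (induction n) (simp_all add: regular_one regular_mult)

text \<open>Above \<open>R s\<close> the left ideals satisfy the descending chain condition, so the chain of the
  \<open>R s + I\<^sup>n\<close> becomes stationary.\<close>

lemma power_modulo_regular:
  assumes "left_hereditary R" "left_noetherian (opposite_ring R)" "s \<in> regular_elements R"
  shows "\<exists>m. \<forall>n. \<forall>x\<in>power m. \<exists>r\<in>carrier R. \<exists>u\<in>power n. x = r \<otimes> s \<oplus> u"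
proof -
  note s = regular_carrier[OF assms(3)]
  define A where "A n = {x. \<exists>r\<in>carrier R. \<exists>u\<in>power n. x = r \<otimes> s \<oplus> u}" for n
  have AI: "r \<otimes> s \<oplus> u \<in> A n" if "r \<in> carrier R" "u \<in> power n" for r u n using that by (auto simp: A_def)
  have AD: "\<exists>r\<in>carrier R. \<exists>u\<in>power n. x = r \<otimes> s \<oplus> u" if "x \<in> A n" for x n using that by (simp add: A_def)
  note P = left_idealD[OF power_left_ideal]
  have pc: "u \<in> carrier R" if "u \<in> power n" for u n using that P(2) by blast
  have li: "left_ideal R (A n)" for n
  proof (rule left_idealI)
    show "A n \<subseteq> carrier R" using s pc by (auto simp: A_def)
    show "\<zero> \<in> A n" using AI[OF zero_closed P(3)] s by simp
    show "x \<ominus> y \<in> A n" if xy: "x \<in> A n" "y \<in> A n" for x y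
    proof -
      obtain a u b v where *: "a \<in> carrier R" "u \<in> power n" "x = a \<otimes> s \<oplus> u" "b \<in> carrier R" "v \<in> power n" "y = b \<otimes> s \<oplus> v"
        using AD[OF xy(1)] AD[OF xy(2)] by blast
      have "x \<ominus> y = (a \<ominus> b) \<otimes> s \<oplus> (u \<ominus> v)"
        unfolding *(3,6) using * s pc by (simp add: diff_add_add l_distr_minus)
      then show ?thesis using AI[OF minus_closed[OF *(1,4)] P(5)[OF *(2,5)]] by simp
    qed
    show "c \<otimes> x \<in> A n" if cx: "c \<in> carrier R" "x \<in> A n" for c x
    proof -
      obtain a u where *: "a \<in> carrier R" "u \<in> power n" "x = a \<otimes> s \<oplus> u" using AD[OF cx(2)] by blast
      have "c \<otimes> x = (c \<otimes> a) \<otimes> s \<oplus> c \<otimes> u" unfolding *(3) using * s pc cx by (simp add: r_distr m_assoc)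
      then show ?thesis using AI[OF m_closed[OF cx(1) *(1)] P(7)[OF cx(1) *(2)]] by simp
    qed
  qed
  have sA: "s \<in> A n" for n using AI[OF one_closed P(3)] s by simp
  have "\<exists>M\<in>range A. \<forall>N\<in>range A. N \<subseteq> M \<longrightarrow> N = M"
    by (rule dcc_aboveD[OF hereditary_dcc[OF assms(3,1,2), of "{s}"]]) (use li sA in auto)
  then obtain m where m: "\<And>n. A n \<subseteq> A m \<Longrightarrow> A n = A m" by auto
  have anti: "A n' \<subseteq> A n" if "n \<le> n'" for n n' using power_antimono[OF that] unfolding A_def by blast
  have "x \<in> A n" if x: "x \<in> power m" for n x
  proof -
    have "x \<in> A m" using AI[OF zero_closed x] s pc[OF x] by simp
    \<comment> \<open>The maximum covers both \<open>n \<ge> m\<close>, where the chain is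
      stationary, and \<open>n < m\<close>, where it is merely decreasing.\<close>
    also have "A m = A (max m n)" using m[OF anti[of m "max m n"]] by simp
    also have "\<dots> \<subseteq> A n" by (rule anti) simp
    finally show ?thesis .
  qed
  then show ?thesis using AD by blast
qed

end

text \<open>Collects what is needed about the powers of \<open>I\<close> in terms of
  \<open>R\<close> alone, so that the quotient ring and the inverse of \<open>I\<close> can be
  forgotten.\<close>

lemma (in ring) HNP_invertible_ideal_filtration:
  assumes HNP: "HNP_ring R" and inv: "invertible_ideal R I" "I \<noteq> carrier R"
  shows "\<exists>A s m. (\<forall>n. ideal (A n) R) \<and> (\<Inter>n. A n) = {\<zero>} \<and> s \<in> carrier R \<and>
    (\<forall>n::nat. s [^] n \<in> A n) \<and>
    (\<forall>n. \<forall>x\<in>A m. \<exists>r\<in>carrier R. \<exists>u\<in>A n. x = r \<otimes> s \<oplus> u) \<and> dcc_above R (A m)"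
proof -
  have prime: "prime_ring R" and her: "left_hereditary R"
    and noeth: "left_noetherian R" "left_noetherian (opposite_ring R)"
    using HNP unfolding HNP_ring_def hereditary_def noetherian_def by blast+
  from inv(1) obtain Q :: "('a \<times> 'a) set ring" and \<iota> J where Q: "classical_quotient_ring R Q \<iota>"
    "subbimodule R Q \<iota> J" "(\<iota> ` I) \<cdot>\<^bsub>Q\<^esub> J = \<iota> ` carrier R" "J \<cdot>\<^bsub>Q\<^esub> (\<iota> ` I) = \<iota> ` carrier R"
    and ideal: "ideal I R"
    unfolding invertible_ideal_def by (elim conjE exE)
  have ringQ: "ring Q" using Q(1) unfolding classical_quotient_ring_def by (elim conjE)
  interpret N: invertible_situation R Q \<iota> I J
    by (intro invertible_situation.intro invertible_situation_axioms.intro quotient_ring.intro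
        quotient_ring_axioms.intro ring_axioms ringQ Q ideal)
  obtain s where s: "s \<in> I" "s \<in> regular_elements R" using N.regular_in_ideal by blast
  obtain m where m: "\<forall>n. \<forall>x\<in>N.power m. \<exists>r\<in>carrier R. \<exists>u\<in>N.power n. x = r \<otimes> s \<oplus> u"
    using N.power_modulo_regular[OF her noeth(2) s(2)] by (elim exE)
  \<comment> \<open>The power \<open>s [^] m\<close> is a regular element of \<open>I^m\<close>, so
    the chain condition holds above \<open>I^m\<close>.\<close>
  have dcc: "dcc_above R (N.power m)"
    by (rule N.hereditary_dcc[OF N.nat_pow_regular[OF s(2)] her noeth(2) N.nat_pow_in_power[OF s(1)]])
  show ?thesis
    by (intro exI[of _ N.power] exI[of _ s] exI[of _ m] conjI allI N.power_ideal
        N.Inter_power[OF prime noeth inv(2)] N.regular_carrier[OF s(2)] N.nat_pow_in_power[OF s(1)] dcc)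
      (use m in blast)
qed

lemma (in base_change) HNP_invertible_ideal_PI:
  assumes T: "left_noetherian T" and dim: "dim_less_card k R (carrier k)"
    and root: "\<And>cs. set cs \<subseteq> carrier B \<Longrightarrow> length cs \<ge> 2 \<Longrightarrow> last cs \<noteq> \<zero>\<^bsub>B\<^esub> \<Longrightarrow>
      \<exists>x\<in>carrier B. horner B cs x = \<zero>\<^bsub>B\<^esub>"
    and HNP: "HNP_ring R" and inv: "invertible_ideal R I" "I \<noteq> carrier R"
  shows "PI_ring R"
proof -
  have noeth: "left_noetherian R" using HNP unfolding HNP_ring_def noetherian_def by (elim conjE)
  from A.HNP_invertible_ideal_filtration[OF HNP inv] obtain A s m where
    A: "\<forall>n. ideal (A n) R" "(\<Inter>n. A n) = {\<zero>\<^bsub>R\<^esub>}" "s \<in> carrier R" "\<forall>n::nat. s [^]\<^bsub>R\<^esub> n \<in> A n"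
    and m: "\<forall>n. \<forall>x\<in>A m. \<exists>r\<in>carrier R. \<exists>u\<in>A n. x = r \<otimes>\<^bsub>R\<^esub> s \<oplus>\<^bsub>R\<^esub> u" and dcc: "dcc_above R (A m)"
    by (elim exE conjE)
  note Am = A(1)[rule_format, of m]
  have left: "left_ideal R (A m)"
    unfolding A.left_ideal_iff using ideal.axioms(1)[OF Am] ideal.I_l_closed[OF Am] by blast
  note ksub = F.ksub_left_ideal[OF left]
  have right: "i \<otimes>\<^bsub>R\<^esub> r \<in> A m" if "i \<in> A m" "r \<in> carrier R" for i r
    using ideal.I_r_closed[OF Am that] .
  obtain V where V: "vectorspace.basis k R V" "ordLess2 (card_of V) (card_of (carrier k))"
    using dim unfolding dim_less_card_def by (elim exE conjE)
  have fin: "F.fin_mod (carrier R) (A m)"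
  \<comment> \<open>Amitsur's counting needs an infinite family of spans. With a finite basis
    \<open>R\<close> itself is finite-dimensional, and so is its quotient.\<close>
  proof (cases "finite V")
    case True
    have "{\<zero>\<^bsub>R\<^esub>} \<subseteq> A m" using F.ksubD(2)[OF ksub] by (simp only: empty_subsetI insert_subset)
    then show ?thesis by (rule F.fin_mod_mono[OF finite_basis[OF V(1) True] subset_refl _ ksub])
  next
    case False
    show ?thesis
    proof (rule F.finite_quotient[OF noeth dcc left right])
      fix L assume L: "maximal_left_ideal R scalars L" "A m \<subseteq> L"
      have "tensor_situation R scalars L T B tensor scalar'"
        by (rule tensor_situation[OF L(1) T infinite_basis_algebraic[OF V(1) False V(2) L(1)] root])
      then show "F.fin_mod (carrier R) L" by (rule tensor_situation.simple_finite[OF _ dcc L(2) right])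
    qed
  qed
  show ?thesis
    by (rule F.PI_criterion[OF A(1)[rule_format] A(2,3) A(4)[rule_format] m[rule_format] fin])
qed

lemma (in algebraic_closure) algebraically_closed: "algebraically_closed L"
  ..

lemma base_change_algebraic_closure:
  assumes "field k" "is_algebraic_closure k kbar" "central_algebra k R" "prime_ring R"
  shows "base_change k R kbar"
proof -
  have closure: "algebraic_closure kbar ((\<lambda>c. c \<odot>\<^bsub>kbar\<^esub> \<one>\<^bsub>kbar\<^esub>) ` carrier k)" and kbar: "central_algebra k kbar"
    using assms(2) unfolding is_algebraic_closure_def by blast+
  have "field kbar" using closure by (rule algebraic_closure.axioms(1))
  moreover have "\<one>\<^bsub>R\<^esub> \<noteq> \<zero>\<^bsub>R\<^esub>" using assms(4) unfolding prime_ring_def by blast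
  ultimately show ?thesis
    using assms(1,3) kbar by (intro base_change.intro field_algebra.intro field_algebra_axioms.intro)
qed

theorem theorem9:
  fixes k :: "('k, 'm) ring_scheme"
    and kbar :: "('k, 'l, 'n) module_scheme"
    and R :: "('k, 'r, 'p) module_scheme"
  assumes "field k"
    and "is_algebraic_closure k kbar"
    and "central_algebra k R"
    and "noetherian (tensor_algebra k R kbar)"
    and "dim_less_card k R (carrier k)"
  shows "(HNP_ring R \<longrightarrow>
            PI_ring R \<or> \<not> (\<exists>I. invertible_ideal R I \<and> I \<noteq> carrier R)) \<and>
         (Dedekind_prime_ring R \<longrightarrow> PI_ring R \<or> simple_ring R)"
proof -
  have closure: "algebraic_closure kbar ((\<lambda>c. c \<odot>\<^bsub>kbar\<^esub> \<one>\<^bsub>kbar\<^esub>) ` carrier k)"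
    using assms(2) unfolding is_algebraic_closure_def by blast
  have main: "PI_ring R" if HNP: "HNP_ring R" and I: "invertible_ideal R I" "I \<noteq> carrier R" for I
  proof (rule base_change.HNP_invertible_ideal_PI[OF _ _ assms(5) _ HNP I])
    show "base_change k R kbar"
      using HNP by (intro base_change_algebraic_closure assms(1-3)) (simp add: HNP_ring_def)
    show "left_noetherian (tensor_algebra k R kbar)" using assms(4) by (simp add: noetherian_def)
  qed (rule algebraically_closed.horner_root[OF algebraic_closure.algebraically_closed[OF closure]])
  \<comment> \<open>If \<open>R\<close> is not simple, it has a nonzero proper ideal, which is
    invertible by the definition of a Dedekind prime ring.\<close>
  have "PI_ring R \<or> simple_ring R" if "Dedekind_prime_ring R"
    using that main unfolding Dedekind_prime_ring_def simple_ring_def HNP_ring_def noetherian_def by blast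
  then show ?thesis using main by blast
qed

end
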